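(* Let $\Bbbk$ be a field. For any three small dg categories $C,D,E$ over $\Bbbk$ there is a unique dg functor $$\alpha_{C,D,E}\colon(C\widetilde\otimes D)\widetilde\otimes E\to C\widetilde\otimes(D\widetilde\otimes E),$$ natural in each argument, which is the identity map on objects, and which is defined on morphisms as follows: (i) for $f\in C$, $g\in D$, $h\in E$ morphisms and $X,Y,Z$ objects of $C,D,E$ respectively, $\alpha_{C,D,E}((f\otimes\mathrm{id}_Y)\otimes\mathrm{id}_Z)=f\otimes(\mathrm{id}_Y\otimes\mathrm{id}_Z)$, $\alpha_{C,D,E}((\mathrm{id}_X\otimes g)\otimes\mathrm{id}_Z)=\mathrm{id}_X\otimes(g\otimes\mathrm{id}_Z)$, $\alpha_{C,D,E}((\mathrm{id}_X\otimes\mathrm{id}_Y)\otimes h)=\mathrm{id}_X\otimes(\mathrm{id}_Y\otimes h)$; (ii) for $f\in C$, $g_1,\dots,g_k\in D$, $k\ge1$, and $Z$ an object of $E$, $\alpha_{C,D,E}(\varepsilon(f;g_1,\dots,g_k)\otimes\mathrm{id}_Z)=\varepsilon(f;g_1\otimes\mathrm{id}_Z,\dots,g_k\otimes\mathrm{id}_Z)$; (iii) for $f\in C$, $g\in D$, $h_1,\dots,h_n\in E$, $X$ an object of $C$, $Y$ an object of $D$, $\alpha_{C,D,E}(\varepsilon(f\otimes\mathrm{id}_Y;h_1,\dots,h_n))=\varepsilon(f;\mathrm{id}_Y\otimes h_1,\dots,\mathrm{id}_Y\otimes h_n)$ and $\alpha_{C,D,E}(\varepsilon(\mathrm{id}_X\otimes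 g;h_1,\dots,h_n))=\mathrm{id}_X\otimes\varepsilon(g;h_1,\dots,h_n)$; (iv) for $f\in C$, $g_1,\dots,g_k\in D$, $h_1,\dots,h_N\in E$, $$\alpha_{C,D,E}\big(\varepsilon(\varepsilon(f;g_1,\dots,g_k);h_1,\dots,h_N)\big)=\sum_{0\le i_1\le j_1\le i_2\le j_2\le\dots\le j_k\le N}(-1)^{\sum_{\ell=1}^k|g_\ell|\cdot\sum_{s\le i_\ell}(|h_s|-1)}$$ $$\varepsilon\big(f;h_1,\dots,h_{i_1},\varepsilon(g_1;h_{i_1+1},\dots,h_{j_1}),h_{j_1+1},\dots,h_{i_2},\varepsilon(g_2;h_{i_2+1},\dots,h_{j_2}),h_{j_2+1},\dots\big),$$ where for $j_\ell=i_\ell$ the corresponding term $\varepsilon(g_\ell;h_{i_\ell+1},\dots,h_{j_\ell})$ is replaced by $g_\ell\otimes\mathrm{id}$, and an argument $h_s$ standing alone on the right-hand side is understood as $\mathrm{id}_Y\otimes h_s$ for the corresponding object $Y$ of $D$. (In (ii)–(iv) the $g_i$, resp. the $h_i$, are chains of composable morphisms.)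
   Context: $|x|$ denotes the degree of $x$. **Twisted tensor product.** For small dg categories $C,D$ over $\Bbbk$, $C\widetilde\otimes D$ is the dg category with objects $\mathrm{Ob}(C)\times\mathrm{Ob}(D)$. As a graded $\Bbbk$-linear category (composition $\star$) it is generated by $f\otimes\mathrm{id}_d$ ($f$ a morphism of $C$, $d\in D$), $\mathrm{id}_c\otimes g$ ($c\in C$, $g$ a morphism of $D$) and, for $n\ge1$, a morphism $f\colon c_0\to c_1$ of $C$ and a chain $d_0\xrightarrow{g_1}d_1\to\dots\xrightarrow{g_n}d_n$ in $D$, new morphisms $\varepsilon(f;g_1,\dots,g_n)\colon(c_0,d_0)\to(c_1,d_n)$ of degree $-n+|f|+\sum_j|g_j|$, subject to: (R1) $(\mathrm{id}_c\otimes g_1)\star(\mathrm{id}_c\otimes g_2)=\mathrm{id}_c\otimes(g_1g_2)$, $(f_1\otimes\mathrm{id}_d)\star(f_2\otimes\mathrm{id}_d)=(f_1f_2)\otimes\mathrm{id}_d$; (R2) $\varepsilon(f;g_1,\dots,g_n)$ is linear in each argument; (R3) for $n\ge1$, $\varepsilon(f;g_1,\dots,g_n)=0$ if $f$ or some $g_i$ is an identity morphism; (R4) $$\varepsilon(f_2f_1;g_1,\dots,g_N)=\sum_{0\le m\le N}(-1)^{|f_1|(\sum_{j=m+1}^N|g_j|+N-m)}\varepsilon(f_2;g_{m+1},\dots,g_N)\star\varepsilon(f_1;g_1,\dots,g_m),$$ where $\varepsilon(f;\varnothing)$ is read as $f\otimes\mathrm{id}$. The differential is the given one on $C\otimes\mathrm{id}_d$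 and $\mathrm{id}_c\otimes D$; for $n=1$ it is determined by $$-d\varepsilon(f;g)+\varepsilon(df;g)+(-1)^{|f|}\varepsilon(f;dg)=(-1)^{|f||g|}(\mathrm{id}_{c_1}\otimes g)\star(f\otimes\mathrm{id}_{d_0})-(f\otimes\mathrm{id}_{d_1})\star(\mathrm{id}_{c_0}\otimes g),$$ and for $n\ge2$ by $$\varepsilon(df;g_1,\dots,g_n)=d\varepsilon(f;g_1,\dots,g_n)-\sum_{j=1}^n(-1)^{|f|+|g_n|+\dots+|g_{j+1}|+n-j}\varepsilon(f;g_1,\dots,dg_j,\dots,g_n)+(-1)^{|f|+n-1}\Big[(-1)^{|f||g_n|+|f|}(\mathrm{id}_{c_1}\otimes g_n)\star\varepsilon(f;g_1,\dots,g_{n-1})$$ $$+(-1)^{|f|+\sum_{i=2}^n(|g_i|+1)+1}\varepsilon(f;g_2,\dots,g_n)\star(\mathrm{id}_{c_0}\otimes g_1)+\sum_{i=1}^{n-1}(-1)^{|f|+\sum_{j=i+1}^n(|g_j|+1)}\varepsilon(f;g_1,\dots,g_{i+1}g_i,\dots,g_n)\Big].$$ It is functorial in both arguments.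
   Formalization: Signs corrected (printed ones are inconsistent unless 2=0): in the differential the ε(f;…,dg_j,…) terms are negated and the bracket's prefactor (−1)^{|f|+n−1} is dropped (n=1: commutator times (−1)^{|f|}); in (iv) the exponent is Σ_l(|g_l|−1)Σ_{s>j_l}(|h_s|−1). *)

theory Defs
  imports "HOL-Algebra.Module" "HOL-Library.FuncSet"
begin

section \<open>Small dg categories over a field\<close>

text \<open>
  A graded vector space is given by its homogeneous components.  Thus \<open>Mor C x y n\<close> is the
  vector space of morphisms from \<open>x\<close> to \<open>y\<close> of degree \<open>n\<close>; different such spaces
  are disjoint, so that a morphism determines its source, target and degree.
  \<open>Comp C g f\<close> is \<open>g\<close> after \<open>f\<close>.
\<close>

record ('k, 'o, 'm) dgcat =
  Obj :: "'o set"
  Mor :: "'o \<Rightarrow> 'o \<Rightarrow> int \<Rightarrow> ('k, 'm) module"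
  Dom :: "'m \<Rightarrow> 'o"
  Cod :: "'m \<Rightarrow> 'o"
  Deg :: "'m \<Rightarrow> int"
  Idn :: "'o \<Rightarrow> 'm"
  Comp :: "'m \<Rightarrow> 'm \<Rightarrow> 'm"
  Dif :: "'m \<Rightarrow> 'm"

definition arr :: "('k, 'o, 'm) dgcat \<Rightarrow> 'm set" where
  "arr C = (\<Union>x\<in>Obj C. \<Union>y\<in>Obj C. \<Union>n. carrier (Mor C x y n))"

text \<open>\<open>sg K n\<close> is the sign \<open>(-1)^n\<close> in \<open>K\<close>.\<close>

definition sg :: "'k ring \<Rightarrow> int \<Rightarrow> 'k" where
  "sg K n = (if even n then \<one>\<^bsub>K\<^esub> else \<ominus>\<^bsub>K\<^esub> \<one>\<^bsub>K\<^esub>)"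

locale dg_category = field K for K :: "'k ring" +
  fixes C :: "('k, 'o, 'm) dgcat"
  assumes mor_module:
      "\<lbrakk>x \<in> Obj C; y \<in> Obj C\<rbrakk> \<Longrightarrow> module K (Mor C x y n)"
    and mor_typed:
      "\<lbrakk>x \<in> Obj C; y \<in> Obj C; f \<in> carrier (Mor C x y n)\<rbrakk>
        \<Longrightarrow> Dom C f = x \<and> Cod C f = y \<and> Deg C f = n"
    and idn_closed:
      "x \<in> Obj C \<Longrightarrow> Idn C x \<in> carrier (Mor C x x 0)"
    and comp_closed:
      "\<lbrakk>x \<in> Obj C; y \<in> Obj C; z \<in> Obj C;
        f \<in> carrier (Mor C x y m); g \<in> carrier (Mor C y z n)\<rbrakk>
        \<Longrightarrow> Comp C g f \<in> carrier (Mor C x z (m + n))"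
    and comp_add_left:
      "\<lbrakk>x \<in> Obj C; y \<in> Obj C; z \<in> Obj C; f \<in> carrier (Mor C x y m);
        g \<in> carrier (Mor C y z n); g' \<in> carrier (Mor C y z n)\<rbrakk>
        \<Longrightarrow> Comp C (g \<oplus>\<^bsub>Mor C y z n\<^esub> g') f = Comp C g f \<oplus>\<^bsub>Mor C x z (m + n)\<^esub> Comp C g' f"
    and comp_add_right:
      "\<lbrakk>x \<in> Obj C; y \<in> Obj C; z \<in> Obj C; f \<in> carrier (Mor C x y m);
        f' \<in> carrier (Mor C x y m); g \<in> carrier (Mor C y z n)\<rbrakk>
        \<Longrightarrow> Comp C g (f \<oplus>\<^bsub>Mor C x y m\<^esub> f') = Comp C g f \<oplus>\<^bsub>Mor C x z (m + n)\<^esub> Comp C g f'"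
    and comp_smult_left:
      "\<lbrakk>x \<in> Obj C; y \<in> Obj C; z \<in> Obj C; a \<in> carrier K;
        f \<in> carrier (Mor C x y m); g \<in> carrier (Mor C y z n)\<rbrakk>
        \<Longrightarrow> Comp C (a \<odot>\<^bsub>Mor C y z n\<^esub> g) f = a \<odot>\<^bsub>Mor C x z (m + n)\<^esub> Comp C g f"
    and comp_smult_right:
      "\<lbrakk>x \<in> Obj C; y \<in> Obj C; z \<in> Obj C; a \<in> carrier K;
        f \<in> carrier (Mor C x y m); g \<in> carrier (Mor C y z n)\<rbrakk>
        \<Longrightarrow> Comp C g (a \<odot>\<^bsub>Mor C x y m\<^esub> f) = a \<odot>\<^bsub>Mor C x z (m + n)\<^esub> Comp C g f"
    and comp_assoc:
      "\<lbrakk>f \<in> arr C; g \<in> arr C; h \<in> arr C; Cod C f = Dom C g; Cod C g = Dom C h\<rbrakk>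
        \<Longrightarrow> Comp C h (Comp C g f) = Comp C (Comp C h g) f"
    and comp_idn_left: "f \<in> arr C \<Longrightarrow> Comp C (Idn C (Cod C f)) f = f"
    and comp_idn_right: "f \<in> arr C \<Longrightarrow> Comp C f (Idn C (Dom C f)) = f"
    and dif_closed:
      "\<lbrakk>x \<in> Obj C; y \<in> Obj C; f \<in> carrier (Mor C x y n)\<rbrakk>
        \<Longrightarrow> Dif C f \<in> carrier (Mor C x y (n + 1))"
    and dif_add:
      "\<lbrakk>x \<in> Obj C; y \<in> Obj C; f \<in> carrier (Mor C x y n); f' \<in> carrier (Mor C x y n)\<rbrakk>
        \<Longrightarrow> Dif C (f \<oplus>\<^bsub>Mor C x y n\<^esub> f') = Dif C f \<oplus>\<^bsub>Mor C x y (n + 1)\<^esub> Dif C f'"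
    and dif_smult:
      "\<lbrakk>x \<in> Obj C; y \<in> Obj C; a \<in> carrier K; f \<in> carrier (Mor C x y n)\<rbrakk>
        \<Longrightarrow> Dif C (a \<odot>\<^bsub>Mor C x y n\<^esub> f) = a \<odot>\<^bsub>Mor C x y (n + 1)\<^esub> Dif C f"
    and dif_dif:
      "\<lbrakk>x \<in> Obj C; y \<in> Obj C; f \<in> carrier (Mor C x y n)\<rbrakk>
        \<Longrightarrow> Dif C (Dif C f) = \<zero>\<^bsub>Mor C x y (n + 2)\<^esub>"
    and dif_comp:
      "\<lbrakk>x \<in> Obj C; y \<in> Obj C; z \<in> Obj C;
        f \<in> carrier (Mor C x y m); g \<in> carrier (Mor C y z n)\<rbrakk>
        \<Longrightarrow> Dif C (Comp C g f) = Comp C (Dif C g) f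
              \<oplus>\<^bsub>Mor C x z (m + n + 1)\<^esub> sg K n \<odot>\<^bsub>Mor C x z (m + n + 1)\<^esub> Comp C g (Dif C f)"

text \<open>
  Both components of a dg functor are taken to be \<^const>\<open>undefined\<close> outside the objects resp.
  morphisms of its source, so that equality of functors is equality of records.
\<close>

record ('o, 'm, 'p, 'n) dgfun =
  FObj :: "'o \<Rightarrow> 'p"
  FMor :: "'m \<Rightarrow> 'n"

locale dg_functor = A: dg_category K A + B: dg_category K B
  for K :: "'k ring" and A :: "('k, 'o, 'm) dgcat" and B :: "('k, 'p, 'n) dgcat" +
  fixes F :: "('o, 'm, 'p, 'n) dgfun"
  assumes fobj: "FObj F \<in> Obj A \<rightarrow>\<^sub>E Obj B"
    and fmor_ext: "FMor F \<in> extensional (arr A)"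
    and fmor_closed:
      "\<lbrakk>x \<in> Obj A; y \<in> Obj A; f \<in> carrier (Mor A x y n)\<rbrakk>
        \<Longrightarrow> FMor F f \<in> carrier (Mor B (FObj F x) (FObj F y) n)"
    and fmor_add:
      "\<lbrakk>x \<in> Obj A; y \<in> Obj A; f \<in> carrier (Mor A x y n); f' \<in> carrier (Mor A x y n)\<rbrakk>
        \<Longrightarrow> FMor F (f \<oplus>\<^bsub>Mor A x y n\<^esub> f') = FMor F f \<oplus>\<^bsub>Mor B (FObj F x) (FObj F y) n\<^esub> FMor F f'"
    and fmor_smult:
      "\<lbrakk>x \<in> Obj A; y \<in> Obj A; a \<in> carrier K; f \<in> carrier (Mor A x y n)\<rbrakk>
        \<Longrightarrow> FMor F (a \<odot>\<^bsub>Mor A x y n\<^esub> f) = a \<odot>\<^bsub>Mor B (FObj F x) (FObj F y) n\<^esub> FMor F f"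
    and fmor_idn: "x \<in> Obj A \<Longrightarrow> FMor F (Idn A x) = Idn B (FObj F x)"
    and fmor_comp:
      "\<lbrakk>f \<in> arr A; g \<in> arr A; Cod A f = Dom A g\<rbrakk>
        \<Longrightarrow> FMor F (Comp A g f) = Comp B (FMor F g) (FMor F f)"
    and fmor_dif: "f \<in> arr A \<Longrightarrow> FMor F (Dif A f) = Dif B (FMor F f)"

definition dgfun_comp ::
  "('k, 'o, 'm) dgcat \<Rightarrow> ('p, 'n, 'q, 'l) dgfun \<Rightarrow> ('o, 'm, 'p, 'n) dgfun \<Rightarrow> ('o, 'm, 'q, 'l) dgfun"
where
  "dgfun_comp A G F =
    \<lparr>FObj = restrict (\<lambda>x. FObj G (FObj F x)) (Obj A),
     FMor = restrict (\<lambda>f. FMor G (FMor F f)) (arr A)\<rparr>"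

text \<open>A nonempty chain of composable morphisms, listed in the order in which they are applied.\<close>

definition chain :: "('k, 'o, 'm) dgcat \<Rightarrow> 'm list \<Rightarrow> bool" where
  "chain D gs \<longleftrightarrow> gs \<noteq> [] \<and> set gs \<subseteq> arr D \<and> successively (\<lambda>g g'. Cod D g = Dom D g') gs"

text \<open>
  The total shifted degree.  The signs below only depend on parities, so a summand
  \<open>|g| + 1\<close> in an exponent is also written \<open>|g| - 1\<close>.
\<close>

definition wt :: "('k, 'o, 'm) dgcat \<Rightarrow> 'm list \<Rightarrow> int" where
  "wt D gs = (\<Sum>g\<leftarrow>gs. Deg D g - 1)"

section \<open>The twisted tensor product\<close>

text \<open>
  Formal expressions in the generators \<open>TL f d\<close> (for \<open>f \<otimes> id\<^sub>d\<close>), \<open>TR c g\<close> (for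
  \<open>id\<^sub>c \<otimes> g\<close>) and \<open>TE f gs\<close> (for \<open>\<epsilon>(f; gs)\<close> with \<open>gs\<close> nonempty).  The term
  \<open>TZero x y n\<close> is the zero morphism of degree \<open>n\<close> and \<open>TId x\<close> the identity.
\<close>

datatype ('k, 'c, 'f, 'd, 'g) tterm =
    TZero "'c \<times> 'd" "'c \<times> 'd" int
  | TId "'c \<times> 'd"
  | TL 'f 'd
  | TR 'c 'g
  | TE 'f "'g list"
  | TAdd "('k, 'c, 'f, 'd, 'g) tterm" "('k, 'c, 'f, 'd, 'g) tterm"
  | TScale 'k "('k, 'c, 'f, 'd, 'g) tterm"
  | TComp "('k, 'c, 'f, 'd, 'g) tterm" "('k, 'c, 'f, 'd, 'g) tterm"

primrec tdom ::
  "('k, 'c, 'f) dgcat \<Rightarrow> ('k, 'd, 'g) dgcat \<Rightarrow> ('k, 'c, 'f, 'd, 'g) tterm \<Rightarrow> 'c \<times> 'd"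
where
  "tdom C D (TZero x y n) = x"
| "tdom C D (TId x) = x"
| "tdom C D (TL f d) = (Dom C f, d)"
| "tdom C D (TR c g) = (c, Dom D g)"
| "tdom C D (TE f gs) = (Dom C f, Dom D (hd gs))"
| "tdom C D (TAdd s t) = tdom C D s"
| "tdom C D (TScale a t) = tdom C D t"
| "tdom C D (TComp s t) = tdom C D t"

primrec tcod ::
  "('k, 'c, 'f) dgcat \<Rightarrow> ('k, 'd, 'g) dgcat \<Rightarrow> ('k, 'c, 'f, 'd, 'g) tterm \<Rightarrow> 'c \<times> 'd"
where
  "tcod C D (TZero x y n) = y"
| "tcod C D (TId x) = x"
| "tcod C D (TL f d) = (Cod C f, d)"
| "tcod C D (TR c g) = (c, Cod D g)"
| "tcod C D (TE f gs) = (Cod C f, Cod D (last gs))"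
| "tcod C D (TAdd s t) = tcod C D s"
| "tcod C D (TScale a t) = tcod C D t"
| "tcod C D (TComp s t) = tcod C D s"

primrec tdeg ::
  "('k, 'c, 'f) dgcat \<Rightarrow> ('k, 'd, 'g) dgcat \<Rightarrow> ('k, 'c, 'f, 'd, 'g) tterm \<Rightarrow> int"
where
  "tdeg C D (TZero x y n) = n"
| "tdeg C D (TId x) = 0"
| "tdeg C D (TL f d) = Deg C f"
| "tdeg C D (TR c g) = Deg D g"
| "tdeg C D (TE f gs) = Deg C f + wt D gs"
| "tdeg C D (TAdd s t) = tdeg C D s"
| "tdeg C D (TScale a t) = tdeg C D t"
| "tdeg C D (TComp s t) = tdeg C D s + tdeg C D t"

definition tpar ::
  "('k, 'c, 'f) dgcat \<Rightarrow> ('k, 'd, 'g) dgcat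
    \<Rightarrow> ('k, 'c, 'f, 'd, 'g) tterm \<Rightarrow> ('k, 'c, 'f, 'd, 'g) tterm \<Rightarrow> bool"
where
  "tpar C D s t \<longleftrightarrow> tdom C D s = tdom C D t \<and> tcod C D s = tcod C D t \<and> tdeg C D s = tdeg C D t"

primrec twf ::
  "'k ring \<Rightarrow> ('k, 'c, 'f) dgcat \<Rightarrow> ('k, 'd, 'g) dgcat \<Rightarrow> ('k, 'c, 'f, 'd, 'g) tterm \<Rightarrow> bool"
where
  "twf K C D (TZero x y n) \<longleftrightarrow> x \<in> Obj C \<times> Obj D \<and> y \<in> Obj C \<times> Obj D"
| "twf K C D (TId x) \<longleftrightarrow> x \<in> Obj C \<times> Obj D"
| "twf K C D (TL f d) \<longleftrightarrow> f \<in> arr C \<and> d \<in> Obj D"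
| "twf K C D (TR c g) \<longleftrightarrow> c \<in> Obj C \<and> g \<in> arr D"
| "twf K C D (TE f gs) \<longleftrightarrow> f \<in> arr C \<and> chain D gs"
| "twf K C D (TAdd s t) \<longleftrightarrow> twf K C D s \<and> twf K C D t \<and> tpar C D s t"
| "twf K C D (TScale a t) \<longleftrightarrow> a \<in> carrier K \<and> twf K C D t"
| "twf K C D (TComp s t) \<longleftrightarrow> twf K C D s \<and> twf K C D t \<and> tdom C D s = tcod C D t"

definition tsum ::
  "'c \<times> 'd \<Rightarrow> 'c \<times> 'd \<Rightarrow> int \<Rightarrow> ('k, 'c, 'f, 'd, 'g) tterm list \<Rightarrow> ('k, 'c, 'f, 'd, 'g) tterm"
where
  "tsum x y n ts = foldr TAdd ts (TZero x y n)"

text \<open>\<open>\<epsilon>(f; gs)\<close>, where \<open>\<epsilon>(f; \<emptyset>)\<close> is read as \<open>f \<otimes> id\<^sub>d\<close>.\<close>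

definition TE0 :: "'f \<Rightarrow> 'g list \<Rightarrow> 'd \<Rightarrow> ('k, 'c, 'f, 'd, 'g) tterm" where
  "TE0 f gs d = (if gs = [] then TL f d else TE f gs)"

text \<open>
  The congruence presenting the twisted tensor product as a graded linear category: first the
  laws of a graded linear category, then linearity in all arguments of the generators, and
  then the defining relations.  The identity of \<open>(c, d)\<close> is \<open>id\<^sub>c \<otimes> id\<^sub>d\<close> in both readings.
\<close>

inductive trel ::
  "'k ring \<Rightarrow> ('k, 'c, 'f) dgcat \<Rightarrow> ('k, 'd, 'g) dgcat
    \<Rightarrow> ('k, 'c, 'f, 'd, 'g) tterm \<Rightarrow> ('k, 'c, 'f, 'd, 'g) tterm \<Rightarrow> bool"
  for K :: "'k ring" and C :: "('k, 'c, 'f) dgcat" and D :: "('k, 'd, 'g) dgcat"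
where
  refl: "twf K C D t \<Longrightarrow> trel K C D t t"
| sym: "trel K C D s t \<Longrightarrow> trel K C D t s"
| trans: "\<lbrakk>trel K C D s t; trel K C D t u\<rbrakk> \<Longrightarrow> trel K C D s u"
| add_cong:
    "\<lbrakk>trel K C D s s'; trel K C D t t'; tpar C D s t\<rbrakk>
      \<Longrightarrow> trel K C D (TAdd s t) (TAdd s' t')"
| scale_cong:
    "\<lbrakk>a \<in> carrier K; trel K C D t t'\<rbrakk> \<Longrightarrow> trel K C D (TScale a t) (TScale a t')"
| comp_cong:
    "\<lbrakk>trel K C D s s'; trel K C D t t'; tdom C D s = tcod C D t\<rbrakk>
      \<Longrightarrow> trel K C D (TComp s t) (TComp s' t')"
| add_assoc:
    "twf K C D (TAdd (TAdd s t) u) \<Longrightarrow> trel K C D (TAdd (TAdd s t) u) (TAdd s (TAdd t u))"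
| add_comm:
    "twf K C D (TAdd s t) \<Longrightarrow> trel K C D (TAdd s t) (TAdd t s)"
| add_zero:
    "twf K C D t
      \<Longrightarrow> trel K C D (TAdd (TZero (tdom C D t) (tcod C D t) (tdeg C D t)) t) t"
| scale_zero:
    "twf K C D t
      \<Longrightarrow> trel K C D (TScale \<zero>\<^bsub>K\<^esub> t) (TZero (tdom C D t) (tcod C D t) (tdeg C D t))"
| scale_one:
    "twf K C D t \<Longrightarrow> trel K C D (TScale \<one>\<^bsub>K\<^esub> t) t"
| scale_scale:
    "\<lbrakk>a \<in> carrier K; b \<in> carrier K; twf K C D t\<rbrakk>
      \<Longrightarrow> trel K C D (TScale a (TScale b t)) (TScale (a \<otimes>\<^bsub>K\<^esub> b) t)"
| scale_add_scalar:
    "\<lbrakk>a \<in> carrier K; b \<in> carrier K; twf K C D t\<rbrakk>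
      \<Longrightarrow> trel K C D (TScale (a \<oplus>\<^bsub>K\<^esub> b) t) (TAdd (TScale a t) (TScale b t))"
| scale_add:
    "\<lbrakk>a \<in> carrier K; twf K C D (TAdd s t)\<rbrakk>
      \<Longrightarrow> trel K C D (TScale a (TAdd s t)) (TAdd (TScale a s) (TScale a t))"
| comp_assoc:
    "twf K C D (TComp (TComp s t) u)
      \<Longrightarrow> trel K C D (TComp (TComp s t) u) (TComp s (TComp t u))"
| comp_id_left:
    "twf K C D t \<Longrightarrow> trel K C D (TComp (TId (tcod C D t)) t) t"
| comp_id_right:
    "twf K C D t \<Longrightarrow> trel K C D (TComp t (TId (tdom C D t))) t"
| comp_add_left:
    "twf K C D (TComp (TAdd s s') t)
      \<Longrightarrow> trel K C D (TComp (TAdd s s') t) (TAdd (TComp s t) (TComp s' t))"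
| comp_add_right:
    "twf K C D (TComp s (TAdd t t'))
      \<Longrightarrow> trel K C D (TComp s (TAdd t t')) (TAdd (TComp s t) (TComp s t'))"
| comp_scale_left:
    "twf K C D (TComp (TScale a s) t)
      \<Longrightarrow> trel K C D (TComp (TScale a s) t) (TScale a (TComp s t))"
| comp_scale_right:
    "twf K C D (TComp s (TScale a t))
      \<Longrightarrow> trel K C D (TComp s (TScale a t)) (TScale a (TComp s t))"
| L_add:
    "\<lbrakk>x \<in> Obj C; y \<in> Obj C; f \<in> carrier (Mor C x y n); f' \<in> carrier (Mor C x y n); d \<in> Obj D\<rbrakk>
      \<Longrightarrow> trel K C D (TL (f \<oplus>\<^bsub>Mor C x y n\<^esub> f') d) (TAdd (TL f d) (TL f' d))"
| L_scale:
    "\<lbrakk>x \<in> Obj C; y \<in> Obj C; f \<in> carrier (Mor C x y n); a \<in> carrier K; d \<in> Obj D\<rbrakk>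
      \<Longrightarrow> trel K C D (TL (a \<odot>\<^bsub>Mor C x y n\<^esub> f) d) (TScale a (TL f d))"
| R_add:
    "\<lbrakk>x \<in> Obj D; y \<in> Obj D; g \<in> carrier (Mor D x y n); g' \<in> carrier (Mor D x y n); c \<in> Obj C\<rbrakk>
      \<Longrightarrow> trel K C D (TR c (g \<oplus>\<^bsub>Mor D x y n\<^esub> g')) (TAdd (TR c g) (TR c g'))"
| R_scale:
    "\<lbrakk>x \<in> Obj D; y \<in> Obj D; g \<in> carrier (Mor D x y n); a \<in> carrier K; c \<in> Obj C\<rbrakk>
      \<Longrightarrow> trel K C D (TR c (a \<odot>\<^bsub>Mor D x y n\<^esub> g)) (TScale a (TR c g))"
| E_add_left:
    "\<lbrakk>x \<in> Obj C; y \<in> Obj C; f \<in> carrier (Mor C x y n); f' \<in> carrier (Mor C x y n); chain D gs\<rbrakk>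
      \<Longrightarrow> trel K C D (TE (f \<oplus>\<^bsub>Mor C x y n\<^esub> f') gs) (TAdd (TE f gs) (TE f' gs))"
| E_scale_left:
    "\<lbrakk>x \<in> Obj C; y \<in> Obj C; f \<in> carrier (Mor C x y n); a \<in> carrier K; chain D gs\<rbrakk>
      \<Longrightarrow> trel K C D (TE (a \<odot>\<^bsub>Mor C x y n\<^esub> f) gs) (TScale a (TE f gs))"
| E_add_right:
    "\<lbrakk>f \<in> arr C; x \<in> Obj D; y \<in> Obj D; g \<in> carrier (Mor D x y n); g' \<in> carrier (Mor D x y n);
      chain D (as @ g # bs)\<rbrakk>
      \<Longrightarrow> trel K C D (TE f (as @ (g \<oplus>\<^bsub>Mor D x y n\<^esub> g') # bs))
            (TAdd (TE f (as @ g # bs)) (TE f (as @ g' # bs)))"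
| E_scale_right:
    "\<lbrakk>f \<in> arr C; x \<in> Obj D; y \<in> Obj D; g \<in> carrier (Mor D x y n); a \<in> carrier K;
      chain D (as @ g # bs)\<rbrakk>
      \<Longrightarrow> trel K C D (TE f (as @ (a \<odot>\<^bsub>Mor D x y n\<^esub> g) # bs)) (TScale a (TE f (as @ g # bs)))"
| L_id:
    "\<lbrakk>c \<in> Obj C; d \<in> Obj D\<rbrakk> \<Longrightarrow> trel K C D (TL (Idn C c) d) (TId (c, d))"
| R_id:
    "\<lbrakk>c \<in> Obj C; d \<in> Obj D\<rbrakk> \<Longrightarrow> trel K C D (TR c (Idn D d)) (TId (c, d))"
| L_comp:
    "\<lbrakk>f1 \<in> arr C; f2 \<in> arr C; Cod C f1 = Dom C f2; d \<in> Obj D\<rbrakk>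
      \<Longrightarrow> trel K C D (TComp (TL f2 d) (TL f1 d)) (TL (Comp C f2 f1) d)"
| R_comp:
    "\<lbrakk>g1 \<in> arr D; g2 \<in> arr D; Cod D g1 = Dom D g2; c \<in> Obj C\<rbrakk>
      \<Longrightarrow> trel K C D (TComp (TR c g2) (TR c g1)) (TR c (Comp D g2 g1))"
| E_id_left:
    "\<lbrakk>c \<in> Obj C; chain D gs; t = TE (Idn C c) gs\<rbrakk>
      \<Longrightarrow> trel K C D t (TZero (tdom C D t) (tcod C D t) (tdeg C D t))"
| E_id_right:
    "\<lbrakk>f \<in> arr C; chain D gs; d \<in> Obj D; Idn D d \<in> set gs; t = TE f gs\<rbrakk>
      \<Longrightarrow> trel K C D t (TZero (tdom C D t) (tcod C D t) (tdeg C D t))"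
| E_comp:
    "\<lbrakk>f1 \<in> arr C; f2 \<in> arr C; Cod C f1 = Dom C f2; chain D gs; t = TE (Comp C f2 f1) gs\<rbrakk>
      \<Longrightarrow> trel K C D t
            (tsum (tdom C D t) (tcod C D t) (tdeg C D t)
              (map (\<lambda>m. TScale (sg K (Deg C f1 * wt D (drop m gs)))
                     (TComp (TE0 f2 (drop m gs) (Cod D (last gs)))
                            (TE0 f1 (take m gs) (Dom D (hd gs)))))
                   [0..<Suc (length gs)]))"

text \<open>
  The differential on expressions; on \<open>\<epsilon>(f; g\<^sub>1, \<dots>, g\<^sub>n)\<close>, for all \<open>n \<ge> 1\<close>, it is
  \[ d\varepsilon(f;g_1,\dots,g_n) = \varepsilon(df;g_1,\dots,g_n)
     + \sum_{j} (-1)^{|f|+\sum_{i>j}(|g_i|-1)+1}\varepsilon(f;g_1,\dots,dg_j,\dots,g_n) - B, \]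
  \[ B = (-1)^{|f||g_n|+|f|}(id\otimes g_n)\star\varepsilon(f;g_1,\dots,g_{n-1})
     + (-1)^{|f|+\sum_{i\ge 2}(|g_i|+1)+1}\varepsilon(f;g_2,\dots,g_n)\star(id\otimes g_1)
     + \sum_{i<n}(-1)^{|f|+\sum_{j>i}(|g_j|+1)}\varepsilon(f;\dots,g_{i+1}g_i,\dots). \]
  Pitfall: in the literature this formula also occurs with \<open>(-1)^{|f|+\<dots>+n-j}\<close> in the first
  sum and with a factor \<open>(-1)^{|f|+n-1}\<close> in front of \<open>B\<close>.  That version does not satisfy
  \<open>d\<^sup>2 = 0\<close> when \<open>2 \<noteq> 0\<close>: already for \<open>|f| = |g| = 0\<close> and \<open>df = 0\<close> it gives
  \<open>d\<^sup>2 \<epsilon>(f;g) = 2((f \<otimes> id) \<star> (id \<otimes> dg) - (id \<otimes> dg) \<star> (f \<otimes> id))\<close>.  The signs used here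
  are compatible with the relation for \<open>\<epsilon>(f\<^sub>2f\<^sub>1; \<dots>)\<close> and the Leibniz rule of
  \<^locale>\<open>dg_category\<close>.
\<close>

primrec tdif ::
  "'k ring \<Rightarrow> ('k, 'c, 'f) dgcat \<Rightarrow> ('k, 'd, 'g) dgcat
    \<Rightarrow> ('k, 'c, 'f, 'd, 'g) tterm \<Rightarrow> ('k, 'c, 'f, 'd, 'g) tterm"
where
  "tdif K C D (TZero x y n) = TZero x y (n + 1)"
| "tdif K C D (TId x) = TZero x x 1"
| "tdif K C D (TL f d) = TL (Dif C f) d"
| "tdif K C D (TR c g) = TR c (Dif D g)"
| "tdif K C D (TE f gs) =
    (let n = length gs; p = Deg C f in
     tsum (tdom C D (TE f gs)) (tcod C D (TE f gs)) (tdeg C D (TE f gs) + 1)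
      ([TE (Dif C f) gs]
       @ map (\<lambda>j. TScale (sg K (p + wt D (drop (j + 1) gs) + 1)) (TE f (gs[j := Dif D (gs ! j)])))
           [0..<n]
       @ map (TScale (\<ominus>\<^bsub>K\<^esub> \<one>\<^bsub>K\<^esub>))
           ([TScale (sg K (p * Deg D (last gs) + p))
               (TComp (TR (Cod C f) (last gs)) (TE0 f (butlast gs) (Dom D (hd gs)))),
             TScale (sg K (p + wt D (tl gs) + 1))
               (TComp (TE0 f (tl gs) (Cod D (last gs))) (TR (Dom C f) (hd gs)))]
            @ map (\<lambda>i. TScale (sg K (p + wt D (drop (i + 1) gs)))
                     (TE f (take i gs @ [Comp D (gs ! (i + 1)) (gs ! i)] @ drop (i + 2) gs)))
                [0..<n - 1])))"
| "tdif K C D (TAdd s t) = TAdd (tdif K C D s) (tdif K C D t)"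
| "tdif K C D (TScale a t) = TScale a (tdif K C D t)"
| "tdif K C D (TComp s t) =
    TAdd (TComp (tdif K C D s) t) (TScale (sg K (tdeg C D s)) (TComp s (tdif K C D t)))"

text \<open>
  Morphisms of the twisted tensor product are equivalence classes of expressions.
  The fields \<^const>\<open>mult\<close> and \<^const>\<open>one\<close> of a module record have no meaning for a module.
\<close>

definition tcls ::
  "'k ring \<Rightarrow> ('k, 'c, 'f) dgcat \<Rightarrow> ('k, 'd, 'g) dgcat
    \<Rightarrow> ('k, 'c, 'f, 'd, 'g) tterm \<Rightarrow> ('k, 'c, 'f, 'd, 'g) tterm set"
where
  "tcls K C D t = {s. trel K C D t s}"

definition ttensor ::
  "'k ring \<Rightarrow> ('k, 'c, 'f) dgcat \<Rightarrow> ('k, 'd, 'g) dgcat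
    \<Rightarrow> ('k, 'c \<times> 'd, ('k, 'c, 'f, 'd, 'g) tterm set) dgcat"
where
  "ttensor K C D =
    \<lparr>Obj = Obj C \<times> Obj D,
     Mor = (\<lambda>x y n.
       \<lparr>carrier = tcls K C D ` {t. twf K C D t \<and> tdom C D t = x \<and> tcod C D t = y \<and> tdeg C D t = n},
        mult = undefined, one = undefined,
        zero = tcls K C D (TZero x y n),
        add = (\<lambda>A B. \<Union>s\<in>A. \<Union>t\<in>B. tcls K C D (TAdd s t)),
        smult = (\<lambda>a A. \<Union>t\<in>A. tcls K C D (TScale a t))\<rparr>),
     Dom = (\<lambda>A. the_elem (tdom C D ` A)),
     Cod = (\<lambda>A. the_elem (tcod C D ` A)),
     Deg = (\<lambda>A. the_elem (tdeg C D ` A)),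
     Idn = (\<lambda>x. tcls K C D (TId x)),
     Comp = (\<lambda>A B. \<Union>s\<in>A. \<Union>t\<in>B. tcls K C D (TComp s t)),
     Dif = (\<lambda>A. \<Union>t\<in>A. tcls K C D (tdif K C D t))\<rparr>"

definition tleft where "tleft K C D f d = tcls K C D (TL f d)"

definition tright where "tright K C D c g = tcls K C D (TR c g)"

definition teps where "teps K C D f gs = tcls K C D (TE f gs)"

text \<open>\<open>F \<otimes> G\<close> applies \<open>F\<close> and \<open>G\<close> to the arguments of the generators.\<close>

definition ttensor_fun ::
  "'k ring \<Rightarrow> ('k, 'c, 'f) dgcat \<Rightarrow> ('k, 'd, 'g) dgcat \<Rightarrow> ('k, 'c1, 'f1) dgcat \<Rightarrow> ('k, 'd1, 'g1) dgcat
    \<Rightarrow> ('c, 'f, 'c1, 'f1) dgfun \<Rightarrow> ('d, 'g, 'd1, 'g1) dgfun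
    \<Rightarrow> ('c \<times> 'd, ('k, 'c, 'f, 'd, 'g) tterm set,
        'c1 \<times> 'd1, ('k, 'c1, 'f1, 'd1, 'g1) tterm set) dgfun"
where
  "ttensor_fun K C D C1 D1 F G =
    \<lparr>FObj = restrict (map_prod (FObj F) (FObj G)) (Obj (ttensor K C D)),
     FMor = restrict
       (\<lambda>A. \<Union>t\<in>A. tcls K C1 D1 (map_tterm id (FObj F) (FMor F) (FObj G) (FMor G) t))
       (arr (ttensor K C D))\<rparr>"

section \<open>The associator\<close>

text \<open>
  A sequence \<open>0 \<le> i\<^sub>1 \<le> j\<^sub>1 \<le> \<dots> \<le> i\<^sub>k \<le> j\<^sub>k \<le> N\<close> is the list of pairs \<open>(i\<^sub>l, j\<^sub>l)\<close>.
\<close>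

definition assoc_index :: "nat \<Rightarrow> nat \<Rightarrow> (nat \<times> nat) list set" where
  "assoc_index k N =
    {ps. length ps = k \<and> sorted (concat (map (\<lambda>(i, j). [i, j]) ps)) \<and> (\<forall>(i, j)\<in>set ps. j \<le> N)}"

text \<open>\<open>h\<^sub>a\<^sub>+\<^sub>1, \<dots>, h\<^sub>b\<close>\<close>

definition segment :: "nat \<Rightarrow> nat \<Rightarrow> 'a list \<Rightarrow> 'a list" where
  "segment a b hs = take (b - a) (drop a hs)"

text \<open>The object reached after the first \<open>a\<close> morphisms of a chain.\<close>

definition chain_obj :: "('k, 'o, 'm) dgcat \<Rightarrow> 'm list \<Rightarrow> nat \<Rightarrow> 'o" where
  "chain_obj E hs a = (if a < length hs then Dom E (hs ! a) else Cod E (last hs))"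

text \<open>
  The arguments of the summand for the indices \<open>ps\<close>, starting after the first \<open>a\<close> of
  the \<open>h\<close>'s and at the object \<open>Y\<close> of \<open>D\<close>.
\<close>

fun assoc_args ::
  "'k ring \<Rightarrow> ('k, 'd, 'g) dgcat \<Rightarrow> ('k, 'e, 'h) dgcat \<Rightarrow> 'h list \<Rightarrow> nat \<Rightarrow> 'd
    \<Rightarrow> 'g list \<Rightarrow> (nat \<times> nat) list \<Rightarrow> ('k, 'd, 'g, 'e, 'h) tterm set list"
where
  "assoc_args K D E hs a Y (g # gs) ((i, j) # ps) =
    map (tright K D E Y) (segment a i hs)
    @ (if i = j then tleft K D E g (chain_obj E hs i) else teps K D E g (segment i j hs))
    # assoc_args K D E hs j (Cod D g) gs ps"
| "assoc_args K D E hs a Y _ _ = map (tright K D E Y) (drop a hs)"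

text \<open>
  The sign exponent is
  \<open>\<Sum>\<^sub>l (|g\<^sub>l| - 1) \<cdot> \<Sum>\<^sub>s (|h\<^sub>s| - 1)\<close>, where \<open>s\<close> ranges over \<open>j\<^sub>l < s \<le> N\<close>:
  the shifted \<open>g\<^sub>l\<close> moves past the shifted \<open>h\<^sub>s\<close> inserted after it, in accordance with the
  relation for \<open>\<epsilon>(f\<^sub>2f\<^sub>1; \<dots>)\<close>.  Pitfall: the exponent \<open>\<Sum>\<^sub>l |g\<^sub>l| \<cdot> \<Sum>\<^sub>s (|h\<^sub>s| - 1)\<close>
  over \<open>s \<le> i\<^sub>l\<close> also occurs in the literature; with it, and with that relation as above, the
  map is not compatible with composition when \<open>2 \<noteq> 0\<close>, as \<open>k = N = 1\<close> already shows.
\<close>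

definition assoc_sign ::
  "'k ring \<Rightarrow> ('k, 'd, 'g) dgcat \<Rightarrow> ('k, 'e, 'h) dgcat
    \<Rightarrow> 'g list \<Rightarrow> 'h list \<Rightarrow> (nat \<times> nat) list \<Rightarrow> 'k"
where
  "assoc_sign K D E gs hs ps =
    sg K (\<Sum>l<length gs. (Deg D (gs ! l) - 1) * wt E (drop (snd (ps ! l)) hs))"

definition associator ::
  "'k ring \<Rightarrow> ('k, 'c, 'f) dgcat \<Rightarrow> ('k, 'd, 'g) dgcat \<Rightarrow> ('k, 'e, 'h) dgcat
    \<Rightarrow> (('c \<times> 'd) \<times> 'e, ('k, 'c \<times> 'd, ('k, 'c, 'f, 'd, 'g) tterm set, 'e, 'h) tterm set,
        'c \<times> ('d \<times> 'e), ('k, 'c, 'f, 'd \<times> 'e, ('k, 'd, 'g, 'e, 'h) tterm set) tterm set) dgfun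
    \<Rightarrow> bool"
where
  "associator K C D E \<alpha> \<longleftrightarrow>
    (let CD = ttensor K C D; DE = ttensor K D E; T = ttensor K C DE; app = FMor \<alpha> in
    dg_functor K (ttensor K CD E) T \<alpha> \<and>
    (\<forall>X\<in>Obj C. \<forall>Y\<in>Obj D. \<forall>Z\<in>Obj E. FObj \<alpha> ((X, Y), Z) = (X, (Y, Z))) \<and>
    (\<forall>f\<in>arr C. \<forall>Y\<in>Obj D. \<forall>Z\<in>Obj E.
      app (tleft K CD E (tleft K C D f Y) Z) = tleft K C DE f (Y, Z)) \<and>
    (\<forall>X\<in>Obj C. \<forall>g\<in>arr D. \<forall>Z\<in>Obj E.
      app (tleft K CD E (tright K C D X g) Z) = tright K C DE X (tleft K D E g Z)) \<and>
    (\<forall>X\<in>Obj C. \<forall>Y\<in>Obj D. \<forall>h\<in>arr E.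
      app (tright K CD E (X, Y) h) = tright K C DE X (tright K D E Y h)) \<and>
    (\<forall>f\<in>arr C. \<forall>gs. \<forall>Z\<in>Obj E. chain D gs \<longrightarrow>
      app (tleft K CD E (teps K C D f gs) Z) = teps K C DE f (map (\<lambda>g. tleft K D E g Z) gs)) \<and>
    (\<forall>f\<in>arr C. \<forall>Y\<in>Obj D. \<forall>hs. chain E hs \<longrightarrow>
      app (teps K CD E (tleft K C D f Y) hs) = teps K C DE f (map (tright K D E Y) hs)) \<and>
    (\<forall>X\<in>Obj C. \<forall>g\<in>arr D. \<forall>hs. chain E hs \<longrightarrow>
      app (teps K CD E (tright K C D X g) hs) = tright K C DE X (teps K D E g hs)) \<and>
    (\<forall>f\<in>arr C. \<forall>gs hs. chain D gs \<longrightarrow> chain E hs \<longrightarrow>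
      (let M = Mor T (Dom C f, (Dom D (hd gs), Dom E (hd hs)))
                     (Cod C f, (Cod D (last gs), Cod E (last hs)))
                     (Deg C f + wt D gs + wt E hs)
       in app (teps K CD E (teps K C D f gs) hs) =
            (\<Oplus>\<^bsub>M\<^esub>ps\<in>assoc_index (length gs) (length hs).
               assoc_sign K D E gs hs ps \<odot>\<^bsub>M\<^esub>
               teps K C DE f (assoc_args K D E hs 0 (Dom D (hd gs)) gs ps)))))"

end

theory Submission
 imports Complex_Main "HOL-Library.Function_Algebras" "HOL-Library.Product_Plus" Defs
begin

text \<open>A dg functor on the twisted tensor product of \<open>C\<close> and \<open>D\<close> amounts to dg functors on \<open>D\<close>, one for each
 object of \<open>C\<close>, and a dg functor on \<open>C\<close> whose values on morphisms are normalized cochains on the bar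
 construction of \<open>D\<close>, \<open>f\<close> being sent to the images of the \<open>\<epsilon>(f; -)\<close>: relation (R4) is compatibility with the
 cup product, and the formula for \<open>d \<epsilon>(f; -)\<close> is compatibility with the Hochschild type differential. Summing over
 shuffles turns cochains on the twisted tensor product of \<open>D\<close> and \<open>E\<close> into cochains on \<open>D\<close> with values in
 cochains on \<open>E\<close>, respecting products and differentials. Applied to the universal cochains on the target this
 gives the associator with formula (iv). Uniqueness and naturality hold because functors that agree on the
 generators coincide.

 Signs are manipulated in a type of class \<^class>\<open>ab_group_add\<close>: since characters into the circle separate the
 points of an abelian group, every graded category embeds into one whose morphisms form subgroups of a type.\<close>

\<comment> \<open>The differential of a twisted tensor product is prescribed on expressions only, so
  it has to be shown to respect the relations and to square to zero. The first follows from the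
  universal property itself, applied to dual numbers, in which a derivation becomes a homomorphism.
  The second is checked on generators: the total differential of the universal cochain of
  \<open>f\<close> is the universal cochain of \<open>df\<close>, and the internal differential has
  the same square as the total one. The universal property thus serves several targets: dual
  numbers, the realization of a dg category, and, for the associator, a category whose morphisms are
  cochains on \<open>E\<close>. This is why targets are locales of subgroups of one type, with a
  product that receives the degree of its right factor: the sign of the cup product depends on it.
  Spaces of cochains contain all graded functions; multilinearity and normalization are predicates
  that are followed through every construction. The associator arises from two nested
  interpretations of expressions: \<open>I\<close> sends those in \<open>C\<close> and
  \<open>D\<close> to cochains on \<open>E\<close>, and these cochains are the data of
  \<open>O\<close>, which ends in the target.\<close>
quotient_type circle = real / "\<lambda>x y. x - y \<in> \<int>"
proof (rule equivpI)
 show "reflp (\<lambda>x y::real. x - y \<in> \<int>)" by (simp add: reflp_def)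
 show "symp (\<lambda>x y::real. x - y \<in> \<int>)"
  unfolding symp_def by (metis Ints_minus minus_diff_eq)
 show "transp (\<lambda>x y::real. x - y \<in> \<int>)"
  unfolding transp_def by (metis Ints_add diff_add_cancel add_diff_eq)
qed

instantiation circle :: ab_group_add
begin

lift_definition zero_circle :: circle is 0 .

lift_definition plus_circle :: "circle => circle => circle" is "(+)"
 by (metis Ints_add add_diff_add)

lift_definition uminus_circle :: "circle => circle" is uminus
 by (metis Ints_minus minus_diff_minus)

lift_definition minus_circle :: "circle => circle => circle" is "(-)"
 by (smt (verit) Ints_diff)

instance
 by standard (transfer; simp)+

end

lift_definition circ :: "real => circle" is "\<lambda>x. x" .

lemma circ_add: "circ (x + y) = circ x + circ y"
 by transfer simp

lemma circ_minus: "circ (- x) = - circ x"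
 by transfer simp

lemma circ_eq_iff: "circ x = circ y \<longleftrightarrow> x - y \<in> \<int>"
 by transfer simp

lemma circ_zero: "circ 0 = 0"
 by transfer simp

lemma circ_surj: "\<exists>x. q = circ x"
 by transfer (metis Ints_0 cancel_comm_monoid_add_class.diff_cancel)

text \<open>Partial homomorphisms into the circle are represented by their graphs, so that the union
 of a chain of them is again one.\<close>

definition char_graph :: "('a, 'b) ring_scheme => ('a \<times> circle) set => bool" where
 "char_graph G r \<longleftrightarrow> r \<subseteq> carrier G \<times> UNIV \<and> (\<zero>\<^bsub>G\<^esub>, 0) \<in> r \<and>
  (\<forall>a p b q. (a, p) \<in> r \<longrightarrow> (b, q) \<in> r \<longrightarrow> (a \<oplus>\<^bsub>G\<^esub> b, p + q) \<in> r) \<and>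
  (\<forall>a p. (a, p) \<in> r \<longrightarrow> (\<ominus>\<^bsub>G\<^esub> a, - p) \<in> r) \<and>
  (\<forall>q. (\<zero>\<^bsub>G\<^esub>, q) \<in> r \<longrightarrow> q = 0)"

section \<open>Characters of an abelian group with values in the circle\<close>

context abelian_group
begin

lemma add_pow_int_0: "add_pow G (0::int) x = \<zero>"
 by (simp add: add_pow_def)

lemma char_graph_unique:
 assumes "char_graph G r" "(a, p) \<in> r" "(a, q) \<in> r"
 shows "p = q"
proof -
 have a: "a \<in> carrier G" using assms unfolding char_graph_def by auto
 have "(\<ominus> a, - q) \<in> r" using assms unfolding char_graph_def by blast
 hence "(a \<oplus> \<ominus> a, p + - q) \<in> r" using assms unfolding char_graph_def by blast
 hence "(\<zero>, p - q) \<in> r" using a by (simp add: r_neg)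
 thus ?thesis using assms(1) unfolding char_graph_def by force
qed

lemma char_graph_multiple:
 assumes r: "char_graph G r" and x: "x \<in> carrier G" "(add_pow G k x, circ s) \<in> r"
 shows "(add_pow G (m * k :: int) x, circ (of_int m * s)) \<in> r"
proof (induction m rule: int_induct[where k = 0])
 case base
 thus ?case using r by (simp add: char_graph_def circ_zero add_pow_int_0)
next
 case (step1 i)
 have "(add_pow G (i * k) x \<oplus> add_pow G k x, circ (of_int i * s) + circ s) \<in> r"
  using r x(2) step1(2) unfolding char_graph_def by blast
 thus ?case
  using x(1) by (simp add: add.int_pow_mult[symmetric] distrib_right circ_add)
next
 case (step2 i)
 have "(\<ominus> add_pow G k x, - circ s) \<in> r"
  using r x(2) unfolding char_graph_def by blast
 hence "(add_pow G (i * k) x \<oplus> \<ominus> add_pow G k x, circ (of_int i * s) + - circ s) \<in> r"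
  using r step2(2) unfolding char_graph_def by blast
 thus ?case
  using x(1) by (simp add: add.int_pow_mult[symmetric] add.int_pow_neg[symmetric]
    left_diff_distrib circ_add[symmetric] circ_minus[symmetric])
qed

text \<open>The circle is divisible, so a value at \<open>x\<close> compatible with the values at
  those multiples of \<open>x\<close> that already lie in the domain exists. It can be taken nonzero
  because \<open>x\<close> itself is outside the domain: either no positive multiple of
  \<open>x\<close> is constrained, or the least constrained one is \<open>k x\<close> with
  \<open>k\<close> at least 2, which leaves \<open>k\<close> choices.\<close>

lemma char_graph_extend:
 assumes r: "char_graph G r" and x: "x \<in> carrier G" "x \<notin> Domain r"
 shows "\<exists>r' y. char_graph G r' \<and> r \<subseteq> r' \<and> (x, y) \<in> r' \<and> y \<noteq> 0"
proof -
 have "\<exists>t. t \<notin> \<int> \<and> (\<forall>n. add_pow G (n::int) x \<in> Domain r \<longrightarrow>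
     (add_pow G n x, circ (of_int n * t)) \<in> r)"
 proof (cases "\<exists>n>0::nat. add_pow G (int n) x \<in> Domain r")
  case True
  \<comment> \<open>The value at \<open>k x\<close> is the only constraint: by minimality the
    integers \<open>n\<close> with \<open>n x\<close> in the domain are exactly the multiples of
    \<open>k\<close>.\<close>
  define k where "k = (LEAST n::nat. n > 0 \<and> add_pow G (int n) x \<in> Domain r)"
  have k: "k > 0" "add_pow G (int k) x \<in> Domain r"
   using True unfolding k_def by (metis (mono_tags, lifting) LeastI_ex)+
  have kmin: "k \<le> n" if "n > 0" "add_pow G (int n) x \<in> Domain r" for n
   unfolding k_def using that by (intro Least_le) auto
  have "k \<noteq> 1" using k x by (auto simp: add.int_pow_1)
  hence k2: "k \<ge> 2" using k by simp
  obtain s where s: "(add_pow G (int k) x, circ s) \<in> r"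
   using k(2) circ_surj by (metis DomainE)
  have "\<exists>t j. t \<notin> \<int> \<and> of_nat k * t = s + of_int j"
  proof (cases "s / of_nat k \<in> \<int>")
   case False
   thus ?thesis using k by (intro exI[of _ "s / of_nat k"] exI[of _ 0]) simp
  next
   case True
   \<comment> \<open>\<open>s / k\<close> and \<open>(s + 1) / k\<close> are both admissible and
     differ by \<open>1 / k\<close>, so they are not both integers.\<close>
   have "(s + 1) / of_nat k \<notin> \<int>"
   proof
    assume "(s + 1) / real k \<in> \<int>"
    hence "(s + 1) / real k - s / real k \<in> \<int>" using True by simp
    hence "1 / real k \<in> \<int>" by (simp add: diff_divide_distrib[symmetric])
    then obtain z :: int where "1 / real k = of_int z" by (elim Ints_cases)
    moreover have "0 < 1 / real k" "1 / real k < 1" using k2 by auto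
    ultimately have "0 < z" "z < 1" by simp_all
    thus False by simp
   qed
   thus ?thesis using k by (intro exI[of _ "(s + 1) / of_nat k"] exI[of _ 1]) simp
  qed
  then obtain t j where t: "t \<notin> \<int>" "of_nat k * t = s + of_int j" by blast
  have "(add_pow G n x, circ (of_int n * t)) \<in> r" if n: "add_pow G n x \<in> Domain r" for n
  proof -
   define m where "m = n div int k"
   have nm: "n = m * int k + n mod int k" by (simp add: m_def)
   have m: "(add_pow G (m * int k) x, circ (of_int m * s)) \<in> r"
    by (rule char_graph_multiple[OF r x(1) s])
   obtain p where p: "(add_pow G n x, p) \<in> r" using n by (rule DomainE)
   have "(\<ominus> add_pow G (m * int k) x, - circ (of_int m * s)) \<in> r"
    using r m unfolding char_graph_def by blast
   hence "(add_pow G n x \<oplus> \<ominus> add_pow G (m * int k) x, p + - circ (of_int m * s)) \<in> r"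
    using r p unfolding char_graph_def by blast
   hence "add_pow G (n - m * int k) x \<in> Domain r"
    using x(1) by (auto simp: add.int_pow_mult[symmetric] add.int_pow_neg[symmetric] Domain.simps)
   hence dom: "add_pow G (int (nat (n mod int k))) x \<in> Domain r"
    using nm k(1) by (simp add: minus_mult_div_eq_mod m_def mult.commute)
   have "nat (n mod int k) < k" using k(1)
    by (metis nat_less_iff of_nat_0_less_iff pos_mod_bound pos_mod_sign)
   hence "nat (n mod int k) = 0" using kmin[OF _ dom] by linarith
   hence "n mod int k = 0" using k(1)
    by (metis nat_0_iff of_nat_0_less_iff order_antisym pos_mod_sign)
   hence n_eq: "n = m * int k" using nm by simp
   have "real_of_int n * t = of_int m * (real k * t)" by (simp add: n_eq)
   also have "\<dots> = of_int m * s + of_int (m * j)" by (simp add: t(2) distrib_left)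
   finally have "circ (of_int n * t) = circ (of_int m * s)"
    unfolding circ_eq_iff by (metis Ints_of_int add_diff_cancel_left')
   with m n_eq show ?thesis by simp
  qed
  with t(1) show ?thesis by blast
 next
  \<comment> \<open>Only \<open>n = 0\<close> meets the domain, so any value is allowed;
    \<open>1/2\<close> is a convenient nonzero one.\<close>
  case False
  have "n = 0" if n: "add_pow G (n::int) x \<in> Domain r" for n
  proof (rule ccontr)
   assume "n \<noteq> 0"
   show False
   proof (cases "n > 0")
    case True
    with False that show False by (metis nat_0_le order_less_imp_le zero_less_nat_eq)
   next
    case neg: False
    obtain p where "(add_pow G n x, p) \<in> r" using n by (rule DomainE)
    hence "(\<ominus> add_pow G n x, - p) \<in> r" using r unfolding char_graph_def by blast
    hence "add_pow G (- n) x \<in> Domain r"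
     using x(1) by (auto simp: add.int_pow_neg Domain.simps)
    with False neg \<open>n \<noteq> 0\<close> show False
     by (metis nat_0_le neg_0_le_iff_le linorder_not_less neg_0_less_iff_less
       order_le_less zero_less_nat_eq)
   qed
  qed
  moreover have "(1/2::real) \<notin> \<int>"
  proof
   assume "(1/2::real) \<in> \<int>"
   then obtain z :: int where z: "1/2 = real_of_int z" by (elim Ints_cases)
   hence "2 * z = 1" by linarith
   thus False by presburger
  qed
  moreover have "(\<zero>, 0) \<in> r" using r unfolding char_graph_def by blast
  ultimately show ?thesis
   by (intro exI[of _ "1/2"] conjI allI impI)
    (assumption, metis add_pow_int_0 circ_zero mult_zero_left of_int_0)
 qed
 then obtain t where t: "t \<notin> \<int>"
   "\<And>n. add_pow G (n::int) x \<in> Domain r ==> (add_pow G n x, circ (of_int n * t)) \<in> r"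
  by blast
 \<comment> \<open>The graph generated by \<open>r\<close> and the pair of \<open>x\<close> with the
   class of \<open>t\<close>. It stays single-valued because a relation \<open>a + n x = 0\<close>
   forces \<open>n x\<close> into the old domain, where \<open>t\<close> was chosen to agree with
   \<open>r\<close>.\<close>
 define r' where "r' = {(a \<oplus> add_pow G (n::int) x, p + circ (of_int n * t)) | a p n. (a, p) \<in> r}"
 have rc: "a \<in> carrier G" if "(a, p) \<in> r" for a p using r that unfolding char_graph_def by auto
 have I: "(a \<oplus> add_pow G n x, p + circ (of_int n * t)) \<in> r'" if "(a, p) \<in> r" for a p n
  using that unfolding r'_def by blast
 have "char_graph G r'"
  unfolding char_graph_def
 proof (intro conjI allI impI, goal_cases)
  show "r' \<subseteq> carrier G \<times> UNIV" unfolding r'_def using rc x(1) by auto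
  show "(\<zero>, 0) \<in> r'" using I[of \<zero> 0 0] r by (simp add: char_graph_def circ_zero add_pow_int_0)
 next
  case (3 a p b q)
  then obtain a' p' n b' q' m where *: "(a', p') \<in> r" "(b', q') \<in> r"
   "a = a' \<oplus> add_pow G (n::int) x" "p = p' + circ (of_int n * t)"
   "b = b' \<oplus> add_pow G (m::int) x" "q = q' + circ (of_int m * t)"
   unfolding r'_def by blast
  have "(a' \<oplus> b', p' + q') \<in> r" using r *(1,2) unfolding char_graph_def by blast
  from I[OF this, of "n + m"] show ?case
   using rc[OF *(1)] rc[OF *(2)] x(1)
   by (simp add: * add.int_pow_mult[symmetric] distrib_right circ_add a_ac ab_semigroup_add_class.add_ac)
 next
  case (4 a p)
  then obtain a' p' n where *: "(a', p') \<in> r"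
   "a = a' \<oplus> add_pow G (n::int) x" "p = p' + circ (of_int n * t)"
   unfolding r'_def by blast
  have "(\<ominus> a', - p') \<in> r" using r *(1) unfolding char_graph_def by blast
  from I[OF this, of "- n"] show ?case
   using rc[OF *(1)] x(1)
   by (simp add: * add.int_pow_neg minus_add circ_minus)
 next
  case (5 q)
  then obtain a p n where *: "(a, p) \<in> r" "\<zero> = a \<oplus> add_pow G (n::int) x"
    "q = p + circ (of_int n * t)"
   unfolding r'_def by blast
  have eq: "add_pow G n x = \<ominus> a" using * rc[OF *(1)] x(1)
   by (metis add.int_pow_closed minus_equality minus_minus a_comm)
  have m: "(\<ominus> a, - p) \<in> r" using r *(1) unfolding char_graph_def by blast
  hence "(\<ominus> a, circ (of_int n * t)) \<in> r" using t(2)[of n] eq by auto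
  from char_graph_unique[OF r this m] show ?case using *(3) by simp
 qed
 moreover have "r \<subseteq> r'"
 proof
  fix z assume "z \<in> r"
  then obtain a p where z: "z = (a, p)" "(a, p) \<in> r" by (cases z) auto
  with I[of a p 0] rc show "z \<in> r'" by (simp add: circ_zero add_pow_int_0)
 qed
 moreover have "(x, circ t) \<in> r'"
  using I[of \<zero> 0 1] r x(1) by (simp add: char_graph_def add.int_pow_1)
 moreover have "circ t \<noteq> 0"
  using t(1) circ_eq_iff[of t 0] by (simp add: circ_zero)
 ultimately show ?thesis by blast
qed

text \<open>Extending the trivial graph once gives \<open>g\<close> a nonzero value. A maximal graph
  above this one, from Zorn's lemma, is total, since otherwise it could be extended again.\<close>

lemma exists_character:
 assumes g: "g \<in> carrier G" "g \<noteq> \<zero>"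
 shows "\<exists>chi::'a => circle. (\<forall>x\<in>carrier G. \<forall>y\<in>carrier G. chi (x \<oplus> y) = chi x + chi y) \<and> chi g \<noteq> 0"
proof -
 have triv: "char_graph G {(\<zero>, 0)}" unfolding char_graph_def by auto
 from char_graph_extend[OF triv g(1)] g(2) obtain r0 y0
  where r0: "char_graph G r0" "(g, y0) \<in> r0" "y0 \<noteq> 0" by auto
 define S where "S = {r. char_graph G r \<and> r0 \<subseteq> r}"
 have "\<exists>M\<in>S. \<forall>X\<in>S. M \<subseteq> X \<longrightarrow> X = M"
 proof (rule subset_Zorn_nonempty)
  show "S \<noteq> {}" using r0 unfolding S_def by blast
 next
  fix \<C> assume ne: "\<C> \<noteq> {}" and ch: "subset.chain S \<C>"
  have cg: "char_graph G c \<and> r0 \<subseteq> c" if "c \<in> \<C>" for c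
   using ch that unfolding S_def subset_chain_def by blast
  obtain c0 where c0: "c0 \<in> \<C>" using ne by blast
  have two: "\<exists>c\<in>\<C>. u \<in> c \<and> v \<in> c" if "u \<in> \<Union>\<C>" "v \<in> \<Union>\<C>" for u v
   using that ch unfolding subset_chain_def by blast
  have "char_graph G (\<Union>\<C>)"
   unfolding char_graph_def
  proof (intro conjI allI impI)
   show "\<Union>\<C> \<subseteq> carrier G \<times> UNIV" using cg unfolding char_graph_def by blast
   show "(\<zero>, 0) \<in> \<Union>\<C>" using cg[OF c0] c0 unfolding char_graph_def by blast
   show "(a \<oplus> b, p + q) \<in> \<Union>\<C>" if "(a, p) \<in> \<Union>\<C>" "(b, q) \<in> \<Union>\<C>" for a p b q
    using two[OF that] cg unfolding char_graph_def by blast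
   show "(\<ominus> a, - p) \<in> \<Union>\<C>" if "(a, p) \<in> \<Union>\<C>" for a p
    using that cg unfolding char_graph_def by blast
   show "q = 0" if "(\<zero>, q) \<in> \<Union>\<C>" for q
    using that cg unfolding char_graph_def by blast
  qed
  moreover have "r0 \<subseteq> \<Union>\<C>" using cg[OF c0] c0 by blast
  ultimately show "\<Union>\<C> \<in> S" unfolding S_def by blast
 qed
 then obtain M where MS: "M \<in> S" and maxS: "\<And>X. X \<in> S ==> M \<subseteq> X ==> X = M" by blast
 have M: "char_graph G M" "r0 \<subseteq> M" using MS unfolding S_def by auto
 have max: "X = M" if "char_graph G X" "M \<subseteq> X" for X
  using maxS[of X] that M(2) unfolding S_def by blast
 have total: "x \<in> Domain M" if "x \<in> carrier G" for x
 proof (rule ccontr)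
  assume "x \<notin> Domain M"
  from char_graph_extend[OF M(1) that this] obtain r' y
   where r': "char_graph G r'" "M \<subseteq> r'" "(x, y) \<in> r'" by blast
  from max[OF r'(1,2)] r'(3) \<open>x \<notin> Domain M\<close> show False by blast
 qed
 define chi where "chi x = (THE p. (x, p) \<in> M)" for x
 have chi: "chi x = p" if "(x, p) \<in> M" for x p
  unfolding chi_def using that char_graph_unique[OF M(1)] by blast
 have "chi (x \<oplus> y) = chi x + chi y" if xy: "x \<in> carrier G" "y \<in> carrier G" for x y
 proof -
  obtain p q where pq: "(x, p) \<in> M" "(y, q) \<in> M" using total xy by blast
  moreover from this have "(x \<oplus> y, p + q) \<in> M" using M(1) unfolding char_graph_def by blast
  ultimately show ?thesis using chi by simp
 qed
 moreover have "chi g \<noteq> 0" using chi r0 M(2) by blast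
 ultimately show ?thesis by blast
qed

end

abbreviation m1 where "m1 K \<equiv> \<ominus>\<^bsub>K\<^esub> \<one>\<^bsub>K\<^esub>"
abbreviation mor where "mor C x y n \<equiv> carrier (Mor C x y n)"

abbreviation madd where "madd C x y n \<equiv> add (Mor C x y n)"

abbreviation mscale where "mscale C x y n \<equiv> smult (Mor C x y n)"

abbreviation lc where "lc C x y n a f b g \<equiv> madd C x y n (mscale C x y n a f) (mscale C x y n b g)"

section \<open>Paths in a graded category\<close>

text \<open>The axioms of a dg category without the differential. The twisted tensor product is
  first recognized as a graded category, and its realization by characters is what makes it possible
  to study the differential afterwards.\<close>

locale graded_category = field K for K :: "'k ring" +
 fixes C :: "('k, 'o, 'm) dgcat"
 assumes mor_module [simp]:
   "[| x \<in> Obj C; y \<in> Obj C|] ==> module K (Mor C x y n)"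
  and mor_typed:
   "[| x \<in> Obj C; y \<in> Obj C; f \<in> mor C x y n|]
    ==> Dom C f = x \<and> Cod C f = y \<and> Deg C f = n"
  and idn_closed:
   "x \<in> Obj C ==> Idn C x \<in> mor C x x 0"
  and comp_closed:
   "[| x \<in> Obj C; y \<in> Obj C; z \<in> Obj C;
    f \<in> mor C x y m; g \<in> mor C y z n|]
    ==> Comp C g f \<in> mor C x z (m + n)"
  and comp_add_left:
   "[| x \<in> Obj C; y \<in> Obj C; z \<in> Obj C; f \<in> mor C x y m;
    g \<in> mor C y z n; g' \<in> mor C y z n|]
    ==> Comp C (madd C y z n g g') f = Comp C g f \<oplus>\<^bsub>Mor C x z (m + n)\<^esub> Comp C g' f"
  and comp_add_right:
   "[| x \<in> Obj C; y \<in> Obj C; z \<in> Obj C; f \<in> mor C x y m;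
    f' \<in> mor C x y m; g \<in> mor C y z n|]
    ==> Comp C g (madd C x y m f f') = Comp C g f \<oplus>\<^bsub>Mor C x z (m + n)\<^esub> Comp C g f'"
  and comp_smult_left:
   "[| x \<in> Obj C; y \<in> Obj C; z \<in> Obj C; a \<in> carrier K;
    f \<in> mor C x y m; g \<in> mor C y z n|]
    ==> Comp C (mscale C y z n a g) f = a \<odot>\<^bsub>Mor C x z (m + n)\<^esub> Comp C g f"
  and comp_smult_right:
   "[| x \<in> Obj C; y \<in> Obj C; z \<in> Obj C; a \<in> carrier K;
    f \<in> mor C x y m; g \<in> mor C y z n|]
    ==> Comp C g (mscale C x y m a f) = a \<odot>\<^bsub>Mor C x z (m + n)\<^esub> Comp C g f"
  and comp_assoc:
   "[| f \<in> arr C; g \<in> arr C; h \<in> arr C; Cod C f = Dom C g; Cod C g = Dom C h|]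
    ==> Comp C h (Comp C g f) = Comp C (Comp C h g) f"
  and comp_idn_left: "f \<in> arr C ==> Comp C (Idn C (Cod C f)) f = f"
  and comp_idn_right: "f \<in> arr C ==> Comp C f (Idn C (Dom C f)) = f"
begin

lemma arrI: "[| x \<in> Obj C; y \<in> Obj C; f \<in> mor C x y n|] ==> f \<in> arr C"
 unfolding arr_def by blast

lemma arr_typed:
 assumes "f \<in> arr C"
 shows "Dom C f \<in> Obj C" "Cod C f \<in> Obj C" "f \<in> mor C (Dom C f) (Cod C f) (Deg C f)"
 using assms mor_typed unfolding arr_def by fastforce+

lemma mor_DCD:
 assumes "x \<in> Obj C" "y \<in> Obj C" "f \<in> mor C x y n"
 shows "Dom C f = x" "Cod C f = y" "Deg C f = n"
 using mor_typed[OF assms] by auto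

lemma idn_arr: "x \<in> Obj C ==> Idn C x \<in> arr C"
 "x \<in> Obj C ==> Dom C (Idn C x) = x"
 "x \<in> Obj C ==> Cod C (Idn C x) = x"
 "x \<in> Obj C ==> Deg C (Idn C x) = 0"
 using mor_DCD[OF _ _ idn_closed] arrI[OF _ _ idn_closed] by auto

lemma comp_arr:
 assumes "f \<in> arr C" "g \<in> arr C" "Cod C f = Dom C g"
 shows "Comp C g f \<in> arr C" "Dom C (Comp C g f) = Dom C f"
  "Cod C (Comp C g f) = Cod C g" "Deg C (Comp C g f) = Deg C f + Deg C g"
proof -
 note t = arr_typed[OF assms(1)] arr_typed[OF assms(2)]
 have *: "Comp C g f \<in> mor C (Dom C f) (Cod C g) (Deg C f + Deg C g)"
  by (rule comp_closed[of _ "Cod C f"]) (use t assms in auto)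
 show "Comp C g f \<in> arr C" "Dom C (Comp C g f) = Dom C f"
  "Cod C (Comp C g f) = Cod C g" "Deg C (Comp C g f) = Deg C f + Deg C g"
  using arrI[OF _ _ *] mor_DCD[OF _ _ *] t by auto
qed

end

sublocale dg_category \<subseteq> graded_category K C
 by (intro graded_category.intro graded_category_axioms.intro field_axioms)
  (fact mor_module mor_typed idn_closed comp_closed comp_add_left comp_add_right
   comp_smult_left comp_smult_right comp_assoc comp_idn_left comp_idn_right)+

context dg_category
begin

lemma dif_arr:
 assumes "f \<in> arr C"
 shows "Dif C f \<in> arr C" "Dom C (Dif C f) = Dom C f" "Cod C (Dif C f) = Cod C f"
  "Deg C (Dif C f) = Deg C f + 1"
proof -
 note t = arr_typed[OF assms]
 note d = dif_closed[OF t]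
 show "Dif C f \<in> arr C" "Dom C (Dif C f) = Dom C f" "Cod C (Dif C f) = Cod C f"
  "Deg C (Dif C f) = Deg C f + 1"
  using arrI[OF _ _ d] mor_DCD[OF _ _ d] t by auto
qed

end

primrec path :: "('k, 'o, 'm) dgcat => 'o => 'm list => bool" where
 "path D d [] \<longleftrightarrow> d \<in> Obj D"
| "path D d (g # gs) \<longleftrightarrow> g \<in> arr D \<and> Dom D g = d \<and> path D (Cod D g) gs"

primrec pend :: "('k, 'o, 'm) dgcat => 'o => 'm list => 'o" where
 "pend D d [] = d"
| "pend D d (g # gs) = pend D (Cod D g) gs"

lemma pend_append [simp]: "pend D d (as @ bs) = pend D (pend D d as) bs"
 by (induction as arbitrary: d) auto

lemma pend_last: "gs \<noteq> [] ==> pend D d gs = Cod D (last gs)"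
 by (induction gs arbitrary: d) (auto split: if_splits)

lemma wt_simps [simp]: "wt D [] = 0" "wt D (g # gs) = (Deg D g - 1) + wt D gs"
 "wt D (as @ bs) = wt D as + wt D bs"
 by (auto simp: wt_def)

context graded_category
begin

lemma path_obj: "path C d gs ==> d \<in> Obj C"
 by (cases gs) (auto simp: arr_typed)

lemma path_end: "path C d gs ==> pend C d gs \<in> Obj C"
 by (induction gs arbitrary: d) auto

lemma path_append [simp]: "path C d (as @ bs) \<longleftrightarrow> path C d as \<and> path C (pend C d as) bs"
 by (induction as arbitrary: d) (auto dest: path_obj)

lemma path_take_drop:
 assumes "path C d gs"
 shows "path C d (take m gs)" "path C (pend C d (take m gs)) (drop m gs)"
 using assms path_append[of d "take m gs" "drop m gs"] by simp_all

lemma chain_path: "chain C gs \<longleftrightarrow> gs \<noteq> [] \<and> path C (Dom C (hd gs)) gs"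
proof (induction gs)
 case (Cons g gs)
 show ?case
 proof (cases gs)
  case Nil
  thus ?thesis by (auto simp: chain_def arr_typed)
 next
  case (Cons g' gs')
  with Cons.IH show ?thesis
   by (auto simp: chain_def)
 qed
qed (simp add: chain_def)

lemma path_chain: "path C d gs ==> gs \<noteq> [] ==> chain C gs \<and> Dom C (hd gs) = d"
 unfolding chain_path by (cases gs) auto

lemma path_arr: "path C d gs ==> set gs \<subseteq> arr C"
 by (induction gs arbitrary: d) auto

end

section \<open>The twisted tensor product as a graded category\<close>

locale tensor_pair = C: dg_category K C + D: dg_category K D
 for K :: "'k ring" and C :: "('k, 'c, 'f) dgcat" and D :: "('k, 'd, 'g) dgcat"
begin

abbreviation "wft \<equiv> twf K C D"
abbreviation "dmt \<equiv> tdom C D"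
abbreviation "cdt \<equiv> tcod C D"
abbreviation "dgt \<equiv> tdeg C D"
abbreviation "part \<equiv> tpar C D"
abbreviation "clt \<equiv> tcls K C D"
abbreviation "dft \<equiv> tdif K C D"
abbreviation "relt \<equiv> trel K C D"

lemma tdom_obj: "wft t ==> dmt t \<in> Obj C \<times> Obj D"
 by (induction t) (auto simp: C.arr_typed D.arr_typed D.chain_path dest: D.path_obj)

lemma tcod_obj: "wft t ==> cdt t \<in> Obj C \<times> Obj D"
proof (induction t)
 case (TE f gs)
 hence "pend D (Dom D (hd gs)) gs \<in> Obj D" by (auto simp: D.chain_path intro: D.path_end)
 with TE show ?case by (auto simp: C.arr_typed pend_last D.chain_path)
qed (auto simp: C.arr_typed D.arr_typed)

lemma tsum_typed:
 assumes "x \<in> Obj C \<times> Obj D" "y \<in> Obj C \<times> Obj D"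
  "\<And>t. t \<in> set ts ==> wft t \<and> dmt t = x \<and> cdt t = y \<and> dgt t = n"
 shows "wft (tsum x y n ts) \<and> dmt (tsum x y n ts) = x \<and>
  cdt (tsum x y n ts) = y \<and> dgt (tsum x y n ts) = n"
 using assms(3) by (induction ts) (use assms(1,2) in "auto simp: tsum_def tpar_def")

lemma TE0_typed:
 assumes "f \<in> arr C" "path D d gs"
 shows "wft (TE0 f gs (pend D d gs))" "dmt (TE0 f gs (pend D d gs)) = (Dom C f, d)"
  "cdt (TE0 f gs (pend D d gs)) = (Cod C f, pend D d gs)"
  "dgt (TE0 f gs (pend D d gs)) = Deg C f + wt D gs"
 using assms D.path_chain[OF assms(2)]
 by (auto simp: TE0_def pend_last)

lemma TE0_obj: "gs \<noteq> [] ==> TE0 f gs d = TE f gs"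
 by (simp add: TE0_def)

lemma E_comp_typed:
 assumes "f1 \<in> arr C" "f2 \<in> arr C" "Cod C f1 = Dom C f2" "chain D gs"
  "t = TComp (TE0 f2 (drop m gs) (Cod D (last gs))) (TE0 f1 (take m gs) (Dom D (hd gs)))"
  "x = (Dom C f1, Dom D (hd gs))" "y = (Cod C f2, Cod D (last gs))"
  "n = Deg C f1 + Deg C f2 + wt D gs"
 shows "wft t \<and> dmt t = x \<and> cdt t = y \<and> dgt t = n"
proof -
 let ?d = "Dom D (hd gs)"
 have p: "path D ?d gs" "gs \<noteq> []" using assms(4) by (auto simp: D.chain_path)
 note q = D.path_take_drop[OF p(1), of m]
 have 1: "TE0 f1 (take m gs) ?d = TE0 f1 (take m gs) (pend D ?d (take m gs))"
  by (auto simp: TE0_def p(2))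
 have e: "pend D (pend D ?d (take m gs)) (drop m gs) = Cod D (last gs)"
  using pend_last[OF p(2)] by (metis append_take_drop_id pend_append)
 have w: "wt D gs = wt D (take m gs) + wt D (drop m gs)"
  by (metis append_take_drop_id wt_simps(3))
 show ?thesis
  using TE0_typed[OF assms(1) q(1)] TE0_typed[OF assms(2) q(2)] assms
  unfolding e by (auto simp: 1 w)
qed

lemma sg_closed: "sg K n \<in> carrier K"
 by (simp add: sg_def)

text \<open>All members of a class are therefore well-formed and parallel, so that
  \<open>the_elem\<close> in the source, target and degree of \<open>ttensor\<close> is applied to a
  singleton.\<close>

lemma trel_typed: "relt s t ==> wft s \<and> wft t \<and> part s t"
proof (induction rule: trel.induct)
 case (add_zero t)
 thus ?case using tdom_obj tcod_obj by (auto simp: tpar_def)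
next
 case (scale_zero t)
 thus ?case using tdom_obj tcod_obj by (auto simp: tpar_def)
next
 case (comp_id_left t)
 thus ?case using tdom_obj tcod_obj by (auto simp: tpar_def)
next
 case (comp_id_right t)
 thus ?case using tdom_obj tcod_obj by (auto simp: tpar_def)
next
 case (L_add x y f n f' d)
 then interpret M: module K "Mor C x y n" by simp
 have "madd C x y n f f' \<in> mor C x y n" using L_add by simp
 note m = C.mor_DCD[OF L_add(1,2) this] C.arrI[OF L_add(1,2) this] C.mor_DCD[OF L_add(1,2) L_add(3)] C.mor_DCD[OF L_add(1,2) L_add(4)]
 thus ?case using L_add by (auto simp: tpar_def m intro: C.arrI)
next
 case (L_scale x y f n a d)
 then interpret M: module K "Mor C x y n" by simp
 have "mscale C x y n a f \<in> mor C x y n" using L_scale by simp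
 note m = C.mor_DCD[OF L_scale(1,2) this] C.arrI[OF L_scale(1,2) this] C.mor_DCD[OF L_scale(1,2) L_scale(3)]
 thus ?case using L_scale by (auto simp: tpar_def m intro: C.arrI)
next
 case (R_add x y f n f' d)
 then interpret M: module K "Mor D x y n" by simp
 have "madd D x y n f f' \<in> mor D x y n" using R_add by simp
 note m = D.mor_DCD[OF R_add(1,2) this] D.arrI[OF R_add(1,2) this] D.mor_DCD[OF R_add(1,2) R_add(3)] D.mor_DCD[OF R_add(1,2) R_add(4)]
 thus ?case using R_add by (auto simp: tpar_def m intro: D.arrI)
next
 case (R_scale x y f n a d)
 then interpret M: module K "Mor D x y n" by simp
 have "mscale D x y n a f \<in> mor D x y n" using R_scale by simp
 note m = D.mor_DCD[OF R_scale(1,2) this] D.arrI[OF R_scale(1,2) this] D.mor_DCD[OF R_scale(1,2) R_scale(3)]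
 thus ?case using R_scale by (auto simp: tpar_def m intro: D.arrI)
next
 case (E_add_left x y f n f' gs)
 then interpret M: module K "Mor C x y n" by simp
 have "madd C x y n f f' \<in> mor C x y n" using E_add_left by simp
 note m = C.mor_DCD[OF E_add_left(1,2) this] C.arrI[OF E_add_left(1,2) this] C.mor_DCD[OF E_add_left(1,2) E_add_left(3)] C.mor_DCD[OF E_add_left(1,2) E_add_left(4)]
 thus ?case using E_add_left by (auto simp: tpar_def m intro: C.arrI)
next
 case (E_scale_left x y f n a gs)
 then interpret M: module K "Mor C x y n" by simp
 have "mscale C x y n a f \<in> mor C x y n" using E_scale_left by simp
 note m = C.mor_DCD[OF E_scale_left(1,2) this] C.arrI[OF E_scale_left(1,2) this] C.mor_DCD[OF E_scale_left(1,2) E_scale_left(3)]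
 thus ?case using E_scale_left by (auto simp: tpar_def m intro: C.arrI)
next
 case (E_add_right f x y g n g' as bs)
 then interpret M: module K "Mor D x y n" by simp
 have "madd D x y n g g' \<in> mor D x y n" using E_add_right by simp
 note m = D.mor_DCD[OF E_add_right(2,3) this] D.arrI[OF E_add_right(2,3) this] D.mor_DCD[OF E_add_right(2,3) E_add_right(4)] D.mor_DCD[OF E_add_right(2,3) E_add_right(5)]
 thus ?case using E_add_right
  by (cases as; cases bs rule: rev_cases)
   (auto simp: tpar_def m D.chain_path intro: D.arrI)
next
 case (E_scale_right f x y g n a as bs)
 then interpret M: module K "Mor D x y n" by simp
 have "mscale D x y n a g \<in> mor D x y n" using E_scale_right by simp
 note m = D.mor_DCD[OF E_scale_right(2,3) this] D.arrI[OF E_scale_right(2,3) this] D.mor_DCD[OF E_scale_right(2,3) E_scale_right(4)]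
 thus ?case using E_scale_right
  by (cases as; cases bs rule: rev_cases)
   (auto simp: tpar_def m D.chain_path intro: D.arrI)
next
 case (E_id_left c gs t)
 hence "wft t" by (simp add: C.idn_arr)
 thus ?case using tdom_obj tcod_obj by (auto simp: tpar_def)
next
 case (E_id_right f gs d t)
 hence "wft t" by simp
 thus ?case using tdom_obj tcod_obj by (auto simp: tpar_def)
next
 case (E_comp f1 f2 gs t)
 have t: "wft t" using E_comp by (simp add: C.comp_arr)
 define ts :: "('k, 'c, 'f, 'd, 'g) tterm list" where "ts = map (\<lambda>m. TScale (sg K (Deg C f1 * wt D (drop m gs)))
           (TComp (TE0 f2 (drop m gs) (Cod D (last gs)))
              (TE0 f1 (take m gs) (Dom D (hd gs)))))
          [0..<Suc (length gs)]"
 have mem: "wft u \<and> dmt u = dmt t \<and> cdt u = cdt t \<and> dgt u = dgt t"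
  if "u \<in> set ts" for u
  using that E_comp_typed[OF E_comp(1-4) HOL.refl HOL.refl HOL.refl HOL.refl] E_comp(1-3,5)
  unfolding ts_def by (auto simp: sg_closed C.comp_arr simp del: upt_Suc twf.simps(8) tdom.simps(8) tcod.simps(8) tdeg.simps(8))
 have "wft (tsum (dmt t) (cdt t) (dgt t) ts) \<and>
  part t (tsum (dmt t) (cdt t) (dgt t) ts)"
  using tsum_typed[OF tdom_obj[OF t] tcod_obj[OF t] mem, of ts] by (simp add: tpar_def)
 thus ?case using t unfolding ts_def[symmetric] by blast
qed (auto simp: tpar_def C.arr_typed D.arr_typed C.idn_arr D.idn_arr C.comp_arr D.comp_arr)

lemma cls_eq_iff:
 assumes "wft s"
 shows "clt s = clt t \<longleftrightarrow> relt s t"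
proof
 assume "clt s = clt t"
 moreover have "s \<in> clt s" using assms by (simp add: tcls_def trel.refl)
 ultimately show "relt s t" by (auto simp: tcls_def intro: trel.sym)
next
 assume "relt s t"
 thus "clt s = clt t"
  by (auto simp: tcls_def intro: trel.sym trel.trans)
qed

lemma cls_eqI: "relt s t ==> clt s = clt t"
 using cls_eq_iff trel_typed by blast

text \<open>The operations of \<open>ttensor\<close> are unions over all representatives. Such a
  union collapses as soon as its members agree.\<close>

lemma cls_Union:
 assumes t: "wft t" and F: "\<And>t'. relt t t' ==> F t' = F t"
 shows "(\<Union>t'\<in>clt t. F t') = F t"
proof -
 have "t \<in> clt t" using t by (simp add: tcls_def trel.refl)
 moreover have "\<And>t'. t' \<in> clt t ==> F t' = F t" by (simp add: tcls_def F)
 ultimately show ?thesis by blast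
qed

lemma cls_the_elem:
 assumes t: "wft t" and F: "\<And>t'. relt t t' ==> F t' = F t"
 shows "the_elem (F ` clt t) = F t"
proof -
 have "t \<in> clt t" using t by (simp add: tcls_def trel.refl)
 moreover have "\<And>t'. t' \<in> clt t ==> F t' = F t" by (simp add: tcls_def F)
 ultimately have "F ` clt t = {F t}" by blast
 thus ?thesis by simp
qed

abbreviation "T \<equiv> ttensor K C D"

lemma Obj_T [simp]: "Obj T = Obj C \<times> Obj D"
 by (simp add: ttensor_def)

lemma Idn_T: "Idn T x = clt (TId x)"
 by (simp add: ttensor_def)

lemma zero_T: "\<zero>\<^bsub>Mor T x y n\<^esub> = clt (TZero x y n)"
 by (simp add: ttensor_def)

lemma carrier_T: "A \<in> mor T x y n \<longleftrightarrow>
  (\<exists>t. A = clt t \<and> wft t \<and> dmt t = x \<and> cdt t = y \<and> dgt t = n)"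
 by (auto simp: ttensor_def)

lemma cls_typed:
 assumes "wft t"
 shows "Dom T (clt t) = dmt t" "Cod T (clt t) = cdt t"
  "Deg T (clt t) = dgt t"
 using assms trel_typed unfolding ttensor_def
 by (auto intro!: cls_the_elem simp: tpar_def)

lemma cls_mor: "wft t ==> x = dmt t ==> y = cdt t ==> n = dgt t ==>
  clt t \<in> mor T x y n"
 unfolding carrier_T by blast

lemma cls_arr: "wft t ==> clt t \<in> arr T"
 unfolding arr_def using cls_mor[OF _ HOL.refl HOL.refl HOL.refl] tdom_obj[of t] tcod_obj[of t]
 by (intro UN_I[of "dmt t"] UN_I[of "cdt t"] UN_I[of "dgt t"]) (simp_all only: Obj_T UNIV_I)

lemma arr_T: "A \<in> arr T \<longleftrightarrow> (\<exists>t. A = clt t \<and> wft t)"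
proof
 assume "A \<in> arr T"
 then obtain x y n where "A \<in> mor T x y n" unfolding arr_def by blast
 thus "\<exists>t. A = clt t \<and> wft t" unfolding carrier_T by blast
qed (use cls_arr in blast)

lemma add_T:
 assumes "wft s" "wft t" "part s t"
 shows "clt s \<oplus>\<^bsub>Mor T x y n\<^esub> clt t = clt (TAdd s t)"
proof -
 have "(\<Union>t'\<in>clt t. clt (TAdd s' t')) = clt (TAdd s' t)"
  if "relt s s'" for s'
  by (rule cls_Union[OF assms(2)])
   (use trel_typed[OF that] that assms in
    \<open>auto intro!: cls_eqI[OF trel.sym] trel.add_cong trel.refl simp: tpar_def\<close>)
 hence "(\<Union>s'\<in>clt s. \<Union>t'\<in>clt t. clt (TAdd s' t'))
   = (\<Union>s'\<in>clt s. clt (TAdd s' t))"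
  by (simp add: tcls_def)
 also have "\<dots> = clt (TAdd s t)"
  by (rule cls_Union[OF assms(1)])
   (use assms in "auto intro!: cls_eqI[OF trel.sym] trel.add_cong trel.refl")
 finally show ?thesis by (simp add: ttensor_def)
qed

lemma smult_T:
 assumes "wft t" "a \<in> carrier K"
 shows "a \<odot>\<^bsub>Mor T x y n\<^esub> clt t = clt (TScale a t)"
 using cls_Union[OF assms(1), of "\<lambda>t. clt (TScale a t)"] assms
 by (auto simp: ttensor_def intro!: cls_eqI[OF trel.sym] trel.scale_cong)

lemma Comp_T:
 assumes "wft s" "wft t" "dmt s = cdt t"
 shows "Comp T (clt s) (clt t) = clt (TComp s t)"
proof -
 have "(\<Union>t'\<in>clt t. clt (TComp s' t')) = clt (TComp s' t)"
  if "relt s s'" for s'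
  by (rule cls_Union[OF assms(2)])
   (use trel_typed[OF that] that assms in
    \<open>auto intro!: cls_eqI[OF trel.sym] trel.comp_cong trel.refl simp: tpar_def\<close>)
 hence "(\<Union>s'\<in>clt s. \<Union>t'\<in>clt t. clt (TComp s' t'))
   = (\<Union>s'\<in>clt s. clt (TComp s' t))"
  by (simp add: tcls_def)
 also have "\<dots> = clt (TComp s t)"
  by (rule cls_Union[OF assms(1)])
   (use assms in "auto intro!: cls_eqI[OF trel.sym] trel.comp_cong trel.refl")
 finally show ?thesis by (simp add: ttensor_def)
qed

text \<open>Expressions have no negation; scaling by minus one supplies the inverse.\<close>

lemma add_neg_rel:
 assumes "wft t"
 shows "relt (TAdd (TScale (m1 K) t) t) (TZero (dmt t) (cdt t) (dgt t))"
proof -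
 have "relt (TAdd (TScale (m1 K) t) t) (TAdd (TScale (m1 K) t) (TScale \<one>\<^bsub>K\<^esub> t))"
  using assms by (intro trel.add_cong trel.refl trel.sym[OF trel.scale_one]) (auto simp: tpar_def)
 also have "relt \<dots> (TScale (m1 K \<oplus>\<^bsub>K\<^esub> \<one>\<^bsub>K\<^esub>) t)"
  using assms by (intro trel.sym[OF trel.scale_add_scalar]) auto
 also (trel.trans) have "relt \<dots> (TZero (dmt t) (cdt t) (dgt t))"
  using assms trel.scale_zero by (simp add: C.l_neg)
 finally (trel.trans) show ?thesis .
qed

lemma T_module:
 assumes xy: "x \<in> Obj T" "y \<in> Obj T"
 shows "module K (Mor T x y n)"
proof -
 let ?M = "Mor T x y n"
 have o: "x \<in> Obj C \<times> Obj D" "y \<in> Obj C \<times> Obj D" using xy by simp_all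
 show ?thesis
 proof (rule moduleI)
  show "cring K" by (rule C.is_cring)
  show "abelian_group ?M"
  proof (rule abelian_groupI)
   fix A B Z assume "A \<in> carrier ?M" "B \<in> carrier ?M" "Z \<in> carrier ?M"
   then obtain a b z where *: "A = clt a" "B = clt b" "Z = clt z"
    "wft a" "wft b" "wft z" "dmt a = x" "dmt b = x" "dmt z = x"
    "cdt a = y" "cdt b = y" "cdt z = y" "dgt a = n" "dgt b = n"
    "dgt z = n"
    unfolding carrier_T by blast
   show "A \<oplus>\<^bsub>?M\<^esub> B \<oplus>\<^bsub>?M\<^esub> Z = A \<oplus>\<^bsub>?M\<^esub> (B \<oplus>\<^bsub>?M\<^esub> Z)"
    using * by (simp add: add_T tpar_def cls_eqI trel.add_assoc)
  next
   fix A B assume "A \<in> carrier ?M" "B \<in> carrier ?M"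
   then obtain a b where *: "A = clt a" "B = clt b"
    "wft a" "wft b" "dmt a = x" "dmt b = x"
    "cdt a = y" "cdt b = y" "dgt a = n" "dgt b = n"
    unfolding carrier_T by blast
   show "A \<oplus>\<^bsub>?M\<^esub> B \<in> carrier ?M"
    using * by (auto simp: add_T tpar_def intro!: cls_mor)
   show "A \<oplus>\<^bsub>?M\<^esub> B = B \<oplus>\<^bsub>?M\<^esub> A"
    using * by (simp add: add_T tpar_def cls_eqI trel.add_comm)
  next
   show "\<zero>\<^bsub>?M\<^esub> \<in> carrier ?M" using o by (auto simp: zero_T intro!: cls_mor)
  next
   fix A assume "A \<in> carrier ?M"
   then obtain a where *: "A = clt a" "wft a" "dmt a = x"
    "cdt a = y" "dgt a = n"
    unfolding carrier_T by blast
   show "\<zero>\<^bsub>?M\<^esub> \<oplus>\<^bsub>?M\<^esub> A = A"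
    using * o trel.add_zero[OF *(2)] by (auto simp: zero_T add_T tpar_def intro!: cls_eqI)
   show "\<exists>B\<in>carrier ?M. B \<oplus>\<^bsub>?M\<^esub> A = \<zero>\<^bsub>?M\<^esub>"
   proof (rule bexI)
    show "clt (TScale (m1 K) a) \<oplus>\<^bsub>?M\<^esub> A = \<zero>\<^bsub>?M\<^esub>"
     using * add_neg_rel[OF *(2)] by (auto simp: zero_T add_T tpar_def intro!: cls_eqI)
    show "clt (TScale (m1 K) a) \<in> carrier ?M"
     using * by (auto intro!: cls_mor)
   qed
  qed
 next
  fix a A assume "a \<in> carrier K" "A \<in> carrier ?M"
  thus "a \<odot>\<^bsub>?M\<^esub> A \<in> carrier ?M"
   unfolding carrier_T
   by (auto simp: smult_T intro: exI[of _ "TScale a _"])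
 next
  fix a b A assume ab: "a \<in> carrier K" "b \<in> carrier K" and "A \<in> carrier ?M"
  then obtain t where *: "A = clt t" "wft t" "dmt t = x"
    "cdt t = y" "dgt t = n"
   unfolding carrier_T by blast
  show "(a \<oplus>\<^bsub>K\<^esub> b) \<odot>\<^bsub>?M\<^esub> A = a \<odot>\<^bsub>?M\<^esub> A \<oplus>\<^bsub>?M\<^esub> b \<odot>\<^bsub>?M\<^esub> A"
   using * ab by (simp add: smult_T add_T tpar_def cls_eqI trel.scale_add_scalar)
  show "(a \<otimes>\<^bsub>K\<^esub> b) \<odot>\<^bsub>?M\<^esub> A = a \<odot>\<^bsub>?M\<^esub> (b \<odot>\<^bsub>?M\<^esub> A)"
   using * ab by (simp add: smult_T) (rule cls_eqI[OF trel.sym[OF trel.scale_scale]])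
 next
  fix a A B assume ab: "a \<in> carrier K" and "A \<in> carrier ?M" "B \<in> carrier ?M"
  then obtain s t where *: "A = clt s" "B = clt t"
    "wft s" "wft t" "dmt s = x" "dmt t = x"
    "cdt s = y" "cdt t = y" "dgt s = n" "dgt t = n"
   unfolding carrier_T by blast
  show "a \<odot>\<^bsub>?M\<^esub> (A \<oplus>\<^bsub>?M\<^esub> B) = a \<odot>\<^bsub>?M\<^esub> A \<oplus>\<^bsub>?M\<^esub> a \<odot>\<^bsub>?M\<^esub> B"
   using * ab by (simp add: smult_T add_T tpar_def cls_eqI trel.scale_add)
 next
  fix A assume "A \<in> carrier ?M"
  then obtain t where *: "A = clt t" "wft t"
   unfolding carrier_T by blast
  show "\<one>\<^bsub>K\<^esub> \<odot>\<^bsub>?M\<^esub> A = A"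
   using * by (simp add: smult_T cls_eqI trel.scale_one)
 qed
qed

lemma T_graded: "graded_category K T"
proof (intro graded_category.intro graded_category_axioms.intro C.field_axioms)
 fix x y n assume "x \<in> Obj T" "y \<in> Obj T"
 thus "module K (Mor T x y n)" by (rule T_module)
next
 fix x y n A assume "x \<in> Obj T" "y \<in> Obj T" "A \<in> mor T x y n"
 thus "Dom T A = x \<and> Cod T A = y \<and> Deg T A = n"
  unfolding carrier_T by (auto simp: cls_typed)
next
 fix x assume "x \<in> Obj T"
 thus "Idn T x \<in> mor T x x 0" by (auto simp: Idn_T intro!: cls_mor)
next
 fix x y z A B m n
 assume "A \<in> mor T x y m" "B \<in> mor T y z n"
 then obtain s t where *: "A = clt s" "B = clt t"
    "wft s" "wft t" "dmt s = x" "dmt t = y"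
    "cdt s = y" "cdt t = z" "dgt s = m" "dgt t = n"
  unfolding carrier_T by blast
 show "Comp T B A \<in> mor T x z (m + n)"
  using * by (auto simp: Comp_T intro!: cls_mor)
next
 fix x y z A B B' m n
 assume "A \<in> mor T x y m" "B \<in> mor T y z n" "B' \<in> mor T y z n"
 then obtain s t t' where *: "A = clt s" "B = clt t" "B' = clt t'"
    "wft s" "wft t" "dmt s = x" "dmt t = y"
    "cdt s = y" "cdt t = z" "dgt s = m" "dgt t = n"
    "wft t'" "dmt t' = y" "cdt t' = z" "dgt t' = n"
  unfolding carrier_T by blast
 show "Comp T (madd T y z n B B') A = Comp T B A \<oplus>\<^bsub>Mor T x z (m + n)\<^esub> Comp T B' A"
  using * by (simp add: Comp_T add_T tpar_def cls_eqI trel.comp_add_left)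
next
 fix x y z A B B' m n
 assume "B \<in> mor T x y m" "B' \<in> mor T x y m" "A \<in> mor T y z n"
 then obtain s t t' where *: "A = clt s" "B = clt t" "B' = clt t'"
    "wft s" "wft t" "dmt s = y" "dmt t = x"
    "cdt s = z" "cdt t = y" "dgt s = n" "dgt t = m"
    "wft t'" "dmt t' = x" "cdt t' = y" "dgt t' = m"
  unfolding carrier_T by blast
 show "Comp T A (madd T x y m B B') = Comp T A B \<oplus>\<^bsub>Mor T x z (m + n)\<^esub> Comp T A B'"
  using * by (simp add: Comp_T add_T tpar_def cls_eqI trel.comp_add_right)
next
 fix x y z a A B m n
 assume a: "a \<in> carrier K" and "A \<in> mor T x y m" "B \<in> mor T y z n"
 then obtain s t where *: "A = clt s" "B = clt t"
    "wft s" "wft t" "dmt s = x" "dmt t = y"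
    "cdt s = y" "cdt t = z" "dgt s = m" "dgt t = n"
  unfolding carrier_T by blast
 show "Comp T (mscale T y z n a B) A = a \<odot>\<^bsub>Mor T x z (m + n)\<^esub> Comp T B A"
  using * a by (simp add: Comp_T smult_T cls_eqI trel.comp_scale_left)
 show "Comp T B (mscale T x y m a A) = a \<odot>\<^bsub>Mor T x z (m + n)\<^esub> Comp T B A"
  using * a by (simp add: Comp_T smult_T cls_eqI trel.comp_scale_right)
next
 fix A B Z assume "A \<in> arr T" "B \<in> arr T" "Z \<in> arr T" and c: "Cod T A = Dom T B" "Cod T B = Dom T Z"
 then obtain a b z where *: "A = clt a" "B = clt b" "Z = clt z"
   "wft a" "wft b" "wft z"
  unfolding arr_T by blast
 have eq: "dmt b = cdt a" "dmt z = cdt b" using * c by (auto simp: cls_typed)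
 show "Comp T Z (Comp T B A) = Comp T (Comp T Z B) A"
  using * eq by (simp add: Comp_T) (rule cls_eqI[OF trel.sym[OF trel.comp_assoc]], simp)
next
 fix A assume "A \<in> arr T"
 then obtain a where *: "A = clt a" "wft a"
  unfolding arr_T by blast
 show "Comp T (Idn T (Cod T A)) A = A"
  using * tcod_obj[of a] by (auto simp: cls_typed Idn_T Comp_T intro!: cls_eqI trel.comp_id_left)
 show "Comp T A (Idn T (Dom T A)) = A"
  using * tdom_obj[of a] by (auto simp: cls_typed Idn_T Comp_T intro!: cls_eqI trel.comp_id_right)
qed

end

section \<open>Deconcatenation and the bar differential\<close>

definition sgv :: "int => 'v::ab_group_add => 'v" where
 "sgv n v = (if even n then v else - v)"

lemma sgv_0 [simp]: "sgv 0 v = v" by (simp add: sgv_def)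
lemma sgv_zero [simp]: "sgv n 0 = 0" by (simp add: sgv_def)
lemma sgv_sgv [simp]: "sgv m (sgv n v) = sgv (m + n) v" by (simp add: sgv_def)
lemma sgv_add: "sgv n (v + w) = sgv n v + sgv n w" by (simp add: sgv_def)
lemma sgv_minus: "sgv n (- v) = - sgv n v" by (simp add: sgv_def)
lemma sgv_diff: "sgv n (v - w) = sgv n v - sgv n w" by (simp add: sgv_def)
lemma sgv_cong: "even (m - n) ==> sgv m v = sgv n v" by (auto simp: sgv_def)
lemma sgv_fun: "sgv n f x = sgv n (f x)" by (simp add: sgv_def)

text \<open>Evaluation of \<open>F\<close> on the deconcatenation coproduct of the list. The
  recursion peels off the first letter, which is what the inductions below need;
  \<open>cut_index\<close> gives the indexed form that occurs in the relations.\<close>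

primrec cut :: "('g list => 'g list => 'v) => 'g list => 'v::ab_group_add" where
 "cut F [] = F [] []"
| "cut F (g # gs) = F [] (g # gs) + cut (\<lambda>as bs. F (g # as) bs) gs"

lemma cut_cong: "(\<And>as bs. as @ bs = gs ==> F as bs = G as bs) ==> cut F gs = cut G gs"
proof (induction gs arbitrary: F G)
 case (Cons g gs)
 have "F [] (g # gs) = G [] (g # gs)" by (rule Cons.prems) simp
 moreover have "cut (\<lambda>as bs. F (g # as) bs) gs = cut (\<lambda>as bs. G (g # as) bs) gs"
  by (rule Cons.IH, rule Cons.prems) simp
 ultimately show ?case by simp
qed simp

lemma cut_add: "cut (\<lambda>as bs. F as bs + G as bs) gs = cut F gs + cut G gs"
 by (induction gs arbitrary: F G) (simp_all add: algebra_simps)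

lemma cut_minus: "cut (\<lambda>as bs. - F as bs) gs = - cut F gs"
 by (induction gs arbitrary: F) simp_all

lemma cut_diff: "cut (\<lambda>as bs. F as bs - G as bs) gs = cut F gs - cut G gs"
 by (induction gs arbitrary: F G) (simp_all add: algebra_simps)

lemma cut_sgv: "cut (\<lambda>as bs. sgv n (F as bs)) gs = sgv n (cut F gs)"
 by (simp add: sgv_def cut_minus)

lemma cut_0: "(\<And>as bs. as @ bs = gs ==> F as bs = 0) ==> cut F gs = 0"
 by (induction gs arbitrary: F) auto

lemma cut_closed:
 assumes "\<And>as bs. as @ bs = gs ==> F as bs \<in> S" "\<And>v w. v \<in> S ==> w \<in> S ==> v + w \<in> S"
 shows "cut F gs \<in> S"
 using assms(1) by (induction gs arbitrary: F) (auto intro: assms(2))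

lemma cut_hom:
 assumes "\<And>as bs. as @ bs = gs ==> F as bs \<in> S" "\<And>v w. v \<in> S ==> w \<in> S ==> v + w \<in> S"
  "\<And>v w. v \<in> S ==> w \<in> S ==> theta (v + w) = theta v + theta w"
 shows "theta (cut F gs) = cut (\<lambda>as bs. theta (F as bs)) gs"
 using assms(1)
proof (induction gs arbitrary: F)
 case (Cons g gs)
 have "F [] (g # gs) \<in> S" by (rule Cons.prems) simp
 moreover have *: "\<And>as bs. as @ bs = gs ==> F (g # as) bs \<in> S" by (rule Cons.prems) simp
 moreover have "cut (\<lambda>as bs. F (g # as) bs) gs \<in> S" by (rule cut_closed[OF * assms(2)])
 ultimately show ?case using assms(3) Cons.IH[OF *] by simp
qed simp

text \<open>Both sides run over all ways to cut the list into three consecutive pieces.\<close>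

lemma cut_coassoc:
 "cut (\<lambda>as bs. cut (\<lambda>a1 a2. F a1 a2 bs) as) gs = cut (\<lambda>as bs. cut (\<lambda>b1 b2. F as b1 b2) bs) gs"
proof (induction gs arbitrary: F)
 case (Cons g gs)
 show ?case
  by (simp add: cut_add Cons.IH[of "\<lambda>a. F (g # a)"] algebra_simps)
qed simp

lemma cut_swap:
 "cut (\<lambda>as bs. cut (\<lambda>cs ds. F as bs cs ds) hs) gs = cut (\<lambda>cs ds. cut (\<lambda>as bs. F as bs cs ds) gs) hs"
 by (induction gs arbitrary: F) (simp_all add: cut_add)

lemma cut_fst: "(\<And>as bs. as @ bs = gs ==> bs \<noteq> [] ==> F as bs = 0) ==> cut F gs = F gs []"
 by (induction gs arbitrary: F) auto

lemma cut_snd: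
 assumes "\<And>as bs. as @ bs = gs ==> as \<noteq> [] ==> F as bs = 0"
 shows "cut F gs = F [] gs"
 using assms by (cases gs) (auto intro: cut_0)

text \<open>A cut leaves a marked letter either in the right piece or in the left one. This isolates
  the argument at which linearity or normalization is tested.\<close>

lemma cut_mid:
 "cut F (as @ x # bs) = cut (\<lambda>a1 a2. F a1 (a2 @ x # bs)) as + cut (\<lambda>b1 b2. F (as @ x # b1) b2) bs"
 by (induction as arbitrary: F) (simp_all add: algebra_simps)

lemma cut_snoc: "cut F (as @ [x]) = cut (\<lambda>a1 a2. F a1 (a2 @ [x])) as + F (as @ [x]) []"
 using cut_mid[of F as x "[]"] by simp

lemma cut_index: "cut F gs = (\<Sum>m\<leftarrow>[0..<Suc (length gs)]. F (take m gs) (drop m gs))"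
proof (induction gs arbitrary: F)
 case (Cons g gs)
 have "(\<Sum>m\<leftarrow>[0..<Suc (length (g # gs))]. F (take m (g # gs)) (drop m (g # gs)))
   = F [] (g # gs) + (\<Sum>m\<leftarrow>map Suc [0..<Suc (length gs)]. F (take m (g # gs)) (drop m (g # gs)))"
  unfolding map_Suc_upt by (subst upt_conv_Cons) simp_all
 also have "(\<Sum>m\<leftarrow>map Suc [0..<Suc (length gs)]. F (take m (g # gs)) (drop m (g # gs)))
   = (\<Sum>m\<leftarrow>[0..<Suc (length gs)]. F (g # take m gs) (drop m gs))"
  unfolding map_map by (simp add: comp_def del: upt_Suc)
 finally show ?case using Cons.IH[of "\<lambda>as. F (g # as)"] by simp
qed simp

lemma cut_fun: "cut F gs x = cut (\<lambda>as bs. F as bs x) gs"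
 by (induction gs arbitrary: F) simp_all

text \<open>Composition of a function with the bar differential. Each summand carries the total
  shifted degree of the letters behind the one that is differentiated, or behind the first of the
  two that are composed.\<close>

primrec bd :: "('k, 'o, 'g) dgcat => ('g list => 'v) => 'g list => 'v::ab_group_add" where
 "bd D G [] = 0"
| "bd D G (g # gs) = sgv (wt D gs) (G (Dif D g # gs)) + bd D (\<lambda>xs. G (g # xs)) gs
  + (case gs of [] => 0 | g' # gs' => sgv (wt D gs) (G (Comp D g' g # gs')))"

lemma bd_add: "bd D (\<lambda>xs. G xs + G' xs) gs = bd D G gs + bd D G' gs"
 by (induction gs arbitrary: G G') (simp_all add: sgv_add algebra_simps split: list.split)

lemma bd_minus: "bd D (\<lambda>xs. - G xs) gs = - bd D G gs"
 by (induction gs arbitrary: G) (simp_all add: sgv_minus split: list.split)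

lemma bd_sgv: "bd D (\<lambda>xs. sgv n (G xs)) gs = sgv n (bd D G gs)"
 by (simp add: sgv_def bd_minus)

lemma bd_zero [simp]: "bd D (\<lambda>xs. 0) gs = 0"
 by (induction gs) (auto split: list.split)

lemma bd_fun: "bd D G gs x = bd D (\<lambda>xs. G xs x) gs"
 by (induction gs arbitrary: G) (auto simp: sgv_fun split: list.split)

lemma cut_wt:
 "cut (\<lambda>as bs. sgv (wt D bs) (sgv (wt D as) (F as bs))) gs = sgv (wt D gs) (cut F gs)"
proof -
 have "cut (\<lambda>as bs. sgv (wt D bs) (sgv (wt D as) (F as bs))) gs = cut (\<lambda>as bs. sgv (wt D gs) (F as bs)) gs"
  by (rule cut_cong) (auto intro: sgv_cong)
 thus ?thesis by (simp add: cut_sgv)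
qed

text \<open>The bar differential is a coderivation for deconcatenation: a cut never goes through a
  letter that has just been composed from two neighbours, so every change happens inside one of the
  two pieces. Changes in the left piece see the letters of the right one behind them, which accounts
  for the extra sign.\<close>

lemma bd_cut:
 "bd D (cut F) gs =
  cut (\<lambda>as bs. sgv (wt D bs) (bd D (\<lambda>xs. F xs bs) as) + bd D (\<lambda>xs. F as xs) bs) gs"
proof (induction gs arbitrary: F)
 case (Cons g gs)
 have c: "cut (\<lambda>as bs. sgv (wt D bs) (case as of [] => 0
    | g' # as' => sgv (wt D as) (F (Comp D g' g # as') bs))) gs
   = (case gs of [] => 0 | g' # gs' => sgv (wt D gs) (cut (\<lambda>as. F (Comp D g' g # as)) gs'))"
 proof (cases gs)
  case (Cons g' gs')
  have "cut (\<lambda>as bs. sgv (wt D bs) (sgv (wt D (g' # as)) (F (Comp D g' g # as) bs))) gs'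
    = cut (\<lambda>as bs. sgv (Deg D g' - 1) (sgv (wt D bs) (sgv (wt D as) (F (Comp D g' g # as) bs)))) gs'"
   by (rule cut_cong) (simp add: algebra_simps)
  also have "\<dots> = sgv (Deg D g' - 1) (sgv (wt D gs') (cut (\<lambda>as. F (Comp D g' g # as)) gs'))"
   by (simp only: cut_sgv cut_wt)
  finally show ?thesis using Cons by simp
 qed simp
 show ?case
  using cut_wt[of D "\<lambda>as. F (Dif D g # as)" gs]
  by (simp add: cut_add sgv_add bd_add Cons.IH c algebra_simps del: sgv_sgv split: list.split)
qed simp

text \<open>The five groups of summands relative to a marked letter: changes to its left, its
  composition with the left neighbour, its differential, its composition with the right neighbour,
  and changes to its right.\<close>

lemma bd_mid:
 "bd D G (as @ x # bs) =
   sgv (wt D (x # bs)) (bd D (\<lambda>xs. G (xs @ x # bs)) as)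
   + (if as = [] then 0 else sgv (wt D (x # bs)) (G (butlast as @ Comp D x (last as) # bs)))
   + sgv (wt D bs) (G (as @ Dif D x # bs))
   + (case bs of [] => 0 | y # bs' => sgv (wt D bs) (G (as @ Comp D y x # bs')))
   + bd D (\<lambda>xs. G (as @ x # xs)) bs"
proof (induction as arbitrary: G)
 case (Cons a as)
 show ?case
 proof (cases as)
  case Nil
  thus ?thesis by (cases bs) (simp_all add: algebra_simps)
 next
  case (Cons a' as')
  thus ?thesis
   using Cons.IH[of "\<lambda>xs. G (a # xs)"]
   by (cases bs) (simp_all add: sgv_add algebra_simps)
 qed
qed (cases bs; simp add: algebra_simps)

text \<open>Translates the recursion into the two indexed sums that occur in
  \<open>tdif\<close>.\<close>

lemma bd_index:
 "bd D G gs =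
  (\<Sum>j\<leftarrow>[0..<length gs]. sgv (wt D (drop (j + 1) gs)) (G (gs[j := Dif D (gs ! j)])))
  + (\<Sum>i\<leftarrow>[0..<length gs - 1]. sgv (wt D (drop (i + 1) gs))
    (G (take i gs @ [Comp D (gs ! (i + 1)) (gs ! i)] @ drop (i + 2) gs)))"
proof (induction gs arbitrary: G)
 case (Cons g gs)
 let ?A = "\<lambda>gs G j. sgv (wt D (drop (j + 1) gs)) (G (gs[j := Dif D (gs ! j)]))"
 let ?B = "\<lambda>gs G i. sgv (wt D (drop (i + 1) gs))
    (G (take i gs @ [Comp D (gs ! (i + 1)) (gs ! i)] @ drop (i + 2) gs))"
 have up: "[0..<Suc n] = 0 # map Suc [0..<n]" for n
  by (simp add: upt_conv_Cons map_Suc_upt del: upt_Suc)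
 have 1: "(\<Sum>j\<leftarrow>[0..<length (g # gs)]. ?A (g # gs) G j)
   = sgv (wt D gs) (G (Dif D g # gs)) + (\<Sum>j\<leftarrow>[0..<length gs]. ?A gs (\<lambda>xs. G (g # xs)) j)"
  by (simp add: up comp_def del: upt_Suc)
 have 2: "(\<Sum>j\<leftarrow>[0..<length (g # gs) - 1]. ?B (g # gs) G j)
   = (case gs of [] => 0 | g' # gs' => sgv (wt D gs) (G (Comp D g' g # gs')))
    + (\<Sum>j\<leftarrow>[0..<length gs - 1]. ?B gs (\<lambda>xs. G (g # xs)) j)"
  by (cases gs) (simp_all add: up comp_def del: upt_Suc)
 show ?case
  unfolding 1 2 bd.simps Cons.IH[of "\<lambda>xs. G (g # xs)"] by (simp only: ab_semigroup_add_class.add_ac)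
qed simp

section \<open>Graded categories with values in an abelian group type\<close>

text \<open>Here the spaces of morphisms are subgroups of a type of class \<^class>\<open>ab_group_add\<close>, so that
 sums of morphisms need no type information.  The first argument of \<open>mul\<close> is the degree of
 the morphism that is applied first.\<close>

locale vgc = field K for K :: "'k ring" +
 fixes Ob :: "'x set" and H :: "'x => 'x => int => 'v::ab_group_add set"
  and sc :: "'k => 'v => 'v" and mul :: "int => 'v => 'v => 'v" and idn :: "'x => 'v"
 assumes H_zero [simp]: "0 \<in> H x y n"
  and H_add: "v \<in> H x y n ==> w \<in> H x y n ==> v + w \<in> H x y n"
  and sc_closed: "a \<in> carrier K ==> v \<in> H x y n ==> sc a v \<in> H x y n"
  and sc_add: "a \<in> carrier K ==> v \<in> H x y n ==> w \<in> H x y n ==> sc a (v + w) = sc a v + sc a w"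
  and sc_plus: "a \<in> carrier K ==> b \<in> carrier K ==> v \<in> H x y n ==>
   sc (a \<oplus>\<^bsub>K\<^esub> b) v = sc a v + sc b v"
  and sc_sc: "a \<in> carrier K ==> b \<in> carrier K ==> v \<in> H x y n ==>
   sc a (sc b v) = sc (a \<otimes>\<^bsub>K\<^esub> b) v"
  and sc_one: "v \<in> H x y n ==> sc \<one>\<^bsub>K\<^esub> v = v"
  and idn_H: "x \<in> Ob ==> idn x \<in> H x x 0"
  and mul_H: "f \<in> H x y m ==> g \<in> H y z n ==> mul m g f \<in> H x z (m + n)"
  and mul_addl: "f \<in> H x y m ==> g \<in> H y z n ==> g' \<in> H y z n ==>
   mul m (g + g') f = mul m g f + mul m g' f"
  and mul_addr: "f \<in> H x y m ==> f' \<in> H x y m ==> g \<in> H y z n ==>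
   mul m g (f + f') = mul m g f + mul m g f'"
  and mul_scl: "a \<in> carrier K ==> f \<in> H x y m ==> g \<in> H y z n ==>
   mul m (sc a g) f = sc a (mul m g f)"
  and mul_scr: "a \<in> carrier K ==> f \<in> H x y m ==> g \<in> H y z n ==>
   mul m g (sc a f) = sc a (mul m g f)"
  and mul_assoc: "f \<in> H x y m ==> g \<in> H y z n ==> h \<in> H z u k ==>
   mul m (mul n h g) f = mul (m + n) h (mul m g f)"
  and mul_idl: "f \<in> H x y n ==> mul n (idn y) f = f"
  and mul_idr: "f \<in> H x y n ==> mul 0 f (idn x) = f"
begin

lemma sc_zero: "a \<in> carrier K ==> sc a 0 = 0"
 using sc_add[of a 0 _ _ _ 0] by simp

lemma sc_null: assumes v: "v \<in> H x y n" shows "sc \<zero>\<^bsub>K\<^esub> v = 0"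
 using sc_plus[OF zero_closed zero_closed v] by simp

lemma sc_neg_one: assumes v: "v \<in> H x y n" shows "sc (m1 K) v = - v"
proof -
 have "sc (m1 K) v + v = sc (m1 K \<oplus>\<^bsub>K\<^esub> \<one>\<^bsub>K\<^esub>) v"
  using sc_plus[OF _ _ v, of "m1 K" "\<one>\<^bsub>K\<^esub>"] sc_one[OF v] by simp
 also have "\<dots> = 0" using sc_null[OF v] by (simp add: l_neg)
 finally show ?thesis by (simp add: eq_neg_iff_add_eq_0)
qed

lemma sc_sg: "v \<in> H x y n ==> sc (sg K m) v = sgv m v"
 by (simp add: sg_def sgv_def sc_one sc_neg_one)

lemma H_neg: "v \<in> H x y n ==> - v \<in> H x y n"
 using sc_closed[of "m1 K" v] sc_neg_one[of v] by simp

lemma H_diff: "v \<in> H x y n ==> w \<in> H x y n ==> v - w \<in> H x y n"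
 using H_add[OF _ H_neg] by fastforce

lemma H_sgv: "v \<in> H x y n ==> sgv m v \<in> H x y n"
 by (simp add: sgv_def H_neg)

lemma sc_neg: assumes "a \<in> carrier K" "v \<in> H x y n" shows "sc a (- v) = - sc a v"
 using sc_add[OF assms H_neg[OF assms(2)]] sc_zero[OF assms(1)] by (simp add: eq_neg_iff_add_eq_0 add.commute)

lemma sc_sgv: "a \<in> carrier K ==> v \<in> H x y n ==> sc a (sgv m v) = sgv m (sc a v)"
 by (simp add: sgv_def sc_neg)

lemma mul_zerol: "f \<in> H x y m ==> mul m 0 f = 0"
 using mul_addl[of f x y m 0 y 0 0] by simp

lemma mul_zeror: "g \<in> H y z n ==> mul m g 0 = 0"
 using mul_addr[of 0 y y m 0 g z n] by simp

lemma mul_negl: assumes "f \<in> H x y m" "g \<in> H y z n" shows "mul m (- g) f = - mul m g f"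
 using mul_addl[OF assms H_neg[OF assms(2)]] mul_zerol[OF assms(1)]
 by (simp add: eq_neg_iff_add_eq_0 add.commute)

lemma mul_negr: assumes "f \<in> H x y m" "g \<in> H y z n" shows "mul m g (- f) = - mul m g f"
 using mul_addr[OF assms(1) H_neg[OF assms(1)] assms(2)] mul_zeror[OF assms(2)]
 by (simp add: eq_neg_iff_add_eq_0 add.commute)

lemma mul_sgvl: "f \<in> H x y m ==> g \<in> H y z n ==> mul m (sgv k g) f = sgv k (mul m g f)"
 by (simp add: sgv_def mul_negl)

lemma mul_sgvr: "f \<in> H x y m ==> g \<in> H y z n ==> mul m g (sgv k f) = sgv k (mul m g f)"
 by (simp add: sgv_def mul_negr)

lemma mul_diffl:
 assumes "f \<in> H x y m" "g \<in> H y z n" "g' \<in> H y z n"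
 shows "mul m (g - g') f = mul m g f - mul m g' f"
 using mul_addl[OF assms(1,2) H_neg[OF assms(3)]] mul_negl[OF assms(1,3)] by simp

lemma mul_diffr:
 assumes "f \<in> H x y m" "f' \<in> H x y m" "g \<in> H y z n"
 shows "mul m g (f - f') = mul m g f - mul m g f'"
 using mul_addr[OF assms(1) H_neg[OF assms(2)] assms(3)] mul_negr[OF assms(2,3)] by simp

lemma H_cut: "(\<And>as bs. as @ bs = gs ==> F as bs \<in> H x y n) ==> cut F gs \<in> H x y n"
 by (rule cut_closed) (auto intro: H_add)

lemma mul_cutl:
 assumes "f \<in> H x y m" "\<And>as bs. as @ bs = gs ==> F as bs \<in> H y z n"
 shows "mul m (cut F gs) f = cut (\<lambda>as bs. mul m (F as bs) f) gs"
 by (rule cut_hom[where S = "H y z n" and theta = "\<lambda>g. mul m g f"])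
  (auto intro: assms H_add mul_addl[OF assms(1)])

lemma mul_cutr:
 assumes "g \<in> H y z n" "\<And>as bs. as @ bs = gs ==> F as bs \<in> H x y m"
 shows "mul m g (cut F gs) = cut (\<lambda>as bs. mul m g (F as bs)) gs"
 by (rule cut_hom[where S = "H x y m" and theta = "\<lambda>f. mul m g f"])
  (auto intro: assms H_add mul_addr[OF _ _ assms(1)])

lemma sc_cut:
 assumes "a \<in> carrier K" "\<And>as bs. as @ bs = gs ==> F as bs \<in> H x y n"
 shows "sc a (cut F gs) = cut (\<lambda>as bs. sc a (F as bs)) gs"
 by (rule cut_hom[where S = "H x y n"]) (auto intro: assms H_add sc_add[OF assms(1)])

end

section \<open>Realization of a graded category by characters\<close>

definition is_char :: "('k, 'm) module => ('m => circle) => bool" where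
 "is_char M chi \<longleftrightarrow> (\<forall>x\<in>carrier M. \<forall>y\<in>carrier M. chi (x \<oplus>\<^bsub>M\<^esub> y) = chi x + chi y)"

text \<open>The index in \<open>'o \<times> 'o \<times> int\<close> records source, target and degree of a morphism.\<close>

typedef ('o, 'm) dual = "UNIV :: ('o \<times> 'o \<times> int => ('m => circle) => circle) set" ..

lemma dual_eqI: "(\<And>t chi. Rep_dual u t chi = Rep_dual v t chi) ==> u = v"
 by (metis Rep_dual_inject ext)

instantiation dual :: (type, type) ab_group_add
begin

definition "0 = Abs_dual (\<lambda>t chi. 0)"
definition "u + v = Abs_dual (\<lambda>t chi. Rep_dual u t chi + Rep_dual v t chi)"
definition "- u = Abs_dual (\<lambda>t chi. - Rep_dual u t chi)"
definition "u - v = Abs_dual (\<lambda>t chi. Rep_dual u t chi - Rep_dual v t chi)"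

instance
 by standard
  (auto intro!: dual_eqI simp: zero_dual_def plus_dual_def uminus_dual_def minus_dual_def
   Abs_dual_inverse algebra_simps)

end

text \<open>A morphism becomes the evaluation functional on the characters of its own space of
  morphisms. Extension by zero to other indices and to functions that are not characters makes it
  additive and sends all zero morphisms to the same element 0.\<close>

definition emb :: "('k, 'o, 'm) dgcat => 'm => ('o, 'm) dual" where
 "emb C m = Abs_dual (\<lambda>t chi. if m \<in> arr C \<and> t = (Dom C m, Cod C m, Deg C m)
   \<and> is_char (Mor C (Dom C m) (Cod C m) (Deg C m)) chi then chi m else 0)"

text \<open>The value \<open>{0}\<close> outside the objects makes 0 a member for all indices, so
  that \<open>H_zero\<close> holds without side conditions.\<close>

definition rH :: "('k, 'o, 'm) dgcat => 'o => 'o => int => ('o, 'm) dual set" where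
 "rH C x y n = (if x \<in> Obj C \<and> y \<in> Obj C then emb C ` mor C x y n else {0})"

text \<open>The preimage is unique only for nonzero functionals, see \<open>pr_emb\<close>; this is
  the reason for the case distinctions in \<open>rsc\<close>, \<open>rmul\<close> and
  \<open>rdif\<close>.\<close>

definition pr :: "('k, 'o, 'm) dgcat => ('o, 'm) dual => 'm" where
 "pr C v = (SOME m. m \<in> arr C \<and> emb C m = v)"

definition rsc :: "('k, 'o, 'm) dgcat => 'k => ('o, 'm) dual => ('o, 'm) dual" where
 "rsc C a v = (if v = 0 then 0 else
   emb C (a \<odot>\<^bsub>Mor C (Dom C (pr C v)) (Cod C (pr C v)) (Deg C (pr C v))\<^esub> pr C v))"

definition rmul :: "('k, 'o, 'm) dgcat => ('o, 'm) dual => ('o, 'm) dual => ('o, 'm) dual" where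
 "rmul C v w = (if v = 0 \<or> w = 0 then 0 else emb C (Comp C (pr C v) (pr C w)))"

definition rdif :: "('k, 'o, 'm) dgcat => ('o, 'm) dual => ('o, 'm) dual" where
 "rdif C v = (if v = 0 then 0 else emb C (Dif C (pr C v)))"

context graded_category
begin

lemma comp_zero_left:
 assumes "x \<in> Obj C" "y \<in> Obj C" "z \<in> Obj C" "f \<in> mor C x y m"
 shows "Comp C \<zero>\<^bsub>Mor C y z n\<^esub> f = \<zero>\<^bsub>Mor C x z (m + n)\<^esub>"
proof -
 interpret M: module K "Mor C y z n" using assms by simp
 interpret N: module K "Mor C x z (m + n)" using assms by simp
 have "Comp C \<zero>\<^bsub>Mor C y z n\<^esub> f \<in> mor C x z (m + n)"
  by (rule comp_closed[OF assms]) simp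
 with comp_add_left[OF assms M.zero_closed M.zero_closed] show ?thesis
  using N.add.r_cancel_one' by auto
qed

lemma comp_zero_right:
 assumes "x \<in> Obj C" "y \<in> Obj C" "z \<in> Obj C" "g \<in> mor C y z n"
 shows "Comp C g \<zero>\<^bsub>Mor C x y m\<^esub> = \<zero>\<^bsub>Mor C x z (m + n)\<^esub>"
proof -
 interpret M: module K "Mor C x y m" using assms by simp
 interpret N: module K "Mor C x z (m + n)" using assms by simp
 have "Comp C g \<zero>\<^bsub>Mor C x y m\<^esub> \<in> mor C x z (m + n)"
  by (rule comp_closed[OF assms(1-3) M.zero_closed assms(4)])
 with comp_add_right[OF assms(1-3) M.zero_closed M.zero_closed assms(4)] show ?thesis
  using N.add.r_cancel_one' by auto
qed

lemma emb_add:
 assumes "x \<in> Obj C" "y \<in> Obj C" "f \<in> mor C x y n" "g \<in> mor C x y n"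
 shows "emb C (madd C x y n f g) = emb C f + emb C g"
proof -
 interpret M: module K "Mor C x y n" using assms by simp
 have s: "madd C x y n f g \<in> mor C x y n" using assms by simp
 note t = mor_DCD[OF assms(1,2) s] mor_DCD[OF assms(1-3)] mor_DCD[OF assms(1,2,4)]
  arrI[OF assms(1,2) s] arrI[OF assms(1-3)] arrI[OF assms(1,2,4)]
 show ?thesis
  by (rule dual_eqI)
   (use assms in "auto simp: emb_def plus_dual_def Abs_dual_inverse t is_char_def")
qed

lemma emb_zero:
 assumes "x \<in> Obj C" "y \<in> Obj C"
 shows "emb C \<zero>\<^bsub>Mor C x y n\<^esub> = 0"
proof -
 interpret M: module K "Mor C x y n" using assms by simp
 show ?thesis
  using emb_add[OF assms M.zero_closed M.zero_closed] by simp
qed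

text \<open>Here the existence of enough characters enters; \<open>emb_inj\<close> follows by
  looking at a difference.\<close>

lemma emb_eq_zeroD:
 assumes "x \<in> Obj C" "y \<in> Obj C" "f \<in> mor C x y n" "emb C f = 0"
 shows "f = \<zero>\<^bsub>Mor C x y n\<^esub>"
proof (rule ccontr)
 assume nz: "f \<noteq> \<zero>\<^bsub>Mor C x y n\<^esub>"
 interpret M: module K "Mor C x y n" using assms by simp
 from M.exists_character[OF assms(3) nz] obtain chi :: "'m => circle"
  where chi: "is_char (Mor C x y n) chi" "chi f \<noteq> 0" unfolding is_char_def by blast
 have "Rep_dual (emb C f) (x, y, n) chi = chi f"
  using chi mor_DCD[OF assms(1-3)] arrI[OF assms(1-3)] by (simp add: emb_def Abs_dual_inverse)
 with chi assms(4) show False by (simp add: zero_dual_def Abs_dual_inverse)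
qed

lemma emb_inj:
 assumes "x \<in> Obj C" "y \<in> Obj C" "f \<in> mor C x y n" "g \<in> mor C x y n"
  "emb C f = emb C g"
 shows "f = g"
proof -
 interpret M: module K "Mor C x y n" using assms by simp
 have n: "\<ominus>\<^bsub>Mor C x y n\<^esub> g \<in> mor C x y n" using assms by simp
 have "emb C (g \<oplus>\<^bsub>Mor C x y n\<^esub> \<ominus>\<^bsub>Mor C x y n\<^esub> g) = 0"
  using assms emb_zero by (simp add: M.r_neg)
 hence "emb C (f \<oplus>\<^bsub>Mor C x y n\<^esub> \<ominus>\<^bsub>Mor C x y n\<^esub> g) = 0"
  using assms n by (simp add: emb_add)
 from emb_eq_zeroD[OF assms(1,2) _ this] have "f \<oplus>\<^bsub>Mor C x y n\<^esub> \<ominus>\<^bsub>Mor C x y n\<^esub> g = \<zero>\<^bsub>Mor C x y n\<^esub>"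
  using assms n by simp
 thus ?thesis using assms(3,4) n by (metis M.minus_equality M.minus_minus)
qed

lemma Rep_emb: "Rep_dual (emb C f) t chi = (if f \<in> arr C \<and> t = (Dom C f, Cod C f, Deg C f)
   \<and> is_char (Mor C (Dom C f) (Cod C f) (Deg C f)) chi then chi f else 0)"
 by (simp add: emb_def Abs_dual_inverse)

lemma emb_support:
 assumes "emb C f \<noteq> 0"
 shows "\<exists>t chi. Rep_dual (emb C f) t chi \<noteq> 0"
 using assms dual_eqI[of "emb C f" 0] by (auto simp: zero_dual_def Abs_dual_inverse)

text \<open>A nonzero functional is supported at one triple of source, target and degree, and
  therefore remembers the space of morphisms from which it came. Inside that space
  \<open>emb_inj\<close> applies.\<close>

lemma pr_emb:
 assumes "f \<in> arr C" "emb C f \<noteq> 0"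
 shows "pr C (emb C f) = f"
proof -
 define m where "m = pr C (emb C f)"
 have m: "m \<in> arr C" "emb C m = emb C f"
  unfolding m_def pr_def using someI[of "\<lambda>m. m \<in> arr C \<and> emb C m = emb C f" f] assms by auto
 obtain t chi where "Rep_dual (emb C f) t chi \<noteq> 0" using emb_support[OF assms(2)] by blast
 with Rep_emb[of f t chi] Rep_emb[of m t chi] m(2)
 have t: "(Dom C m, Cod C m, Deg C m) = (Dom C f, Cod C f, Deg C f)" by (metis (full_types))
 show ?thesis
  using emb_inj[of "Dom C f" "Cod C f" m "Deg C f" f] arr_typed[OF assms(1)] arr_typed[OF m(1)] t m(2)
  unfolding m_def by simp
qed

text \<open>If one factor is sent to 0 it is a zero morphism, so the composite is one as well and
  agrees with the default value of \<open>rmul\<close>.\<close>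

lemma rmul_emb:
 assumes "x \<in> Obj C" "y \<in> Obj C" "z \<in> Obj C" "f \<in> mor C x y m" "g \<in> mor C y z n"
 shows "rmul C (emb C g) (emb C f) = emb C (Comp C g f)"
proof (cases "emb C g = 0 \<or> emb C f = 0")
 case True
 hence "Comp C g f = \<zero>\<^bsub>Mor C x z (m + n)\<^esub>"
  using emb_eq_zeroD[OF assms(2,3,5)] emb_eq_zeroD[OF assms(1,2,4)]
   comp_zero_left[OF assms(1-4)] comp_zero_right[OF assms(1-3,5)] by auto
 thus ?thesis using True assms by (simp add: rmul_def emb_zero)
next
 case False
 thus ?thesis
  using pr_emb[OF arrI[OF assms(2,3,5)]] pr_emb[OF arrI[OF assms(1,2,4)]] by (simp add: rmul_def)
qed

lemma rsc_emb:
 assumes "x \<in> Obj C" "y \<in> Obj C" "a \<in> carrier K" "f \<in> mor C x y n"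
 shows "rsc C a (emb C f) = emb C (mscale C x y n a f)"
proof (cases "emb C f = 0")
 case True
 interpret M: module K "Mor C x y n" using assms by simp
 show ?thesis using emb_eq_zeroD[OF assms(1,2,4) True] True assms
  by (simp add: rsc_def M.smult_r_null emb_zero)
next
 case False
 thus ?thesis
  using pr_emb[OF arrI[OF assms(1,2,4)]] mor_DCD[OF assms(1,2,4)] by (simp add: rsc_def)
qed

lemma rH_I: "x \<in> Obj C ==> y \<in> Obj C ==> f \<in> mor C x y n ==> emb C f \<in> rH C x y n"
 by (simp add: rH_def)

lemma rH_E:
 assumes "v \<in> rH C x y n"
 obtains (zero) "v = 0" "\<not> (x \<in> Obj C \<and> y \<in> Obj C)"
 | (emb) f where "x \<in> Obj C" "y \<in> Obj C" "f \<in> mor C x y n" "v = emb C f"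
 using assms by (auto simp: rH_def split: if_splits)

lemma rH_zero: "0 \<in> rH C x y n"
proof (cases "x \<in> Obj C \<and> y \<in> Obj C")
 case True
 then interpret M: module K "Mor C x y n" by simp
 show ?thesis using True emb_zero[of x y n] rH_I[of x y "\<zero>\<^bsub>Mor C x y n\<^esub>" n] by simp
qed (auto simp: rH_def)

lemma rmul_zero [simp]: "rmul C 0 v = 0" "rmul C v 0 = 0"
 by (simp_all add: rmul_def)

lemma rsc_zero [simp]: "rsc C a 0 = 0"
 by (simp add: rsc_def)

lemma real_vgc: "vgc K (Obj C) (rH C) (rsc C) (\<lambda>_. rmul C) (\<lambda>x. emb C (Idn C x))"
proof (intro vgc.intro vgc_axioms.intro field_axioms, goal_cases)
 case (1 x y n) show ?case by (rule rH_zero)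
next
 case (2 v x y n w)
 thus ?case
 proof (elim rH_E)
  fix f g assume *: "x \<in> Obj C" "y \<in> Obj C" "f \<in> mor C x y n" "g \<in> mor C x y n"
   "v = emb C f" "w = emb C g"
  then interpret M: module K "Mor C x y n" by simp
  show ?thesis using * emb_add[OF *(1-4)] rH_I[OF *(1,2) M.a_closed[OF *(3,4)]] by simp
 qed (auto simp: rH_def)
next
 case (3 a v x y n)
 thus ?case
 proof (elim rH_E)
  fix f assume *: "x \<in> Obj C" "y \<in> Obj C" "f \<in> mor C x y n" "v = emb C f" "a \<in> carrier K"
  then interpret M: module K "Mor C x y n" by simp
  show ?thesis using * by (simp add: rsc_emb rH_I)
 qed (auto simp: rH_zero)
next
 case (4 a v x y n w)
 thus ?case
 proof (elim rH_E)
  fix f g assume *: "x \<in> Obj C" "y \<in> Obj C" "f \<in> mor C x y n" "g \<in> mor C x y n"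
   "v = emb C f" "w = emb C g" "a \<in> carrier K"
  then interpret M: module K "Mor C x y n" by simp
  show ?thesis
   using * emb_add[OF *(1-4)] emb_add[OF *(1,2) M.smult_closed M.smult_closed, OF *(7,3) *(7,4)]
    rsc_emb[OF *(1,2,7) M.a_closed[OF *(3,4)]]
   by (simp add: rsc_emb[OF *(1,2,7)] M.smult_r_distr)
 qed auto
next
 fix a b v x y n assume "a \<in> carrier K" "b \<in> carrier K" "v \<in> rH C x y n"
 thus "rsc C (a \<oplus>\<^bsub>K\<^esub> b) v = rsc C a v + rsc C b v" "rsc C a (rsc C b v) = rsc C (a \<otimes>\<^bsub>K\<^esub> b) v"
 proof (atomize (full), elim rH_E)
  fix f assume *: "x \<in> Obj C" "y \<in> Obj C" "f \<in> mor C x y n" "v = emb C f"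
   "a \<in> carrier K" "b \<in> carrier K"
  then interpret M: module K "Mor C x y n" by simp
  show "rsc C (a \<oplus>\<^bsub>K\<^esub> b) v = rsc C a v + rsc C b v \<and> rsc C a (rsc C b v) = rsc C (a \<otimes>\<^bsub>K\<^esub> b) v"
   using * emb_add[OF *(1,2) M.smult_closed M.smult_closed, OF *(5,3) *(6,3)]
   by (simp add: rsc_emb[OF *(1,2)] M.smult_l_distr M.smult_assoc1)
 qed auto
next
 case (7 v x y n)
 thus ?case
 proof (elim rH_E)
  fix f assume *: "x \<in> Obj C" "y \<in> Obj C" "f \<in> mor C x y n" "v = emb C f"
  then interpret M: module K "Mor C x y n" by simp
  show ?thesis using * by (simp add: rsc_emb)
 qed auto
next
 case (8 x)
 thus ?case by (simp add: rH_I idn_closed)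
next
 case (9 f x y m g z n)
 thus ?case
  by (elim rH_E) (auto simp: rH_zero rmul_emb intro!: rH_I comp_closed[of x y z])
next
 case (10 f x y m g z n g')
 thus ?case
 proof (elim rH_E)
  fix u v w assume *: "x \<in> Obj C" "y \<in> Obj C" "z \<in> Obj C" "u \<in> mor C x y m"
   "v \<in> mor C y z n" "w \<in> mor C y z n" "f = emb C u" "g = emb C v" "g' = emb C w"
  then interpret M: module K "Mor C y z n" by simp
  show ?thesis
   using * emb_add[OF *(2,3,5,6)] comp_add_left[OF *(1-6)]
    emb_add[OF *(1,3) comp_closed[OF *(1-3) *(4,5)] comp_closed[OF *(1-3) *(4,6)]]
    rmul_emb[OF *(1-4) M.a_closed[OF *(5,6)]]
   by (simp add: rmul_emb[OF *(1-4)])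
 qed auto
next
 fix f x y m g z n f' assume "f \<in> rH C x y m" "f' \<in> rH C x y m" "g \<in> rH C y z n"
 thus "rmul C g (f + f') = rmul C g f + rmul C g f'"
 proof (elim rH_E)
  fix u v w assume *: "x \<in> Obj C" "y \<in> Obj C" "z \<in> Obj C" "u \<in> mor C x y m"
   "v \<in> mor C x y m" "w \<in> mor C y z n" "f = emb C u" "f' = emb C v" "g = emb C w"
  then interpret M: module K "Mor C x y m" by simp
  show ?thesis
   using * emb_add[OF *(1,2,4,5)] comp_add_right[OF *(1-6)]
    emb_add[OF *(1,3) comp_closed[OF *(1-3) *(4,6)] comp_closed[OF *(1-3) *(5,6)]]
    rmul_emb[OF *(1-3) M.a_closed[OF *(4,5)] *(6)]
   by (simp add: rmul_emb[OF *(1-3) _ *(6)])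
 qed auto
next
 fix a f x y m g z n assume "a \<in> carrier K" "f \<in> rH C x y m" "g \<in> rH C y z n"
 thus "rmul C (rsc C a g) f = rsc C a (rmul C g f)" "rmul C g (rsc C a f) = rsc C a (rmul C g f)"
 proof (atomize (full), elim rH_E)
  fix u v assume *: "x \<in> Obj C" "y \<in> Obj C" "z \<in> Obj C" "u \<in> mor C x y m"
   "v \<in> mor C y z n" "f = emb C u" "g = emb C v" "a \<in> carrier K"
  then interpret M: module K "Mor C x y m" by simp
  interpret N: module K "Mor C y z n" using * by simp
  have [simp]: "rsc C a (emb C (Comp C v u)) = emb C (a \<odot>\<^bsub>Mor C x z (m + n)\<^esub> Comp C v u)"
   using * by (intro rsc_emb comp_closed) auto
  show "rmul C (rsc C a g) f = rsc C a (rmul C g f) \<and> rmul C g (rsc C a f) = rsc C a (rmul C g f)"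
   using * comp_smult_left[OF *(1-3) *(8) *(4,5)] comp_smult_right[OF *(1-3) *(8) *(4,5)]
    rmul_emb[OF *(1-4) N.smult_closed[OF *(8,5)]] rmul_emb[OF *(1-3) M.smult_closed[OF *(8,4)] *(5)]
   by (simp add: rsc_emb[OF *(2,3) *(8,5)] rsc_emb[OF *(1,2) *(8,4)] rmul_emb[OF *(1-3)])
 qed auto
next
 case (14 f x y m g z n h w k)
 thus ?case
 proof (elim rH_E)
  fix u v t assume *: "x \<in> Obj C" "y \<in> Obj C" "z \<in> Obj C" "w \<in> Obj C" "u \<in> mor C x y m"
   "v \<in> mor C y z n" "t \<in> mor C z w k" "f = emb C u" "g = emb C v" "h = emb C t"
  have "Comp C t (Comp C v u) = Comp C (Comp C t v) u"
   using * mor_DCD by (intro comp_assoc) (auto intro: arrI simp: mor_DCD[OF *(1,2,5)] mor_DCD[OF *(2,3,6)] mor_DCD[OF *(3,4,7)])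
  thus ?thesis
   using * by (simp add: rmul_emb[OF *(1-3)] rmul_emb[OF *(2-4)]
     rmul_emb[OF *(1,3,4) comp_closed[OF *(1-3) *(5,6)]]
     rmul_emb[OF *(1,2,4) _ comp_closed[OF *(2-4) *(6,7)]])
 qed auto
next
 fix f x y n assume "f \<in> rH C x y n"
 thus "rmul C (emb C (Idn C y)) f = f" "rmul C f (emb C (Idn C x)) = f"
 proof (atomize (full), elim rH_E)
  fix u assume *: "x \<in> Obj C" "y \<in> Obj C" "u \<in> mor C x y n" "f = emb C u"
  thus "rmul C (emb C (Idn C y)) f = f \<and> rmul C f (emb C (Idn C x)) = f"
   using rmul_emb[OF *(1,2,2,3) idn_closed[OF *(2)]] rmul_emb[OF *(1,1,2) idn_closed[OF *(1)] *(3)]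
    mor_DCD[OF *(1-3)] arrI[OF *(1-3)] comp_idn_left[of u] comp_idn_right[of u] by simp
 qed auto
qed

end

context dg_category
begin

lemma dif_zero:
 assumes "x \<in> Obj C" "y \<in> Obj C"
 shows "Dif C \<zero>\<^bsub>Mor C x y n\<^esub> = \<zero>\<^bsub>Mor C x y (n + 1)\<^esub>"
proof -
 interpret M: module K "Mor C x y n" using assms by simp
 interpret N: module K "Mor C x y (n + 1)" using assms by simp
 show ?thesis
  using dif_add[OF assms M.zero_closed M.zero_closed] dif_closed[OF assms M.zero_closed]
   N.add.r_cancel_one' by auto
qed

lemma rdif_emb:
 assumes "x \<in> Obj C" "y \<in> Obj C" "f \<in> mor C x y n"
 shows "rdif C (emb C f) = emb C (Dif C f)"
proof (cases "emb C f = 0")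
 case True
 show ?thesis using emb_eq_zeroD[OF assms True] True assms
  by (simp add: rdif_def dif_zero emb_zero)
next
 case False
 thus ?thesis
  using pr_emb[OF arrI[OF assms]] by (simp add: rdif_def)
qed

text \<open>The Leibniz rule for the composite of the identity with itself gives
  \<open>d(id) = d(id) + d(id)\<close>.\<close>

lemma dif_idn:
 assumes "x \<in> Obj C"
 shows "Dif C (Idn C x) = \<zero>\<^bsub>Mor C x x 1\<^esub>"
proof -
 interpret M: module K "Mor C x x 1" using assms by simp
 note i = idn_closed[OF assms]
 have d: "Dif C (Idn C x) \<in> mor C x x 1" using dif_closed[OF assms assms i] by simp
 have "Dif C (Comp C (Idn C x) (Idn C x)) = Dif C (Idn C x) \<oplus>\<^bsub>Mor C x x 1\<^esub> Dif C (Idn C x)"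
  using dif_comp[OF assms assms assms i i] comp_idn_left[of "Dif C (Idn C x)"]
   comp_idn_right[of "Dif C (Idn C x)"] arrI[OF assms assms d] mor_DCD[OF assms assms d] d
  by (simp add: sg_def)
 moreover have "Comp C (Idn C x) (Idn C x) = Idn C x"
  using comp_idn_left[of "Idn C x"] idn_arr[OF assms] by simp
 ultimately show ?thesis using d M.add.r_cancel_one' by auto
qed

end

lemma sgv_prod: "sgv n (v, w) = (sgv n v, sgv n w)"
 by (simp add: sgv_def)

lemma cut_prod: "cut (\<lambda>as bs. (F as bs, G as bs)) gs = (cut F gs, cut G gs)"
 by (induction gs arbitrary: F G) (simp_all add: zero_prod_def)

section \<open>Cochains on the bar construction\<close>

text \<open>The square of the differential is left unconstrained because the total differential on
  arbitrary cochains has to be an instance, and the bar differential squares to zero only on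
  multilinear ones. Source, target and degree are arguments of \<open>dif\<close> because the
  differential of a cochain depends on them through the functors between which it lives.\<close>

locale vdg = vgc K Ob H sc mul idn
 for K :: "'k ring" and Ob :: "'x set" and H :: "'x => 'x => int => 'v::ab_group_add set"
  and sc mul idn +
 fixes dif :: "'x => 'x => int => 'v => 'v"
 assumes dif_H: "x \<in> Ob ==> y \<in> Ob ==> v \<in> H x y n ==> dif x y n v \<in> H x y (n + 1)"
  and dif_add: "x \<in> Ob ==> y \<in> Ob ==> v \<in> H x y n ==> w \<in> H x y n ==> dif x y n (v + w) = dif x y n v + dif x y n w"
  and dif_sc: "x \<in> Ob ==> y \<in> Ob ==> a \<in> carrier K ==> v \<in> H x y n ==> dif x y n (sc a v) = sc a (dif x y n v)"
  and dif_mul: "x \<in> Ob ==> y \<in> Ob ==> z \<in> Ob ==> f \<in> H x y m ==> g \<in> H y z n ==>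
   dif x z (m + n) (mul m g f) = mul m (dif y z n g) f + sgv n (mul (m + 1) g (dif x y m f))"
begin

lemma dif_0: "x \<in> Ob ==> y \<in> Ob ==> dif x y n 0 = 0"
 using dif_add[of x y 0 n 0] by simp

lemma dif_neg:
 assumes "x \<in> Ob" "y \<in> Ob" "v \<in> H x y n"
 shows "dif x y n (- v) = - dif x y n v"
 using dif_add[OF assms H_neg[OF assms(3)]] dif_0[OF assms(1,2)] by (simp add: eq_neg_iff_add_eq_0 add.commute)

lemma dif_sgv: "x \<in> Ob ==> y \<in> Ob ==> v \<in> H x y n ==> dif x y n (sgv m v) = sgv m (dif x y n v)"
 by (simp add: sgv_def dif_neg)

lemma dif_idn: assumes "x \<in> Ob" shows "dif x x 0 (idn x) = 0"
proof -
 note i = idn_H[OF assms]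
 have "dif x x 0 (idn x) \<in> H x x 1" using dif_H[OF assms assms i] by simp
 hence "mul 0 (dif x x 0 (idn x)) (idn x) = dif x x 0 (idn x)"
  "mul 1 (idn x) (dif x x 0 (idn x)) = dif x x 0 (idn x)"
  using mul_idr mul_idl by auto
 thus ?thesis using dif_mul[OF assms assms assms i i] mul_idl[OF i] by simp
qed

end

lemma (in vgc) sc_diff:
 assumes "a \<in> carrier K" "v \<in> H x y n" "w \<in> H x y n"
 shows "sc a (v - w) = sc a v - sc a w"
 using sc_add[OF assms(1,2) H_neg[OF assms(3)]] sc_neg[OF assms(1,3)] by simp

text \<open>The value 0 off the paths makes equality of cochains equality of functions.
  Multilinearity and normalization are kept apart, as \<open>linc\<close> and
  \<open>redc\<close>.\<close>

definition cochs :: "('k, 'd, 'g) dgcat => ('x => 'x => int => 'v::ab_group_add set)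
  => ('d => 'x) => ('d => 'x) => int => ('d => 'g list => 'v) set" where
 "cochs D H Ph Ps p = {phi. \<forall>d gs. if path D d gs
   then phi d gs \<in> H (Ph d) (Ps (pend D d gs)) (p + wt D gs) else phi d gs = 0}"

text \<open>The cup product. With \<open>p\<close> the degree of the factor applied first, the sign
  is that of the relation \<open>E_comp\<close>.\<close>

definition mulc :: "('k, 'd, 'g) dgcat => (int => 'v => 'v => 'v) => int
  => ('d => 'g list => 'v) => ('d => 'g list => 'v) => 'd => 'g list => 'v::ab_group_add" where
 "mulc D mul p psi phi d gs = (if path D d gs then
   cut (\<lambda>as bs. sgv (p * wt D bs) (mul (p + wt D as) (psi (pend D d as) bs) (phi d as))) gs else 0)"

definition scc :: "('k => 'v => 'v) => 'k => ('d => 'g list => 'v) => 'd => 'g list => 'v" where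
 "scc sc a phi d gs = sc a (phi d gs)"

definition idc :: "('k, 'd, 'g) dgcat => ('x => 'v) => ('d => 'x) => 'd => 'g list => 'v::ab_group_add"
 where "idc D idn Ph d gs = (if d \<in> Obj D \<and> gs = [] then idn (Ph d) else 0)"

text \<open>The twisting cochain of a functor: the functor seen as a cochain supported on paths of
  length one. It has degree 1 because a letter \<open>g\<close> counts as
  \<open>|g| - 1\<close>.\<close>

definition rho :: "('k, 'd, 'g) dgcat => ('g => 'v) => 'd => 'g list => 'v::ab_group_add" where
 "rho D R d gs = (if path D d gs \<and> length gs = 1 then R (hd gs) else 0)"

definition bdc :: "('k, 'd, 'g) dgcat => ('d => 'g list => 'v) => 'd => 'g list => 'v::ab_group_add" where
 "bdc D phi d gs = (if path D d gs then bd D (phi d) gs else 0)"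

definition ddc :: "('k, 'd, 'g) dgcat => ('x => 'x => int => 'v => 'v) => ('d => 'x) => ('d => 'x) => int
  => ('d => 'g list => 'v) => 'd => 'g list => 'v::ab_group_add" where
 "ddc D dif Ph Ps p phi d gs =
  (if path D d gs then dif (Ph d) (Ps (pend D d gs)) (p + wt D gs) (phi d gs) else 0)"

text \<open>The graded commutator with the twisting cochains, plus composition with the bar
  differential: the Hochschild part of the differential, without the differential of the
  target.\<close>

definition dlc :: "('k, 'd, 'g) dgcat => (int => 'v => 'v => 'v) => ('g => 'v) => ('g => 'v) => int
  => ('d => 'g list => 'v) => 'd => 'g list => 'v::ab_group_add" where
 "dlc D mul R S p phi = mulc D mul p (rho D S) phi - sgv p (mulc D mul 1 phi (rho D R)) + sgv p (bdc D phi)"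

definition difc where
 "difc D mul dif Ph Ps R S p phi = ddc D dif Ph Ps p phi + dlc D mul R S p phi"

definition ling :: "'k ring => ('k, 'd, 'g) dgcat => ('k => 'v => 'v) => 'd => ('g list => 'v::ab_group_add)
  => bool" where
 "ling K D sc d G \<longleftrightarrow> (\<forall>as bs x y u v n a b. u \<in> Obj D \<longrightarrow> v \<in> Obj D \<longrightarrow>
   x \<in> mor D u v n \<longrightarrow> y \<in> mor D u v n \<longrightarrow> a \<in> carrier K \<longrightarrow> b \<in> carrier K \<longrightarrow>
   path D d (as @ x # bs) \<longrightarrow>
   G (as @ (lc D u v n a x b y) # bs)
    = sc a (G (as @ x # bs)) + sc b (G (as @ y # bs)))"

definition linc :: "'k ring => ('k, 'd, 'g) dgcat => ('k => 'v => 'v) => ('d => 'g list => 'v::ab_group_add)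
  => bool" where
 "linc K D sc phi \<longleftrightarrow> (\<forall>d. ling K D sc d (phi d))"

definition redc :: "('k, 'd, 'g) dgcat => ('d => 'g list => 'v::ab_group_add) => bool" where
 "redc D phi \<longleftrightarrow> (\<forall>d as bs c. c \<in> Obj D \<longrightarrow> path D d (as @ Idn D c # bs) \<longrightarrow> phi d (as @ Idn D c # bs) = 0)"

context dg_category
begin

text \<open>Every list at which \<open>bd\<close> evaluates its function has the same ends and a
  total shifted degree larger by one: a differential raises a degree by one, and composing two
  letters loses one of two shifts by minus one.\<close>

lemma bd_cong:
 assumes "path C d gs"
  "\<And>xs. path C d xs ==> pend C d xs = pend C d gs ==> wt C xs = wt C gs + 1 ==> G xs = G' xs"
 shows "bd C G gs = bd C G' gs"
 using assms
proof (induction gs arbitrary: d G G')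
 case (Cons g gs)
 have g: "g \<in> arr C" "Dom C g = d" "path C (Cod C g) gs" using Cons.prems(1) by auto
 have 1: "G (Dif C g # gs) = G' (Dif C g # gs)"
  by (rule Cons.prems(2)) (use g in "auto simp: dif_arr")
 have 2: "bd C (\<lambda>xs. G (g # xs)) gs = bd C (\<lambda>xs. G' (g # xs)) gs"
  by (rule Cons.IH[OF g(3)], rule Cons.prems(2)) (use g in auto)
 have 3: "G (Comp C g' g # gs') = G' (Comp C g' g # gs')" if "gs = g' # gs'" for g' gs'
  by (rule Cons.prems(2)) (use g that in "auto simp: comp_arr")
 show ?case using 1 2 3 by (auto split: list.split)
qed simp

lemma bd_closed:
 assumes "path C d gs"
  "\<And>xs. path C d xs ==> pend C d xs = pend C d gs ==> wt C xs = wt C gs + 1 ==> G xs \<in> S"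
  "0 \<in> S" "\<And>v w. v \<in> S ==> w \<in> S ==> v + w \<in> S" "\<And>v. v \<in> S ==> - v \<in> S"
 shows "bd C G gs \<in> S"
 using assms(1,2)
proof (induction gs arbitrary: d G)
 case (Cons g gs)
 have g: "g \<in> arr C" "Dom C g = d" "path C (Cod C g) gs" using Cons.prems(1) by auto
 have s: "sgv n v \<in> S" if "v \<in> S" for v n using that assms(5) by (simp add: sgv_def)
 have 1: "G (Dif C g # gs) \<in> S"
  by (rule Cons.prems(2)) (use g in "auto simp: dif_arr")
 have 2: "bd C (\<lambda>xs. G (g # xs)) gs \<in> S"
  by (rule Cons.IH[OF g(3)], rule Cons.prems(2)) (use g in auto)
 have 3: "G (Comp C g' g # gs') \<in> S" if "gs = g' # gs'" for g' gs'
  by (rule Cons.prems(2)) (use g that in "auto simp: comp_arr")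
 show ?case
 proof (cases gs)
  case Nil
  thus ?thesis using 1 by simp
 next
  case (Cons g' gs')
  from assms(4)[OF assms(4)[OF s[OF 1] 2] s[OF 3[OF Cons]]] Cons show ?thesis by simp
 qed
qed (simp add: assms(3))

lemma bd_hom:
 assumes "path C d gs"
  "\<And>xs. path C d xs ==> pend C d xs = pend C d gs ==> wt C xs = wt C gs + 1 ==> G xs \<in> S"
  "0 \<in> S" "\<And>v w. v \<in> S ==> w \<in> S ==> v + w \<in> S" "\<And>v. v \<in> S ==> - v \<in> S"
  "\<And>v w. v \<in> S ==> w \<in> S ==> theta (v + w) = theta v + theta w"
 shows "theta (bd C G gs) = bd C (\<lambda>xs. theta (G xs)) gs"
 using assms(1,2)
proof (induction gs arbitrary: d G)
 case Nil
 have "theta 0 = 0" using assms(6)[OF assms(3,3)] by simp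
 thus ?case by simp
next
 case (Cons g gs)
 have g: "g \<in> arr C" "Dom C g = d" "path C (Cod C g) gs" using Cons.prems(1) by auto
 have s: "sgv n v \<in> S" if "v \<in> S" for v n using that assms(5) by (simp add: sgv_def)
 have z: "theta 0 = 0" using assms(6)[OF assms(3,3)] by simp
 have "theta (- v) = - theta v" if "v \<in> S" for v
  using assms(6)[OF that assms(5)[OF that]] z by (simp add: eq_neg_iff_add_eq_0 add.commute)
 hence ts: "theta (sgv n v) = sgv n (theta v)" if "v \<in> S" for v n using that by (simp add: sgv_def)
 have 1: "G (Dif C g # gs) \<in> S"
  by (rule Cons.prems(2)) (use g in "auto simp: dif_arr")
 have 2: "theta (bd C (\<lambda>xs. G (g # xs)) gs) = bd C (\<lambda>xs. theta (G (g # xs))) gs"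
  by (rule Cons.IH[OF g(3)], rule Cons.prems(2)) (use g in auto)
 have 3: "bd C (\<lambda>xs. G (g # xs)) gs \<in> S"
  by (rule bd_closed[OF g(3)], rule Cons.prems(2)) (use g assms(3-5) in auto)
 have 4: "G (Comp C g' g # gs') \<in> S" if "gs = g' # gs'" for g' gs'
  by (rule Cons.prems(2)) (use g that in "auto simp: comp_arr")
 show ?case
 proof (cases gs)
  case Nil
  thus ?thesis using assms(6)[OF s[OF 1] 3] ts[OF 1] 2 by simp
 next
  case (Cons g' gs')
  from assms(6)[OF assms(4)[OF s[OF 1] 3] s[OF 4[OF Cons]]] assms(6)[OF s[OF 1] 3]
   ts[OF 1] ts[OF 4[OF Cons]] 2 Cons
  show ?thesis by simp
 qed
qed

end

section \<open>The graded category of cochains\<close>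

locale coch_base = D: dg_category K D + T: vgc K Ob H sc mul idn
 for K :: "'k ring" and D :: "('k, 'd, 'g) dgcat" and Ob :: "'x set"
  and H :: "'x => 'x => int => 'v::ab_group_add set" and sc mul idn
begin

abbreviation "hc \<equiv> cochs D H"
abbreviation "mc \<equiv> mulc D mul"

lemma cochsI:
 assumes "\<And>d gs. path D d gs ==> phi d gs \<in> H (Ph d) (Ps (pend D d gs)) (p + wt D gs)"
  "\<And>d gs. \<not> path D d gs ==> phi d gs = 0"
 shows "phi \<in> hc Ph Ps p"
 using assms by (auto simp: cochs_def)

lemma cochsD:
 "phi \<in> hc Ph Ps p ==> path D d gs ==> phi d gs \<in> H (Ph d) (Ps (pend D d gs)) (p + wt D gs)"
 unfolding cochs_def by (metis (mono_tags, lifting) mem_Collect_eq)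

lemma cochs_ext: "phi \<in> hc Ph Ps p ==> \<not> path D d gs ==> phi d gs = 0"
 unfolding cochs_def by (metis (mono_tags, lifting) mem_Collect_eq)

lemma mulc_path: "path D d gs ==> mc p psi phi d gs
  = cut (\<lambda>as bs. sgv (p * wt D bs) (mul (p + wt D as) (psi (pend D d as) bs) (phi d as))) gs"
 by (simp add: mulc_def)

lemma mul_typed:
 assumes "phi \<in> hc Ph Ps p" "psi \<in> hc Ps Xi q" "path D d (as @ bs)"
 shows "mul (p + wt D as) (psi (pend D d as) bs) (phi d as)
  \<in> H (Ph d) (Xi (pend D d (as @ bs))) (p + q + wt D (as @ bs))"
proof -
 have "mul (p + wt D as) (psi (pend D d as) bs) (phi d as)
   \<in> H (Ph d) (Xi (pend D (pend D d as) bs)) (p + wt D as + (q + wt D bs))"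
  by (rule T.mul_H[OF cochsD[OF assms(1)] cochsD[OF assms(2)]]) (use assms(3) in auto)
 moreover have "p + wt D as + (q + wt D bs) = p + q + wt D (as @ bs)" by simp
 ultimately show ?thesis by (simp del: wt_simps)
qed

lemma mulc_typed:
 assumes "phi \<in> hc Ph Ps p" "psi \<in> hc Ps Xi q"
 shows "mc p psi phi \<in> hc Ph Xi (p + q)"
proof (rule cochsI, goal_cases)
 case p: (1 d gs)
 show ?case
  unfolding mulc_path[OF p]
  by (rule T.H_cut, rule T.H_sgv) (use mul_typed[OF assms] p in auto)
qed (simp add: mulc_def)

lemma bdc_typed:
 assumes "phi \<in> hc Ph Ps p"
 shows "bdc D phi \<in> hc Ph Ps (p + 1)"
proof (rule cochsI, goal_cases)
 case p: (1 d gs)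
 have "bd D (phi d) gs \<in> H (Ph d) (Ps (pend D d gs)) (p + 1 + wt D gs)"
 proof (rule D.bd_closed[OF p], goal_cases)
  case (1 xs)
  thus ?case
   using cochsD[OF assms, of d xs] by (simp add: algebra_simps)
 qed (auto intro: T.H_add T.H_neg)
 thus ?case
  by (simp add: bdc_def p)
qed (simp add: bdc_def)

lemma rho_typed:
 assumes "\<And>g. g \<in> arr D ==> R g \<in> H (Ph (Dom D g)) (Ph (Cod D g)) (Deg D g + n)"
 shows "rho D R \<in> hc Ph Ph (n + 1)"
proof (rule cochsI, goal_cases)
 case p: (1 d gs)
 show ?case
 proof (cases "length gs = 1")
  case True
  then obtain g where "gs = [g]" by (cases gs) auto
  thus ?thesis using p assms[of g] by (simp add: rho_def add.commute)
 qed (simp add: rho_def)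
qed (simp add: rho_def)

text \<open>Associativity compares sums over cuts into three pieces by \<open>cut_coassoc\<close>.
  The unit is supported on empty paths, so a single cut survives in a product with it.\<close>

lemma coch_vgc:
 assumes "\<And>x d. x \<in> Ob' ==> d \<in> Obj D ==> Ph x d \<in> Ob"
 shows "vgc K Ob' (\<lambda>x y p. hc (Ph x) (Ph y) p) (scc sc) mc (\<lambda>x. idc D idn (Ph x))"
proof (intro vgc.intro vgc_axioms.intro D.field_axioms, goal_cases)
 case (1 x y n) show ?case by (auto intro: cochsI)
next
 case *: (2 v x y n w)
 thus ?case
  by (auto intro!: cochsI T.H_add[OF cochsD[OF *(1)] cochsD[OF *(2)]] simp: cochs_ext[OF *(1)] cochs_ext[OF *(2)])
next
 case *: (3 a v x y n)
 thus ?case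
  by (auto intro!: cochsI T.sc_closed[OF *(1) cochsD[OF *(2)]] simp: scc_def T.sc_zero cochs_ext[OF *(2)])
next
 case *: (4 a v x y n w)
 show ?case
 proof (intro ext, goal_cases)
  case (1 d gs) show ?case
   using * cochsD[OF *(2), of d gs] cochsD[OF *(3), of d gs]
   by (cases "path D d gs") (auto simp: scc_def T.sc_add cochs_ext[OF *(2)] cochs_ext[OF *(3)] T.sc_zero)
 qed
next
 fix a b v x y n assume *: "a \<in> carrier K" "b \<in> carrier K" "v \<in> hc (Ph x) (Ph y) n"
 show "scc sc (a \<oplus>\<^bsub>K\<^esub> b) v = scc sc a v + scc sc b v"
 proof (intro ext, goal_cases)
  case (1 d gs) show ?case
   using * cochsD[OF *(3), of d gs]
   by (cases "path D d gs") (auto simp: scc_def T.sc_plus cochs_ext[OF *(3)] T.sc_zero)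
 qed
 show "scc sc a (scc sc b v) = scc sc (a \<otimes>\<^bsub>K\<^esub> b) v"
 proof (intro ext, goal_cases)
  case (1 d gs) show ?case
   using * cochsD[OF *(3), of d gs]
   by (cases "path D d gs") (auto simp: scc_def T.sc_sc cochs_ext[OF *(3)] T.sc_zero)
 qed
next
 case *: (7 v x y n)
 show ?case
 proof (intro ext, goal_cases)
  case (1 d gs) show ?case
   using cochsD[OF *, of d gs]
   by (cases "path D d gs") (auto simp: scc_def T.sc_one cochs_ext[OF *] T.sc_zero)
 qed
next
 case (8 x)
 thus ?case
  using assms by (auto intro!: cochsI T.idn_H simp: idc_def)
next
 case (9 f x y m g z n)
 thus ?case by (rule mulc_typed)
next
 case *: (10 f x y m g z n g')
 show ?case
 proof (intro ext, goal_cases)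
  case (1 d gs) show ?case
   unfolding mulc_def plus_fun_def
   by (auto simp: cut_add[symmetric] sgv_add[symmetric] intro!: cut_cong arg_cong[where f = "sgv _"]
     T.mul_addl cochsD[OF *(1)] cochsD[OF *(2)] cochsD[OF *(3)])
 qed
next
 fix f x y m g z n f'
 assume *: "f \<in> hc (Ph x) (Ph y) m" "f' \<in> hc (Ph x) (Ph y) m"
  "g \<in> hc (Ph y) (Ph z) n"
 show "mc m g (f + f') = mc m g f + mc m g f'"
 proof (intro ext, goal_cases)
  case (1 d gs) show ?case
   unfolding mulc_def plus_fun_def
   by (auto simp: cut_add[symmetric] sgv_add[symmetric] intro!: cut_cong arg_cong[where f = "sgv _"]
     T.mul_addr cochsD[OF *(1)] cochsD[OF *(2)] cochsD[OF *(3)])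
 qed
next
 fix a f x y m g z n
 assume *: "a \<in> carrier K" "f \<in> hc (Ph x) (Ph y) m" "g \<in> hc (Ph y) (Ph z) n"
 have e: "sc a (mc m g f d gs) = cut (\<lambda>as bs. sgv (m * wt D bs) (sc a (mul (m + wt D as) (g (pend D d as) bs) (f d as)))) gs"
  if p: "path D d gs" for d gs
 proof -
  have t: "mul (m + wt D as) (g (pend D d as) bs) (f d as) \<in> H (Ph x d) (Ph z (pend D d gs)) (m + n + wt D gs)"
   if "as @ bs = gs" for as bs
   using mul_typed[OF *(2,3), of d as bs] p that by auto
  show ?thesis
   unfolding mulc_path[OF p]
   by (subst T.sc_cut[OF *(1)], rule T.H_sgv, erule t) (auto intro!: cut_cong T.sc_sgv[OF *(1) t])
 qed
 show "mc m (scc sc a g) f = scc sc a (mc m g f)"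
 proof (intro ext, goal_cases)
  case (1 d gs) show ?case
  proof (cases "path D d gs")
   case True
   show ?thesis
    unfolding scc_def[of sc a "mc m g f"] e[OF True] unfolding mulc_path[OF True] scc_def
    by (rule cut_cong, rule arg_cong[where f = "sgv _"], rule T.mul_scl[OF *(1) cochsD[OF *(2)] cochsD[OF *(3)]])
     (use True in auto)
  qed (simp add: scc_def mulc_def T.sc_zero *(1))
 qed
 show "mc m g (scc sc a f) = scc sc a (mc m g f)"
 proof (intro ext, goal_cases)
  case (1 d gs) show ?case
  proof (cases "path D d gs")
   case True
   show ?thesis
    unfolding scc_def[of sc a "mc m g f"] e[OF True] unfolding mulc_path[OF True] scc_def
    by (rule cut_cong, rule arg_cong[where f = "sgv _"], rule T.mul_scr[OF *(1) cochsD[OF *(2)] cochsD[OF *(3)]])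
     (use True in auto)
  qed (simp add: scc_def mulc_def T.sc_zero *(1))
 qed
next
 case *: (14 f x y m g z n h w k)
 show ?case
 proof (intro ext, goal_cases)
  case (1 d gs)
  show ?case
  proof (cases "path D d gs")
   case p: True
   have "mc m (mc n h g) f d gs
    = cut (\<lambda>as bs. cut (\<lambda>b1 b2. sgv (m * wt D bs + n * wt D b2)
      (mul (m + wt D as) (mul (n + wt D b1) (h (pend D (pend D d as) b1) b2) (g (pend D d as) b1)) (f d as))) bs) gs"
    unfolding mulc_path[OF p]
   proof (rule cut_cong, goal_cases)
    case s: (1 as bs)
    have pa: "path D d as" "path D (pend D d as) bs" using p s by auto
    have t: "mul (n + wt D b1) (h (pend D (pend D d as) b1) b2) (g (pend D d as) b1)
      \<in> H (Ph y (pend D d as)) (Ph w (pend D d gs)) (n + k + wt D bs)"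
     if "b1 @ b2 = bs" for b1 b2
     using mul_typed[OF *(2,3), of "pend D d as" b1 b2] pa that s by auto
    show ?case
     unfolding mulc_path[OF pa(2)]
     by (subst T.mul_cutl[OF cochsD[OF *(1) pa(1)]], rule T.H_sgv, erule t, unfold cut_sgv[symmetric],
       rule cut_cong) (simp add: T.mul_sgvl[OF cochsD[OF *(1) pa(1)] t])
   qed
   also have "\<dots> = cut (\<lambda>as bs. cut (\<lambda>b1 b2. sgv ((m + n) * wt D b2 + m * wt D b1)
      (mul (m + n + wt D (as @ b1)) (h (pend D (pend D d as) b1) b2)
       (mul (m + wt D as) (g (pend D d as) b1) (f d as)))) bs) gs"
   proof (intro cut_cong, goal_cases)
    case s: (1 as bs b1 b2)
    have pa: "path D d as" "path D (pend D d as) b1" "path D (pend D (pend D d as) b1) b2"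
     using p s by auto
    have "mul (m + wt D as) (mul (n + wt D b1) (h (pend D (pend D d as) b1) b2) (g (pend D d as) b1)) (f d as)
     = mul (m + wt D as + (n + wt D b1)) (h (pend D (pend D d as) b1) b2)
       (mul (m + wt D as) (g (pend D d as) b1) (f d as))"
     by (rule T.mul_assoc[OF cochsD[OF *(1)] cochsD[OF *(2)] cochsD[OF *(3)]]) (use pa in auto)
    moreover have "m + wt D as + (n + wt D b1) = m + n + wt D (as @ b1)" by simp
    \<comment> \<open>The sign of the outer cut is distributed over the two pieces \<open>b1\<close>
      and \<open>b2\<close> of \<open>bs\<close>.\<close>
    moreover have "m * wt D bs + n * wt D b2 = (m + n) * wt D b2 + m * wt D b1"
     unfolding s(2)[symmetric] by (simp add: algebra_simps)
    ultimately show ?case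
     by (simp only:)
   qed
   also have "\<dots> = cut (\<lambda>as bs. cut (\<lambda>a1 a2. sgv ((m + n) * wt D bs + m * wt D a2)
      (mul (m + n + wt D (a1 @ a2)) (h (pend D (pend D d a1) a2) bs)
       (mul (m + wt D a1) (g (pend D d a1) a2) (f d a1)))) as) gs"
    by (rule cut_coassoc[symmetric])
   also have "\<dots> = mc (m + n) h (mc m g f) d gs"
    unfolding mulc_path[OF p]
   proof (rule cut_cong, goal_cases)
    case s: (1 as bs)
    have pa: "path D d as" "path D (pend D d as) bs" using p s by auto
    have t: "mul (m + wt D b1) (g (pend D d b1) b2) (f d b1)
      \<in> H (Ph x d) (Ph z (pend D d as)) (m + n + wt D as)"
     if "b1 @ b2 = as" for b1 b2
     using mul_typed[OF *(1,2), of d b1 b2] pa that s by auto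
    show ?case
     unfolding mulc_path[OF pa(1)]
     by (subst T.mul_cutr[OF cochsD[OF *(3) pa(2)]], rule T.H_sgv, erule t, unfold cut_sgv[symmetric],
       rule cut_cong) (auto simp: T.mul_sgvr[OF t cochsD[OF *(3) pa(2)]] simp del: wt_simps)
   qed
   finally show ?thesis .
  qed (simp add: mulc_def)
 qed
next
 fix f x y n assume *: "f \<in> hc (Ph x) (Ph y) n"
 have z: "mul 0 v 0 = 0" if "v \<in> H x' y' n'" for v x' y' n'
  using T.mul_zeror[OF that, of 0] .
 show "mc n (idc D idn (Ph y)) f = f"
 proof (intro ext, goal_cases)
  case (1 d gs) show ?case
  proof (cases "path D d gs")
   case p: True
   show ?thesis unfolding mulc_path[OF p]
    by (subst cut_fst)
     (use p T.mul_zerol[OF cochsD[OF *]] T.mul_idl[OF cochsD[OF * p]] in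
      \<open>auto simp: idc_def dest: D.path_end\<close>)
  qed (simp add: mulc_def cochs_ext[OF *])
 qed
 show "mc 0 f (idc D idn (Ph x)) = f"
 proof (intro ext, goal_cases)
  case (1 d gs) show ?case
  proof (cases "path D d gs")
   case p: True
   show ?thesis unfolding mulc_path[OF p]
    by (subst cut_snd)
     (use p T.mul_zeror[OF cochsD[OF *]] T.mul_idr[OF cochsD[OF * p]] in
      \<open>auto simp: idc_def dest: D.path_obj\<close>)
  qed (simp add: mulc_def cochs_ext[OF *])
 qed
qed

text \<open>The dual of \<open>bd_cut\<close>: composition with the bar differential is a derivation
  of the cup product. The factor \<open>sgv p\<close> appears because a change in the right piece
  raises its shifted degree by one, and this degree is multiplied by \<open>p\<close> in the sign of
  the product.\<close>

lemma bdc_mulc: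
 assumes "phi \<in> hc Ph Ps p" "psi \<in> hc Ps Xi q"
 shows "bdc D (mc p psi phi)
  = sgv p (mc p (bdc D psi) phi) + mc (p + 1) psi (bdc D phi)"
proof (intro ext, goal_cases)
 case (1 d gs)
 show ?case
 proof (cases "path D d gs")
  case p: True
  let ?F = "\<lambda>as bs. sgv (p * wt D bs) (mul (p + wt D as) (psi (pend D d as) bs) (phi d as))"
  have "bdc D (mc p psi phi) d gs = bd D (cut ?F) gs"
   unfolding bdc_def using p by (auto intro!: D.bd_cong[OF p] simp: mulc_path)
  also have "\<dots> = cut (\<lambda>as bs. sgv (wt D bs) (bd D (\<lambda>xs. ?F xs bs) as) + bd D (\<lambda>xs. ?F as xs) bs) gs"
   by (rule bd_cut)
  also have "\<dots> = cut (\<lambda>as bs. sgv ((p + 1) * wt D bs)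
     (mul (p + 1 + wt D as) (psi (pend D d as) bs) (bdc D phi d as))
    + sgv p (sgv (p * wt D bs) (mul (p + wt D as) (bdc D psi (pend D d as) bs) (phi d as)))) gs"
  proof (rule cut_cong, goal_cases)
   case s: (1 as bs)
   have pa: "path D d as" "path D (pend D d as) bs" using p s by auto
   let ?m = "pend D d as"
   note psi = cochsD[OF assms(2) pa(2)] and phi = cochsD[OF assms(1) pa(1)]
   have "bd D (\<lambda>xs. ?F xs bs) as
     = bd D (\<lambda>xs. sgv (p * wt D bs) (mul (p + 1 + wt D as) (psi ?m bs) (phi d xs))) as"
    by (rule D.bd_cong[OF pa(1)]) (simp add: algebra_simps)
   also have "\<dots> = sgv (p * wt D bs) (mul (p + 1 + wt D as) (psi ?m bs) (bd D (phi d) as))"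
   proof -
    have "mul (p + 1 + wt D as) (psi ?m bs) (bd D (phi d) as)
      = bd D (\<lambda>xs. mul (p + 1 + wt D as) (psi ?m bs) (phi d xs)) as"
    proof (rule D.bd_hom[OF pa(1), where theta = "mul (p + 1 + wt D as) (psi ?m bs)"
      and S = "H (Ph d) (Ps ?m) (p + 1 + wt D as)"], goal_cases)
    case (1 xs)
    thus ?case
     using cochsD[OF assms(1), of d xs] by (simp add: algebra_simps)
    qed (auto intro: T.H_add T.H_neg T.mul_addr[OF _ _ psi])
    thus ?thesis by (simp only: bd_sgv)
   qed
   finally have 1: "bd D (\<lambda>xs. ?F xs bs) as
     = sgv (p * wt D bs) (mul (p + 1 + wt D as) (psi ?m bs) (bdc D phi d as))"
    by (simp add: bdc_def pa)
   have "bd D (\<lambda>xs. ?F as xs) bs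
     = bd D (\<lambda>xs. sgv (p * (wt D bs + 1)) (mul (p + wt D as) (psi ?m xs) (phi d as))) bs"
    by (rule D.bd_cong[OF pa(2)]) simp
   also have "\<dots> = sgv (p * (wt D bs + 1)) (mul (p + wt D as) (bd D (psi ?m) bs) (phi d as))"
   proof -
    have "mul (p + wt D as) (bd D (psi ?m) bs) (phi d as)
      = bd D (\<lambda>xs. mul (p + wt D as) (psi ?m xs) (phi d as)) bs"
    proof (rule D.bd_hom[OF pa(2), where theta = "\<lambda>g. mul (p + wt D as) g (phi d as)"
      and S = "H (Ps ?m) (Xi (pend D ?m bs)) (q + 1 + wt D bs)"], goal_cases)
    case (1 xs)
    thus ?case
     using cochsD[OF assms(2), of ?m xs] by (simp add: algebra_simps)
    qed (auto intro: T.H_add T.H_neg T.mul_addl[OF phi])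
    thus ?thesis by (simp only: bd_sgv)
   qed
   finally have 2: "bd D (\<lambda>xs. ?F as xs) bs
     = sgv (p * (wt D bs + 1)) (mul (p + wt D as) (bdc D psi ?m bs) (phi d as))"
    by (simp add: bdc_def pa)
   show ?case
    unfolding 1 2 by (simp add: algebra_simps)
  qed
  also have "\<dots> = (sgv p (mc p (bdc D psi) phi) + mc (p + 1) psi (bdc D phi)) d gs"
   by (simp add: cut_add cut_sgv sgv_fun mulc_path[OF p] del: sgv_sgv)
  finally show ?thesis .
 qed (simp add: mulc_def bdc_def sgv_fun)
qed

section \<open>Multilinear and normalized cochains\<close>

lemma mor_par:
 assumes "u \<in> Obj D" "v \<in> Obj D" "x \<in> mor D u v n" "y \<in> mor D u v n"
 shows "path D d (as @ x # bs) \<longleftrightarrow> path D d (as @ y # bs)"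
  "pend D d (as @ x # bs) = pend D d (as @ y # bs)" "wt D (as @ x # bs) = wt D (as @ y # bs)"
 using D.mor_DCD[OF assms(1-3)] D.mor_DCD[OF assms(1,2,4)] D.arrI[OF assms(1-3)] D.arrI[OF assms(1,2,4)]
 by auto

context
 fixes d G A Ps p
 assumes lin: "ling K D sc d G"
  and typed: "\<And>xs. path D d xs ==> G xs \<in> H A (Ps (pend D d xs)) (p + wt D xs)"
begin

lemma ling_add:
 assumes "u \<in> Obj D" "v \<in> Obj D"
  "x \<in> mor D u v n" "y \<in> mor D u v n" "path D d (as @ x # bs)"
 shows "G (as @ (madd D u v n x y) # bs) = G (as @ x # bs) + G (as @ y # bs)"
proof -
 interpret M: module K "Mor D u v n" using assms by simp
 have "path D d (as @ y # bs)" using assms(5) mor_par(1)[OF assms(1-4)] by blast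
 hence "sc \<one>\<^bsub>K\<^esub> (G (as @ x # bs)) = G (as @ x # bs)" "sc \<one>\<^bsub>K\<^esub> (G (as @ y # bs)) = G (as @ y # bs)"
  using T.sc_one[OF typed] assms(5) by auto
 thus ?thesis
  using lin[unfolded ling_def, rule_format, OF assms(1-4) D.one_closed D.one_closed assms(5)] assms(3,4)
  by simp
qed

lemma ling_scale:
 assumes "u \<in> Obj D" "v \<in> Obj D"
  "x \<in> mor D u v n" "a \<in> carrier K" "path D d (as @ x # bs)"
 shows "G (as @ (mscale D u v n a x) # bs) = sc a (G (as @ x # bs))"
proof -
 interpret M: module K "Mor D u v n" using assms by simp
 show ?thesis
  \<comment> \<open>Linearity is instantiated with \<open>x\<close> twice, the second time with
    coefficient zero.\<close>
  using lin[unfolded ling_def, rule_format, OF assms(1-3,3,4) D.zero_closed assms(5)] assms(3,4)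
   T.sc_null[OF typed[OF assms(5)]]
  by (simp add: M.smult_l_null)
qed

lemma ling_sg:
 assumes "u \<in> Obj D" "v \<in> Obj D" "x \<in> mor D u v n" "path D d (as @ x # bs)"
 shows "G (as @ (sg K m \<odot>\<^bsub>Mor D u v n\<^esub> x) # bs) = sgv m (G (as @ x # bs))"
 using ling_scale[OF assms(1-3) _ assms(4), of "sg K m"] T.sc_sg[OF typed[OF assms(4)]]
 by (simp add: sg_def)

lemma ling_zero:
 assumes "u \<in> Obj D" "v \<in> Obj D" "path D d as" "pend D d as = u" "path D v bs"
 shows "G (as @ \<zero>\<^bsub>Mor D u v n\<^esub> # bs) = 0"
proof -
 interpret M: module K "Mor D u v n" using assms by simp
 have "path D d (as @ \<zero>\<^bsub>Mor D u v n\<^esub> # bs)"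
  using assms D.mor_DCD[OF assms(1,2) M.zero_closed] D.arrI[OF assms(1,2) M.zero_closed] by auto
 from ling_add[OF assms(1,2) M.zero_closed M.zero_closed this] show ?thesis by simp
qed

end

lemma ling_shift:
 assumes "ling K D sc d G" "g \<in> arr D" "Dom D g = d"
 shows "ling K D sc (Cod D g) (\<lambda>xs. G (g # xs))"
 unfolding ling_def
proof (intro allI impI, goal_cases)
 case *: (1 as bs x y u v n a b)
 show ?case
  using assms(1)[unfolded ling_def, rule_format, OF *(1-6), of "g # as" bs] * assms(2,3) by simp
qed

text \<open>\<open>lp A B n a b x y z f\<close> says that \<open>f\<close> is linear at \<open>z = a x + b y\<close>.\<close>

definition lp :: "'x => 'x => int => 'k => 'k => 'w => 'w => 'w => ('w => 'v) => bool" where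
 "lp A B n a b x y z f \<longleftrightarrow> a \<in> carrier K \<and> b \<in> carrier K \<and> f x \<in> H A B n \<and> f y \<in> H A B n
   \<and> f z = sc a (f x) + sc b (f y)"

lemma lp_cong: "lp A B n a b x y z f ==> f x = g x ==> f y = g y ==> f z = g z ==> lp A B n a b x y z g"
 by (simp add: lp_def)

lemma lp_zero: "a \<in> carrier K ==> b \<in> carrier K ==> lp A B n a b x y z (\<lambda>w. 0)"
 by (simp add: lp_def T.sc_zero)

lemma lp_add: "lp A B n a b x y z f ==> lp A B n a b x y z g ==> lp A B n a b x y z (\<lambda>w. f w + g w)"
 unfolding lp_def by (auto simp: T.sc_add[of _ _ A B n] algebra_simps intro: T.H_add)

lemma lp_neg: "lp A B n a b x y z f ==> lp A B n a b x y z (\<lambda>w. - f w)"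
 unfolding lp_def by (auto simp: T.sc_neg[of _ _ A B n] algebra_simps intro: T.H_neg)

lemma lp_sgv: "lp A B n a b x y z f ==> lp A B n a b x y z (\<lambda>w. sgv m (f w))"
 using lp_neg by (cases "even m") (auto simp: sgv_def)

lemma lp_mull:
 assumes "lp A B n a b x y z f" "g \<in> H C A m"
 shows "lp C B (m + n) a b x y z (\<lambda>w. mul m (f w) g)"
proof -
 have *: "a \<in> carrier K" "b \<in> carrier K" "f x \<in> H A B n" "f y \<in> H A B n" "f z = sc a (f x) + sc b (f y)"
  using assms(1) unfolding lp_def by auto
 show ?thesis
  unfolding lp_def using * assms(2) T.mul_H[OF assms(2)]
  by (simp add: T.mul_addl[OF assms(2) T.sc_closed[OF *(1,3)] T.sc_closed[OF *(2,4)]]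
    T.mul_scl[OF *(1) assms(2) *(3)] T.mul_scl[OF *(2) assms(2) *(4)])
qed

lemma lp_mulr:
 assumes "lp A B n a b x y z f" "g \<in> H B C m"
 shows "lp A C (n + m) a b x y z (\<lambda>w. mul n g (f w))"
proof -
 have *: "a \<in> carrier K" "b \<in> carrier K" "f x \<in> H A B n" "f y \<in> H A B n" "f z = sc a (f x) + sc b (f y)"
  using assms(1) unfolding lp_def by auto
 show ?thesis
  unfolding lp_def using * assms(2) T.mul_H[OF _ assms(2)]
  by (simp add: T.mul_addr[OF T.sc_closed[OF *(1,3)] T.sc_closed[OF *(2,4)] assms(2)]
    T.mul_scr[OF *(1) *(3) assms(2)] T.mul_scr[OF *(2) *(4) assms(2)])
qed

lemma lp_cut:
 assumes "\<And>as bs. as @ bs = gs ==> lp A B n a b x y z (\<lambda>w. F w as bs)"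
 shows "lp A B n a b x y z (\<lambda>w. cut (F w) gs)"
 using assms
proof (induction gs arbitrary: F)
 case (Cons g gs)
 have "lp A B n a b x y z (\<lambda>w. F w [] (g # gs))" by (rule Cons.prems) simp
 moreover have "lp A B n a b x y z (\<lambda>w. cut (\<lambda>as. F w (g # as)) gs)"
  by (rule Cons.IH, rule Cons.prems) simp
 ultimately show ?case using lp_add by simp
qed simp

lemma lp_bd:
 assumes "path D d gs" "a \<in> carrier K" "b \<in> carrier K"
  "\<And>xs. path D d xs ==> pend D d xs = pend D d gs ==> wt D xs = wt D gs + 1 ==>
   lp A B n a b x y z (\<lambda>w. F w xs)"
 shows "lp A B n a b x y z (\<lambda>w. bd D (F w) gs)"
 using assms(1,4)
proof (induction gs arbitrary: d F)
 case Nil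
 thus ?case using assms(2,3) by (simp add: lp_zero)
next
 case (Cons g gs)
 have g: "g \<in> arr D" "Dom D g = d" "path D (Cod D g) gs" using Cons.prems(1) by auto
 have 1: "lp A B n a b x y z (\<lambda>w. sgv (wt D gs) (F w (Dif D g # gs)))"
  by (rule lp_sgv, rule Cons.prems(2)) (use g in "auto simp: D.dif_arr")
 have 2: "lp A B n a b x y z (\<lambda>w. bd D (\<lambda>xs. F w (g # xs)) gs)"
  by (rule Cons.IH[OF g(3)], rule Cons.prems(2)) (use g in auto)
 show ?case
 proof (cases gs)
  case Nil
  thus ?thesis using 1 2 lp_add by simp
 next
  case (Cons g' gs')
  have 3: "lp A B n a b x y z (\<lambda>w. sgv (wt D gs) (F w (Comp D g' g # gs')))"
   by (rule lp_sgv, rule Cons.prems(2)) (use g Cons in "auto simp: D.comp_arr")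
  from lp_add[OF lp_add[OF 1 2] 3] show ?thesis by (simp only: Cons bd.simps list.case)
 qed
qed

lemma lp_arg:
 assumes "ling K D sc d G" "\<And>xs. path D d xs ==> G xs \<in> H A (Ps (pend D d xs)) (p + wt D xs)"
  "u \<in> Obj D" "v \<in> Obj D" "x \<in> mor D u v n" "y \<in> mor D u v n"
  "a \<in> carrier K" "b \<in> carrier K" "path D d (as @ x # bs)"
  "z = lc D u v n a x b y"
  "B = Ps (pend D d (as @ x # bs))" "m = p + wt D (as @ x # bs)"
 shows "lp A B m a b x y z (\<lambda>w. G (as @ w # bs))"
 using assms(1)[unfolded ling_def, rule_format, OF assms(3-9)] assms(2)[OF assms(9)]
  assms(2)[of "as @ y # bs"] mor_par(1,2)[OF assms(3-6), of d as bs] mor_par(3)[OF assms(3-6), of as bs] assms(7-12)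
 unfolding lp_def by simp

end

text \<open>A family of graded functors from \<open>D\<close>, indexed by \<open>Ob'\<close>. The
  target carries no differential here; compatibility with differentials is a hypothesis of
  \<open>df_df\<close>.\<close>

locale coch = coch_base K D Ob H sc mul idn
 for K :: "'k ring" and D :: "('k, 'd, 'g) dgcat" and Ob :: "'x set"
  and H :: "'x => 'x => int => 'v::ab_group_add set" and sc mul idn +
 fixes Ob' :: "'y set" and Ph :: "'y => 'd => 'x" and R :: "'y => 'g => 'v"
 assumes Phi_Ob: "y \<in> Ob' ==> d \<in> Obj D ==> Ph y d \<in> Ob"
  and R_H: "y \<in> Ob' ==> g \<in> arr D ==> R y g \<in> H (Ph y (Dom D g)) (Ph y (Cod D g)) (Deg D g)"
  and R_lin: "[| y \<in> Ob'; u \<in> Obj D; v \<in> Obj D; g \<in> mor D u v n; g' \<in> mor D u v n;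
    a \<in> carrier K; b \<in> carrier K|] ==>
   R y (lc D u v n a g b g') = sc a (R y g) + sc b (R y g')"
  and R_comp: "[| y \<in> Ob'; g \<in> arr D; g' \<in> arr D; Cod D g = Dom D g'|] ==>
   R y (Comp D g' g) = mul (Deg D g) (R y g') (R y g)"
  and R_id: "y \<in> Ob' ==> d \<in> Obj D ==> R y (Idn D d) = idn (Ph y d)"
begin

abbreviation "Hc x y p \<equiv> cochs D H (Ph x) (Ph y) p"
abbreviation "rh y \<equiv> rho D (R y)"
abbreviation "dl x y p phi \<equiv> dlc D mul (R x) (R y) p phi"

sublocale CC: vgc K Ob' Hc "scc sc" mc "\<lambda>x. idc D idn (Ph x)"
 by (rule coch_vgc) (rule Phi_Ob)

lemma rho_H: "y \<in> Ob' ==> rh y \<in> Hc y y 1"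
 using rho_typed[of "R y" "Ph y" 0] R_H by simp

lemma Hc_cast: "phi \<in> Hc x y p ==> p = q ==> phi \<in> Hc x y q" by simp

lemma dl_H:
 assumes "x \<in> Ob'" "y \<in> Ob'" "phi \<in> Hc x y p"
 shows "dl x y p phi \<in> Hc x y (p + 1)"
 unfolding dlc_def
 by (intro CC.H_add CC.H_diff CC.H_sgv CC.mul_H[OF assms(3) rho_H[OF assms(2)]]
   Hc_cast[OF CC.mul_H[OF rho_H[OF assms(1)] assms(3)]] bdc_typed[OF assms(3)]) simp

lemma bdc_add: "bdc D (phi + psi) = bdc D phi + bdc D psi"
 by (intro ext) (simp add: bdc_def bd_add plus_fun_def)

lemma bdc_minus: "bdc D (- phi) = - bdc D phi"
 by (intro ext) (simp add: bdc_def bd_minus fun_Compl_def)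

lemma bdc_sgv: "bdc D (sgv m phi) = sgv m (bdc D phi)"
 by (simp add: sgv_def bdc_minus)

lemma bdc_diff: "bdc D (phi - psi) = bdc D phi - bdc D psi"
 using bdc_add[of phi "- psi"] bdc_minus[of psi] by simp

lemma bdc_sc:
 assumes "a \<in> carrier K" "phi \<in> Hc x y p"
 shows "bdc D (scc sc a phi) = scc sc a (bdc D phi)"
proof (intro ext, goal_cases)
 case (1 d gs) show ?case
 proof (cases "path D d gs")
  case p: True
  have "sc a (bd D (phi d) gs) = bd D (\<lambda>xs. sc a (phi d xs)) gs"
  proof (rule D.bd_hom[OF p, where theta = "sc a" and S = "H (Ph x d) (Ph y (pend D d gs)) (p + 1 + wt D gs)"], goal_cases)
   case (1 xs)
   thus ?case
    using cochsD[OF assms(2), of d xs] by (simp add: algebra_simps)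
  qed (auto intro: T.H_add T.H_neg T.sc_add[OF assms(1)])
  thus ?thesis using p by (simp add: bdc_def scc_def[abs_def])
 qed (simp add: bdc_def scc_def T.sc_zero assms)
qed

lemma dl_add:
 assumes "x \<in> Ob'" "y \<in> Ob'" "phi \<in> Hc x y p" "psi \<in> Hc x y p"
 shows "dl x y p (phi + psi) = dl x y p phi + dl x y p psi"
 unfolding dlc_def
 by (simp add: CC.mul_addr[OF assms(3,4) rho_H[OF assms(2)]] CC.mul_addl[OF rho_H[OF assms(1)] assms(3,4)]
   bdc_add sgv_add algebra_simps)

lemma dl_sc:
 assumes "x \<in> Ob'" "y \<in> Ob'" "phi \<in> Hc x y p" "a \<in> carrier K"
 shows "dl x y p (scc sc a phi) = scc sc a (dl x y p phi)"
proof -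
 note r = rho_H[OF assms(2)] rho_H[OF assms(1)]
 note t1 = CC.mul_H[OF assms(3) r(1)] and t2 = Hc_cast[OF CC.mul_H[OF r(2) assms(3)] add.commute]
  and t3 = bdc_typed[OF assms(3)]
 have "scc sc a (dl x y p phi) = scc sc a (mc p (rh y) phi)
   - sgv p (scc sc a (mc 1 phi (rh x))) + sgv p (scc sc a (bdc D phi))"
  unfolding dlc_def
  by (simp add: CC.sc_add[OF assms(4) CC.H_diff[OF t1 CC.H_sgv[OF t2]] CC.H_sgv[OF t3]]
    CC.sc_diff[OF assms(4) t1 CC.H_sgv[OF t2]] CC.sc_sgv[OF assms(4) t3] CC.sc_sgv[OF assms(4) t2])
 thus ?thesis
  unfolding dlc_def
  by (simp add: CC.mul_scr[OF assms(4,3) r(1)] CC.mul_scl[OF assms(4) r(2) assms(3)] bdc_sc[OF assms(4,3)])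
qed

text \<open>The derivation property of the part of the differential that does not involve the
 differential of the target.\<close>

lemma dl_mulc:
 assumes o: "x \<in> Ob'" "y \<in> Ob'" "z \<in> Ob'" and phi: "phi \<in> Hc x y p" and psi: "psi \<in> Hc y z q"
 shows "dl x z (p + q) (mc p psi phi) = mc p (dl y z q psi) phi + sgv q (mc (p + 1) psi (dl x y p phi))"
proof -
 note r = rho_H[OF o(1)] rho_H[OF o(2)] rho_H[OF o(3)]
 note a1 = CC.mul_assoc[OF phi psi r(3)] and a2 = CC.mul_assoc[OF r(1) phi psi] and a3 = CC.mul_assoc[OF phi r(2) psi]
 have [simp]: "1 + p = p + 1" by simp
 have t1: "mc 1 psi (rh y) \<in> Hc y z (q + 1)" by (rule Hc_cast[OF CC.mul_H[OF r(2) psi]]) simp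
 have t2: "mc 1 phi (rh x) \<in> Hc x y (p + 1)" by (rule Hc_cast[OF CC.mul_H[OF r(1) phi]]) simp
 note t3 = CC.mul_H[OF psi r(3)] CC.mul_H[OF phi r(2)] bdc_typed[OF phi] bdc_typed[OF psi]
 have 1: "mc p (dl y z q psi) phi = mc (p + q) (rh z) (mc p psi phi) - sgv q (mc (p + 1) psi (mc p (rh y) phi))
   + sgv q (mc p (bdc D psi) phi)"
  unfolding dlc_def
  by (simp add: CC.mul_addl[OF phi CC.H_diff[OF t3(1) CC.H_sgv[OF t1]] CC.H_sgv[OF t3(4)]]
    CC.mul_diffl[OF phi t3(1) CC.H_sgv[OF t1]] CC.mul_sgvl[OF phi t1] CC.mul_sgvl[OF phi t3(4)] a1 a3)
 have 2: "mc (p + 1) psi (dl x y p phi) = mc (p + 1) psi (mc p (rh y) phi) - sgv p (mc 1 (mc p psi phi) (rh x))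
   + sgv p (mc (p + 1) psi (bdc D phi))"
  unfolding dlc_def
  by (simp add: CC.mul_addr[OF CC.H_diff[OF t3(2) CC.H_sgv[OF t2]] CC.H_sgv[OF t3(3)] psi]
    CC.mul_diffr[OF t3(2) CC.H_sgv[OF t2] psi] CC.mul_sgvr[OF t2 psi] CC.mul_sgvr[OF t3(3) psi] a2)
 show ?thesis
  \<comment> \<open>The two products with the twisting cochain of \<open>y\<close> in the middle
    cancel; splitting into parities turns all remaining signs into plus or minus.\<close>
  unfolding 1 2 unfolding dlc_def bdc_mulc[OF phi psi]
  by (cases "even p"; cases "even q") (simp_all add: sgv_def)
qed

end

context coch_base
begin

lemma lp_idx: "lp A B n a b x y z f ==> n = n' ==> B = B' ==> lp A B' n' a b x y z f"
 by simp

lemma lp_comp: "lp A B n a b (k x) (k y) (k z) f ==> lp A B n a b x y z (\<lambda>w. f (k w))"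
 by (simp add: lp_def)

lemma lp_sgv':
 assumes "lp A B n a b x y z f" "k y = k x" "k z = k x"
 shows "lp A B n a b x y z (\<lambda>w. sgv (k w) (f w))"
 using lp_cong[OF lp_sgv[OF assms(1), of "k x"], of "\<lambda>w. sgv (k w) (f w)"] assms(2,3) by simp

lemma lincI:
 assumes "\<And>d as bs x y u v n a b z. [| u \<in> Obj D; v \<in> Obj D; x \<in> mor D u v n;
   y \<in> mor D u v n; z \<in> mor D u v n; a \<in> carrier K; b \<in> carrier K; path D d (as @ x # bs);
   z = lc D u v n a x b y|]
  ==> \<exists>A B m. lp A B m a b x y z (\<lambda>w. phi d (as @ w # bs))"
 shows "linc K D sc phi"
 unfolding linc_def ling_def
proof (intro allI impI, goal_cases)
 case *: (1 d as bs x y u v n a b)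
 then interpret M: module K "Mor D u v n" by simp
 have "lc D u v n a x b y \<in> mor D u v n" using * by simp
 from assms[OF *(1-4) this *(5-7) HOL.refl]
 show ?case
  unfolding lp_def by blast
qed

lemma lincD:
 assumes "linc K D sc phi" "phi \<in> hc Ph Ps p"
  "u \<in> Obj D" "v \<in> Obj D" "x \<in> mor D u v n" "y \<in> mor D u v n"
  "a \<in> carrier K" "b \<in> carrier K" "path D d (as @ x # bs)"
  "z = lc D u v n a x b y"
 shows "lp (Ph d) (Ps (pend D d (as @ x # bs))) (p + wt D (as @ x # bs)) a b x y z (\<lambda>w. phi d (as @ w # bs))"
 by (rule lp_arg[OF _ cochsD[OF assms(2)] assms(3-10)]) (use assms(1) in "auto simp: linc_def")

lemma linc_plus:
 assumes "linc K D sc phi" "phi \<in> hc Ph Ps p" "linc K D sc psi" "psi \<in> hc Ph Ps p"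
 shows "linc K D sc (phi + psi)"
proof (rule lincI, goal_cases)
 case (1 d as bs x y u v n a b z)
 show ?case
  using lp_add[OF lincD[OF assms(1,2) 1(1-4,6-9)] lincD[OF assms(3,4) 1(1-4,6-9)]]
  by (auto simp: plus_fun_def)
qed

lemma linc_neg:
 assumes "linc K D sc phi" "phi \<in> hc Ph Ps p"
 shows "linc K D sc (- phi)"
proof (rule lincI, goal_cases)
 case (1 d as bs x y u v n a b z)
 show ?case
  using lp_neg[OF lincD[OF assms(1,2) 1(1-4,6-9)]] by (auto simp: fun_Compl_def)
qed

lemma linc_sgv:
 assumes "linc K D sc phi" "phi \<in> hc Ph Ps p"
 shows "linc K D sc (sgv m phi)"
 using assms linc_neg[OF assms] by (simp add: sgv_def)

lemma linc_scc:
 assumes "linc K D sc phi" "phi \<in> hc Ph Ps p" "c \<in> carrier K"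
 shows "linc K D sc (scc sc c phi)"
proof (rule lincI, goal_cases)
 case (1 d as bs x y u v n a b z)
 note l = lincD[OF assms(1,2) 1(1-4,6-9), unfolded lp_def]
 hence x: "phi d (as @ x # bs) \<in> H (Ph d) (Ps (pend D d (as @ x # bs))) (p + wt D (as @ x # bs))"
  and y: "phi d (as @ y # bs) \<in> H (Ph d) (Ps (pend D d (as @ x # bs))) (p + wt D (as @ x # bs))"
  by auto
 have "lp (Ph d) (Ps (pend D d (as @ x # bs))) (p + wt D (as @ x # bs)) a b x y z (\<lambda>w. scc sc c phi d (as @ w # bs))"
  using l x y assms(3) D.m_comm[OF assms(3) 1(6)] D.m_comm[OF assms(3) 1(7)]
  unfolding lp_def scc_def
  by (simp add: T.sc_closed T.sc_add[OF _ T.sc_closed[OF _ x] T.sc_closed[OF _ y]]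
    T.sc_sc[OF _ _ x] T.sc_sc[OF _ _ y])
 thus ?case by blast
qed

lemma linc_0: "linc K D sc (0 :: 'd => 'g list => 'v)"
 by (rule lincI) (auto intro!: exI lp_zero)

text \<open>For each cut the varied letter lies in exactly one of the two factors, and
  multiplication by the other one preserves linearity.\<close>

lemma linc_mulc:
 assumes phi: "phi \<in> hc Ph Ps p" and psi: "psi \<in> hc Ps Xi q"
  and lin: "linc K D sc phi" "linc K D sc psi"
 shows "linc K D sc (mc p psi phi)"
proof (rule lincI, goal_cases)
 case (1 d as bs x y u v n a b z)
 note xy = mor_par[OF 1(1-4)] and xz = mor_par[OF 1(1,2,3,5)]
 note dcd = D.mor_DCD[OF 1(1-3)] D.mor_DCD[OF 1(1,2,4)] D.mor_DCD[OF 1(1,2,5)]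
 have p: "path D d (as @ x # bs)" "path D d (as @ y # bs)" "path D d (as @ z # bs)"
  using 1(8) xy(1) xz(1) by blast+
 have p': "path D d as" "pend D d as = u" "path D v bs" "x \<in> arr D" using p(1) dcd by auto
 let ?F = "\<lambda>as bs. sgv (p * wt D bs) (mul (p + wt D as) (psi (pend D d as) bs) (phi d as))"
 let ?lp = "lp (Ph d) (Xi (pend D d (as @ x # bs))) (p + q + wt D (as @ x # bs)) a b x y z"
 have A: "?lp (\<lambda>w. ?F a1 (a2 @ w # bs))" if s: "a1 @ a2 = as" for a1 a2
 proof -
  have pa: "path D d a1" "path D (pend D d a1) (a2 @ x # bs)" using p(1) s by auto
  show ?thesis
  proof (rule lp_sgv', rule lp_idx)
   show "lp (Ph d) (Xi (pend D (pend D d a1) (a2 @ x # bs))) ((p + wt D a1) + (q + wt D (a2 @ x # bs))) a b x y z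
     (\<lambda>w. mul (p + wt D a1) (psi (pend D d a1) (a2 @ w # bs)) (phi d a1))"
    by (rule lp_mull[OF lincD[OF lin(2) psi 1(1-4,6,7) pa(2) 1(9)] cochsD[OF phi pa(1)]])
  qed (use s dcd in auto)
 qed
 have B: "?lp (\<lambda>w. ?F (as @ w # b1) b2)" if s: "b1 @ b2 = bs" for b1 b2
 proof -
  have pa: "path D d (as @ x # b1)" "path D (pend D d (as @ x # b1)) b2" using p(1) s by auto
  have "?lp (\<lambda>w. sgv (p * wt D b2) (mul (p + wt D (as @ x # b1)) (psi (pend D d (as @ x # b1)) b2) (phi d (as @ w # b1))))"
  proof (rule lp_sgv, rule lp_idx)
   show "lp (Ph d) (Xi (pend D (pend D d (as @ x # b1)) b2)) ((p + wt D (as @ x # b1)) + (q + wt D b2)) a b x y z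
     (\<lambda>w. mul (p + wt D (as @ x # b1)) (psi (pend D d (as @ x # b1)) b2) (phi d (as @ w # b1)))"
    by (rule lp_mulr[OF lincD[OF lin(1) phi 1(1-4,6,7) pa(1) 1(9)] cochsD[OF psi pa(2)]])
  qed (use s in auto)
  thus ?thesis by (rule lp_cong) (use dcd in auto)
 qed
 have "?lp (\<lambda>w. cut (\<lambda>a1 a2. ?F a1 (a2 @ w # bs)) as + cut (\<lambda>b1 b2. ?F (as @ w # b1) b2) bs)"
  by (rule lp_add; rule lp_cut) (fact A, fact B)
 hence "?lp (\<lambda>w. mc p psi phi d (as @ w # bs))"
  by (rule lp_cong) (simp_all only: mulc_path[OF p(1)] mulc_path[OF p(2)] mulc_path[OF p(3)] cut_mid)
 thus ?case by blast
qed

lemma comp_lin: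
 assumes "u \<in> Obj D" "v \<in> Obj D" "x \<in> mor D u v n" "y \<in> mor D u v n"
  "a \<in> carrier K" "b \<in> carrier K" "z = lc D u v n a x b y"
 shows "l \<in> arr D ==> Cod D l = u ==> Comp D z l = a \<odot>\<^bsub>Mor D (Dom D l) v (Deg D l + n)\<^esub> Comp D x l
    \<oplus>\<^bsub>Mor D (Dom D l) v (Deg D l + n)\<^esub> b \<odot>\<^bsub>Mor D (Dom D l) v (Deg D l + n)\<^esub> Comp D y l"
  "l \<in> arr D ==> Dom D l = v ==> Comp D l z = a \<odot>\<^bsub>Mor D u (Cod D l) (n + Deg D l)\<^esub> Comp D l x
    \<oplus>\<^bsub>Mor D u (Cod D l) (n + Deg D l)\<^esub> b \<odot>\<^bsub>Mor D u (Cod D l) (n + Deg D l)\<^esub> Comp D l y"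
  "Dif D z = a \<odot>\<^bsub>Mor D u v (n + 1)\<^esub> Dif D x \<oplus>\<^bsub>Mor D u v (n + 1)\<^esub> b \<odot>\<^bsub>Mor D u v (n + 1)\<^esub> Dif D y"
proof -
 interpret M: module K "Mor D u v n" using assms by simp
 note c = M.smult_closed[OF assms(5,3)] M.smult_closed[OF assms(6,4)]
 { assume l: "l \<in> arr D" "Cod D l = u"
  note t = D.arr_typed[OF l(1)]
  have t': "l \<in> mor D (Dom D l) u (Deg D l)" using t l by simp
  show "Comp D z l = a \<odot>\<^bsub>Mor D (Dom D l) v (Deg D l + n)\<^esub> Comp D x l
    \<oplus>\<^bsub>Mor D (Dom D l) v (Deg D l + n)\<^esub> b \<odot>\<^bsub>Mor D (Dom D l) v (Deg D l + n)\<^esub> Comp D y l"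
   unfolding assms(7) D.comp_add_left[OF t(1) assms(1,2) t' c]
    D.comp_smult_left[OF t(1) assms(1,2,5) t' assms(3)] D.comp_smult_left[OF t(1) assms(1,2,6) t' assms(4)] .. }
 { assume l: "l \<in> arr D" "Dom D l = v"
  note t = D.arr_typed[OF l(1)]
  have t': "l \<in> mor D v (Cod D l) (Deg D l)" using t l by simp
  show "Comp D l z = a \<odot>\<^bsub>Mor D u (Cod D l) (n + Deg D l)\<^esub> Comp D l x
    \<oplus>\<^bsub>Mor D u (Cod D l) (n + Deg D l)\<^esub> b \<odot>\<^bsub>Mor D u (Cod D l) (n + Deg D l)\<^esub> Comp D l y"
   unfolding assms(7) D.comp_add_right[OF assms(1,2) t(2) c t']
    D.comp_smult_right[OF assms(1,2) t(2) assms(5,3) t'] D.comp_smult_right[OF assms(1,2) t(2) assms(6,4) t'] .. }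
 show "Dif D z = a \<odot>\<^bsub>Mor D u v (n + 1)\<^esub> Dif D x \<oplus>\<^bsub>Mor D u v (n + 1)\<^esub> b \<odot>\<^bsub>Mor D u v (n + 1)\<^esub> Dif D y"
  unfolding assms(7) D.dif_add[OF assms(1,2) c] D.dif_smult[OF assms(1,2,5,3)] D.dif_smult[OF assms(1,2,6,4)] ..
qed

text \<open>The facts \<open>t1\<close> to \<open>t5\<close> treat the five groups of
  \<open>bd_mid\<close>. The varied letter survives as itself, as its differential or as a
  composite, each of which depends linearly on it.\<close>

lemma linc_bdc:
 assumes phi: "phi \<in> hc Ph Ps p" and lin: "linc K D sc phi"
 shows "linc K D sc (bdc D phi)"
proof (rule lincI, goal_cases)
 case (1 d as bs x y u v n a b z)
 note xy = mor_par[OF 1(1-4)] and xz = mor_par[OF 1(1,2,3,5)]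
 note dcd = D.mor_DCD[OF 1(1-3)] D.mor_DCD[OF 1(1,2,4)] D.mor_DCD[OF 1(1,2,5)]
 note cl = comp_lin[OF 1(1-4,6,7,9)]
 have p: "path D d (as @ x # bs)" "path D d (as @ y # bs)" "path D d (as @ z # bs)"
  using 1(8) xy(1) xz(1) by blast+
 have p': "path D d as" "pend D d as = u" "path D v bs" "x \<in> arr D" using p(1) dcd by auto
 let ?lp = "lp (Ph d) (Ps (pend D d (as @ x # bs))) (p + 1 + wt D (as @ x # bs)) a b x y z"
 note L = lincD[OF lin phi]
 have t1: "?lp (\<lambda>w. sgv (wt D (w # bs)) (bd D (\<lambda>xs. phi d (xs @ w # bs)) as))"
 proof (rule lp_sgv', rule lp_bd[OF p'(1) 1(6,7)], goal_cases)
  case xs: (1 xs)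
  have pxs: "path D d (xs @ x # bs)" using xs p(1) by auto
  show ?case
   by (rule lp_idx[OF L[OF 1(1-4,6,7) pxs 1(9)]]) (use xs in auto)
 qed (use dcd in auto)
 have t2: "?lp (\<lambda>w. if as = [] then 0 else sgv (wt D (w # bs)) (phi d (butlast as @ Comp D w (last as) # bs)))"
 proof (cases as rule: rev_cases)
  case Nil
  thus ?thesis using 1(6,7) by (simp add: lp_zero)
 next
  case (snoc as0 l)
  have l: "l \<in> arr D" "Cod D l = u" "Dom D l = pend D d as0" using p'(1,2) snoc by auto
  note t = D.arr_typed[OF l(1)]
  have t': "l \<in> mor D (Dom D l) u (Deg D l)" using t l by simp
  note c = D.comp_closed[OF t(1) 1(1,2) t' 1(3)] D.comp_closed[OF t(1) 1(1,2) t' 1(4)]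
  have pc: "path D d (as0 @ Comp D x l # bs)"
   using p snoc l dcd by (auto simp: D.comp_arr)
  have "?lp (\<lambda>w. sgv (wt D (w # bs)) (phi d (as0 @ Comp D w l # bs)))"
  proof (rule lp_sgv', rule lp_comp[where k = "\<lambda>w. Comp D w l"], rule lp_idx[OF L[OF t(1) 1(2) c 1(6,7) pc cl(1)[OF l(1,2)]]])
  qed (use p snoc l dcd in "auto simp: D.comp_arr")
  thus ?thesis using snoc by simp
 qed
 have t3: "?lp (\<lambda>w. sgv (wt D bs) (phi d (as @ Dif D w # bs)))"
 proof -
  have pc: "path D d (as @ Dif D x # bs)" using p dcd by (auto simp: D.dif_arr)
  show ?thesis
   by (rule lp_sgv, rule lp_comp[where k = "Dif D"],
     rule lp_idx[OF L[OF 1(1,2) D.dif_closed[OF 1(1-3)] D.dif_closed[OF 1(1,2,4)] 1(6,7) pc cl(3)]])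
    (use p dcd in "auto simp: D.dif_arr")
 qed
 have t4: "?lp (\<lambda>w. case bs of [] => 0 | g # bs' => sgv (wt D bs) (phi d (as @ Comp D g w # bs')))"
 proof (cases bs)
  case Nil
  thus ?thesis using 1(6,7) by (simp add: lp_zero)
 next
  case (Cons l bs')
  have l: "l \<in> arr D" "Dom D l = v" using p'(3) Cons by auto
  note t = D.arr_typed[OF l(1)]
  have t': "l \<in> mor D v (Cod D l) (Deg D l)" using t l by simp
  note c = D.comp_closed[OF 1(1,2) t(2) 1(3) t'] D.comp_closed[OF 1(1,2) t(2) 1(4) t']
  have pc: "path D d (as @ Comp D l x # bs')"
   using p Cons l dcd by (auto simp: D.comp_arr)
  have "?lp (\<lambda>w. sgv (wt D bs) (phi d (as @ Comp D l w # bs')))"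
   by (rule lp_sgv, rule lp_comp[where k = "\<lambda>w. Comp D l w"],
     rule lp_idx[OF L[OF 1(1) t(2) c 1(6,7) pc cl(2)[OF l]]])
    (use p Cons l dcd in "auto simp: D.comp_arr")
  thus ?thesis using Cons by simp
 qed
 have t5: "?lp (\<lambda>w. bd D (\<lambda>xs. phi d (as @ w # xs)) bs)"
 proof (rule lp_bd[OF p'(3) 1(6,7)], goal_cases)
  case xs: (1 xs)
  have pxs: "path D d (as @ x # xs)" using xs p(1) dcd by auto
  show ?case
   by (rule lp_idx[OF L[OF 1(1-4,6,7) pxs 1(9)]]) (use xs dcd in auto)
 qed
 have "?lp (\<lambda>w. bdc D phi d (as @ w # bs))"
  by (rule lp_cong[OF lp_add[OF lp_add[OF lp_add[OF lp_add[OF t1 t2] t3] t4] t5]])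
   (simp_all only: bdc_def p if_True bd_mid)
 thus ?case by blast
qed

lemma redc_mulc:
 assumes phi: "phi \<in> hc Ph Ps p" and psi: "psi \<in> hc Ps Xi q"
  and red: "redc D phi" "redc D psi"
 shows "redc D (mc p psi phi)"
 unfolding redc_def
proof (intro allI impI, goal_cases)
 case (1 d as bs c)  note c = 1(1) and p = 1(2)
 have A: "cut (\<lambda>a1 a2. sgv (p * wt D (a2 @ Idn D c # bs)) (mul (p + wt D a1) (psi (pend D d a1) (a2 @ Idn D c # bs)) (phi d a1))) as = 0"
 proof (rule cut_0, goal_cases)
  case s: (1 a1 a2)
  have pa: "path D d a1" "path D (pend D d a1) (a2 @ Idn D c # bs)" using p s by auto
  show ?case
   using red(2)[unfolded redc_def, rule_format, OF c pa(2)] T.mul_zerol[OF cochsD[OF phi pa(1)]] by simp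
 qed
 have B: "cut (\<lambda>b1 b2. sgv (p * wt D b2) (mul (p + wt D (as @ Idn D c # b1)) (psi (pend D d (as @ Idn D c # b1)) b2) (phi d (as @ Idn D c # b1)))) bs = 0"
 proof (rule cut_0, goal_cases)
  case s: (1 b1 b2)
  have pa: "path D d (as @ Idn D c # b1)" "path D (pend D d (as @ Idn D c # b1)) b2" using p s by auto
  show ?case
   using red(1)[unfolded redc_def, rule_format, OF c pa(1)] T.mul_zeror[OF cochsD[OF psi pa(2)]] by simp
 qed
 show ?case
  unfolding mulc_path[OF p] cut_mid A B by simp
qed

text \<open>Changes at distant places cancel in pairs, since carrying out the later one first
  reverses the sign of the other. What remains is \<open>dd = 0\<close>, the Leibniz rule and
  associativity. Linearity is used to split the value at the differential of a composite and to kill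
  the value at \<open>dd g = 0\<close>.\<close>

lemma bd_bd:
 assumes "path D d gs" "ling K D sc d G"
  "\<And>xs. path D d xs ==> G xs \<in> H A (Ps (pend D d xs)) (p + wt D xs)"
 shows "bd D (bd D G) gs = 0"
 using assms
proof (induction gs arbitrary: d G p)
 case (Cons g gs)
 note lin = Cons.prems(2) and typed = Cons.prems(3)
 have g: "g \<in> arr D" "Dom D g = d" "path D (Cod D g) gs" using Cons.prems(1) by auto
 note gt = D.arr_typed[OF g(1)] and gd = D.dif_arr[OF g(1)]
 let ?W = "wt D gs"
 have IH: "bd D (bd D (\<lambda>xs. G (g # xs))) gs = 0"
 proof (rule Cons.IH[OF g(3) ling_shift[OF lin g(1,2)]])
  fix xs assume "path D (Cod D g) xs"
  thus "G (g # xs) \<in> H A (Ps (pend D (Cod D g) xs)) ((p + (Deg D g - 1)) + wt D xs)"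
   using typed[of "g # xs"] g by (simp add: algebra_simps)
 qed
 have dd: "G (Dif D (Dif D g) # gs) = 0"
 proof -
  have "Dif D (Dif D g) = \<zero>\<^bsub>Mor D (Dom D g) (Cod D g) (Deg D g + 2)\<^esub>" by (rule D.dif_dif[OF gt])
  with ling_zero[OF lin typed gt(1,2), of "[]" gs "Deg D g + 2"] g gt show ?thesis by simp
 qed
 \<comment> \<open>A change behind \<open>g\<close> raises the shifted degree there by one and thus
   flips the sign of the term with \<open>Dif D g\<close>.\<close>
 have first: "bd D (\<lambda>xs. sgv (wt D xs) (G (Dif D g # xs))) gs = - sgv ?W (bd D (\<lambda>xs. G (Dif D g # xs)) gs)"
 proof -
  have "bd D (\<lambda>xs. sgv (wt D xs) (G (Dif D g # xs))) gs = bd D (\<lambda>xs. sgv (?W + 1) (G (Dif D g # xs))) gs"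
   by (rule D.bd_cong[OF g(3)]) simp
  thus ?thesis by (simp add: bd_sgv) (simp add: sgv_def)
 qed
 \<comment> \<open>The summand in which \<open>g\<close> is composed with the first letter behind
   it, as a function of the letters behind \<open>g\<close>.\<close>
 define X where "X xs = (case xs of [] => 0 | g' # gs' => sgv (wt D xs) (G (Comp D g' g # gs')))" for xs
 have expand: "bd D (bd D G) (g # gs) = sgv ?W (bd D G (Dif D g # gs))
   + (- sgv ?W (bd D (\<lambda>xs. G (Dif D g # xs)) gs) + bd D X gs)
   + (case gs of [] => 0 | g' # gs' => sgv ?W (bd D G (Comp D g' g # gs')))"
  unfolding bd.simps(2)[of D "bd D G"] first[symmetric]
  by (simp add: bd_add IH X_def[abs_def])
 show ?case
 proof (cases gs)
  case Nil
  thus ?thesis unfolding expand using dd by (simp add: X_def)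
 next
  case gs: (Cons g' gs')
  have g': "g' \<in> arr D" "Dom D g' = Cod D g" "path D (Cod D g') gs'" using g(3) gs by auto
  note gt' = D.arr_typed[OF g'(1)]
  let ?W' = "wt D gs'"
  have m': "g' \<in> mor D (Cod D g) (Cod D g') (Deg D g')" using gt' g' by simp
  have DC: "Dif D (Comp D g' g) = Comp D (Dif D g') g \<oplus>\<^bsub>Mor D (Dom D g) (Cod D g') (Deg D g + Deg D g' + 1)\<^esub>
    sg K (Deg D g') \<odot>\<^bsub>Mor D (Dom D g) (Cod D g') (Deg D g + Deg D g' + 1)\<^esub> Comp D g' (Dif D g)"
   by (rule D.dif_comp[OF gt(1,2) gt'(2) gt(3) m'])
  let ?M = "Mor D (Dom D g) (Cod D g') (Deg D g + Deg D g' + 1)"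
  interpret M: module K ?M using gt gt' by simp
  have c1: "Comp D (Dif D g') g \<in> carrier ?M"
   using D.comp_closed[OF gt(1,2) gt'(2) gt(3) D.dif_closed[OF gt(2) gt'(2) m']] by (simp add: algebra_simps)
  have c2: "Comp D g' (Dif D g) \<in> carrier ?M"
   using D.comp_closed[OF gt(1,2) gt'(2) D.dif_closed[OF gt] m'] by (simp add: algebra_simps)
  have pc1: "path D d ([] @ Comp D (Dif D g') g # gs')" and pc2: "path D d ([] @ Comp D g' (Dif D g) # gs')"
   using g g' gd D.dif_arr[OF g'(1)] by (simp_all add: D.comp_arr)
  have sm: "sg K (Deg D g') \<odot>\<^bsub>?M\<^esub> Comp D g' (Dif D g) \<in> carrier ?M"
   using c2 by (simp add: sg_def)
  have GC: "G (Dif D (Comp D g' g) # gs') = G (Comp D (Dif D g') g # gs') + sgv (Deg D g') (G (Comp D g' (Dif D g) # gs'))"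
   using ling_add[OF lin typed gt(1) gt'(2) c1 sm pc1] ling_sg[OF lin typed gt(1) gt'(2) c2 pc2, of "Deg D g'"]
   unfolding DC by simp
  have second: "bd D (\<lambda>ys. X (g' # ys)) gs' = sgv (Deg D g' + ?W') (bd D (\<lambda>ys. G (Comp D g' g # ys)) gs')"
  proof -
   have "bd D (\<lambda>ys. X (g' # ys)) gs' = bd D (\<lambda>ys. sgv (Deg D g' + ?W') (G (Comp D g' g # ys))) gs'"
    by (rule D.bd_cong[OF g'(3)]) (simp add: X_def)
   thus ?thesis by (simp add: bd_sgv)
  qed
  have BX: "bd D X gs = sgv ?W' (sgv (Deg D g' + ?W') (G (Comp D (Dif D g') g # gs')))
    + sgv (Deg D g' + ?W') (bd D (\<lambda>ys. G (Comp D g' g # ys)) gs')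
    + (case gs' of [] => 0 | g'' # gs'' =>
      sgv ?W' (sgv (Deg D g' + Deg D g'' - 1 + wt D gs'') (G (Comp D (Comp D g'' g') g # gs''))))"
   unfolding gs bd.simps(2)[of D X] second
   using D.dif_arr[OF g'(1)] g'(3) g'
   by (auto simp: X_def D.comp_arr split: list.split intro!: arg_cong[where f = "\<lambda>k. sgv k _"])
  have assoc: "Comp D g'' (Comp D g' g) = Comp D (Comp D g'' g') g" if "gs' = g'' # gs''" for g'' gs''
   by (rule D.comp_assoc[OF g(1) g'(1)]) (use g g' that in auto)
  show ?thesis
   unfolding expand BX
   unfolding gs list.case bd.simps GC
   using dd assoc unfolding gs
   by (cases "even (Deg D g')"; cases "even ?W'"; cases gs') (auto simp: sgv_def)
 qed
qed simp

end

context coch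
begin

lemma linc_rho:
 assumes y: "y \<in> Ob'"
 shows "linc K D sc (rh y)"
proof (rule lincI, goal_cases)
 case (1 d as bs x w u v n a b z)
 note xy = mor_par[OF 1(1-4)] and xz = mor_par[OF 1(1,2,3,5)]
 have p: "path D d (as @ x # bs)" "path D d (as @ w # bs)" "path D d (as @ z # bs)"
  using 1(8) xy(1) xz(1) by blast+
 show ?case
 proof (cases "as = [] \<and> bs = []")
  case True
  have "lp (Ph y u) (Ph y v) n a b x w z (R y)"
   unfolding lp_def 1(9) using R_lin[OF y 1(1-4,6,7)] R_H[OF y D.arrI[OF 1(1-3)]] R_H[OF y D.arrI[OF 1(1,2,4)]]
    D.mor_DCD[OF 1(1-3)] D.mor_DCD[OF 1(1,2,4)] 1(6,7) by simp
  hence "lp (Ph y u) (Ph y v) n a b x w z (\<lambda>w. rh y d (as @ w # bs))"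
   by (rule lp_cong) (use p True in "auto simp: rho_def")
  thus ?thesis by blast
 next
  case False
  have "lp (Ph y u) (Ph y v) n a b x w z (\<lambda>w. rh y d (as @ w # bs))"
   by (rule lp_cong[OF lp_zero[OF 1(6,7)]]) (use False in "auto simp: rho_def")
  thus ?thesis by blast
 qed
qed

lemma linc_dl:
 assumes "x \<in> Ob'" "y \<in> Ob'" "phi \<in> Hc x y p" "linc K D sc phi"
 shows "linc K D sc (dl x y p phi)"
proof -
 note r = rho_H[OF assms(2)] rho_H[OF assms(1)]
 note t1 = CC.mul_H[OF assms(3) r(1)] and t2 = Hc_cast[OF CC.mul_H[OF r(2) assms(3)] add.commute]
  and t3 = bdc_typed[OF assms(3)]
 note l1 = linc_mulc[OF assms(3) r(1) assms(4) linc_rho[OF assms(2)]]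
  and l2 = linc_mulc[OF r(2) assms(3) linc_rho[OF assms(1)] assms(4)]
  and l3 = linc_bdc[OF assms(3,4)]
 have "linc K D sc (mc p (rh y) phi + - sgv p (mc 1 phi (rh x)) + sgv p (bdc D phi))"
  by (intro linc_plus[OF _ CC.H_add[OF t1 CC.H_neg[OF CC.H_sgv[OF t2]]] _ CC.H_sgv[OF t3]]
    linc_plus[OF l1 t1 _ CC.H_neg[OF CC.H_sgv[OF t2]]] linc_neg[OF linc_sgv[OF l2 t2] CC.H_sgv[OF t2]]
    linc_sgv[OF l3 t3])
 thus ?thesis by (simp add: dlc_def)
qed

text \<open>The two products of an identity with its neighbours cancel; at the ends of the list
 the missing neighbour is replaced by the outer terms.\<close>

lemma redc_dl:
 assumes xy: "x \<in> Ob'" "y \<in> Ob'" and phi: "phi \<in> Hc x y p" and lin: "linc K D sc phi" and red: "redc D phi"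
 shows "redc D (dl x y p phi)"
 unfolding redc_def
proof (intro allI impI, goal_cases)
 case (1 d as bs c)  note c = 1(1) and p = 1(2)
 note i = D.idn_arr[OF c]
 have p': "path D d as" "pend D d as = c" "path D c bs" using p i by auto
 have pab: "path D d (as @ bs)" using p' by simp
 note r0 = red[unfolded redc_def, rule_format, OF c]
 note phia = cochsD[OF phi p'(1)] and phib = cochsD[OF phi p'(3)]
 have rx: "R x (Idn D c) = idn (Ph x c)" and ry: "R y (Idn D c) = idn (Ph y c)" using R_id xy c by auto
 have A: "mc p (rh y) phi d (as @ Idn D c # bs) = (if bs = [] then sgv p (phi d as) else 0)"
 proof -
  have 1: "cut (\<lambda>b1 b2. sgv (p * wt D b2) (mul (p + wt D (as @ Idn D c # b1)) (rh y (pend D d (as @ Idn D c # b1)) b2) (phi d (as @ Idn D c # b1)))) bs = 0"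
  proof (rule cut_0, goal_cases)
   case s: (1 b1 b2)
   have pa: "path D d (as @ Idn D c # b1)" "path D (pend D d (as @ Idn D c # b1)) b2" using p s by auto
   show ?case
    using r0[OF pa(1)] T.mul_zeror[OF cochsD[OF rho_H[OF xy(2)] pa(2)]] by simp
  qed
  have 2: "cut (\<lambda>a1 a2. sgv (p * wt D (a2 @ Idn D c # bs)) (mul (p + wt D a1) (rh y (pend D d a1) (a2 @ Idn D c # bs)) (phi d a1))) as
   = sgv (p * wt D (Idn D c # bs)) (mul (p + wt D as) (rh y c (Idn D c # bs)) (phi d as))"
   using p'(2) p by (subst cut_fst) (auto simp: rho_def T.mul_zerol[OF cochsD[OF phi]])
  show ?thesis
   unfolding mulc_path[OF p] cut_mid 1 2
   using i p' c by (auto simp: rho_def ry T.mul_idl[OF phia, unfolded p'(2)] T.mul_zerol[OF phia] intro!: sgv_cong)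
 qed
 have B: "mc 1 phi (rh x) d (as @ Idn D c # bs) = (if as = [] then sgv (wt D bs) (phi d bs) else 0)"
 proof -
  have 1: "cut (\<lambda>a1 a2. sgv (1 * wt D (a2 @ Idn D c # bs)) (mul (1 + wt D a1) (phi (pend D d a1) (a2 @ Idn D c # bs)) (rh x d a1))) as = 0"
  proof (rule cut_0, goal_cases)
   case s: (1 a1 a2)
   have pa: "path D d a1" "path D (pend D d a1) (a2 @ Idn D c # bs)" using p s by auto
   show ?case
    using r0[OF pa(2)] T.mul_zerol[OF cochsD[OF rho_H[OF xy(1)] pa(1)]] by simp
  qed
  have 2: "cut (\<lambda>b1 b2. sgv (1 * wt D b2) (mul (1 + wt D (as @ Idn D c # b1)) (phi (pend D d (as @ Idn D c # b1)) b2) (rh x d (as @ Idn D c # b1)))) bs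
   = sgv (wt D bs) (mul (1 + wt D (as @ [Idn D c])) (phi (pend D d (as @ [Idn D c])) bs) (rh x d (as @ [Idn D c])))"
  proof (subst cut_snd, goal_cases)
   case s: (1 b1 b2)
   have pa: "path D (pend D d (as @ Idn D c # b1)) b2" using p s by auto
   show ?case
    using s T.mul_zeror[OF cochsD[OF phi pa]] by (simp add: rho_def)
  qed simp
  show ?thesis
   unfolding mulc_path[OF p] cut_mid 1 2
   using i p' c T.mul_zeror[OF phib] T.mul_idr[OF phib] by (auto simp: rho_def rx)
 qed
 have C: "bdc D phi d (as @ Idn D c # bs) =
   (if as = [] then 0 else sgv (wt D bs - 1) (phi d (as @ bs))) + (if bs = [] then 0 else sgv (wt D bs) (phi d (as @ bs)))"
 proof -
  have 1: "bd D (\<lambda>xs. phi d (xs @ Idn D c # bs)) as = 0"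
  proof -
   have "bd D (\<lambda>xs. phi d (xs @ Idn D c # bs)) as = bd D (\<lambda>xs. 0) as"
    by (rule D.bd_cong[OF p'(1)], rule r0) (use p p' in auto)
   thus ?thesis by simp
  qed
  have 2: "bd D (\<lambda>xs. phi d (as @ Idn D c # xs)) bs = 0"
  proof -
   have "bd D (\<lambda>xs. phi d (as @ Idn D c # xs)) bs = bd D (\<lambda>xs. 0) bs"
    by (rule D.bd_cong[OF p'(3)], rule r0) (use p p' i in auto)
   thus ?thesis by simp
  qed
  \<comment> \<open>The differential of an identity is zero, and \<open>phi\<close> is linear in
    this place.\<close>
  have 3: "phi d (as @ Dif D (Idn D c) # bs) = 0"
   unfolding D.dif_idn[OF c]
   by (rule ling_zero[OF _ cochsD[OF phi] c c p']) (use lin in "simp_all add: linc_def")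
  \<comment> \<open>The identity has degree 0 and hence shifted degree minus one. This gives the
    opposite sign to that in \<open>5\<close>, so that the two compositions of an inner identity
    cancel.\<close>
  have 4: "(if as = [] then 0 else sgv (wt D (Idn D c # bs)) (phi d (butlast as @ Comp D (Idn D c) (last as) # bs)))
    = (if as = [] then 0 else sgv (wt D bs - 1) (phi d (as @ bs)))"
   using p'(1,2) D.comp_idn_left[of "last as"] i by (cases as rule: rev_cases) (auto intro!: sgv_cong)
  have 5: "(case bs of [] => 0 | g # bs' => sgv (wt D bs) (phi d (as @ Comp D g (Idn D c) # bs')))
    = (if bs = [] then 0 else sgv (wt D bs) (phi d (as @ bs)))"
   using p'(3) D.comp_idn_right[of "hd bs"] by (cases bs) auto
  show ?thesis
   unfolding bdc_def bd_mid 1 2 3 4 5 using p by simp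
 qed
 have cd: "as = [] ==> c = d" using p' by auto
 show ?case
  unfolding dlc_def plus_fun_def fun_diff_def sgv_fun A B C using cd
  by (cases "as = []"; cases "bs = []") (auto simp: sgv_def)
qed

text \<open>The Maurer-Cartan equation up to the differential: on two letters the product and the
  bar term express \<open>R(g' g) = R(g') R(g)\<close>, on one letter the bar term is
  \<open>R(dg)\<close>.\<close>

lemma rho_rho:
 assumes y: "y \<in> Ob'"
 shows "mc 1 (rh y) (rh y) = bdc D (rh y) - rho D (\<lambda>g. R y (Dif D g))"
proof (intro ext, goal_cases)
 case (1 d gs)
 note \<rho> = rho_H[OF y]
 show ?case
 proof (cases "path D d gs")
  case p: True
  have split: "cut (\<lambda>as bs. sgv (1 * wt D bs) (mul (1 + wt D as) (rh y (pend D d as) bs) (rh y d as))) gs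
   = (case gs of [g, g'] => sgv (wt D [g']) (mul (Deg D g) (R y g') (R y g)) | _ => 0)"
  proof (cases "\<exists>g g'. gs = [g, g']")
   case True
   then obtain g g' where gs: "gs = [g, g']" by blast
   have "rh y d [] = 0" "rh y (Cod D g') [] = 0" by (auto simp: rho_def)
   thus ?thesis
    using p T.mul_zeror[OF cochsD[OF \<rho>], of d "[g, g']"] T.mul_zerol[OF cochsD[OF \<rho>], of d "[g, g']"]
    by (simp add: gs rho_def D.arr_typed)
  next
   case False
   have "cut (\<lambda>as bs. sgv (1 * wt D bs) (mul (1 + wt D as) (rh y (pend D d as) bs) (rh y d as))) gs = 0"
   proof (rule cut_0, goal_cases)
    case s: (1 as bs)
    have pa: "path D d as" "path D (pend D d as) bs" using p s by auto
    have "length as \<noteq> 1 \<or> length bs \<noteq> 1"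
     using False s by (auto simp: length_Suc_conv)
    thus ?case
     using T.mul_zeror[OF cochsD[OF \<rho> pa(2)]] T.mul_zerol[OF cochsD[OF \<rho> pa(1)]]
     by (auto simp: rho_def)
   qed
   thus ?thesis using False by (auto split: list.split)
  qed
  have b: "bd D (rh y d) gs = (case gs of [g] => R y (Dif D g)
    | [g, g'] => sgv (wt D [g']) (R y (Comp D g' g)) | _ => 0)"
  proof -
   \<comment> \<open>One change shortens a list by at most one letter, so \<open>rho\<close> is
     evaluated on at least two letters. The inner claim is the version of this for arbitrary
     lengths, which the induction requires.\<close>
   have z: "bd D (rh y d) gs = 0" if "length gs > 2"
   proof -
    have "bd D G gs = 0" if "length gs > n + 1" "\<And>xs. length xs > n ==> G xs = 0" for G :: "'g list => 'v" and n gs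
     using that
    proof (induction gs arbitrary: G n)
     case (Cons g gs)
     have "bd D (\<lambda>xs. G (g # xs)) gs = 0"
     proof (cases n)
      case 0
      have "G (g # xs) = 0" for xs using Cons.prems(2)[of "g # xs"] 0 by simp
      thus ?thesis by simp
     next
      case (Suc m)
      show ?thesis by (rule Cons.IH[of m]) (use Cons.prems Suc in auto)
     qed
     thus ?case using Cons.prems by (auto split: list.split)
    qed simp
    from this[of 1 gs "rh y d"] that show ?thesis by (simp add: rho_def)
   qed
   show ?thesis
   proof (cases gs)
    case (Cons g gs')
    show ?thesis
    proof (cases gs')
     case Nil
     thus ?thesis using Cons p by (simp add: rho_def D.dif_arr)
    next
     case (Cons g' gs'')
     thus ?thesis using \<open>gs = g # gs'\<close> p z
      by (cases gs'') (simp_all add: rho_def D.comp_arr)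
    qed
   qed simp
  qed
  have L: "mc 1 (rh y) (rh y) d gs = (case gs of [g, g'] => sgv (wt D [g']) (mul (Deg D g) (R y g') (R y g)) | _ => 0)"
   by (simp only: mulc_path[OF p] split)
  have M: "bdc D (rh y) d gs = (case gs of [g] => R y (Dif D g)
    | [g, g'] => sgv (wt D [g']) (R y (Comp D g' g)) | _ => 0)"
   using p by (simp only: bdc_def b if_True)
  show ?thesis
   unfolding fun_diff_def L M using p R_comp[OF y]
   by (cases gs; cases "tl gs"; cases "tl (tl gs)") (auto simp: rho_def)
 qed (simp add: mulc_def bdc_def rho_def)
qed

lemma rho_dif_H: "y \<in> Ob' ==> rho D (\<lambda>g. R y (Dif D g)) \<in> Hc y y 2"
proof (rule Hc_cast[OF rho_typed[where n = 1]], goal_cases)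
 case (1 g)
 thus ?case
  using R_H[of y "Dif D g"] D.dif_arr[of g] by simp
qed simp

text \<open>The curvature. With associativity, \<open>bdc_mulc\<close>, \<open>bd_bd\<close> and
  \<open>rho_rho\<close> everything cancels except the terms that measure how far the twisting
  cochains are from satisfying the Maurer-Cartan equation without internal differential.\<close>

lemma dl_dl:
 assumes xy: "x \<in> Ob'" "y \<in> Ob'" and phi: "phi \<in> Hc x y p" and lin: "linc K D sc phi"
 shows "dl x y (p + 1) (dl x y p phi)
  = mc 2 phi (rho D (\<lambda>g. R x (Dif D g))) - mc p (rho D (\<lambda>g. R y (Dif D g))) phi"
proof -
 note r = rho_H[OF xy(1)] rho_H[OF xy(2)]
 note d = rho_dif_H[OF xy(1)] rho_dif_H[OF xy(2)]
 have [simp]: "1 + p = p + 1" "1 + 1 = (2::int)" by simp_all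
 define A where "A = mc p (rh y) phi"
 define B where "B = mc 1 phi (rh x)"
 define C where "C = bdc D phi"
 have tA: "A \<in> Hc x y (p + 1)" unfolding A_def by (rule CC.mul_H[OF phi r(2)])
 have tB: "B \<in> Hc x y (p + 1)" unfolding B_def by (rule Hc_cast[OF CC.mul_H[OF r(1) phi]]) simp
 have tC: "C \<in> Hc x y (p + 1)" unfolding C_def by (rule bdc_typed[OF phi])
 have dl: "dl x y p phi = A - sgv p B + sgv p C" by (simp add: dlc_def A_def B_def C_def)
 have CC0: "bdc D C = 0"
 proof (intro ext)
  fix d gs
  have "bd D (bdc D phi d) gs = 0" if p: "path D d gs"
  proof -
   have "bd D (bdc D phi d) gs = bd D (bd D (phi d)) gs"
    by (rule D.bd_cong[OF p]) (simp add: bdc_def)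
   also have "\<dots> = 0"
    by (rule bd_bd[OF p _ cochsD[OF phi]]) (use lin in "simp_all add: linc_def")
   finally show ?thesis .
  qed
  thus "bdc D C d gs = 0 d gs" by (simp add: C_def bdc_def)
 qed
 have rr: "mc 1 (rh y) (rh y) = bdc D (rh y) - rho D (\<lambda>g. R y (Dif D g))" if "y \<in> Ob'" for y
  by (rule rho_rho[OF that])
 have bt: "bdc D (rh y) \<in> Hc y y 2" if "y \<in> Ob'" for y
  using bdc_typed[OF rho_H[OF that]] by simp
 have 1: "mc (p + 1) (rh y) A = mc p (bdc D (rh y)) phi - mc p (rho D (\<lambda>g. R y (Dif D g))) phi"
  using CC.mul_assoc[OF phi r(2) r(2)] CC.mul_diffl[OF phi bt[OF xy(2)] d(2)]
  by (simp add: A_def rr[OF xy(2)])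
 have 2: "mc (p + 1) (rh y) B = mc 1 A (rh x)"
  using CC.mul_assoc[OF r(1) phi r(2)] by (simp add: A_def B_def)
 have 3: "mc 1 B (rh x) = mc 2 phi (bdc D (rh x)) - mc 2 phi (rho D (\<lambda>g. R x (Dif D g)))"
  using CC.mul_assoc[OF r(1) r(1) phi] CC.mul_diffr[OF bt[OF xy(1)] d(1) phi]
  by (simp add: B_def rr[OF xy(1)])
 have 4: "bdc D A = sgv p (mc p (bdc D (rh y)) phi) + mc (p + 1) (rh y) C"
  unfolding A_def C_def by (rule bdc_mulc[OF phi r(2)])
 have 5: "bdc D B = - mc 1 C (rh x) + mc 2 phi (bdc D (rh x))"
  using bdc_mulc[OF r(1) phi] by (simp add: B_def C_def sgv_def)
 have 6: "mc (p + 1) (rh y) (dl x y p phi) = mc (p + 1) (rh y) A - sgv p (mc (p + 1) (rh y) B) + sgv p (mc (p + 1) (rh y) C)"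
  unfolding dl
  by (simp add: CC.mul_addr[OF CC.H_diff[OF tA CC.H_sgv[OF tB]] CC.H_sgv[OF tC] r(2)]
    CC.mul_diffr[OF tA CC.H_sgv[OF tB] r(2)] CC.mul_sgvr[OF tB r(2)] CC.mul_sgvr[OF tC r(2)])
 have 7: "mc 1 (dl x y p phi) (rh x) = mc 1 A (rh x) - sgv p (mc 1 B (rh x)) + sgv p (mc 1 C (rh x))"
  unfolding dl
  by (simp add: CC.mul_addl[OF r(1) CC.H_diff[OF tA CC.H_sgv[OF tB]] CC.H_sgv[OF tC]]
    CC.mul_diffl[OF r(1) tA CC.H_sgv[OF tB]] CC.mul_sgvl[OF r(1) tB] CC.mul_sgvl[OF r(1) tC])
 have 8: "bdc D (dl x y p phi) = bdc D A - sgv p (bdc D B)"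
  unfolding dl by (simp add: bdc_add bdc_diff bdc_sgv CC0)
 show ?thesis
  unfolding dlc_def[of D mul "R x" "R y" "p + 1"] 6 7 8 1 2 3 4 5
  by (cases "even p") (simp_all add: sgv_def)
qed

end

section \<open>The total differential of cochains\<close>

locale coch_dg = coch K D Ob H sc mul idn Ob' Ph R + TD: vdg K Ob H sc mul idn dif
 for K :: "'k ring" and D :: "('k, 'd, 'g) dgcat" and Ob :: "'x set"
  and H :: "'x => 'x => int => 'v::ab_group_add set" and sc mul idn
  and Ob' :: "'y set" and Ph :: "'y => 'd => 'x" and R :: "'y => 'g => 'v" and dif
begin

abbreviation "dd x y p phi \<equiv> ddc D dif (Ph x) (Ph y) p phi"
abbreviation "df x y p phi \<equiv> difc D mul dif (Ph x) (Ph y) (R x) (R y) p phi"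

lemma objs:
 assumes "x \<in> Ob'" "y \<in> Ob'" "path D d gs"
 shows "Ph x d \<in> Ob" "Ph y (pend D d gs) \<in> Ob"
 using assms Phi_Ob D.path_obj D.path_end by blast+

lemma dd_H:
 assumes "x \<in> Ob'" "y \<in> Ob'" "phi \<in> Hc x y p"
 shows "dd x y p phi \<in> Hc x y (p + 1)"
proof (rule cochsI, goal_cases)
 case p: (1 d gs)
 show ?case
  using TD.dif_H[OF objs[OF assms(1,2) p] cochsD[OF assms(3) p]] p by (simp add: ddc_def algebra_simps)
qed (simp add: ddc_def)

lemma dd_add:
 assumes "x \<in> Ob'" "y \<in> Ob'" "phi \<in> Hc x y p" "psi \<in> Hc x y p"
 shows "dd x y p (phi + psi) = dd x y p phi + dd x y p psi"
proof (intro ext, goal_cases)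
 case (1 d gs) show ?case
  using TD.dif_add[OF objs[OF assms(1,2)] cochsD[OF assms(3)] cochsD[OF assms(4)], of d gs]
  by (cases "path D d gs") (simp_all add: ddc_def)
qed

lemma dd_neg:
 assumes "x \<in> Ob'" "y \<in> Ob'" "phi \<in> Hc x y p"
 shows "dd x y p (- phi) = - dd x y p phi"
 using dd_add[OF assms CC.H_neg[OF assms(3)]] dd_add[OF assms(1,2) CC.H_zero CC.H_zero]
 by (simp add: eq_neg_iff_add_eq_0 add.commute)

lemma dd_sgv:
 "x \<in> Ob' ==> y \<in> Ob' ==> phi \<in> Hc x y p ==> dd x y p (sgv m phi) = sgv m (dd x y p phi)"
 by (simp add: sgv_def dd_neg)

lemma dd_diff:
 assumes "x \<in> Ob'" "y \<in> Ob'" "phi \<in> Hc x y p" "psi \<in> Hc x y p"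
 shows "dd x y p (phi - psi) = dd x y p phi - dd x y p psi"
 using dd_add[OF assms(1-3) CC.H_neg[OF assms(4)]] dd_neg[OF assms(1,2,4)] by simp

lemma dd_sc:
 assumes "x \<in> Ob'" "y \<in> Ob'" "a \<in> carrier K" "phi \<in> Hc x y p"
 shows "dd x y p (scc sc a phi) = scc sc a (dd x y p phi)"
proof (intro ext, goal_cases)
 case (1 d gs) show ?case
  using TD.dif_sc[OF objs[OF assms(1,2)] assms(3) cochsD[OF assms(4)], of d gs] T.sc_zero[OF assms(3)]
  by (cases "path D d gs") (simp_all add: ddc_def scc_def)
qed

lemma dd_mulc:
 assumes o: "x \<in> Ob'" "y \<in> Ob'" "z \<in> Ob'" and phi: "phi \<in> Hc x y p" and psi: "psi \<in> Hc y z q"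
 shows "dd x z (p + q) (mc p psi phi) = mc p (dd y z q psi) phi + sgv q (mc (p + 1) psi (dd x y p phi))"
proof (intro ext, goal_cases)
 case (1 d gs)
 show ?case
 proof (cases "path D d gs")
  case p: True
  let ?m = "\<lambda>as bs. mul (p + wt D as) (psi (pend D d as) bs) (phi d as)"
  let ?H = "H (Ph x d) (Ph z (pend D d gs)) (p + q + wt D gs)"
  let ?d = "dif (Ph x d) (Ph z (pend D d gs)) (p + q + wt D gs)"
  note xz = objs[OF o(1,3) p]
  have t: "?m as bs \<in> ?H" if "as @ bs = gs" for as bs
   using mul_typed[OF phi psi, of d as bs] p that by auto
  have "?d (cut (\<lambda>as bs. sgv (p * wt D bs) (?m as bs)) gs)
   = cut (\<lambda>as bs. ?d (sgv (p * wt D bs) (?m as bs))) gs"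
  proof (rule cut_hom[where S = ?H])
   show "sgv (p * wt D bs) (?m as bs) \<in> ?H" if "as @ bs = gs" for as bs
    by (rule T.H_sgv[OF t[OF that]])
  qed (auto intro: T.H_add TD.dif_add[OF xz])
  also have "\<dots> = cut (\<lambda>as bs. sgv (p * wt D bs) (mul (p + wt D as) (dd y z q psi (pend D d as) bs) (phi d as))
    + sgv q (sgv ((p + 1) * wt D bs) (mul (p + 1 + wt D as) (psi (pend D d as) bs) (dd x y p phi d as)))) gs"
  proof (rule cut_cong, goal_cases)
   case s: (1 as bs)
   have pa: "path D d as" "path D (pend D d as) bs" using p s by auto
   have i: "p + wt D as + (q + wt D bs) = p + q + wt D gs" using s by auto
   have e: "pend D (pend D d as) bs = pend D d gs" using s by auto
   note dm = TD.dif_mul[OF objs[OF o(1,2) pa(1)] objs(2)[OF o(2,3) pa(2)] cochsD[OF phi pa(1)] cochsD[OF psi pa(2)],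
     unfolded i e]
   have "?d (sgv (p * wt D bs) (?m as bs)) = sgv (p * wt D bs) (?d (?m as bs))"
    by (rule TD.dif_sgv[OF xz t[OF s]])
   also have "\<dots> = sgv (p * wt D bs) (mul (p + wt D as) (dd y z q psi (pend D d as) bs) (phi d as)
     + sgv (q + wt D bs) (mul (p + 1 + wt D as) (psi (pend D d as) bs) (dd x y p phi d as)))"
    unfolding dm using pa e by (simp add: ddc_def algebra_simps)
   finally show ?case
    by (simp add: sgv_add algebra_simps)
  qed
  finally show ?thesis
   using p by (simp add: ddc_def[of D dif _ _ "p + q"] mulc_path cut_add cut_sgv sgv_fun del: sgv_sgv)
 qed (simp add: ddc_def mulc_def sgv_fun)
qed

text \<open>The internal differential acts on values, the bar differential on arguments. Together
  with the sign of the bar term in \<open>dlc\<close> this makes the two parts of the total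
  differential anticommute.\<close>

lemma dd_bdc:
 assumes "x \<in> Ob'" "y \<in> Ob'" "phi \<in> Hc x y p"
 shows "dd x y (p + 1) (bdc D phi) = bdc D (dd x y p phi)"
proof (intro ext, goal_cases)
 case (1 d gs)
 show ?case
 proof (cases "path D d gs")
  case p: True
  let ?d = "dif (Ph x d) (Ph y (pend D d gs)) (p + 1 + wt D gs)"
  have "?d (bd D (phi d) gs) = bd D (\<lambda>xs. ?d (phi d xs)) gs"
  proof (rule D.bd_hom[OF p, where S = "H (Ph x d) (Ph y (pend D d gs)) (p + 1 + wt D gs)"], goal_cases)
   case (1 xs)
   thus ?case
    using cochsD[OF assms(3), of d xs] by (simp add: algebra_simps)
  qed (auto intro: T.H_add T.H_neg TD.dif_add[OF objs[OF assms(1,2) p]])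
  also have "\<dots> = bd D (dd x y p phi d) gs"
   by (rule D.bd_cong[OF p]) (simp add: ddc_def algebra_simps)
  finally show ?thesis using p by (simp add: ddc_def bdc_def)
 qed (simp add: ddc_def bdc_def)
qed

lemma df_vdg: "vdg K Ob' Hc (scc sc) mc (\<lambda>x. idc D idn (Ph x)) df"
proof (intro vdg.intro vdg_axioms.intro CC.vgc_axioms, goal_cases)
 case *: (1 x y v n)
 thus ?case
  unfolding difc_def by (intro CC.H_add dd_H dl_H)
next
 case *: (2 x y v n w)
 thus ?case
  unfolding difc_def by (simp add: dd_add dl_add)
next
 case *: (3 x y a v n)
 thus ?case
  unfolding difc_def
  by (simp add: dd_sc dl_sc CC.sc_add[OF *(3) dd_H[OF *(1,2,4)] dl_H[OF *(1,2,4)]])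
next
 case *: (4 x y z f m g n)
 show ?case
  unfolding difc_def dd_mulc[OF *] dl_mulc[OF *]
   CC.mul_addl[OF *(4) dd_H[OF *(2,3,5)] dl_H[OF *(2,3,5)]]
   CC.mul_addr[OF dd_H[OF *(1,2,4)] dl_H[OF *(1,2,4)] *(5)]
  by (simp add: sgv_add algebra_simps)
qed

text \<open>The mixed terms of internal and Hochschild part reduce to the internal differential of
  the twisting cochains. For functors that commute with differentials this is exactly the curvature
  of \<open>dl_dl\<close> with the opposite sign. The square of the internal differential remains on
  the right; for the universal cochains the equation is read backwards to show that it
  vanishes.\<close>

lemma df_df:
 assumes xy: "x \<in> Ob'" "y \<in> Ob'" and phi: "phi \<in> Hc x y p" and lin: "linc K D sc phi"
  and R_dif: "\<And>y g. y \<in> Ob' ==> g \<in> arr D ==>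
   dif (Ph y (Dom D g)) (Ph y (Cod D g)) (Deg D g) (R y g) = R y (Dif D g)"
 shows "df x y (p + 1) (df x y p phi) = dd x y (p + 1) (dd x y p phi)"
proof -
 \<comment> \<open>The internal differential turns the twisting cochain of \<open>R\<close> into the
   length one cochain of \<open>R\<close> after \<open>d\<close>, the term that also occurs in
   \<open>rho_rho\<close>.\<close>
 have dr: "dd y y 1 (rh y) = rho D (\<lambda>g. R y (Dif D g))" if y: "y \<in> Ob'" for y
 proof (intro ext, goal_cases)
  case (1 d gs)
  show ?case
  proof (cases "path D d gs \<and> length gs = 1")
   case True
   then obtain g where "gs = [g]" by (cases gs) auto
   thus ?thesis using True R_dif[OF y, of g] by (simp add: ddc_def rho_def)
  next
   case False
   thus ?thesis using TD.dif_0[OF objs[OF y y]] by (auto simp: ddc_def rho_def)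
  qed
 qed
 note r = rho_H[OF xy(1)] rho_H[OF xy(2)]
 have [simp]: "1 + p = p + 1" by simp
 have tA: "mc p (rh y) phi \<in> Hc x y (p + 1)" by (rule CC.mul_H[OF phi r(2)])
 have tB: "mc 1 phi (rh x) \<in> Hc x y (p + 1)" by (rule Hc_cast[OF CC.mul_H[OF r(1) phi]]) simp
 have tC: "bdc D phi \<in> Hc x y (p + 1)" by (rule bdc_typed[OF phi])
 have 1: "dd x y (p + 1) (dl x y p phi) = mc p (rho D (\<lambda>g. R y (Dif D g))) phi - mc (p + 1) (rh y) (dd x y p phi)
  - sgv p (mc 1 (dd x y p phi) (rh x)) - mc 2 phi (rho D (\<lambda>g. R x (Dif D g))) + sgv p (bdc D (dd x y p phi))"
  unfolding dlc_def
   dd_add[OF xy CC.H_diff[OF tA CC.H_sgv[OF tB]] CC.H_sgv[OF tC]]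
   dd_diff[OF xy tA CC.H_sgv[OF tB]] dd_sgv[OF xy tB] dd_sgv[OF xy tC] dd_bdc[OF xy phi]
   dd_mulc[OF xy xy(2) phi r(2)] 
  using dd_mulc[OF xy(1) xy r(1) phi]
  by (cases "even p") (simp_all add: dr[OF xy(1)] dr[OF xy(2)] sgv_def)
 have 2: "df x y (p + 1) (df x y p phi) = dd x y (p + 1) (dd x y p phi) + dd x y (p + 1) (dl x y p phi)
   + dl x y (p + 1) (dd x y p phi) + dl x y (p + 1) (dl x y p phi)"
  unfolding difc_def dd_add[OF xy dd_H[OF xy phi] dl_H[OF xy phi]] dl_add[OF xy dd_H[OF xy phi] dl_H[OF xy phi]]
  by (simp only: ab_semigroup_add_class.add_ac)
 show ?thesis
  unfolding 2 1 dl_dl[OF xy phi lin]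
  unfolding dlc_def
  by (cases "even p") (simp_all add: sgv_def)
qed

end

section \<open>The differential of the twisted tensor product\<close>

lemma bd_nonempty: "(\<And>xs. xs \<noteq> [] ==> G xs = 0) ==> bd D G gs = 0"
proof (induction gs arbitrary: G)
 case (Cons g gs)
 thus ?case by (auto split: list.split)
qed simp

context dg_category
begin

lemma path_dif:
 assumes "path C d gs" "j < length gs"
 shows "path C d (gs[j := Dif C (gs ! j)])" "pend C d (gs[j := Dif C (gs ! j)]) = pend C d gs"
  "wt C (gs[j := Dif C (gs ! j)]) = wt C gs + 1"
 using assms by (induction gs arbitrary: d j) (auto simp: dif_arr split: nat.split)

lemma path_merge:
 assumes "path C d gs" "i + 1 < length gs"
 defines "xs \<equiv> take i gs @ [Comp C (gs ! (i + 1)) (gs ! i)] @ drop (i + 2) gs"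
 shows "path C d xs" "pend C d xs = pend C d gs" "wt C xs = wt C gs + 1"
proof -
 let ?a = "take i gs" and ?g = "gs ! i" and ?g' = "gs ! (i + 1)" and ?b = "drop (i + 2) gs"
 have "gs = ?a @ ?g # ?g' # ?b"
  using assms(2) by (metis Cons_nth_drop_Suc Suc_eq_plus1 Suc_lessD add_2_eq_Suc' append_take_drop_id)
 hence *: "path C d (?a @ ?g # ?g' # ?b)" "pend C d gs = pend C d (?a @ ?g # ?g' # ?b)"
  "wt C gs = wt C (?a @ ?g # ?g' # ?b)"
  using assms(1) by simp_all
 show "path C d xs" "pend C d xs = pend C d gs" "wt C xs = wt C gs + 1"
  unfolding *(2,3) using *(1) by (auto simp: xs_def comp_arr)
qed

end

context coch
begin

text \<open>The twisting cochain is supported on length one, so only the cut in front of the last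
  letter survives.\<close>

lemma mulc_rho_snoc:
 assumes "y \<in> Ob'" "phi \<in> Hc x y p" "path D d (as @ [g])"
 shows "mc p (rh y) phi d (as @ [g]) = sgv (p * (Deg D g - 1)) (mul (p + wt D as) (R y g) (phi d as))"
proof -
 have pa: "path D d as" "path D (pend D d as) [g]" "path D (Cod D g) []" using assms(3) by auto
 have 1: "rh y z [] = 0" for z by (simp add: rho_def)
 have 2: "cut (\<lambda>a1 a2. sgv (p * wt D (a2 @ [g])) (mul (p + wt D a1) (rh y (pend D d a1) (a2 @ [g])) (phi d a1))) as
   = sgv (p * wt D [g]) (mul (p + wt D as) (rh y (pend D d as) [g]) (phi d as))"
 proof (subst cut_fst, goal_cases)
  case s: (1 a1 a2)
  have "path D d a1" using pa(1) s by auto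
  from T.mul_zerol[OF cochsD[OF assms(2) this]] s(2)
  show ?case
   by (simp add: rho_def)
 qed simp
 show ?thesis
  unfolding mulc_path[OF assms(3)] cut_snoc 2 1 using T.mul_zerol[OF cochsD[OF assms(2,3)]] pa(2)
  by (simp add: rho_def)
qed

lemma mulc_rho_cons:
 assumes "x \<in> Ob'" "phi \<in> Hc x y p" "path D d (g # gs)"
 shows "mc 1 phi (rh x) d (g # gs) = sgv (wt D gs) (mul (Deg D g) (phi (Cod D g) gs) (R x g))"
proof -
 have pa: "g \<in> arr D" "Dom D g = d" "path D (Cod D g) gs" using assms(3) by auto
 have 1: "cut (\<lambda>as bs. sgv (1 * wt D bs) (mul (1 + wt D (g # as)) (phi (pend D d (g # as)) bs) (rh x d (g # as)))) gs
   = sgv (1 * wt D gs) (mul (1 + wt D [g]) (phi (pend D d [g]) gs) (rh x d [g]))"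
 proof (subst cut_snd, goal_cases)
  case s: (1 as bs)
  have "path D (pend D (Cod D g) as) bs" using pa(3) s by auto
  from T.mul_zeror[OF cochsD[OF assms(2) this]] s(2)
  show ?case
   by (simp add: rho_def)
 qed simp
 have "rh x d [] = 0" by (simp add: rho_def)
 thus ?thesis
  unfolding mulc_path[OF assms(3)] cut.simps 1
  using pa T.mul_zeror[OF cochsD[OF assms(2,3)]] by (simp add: rho_def D.arr_typed)
qed

lemma dl_Nil:
 assumes "x \<in> Ob'" "y \<in> Ob'" "phi \<in> Hc x y p" "d \<in> Obj D"
 shows "dl x y p phi d [] = 0"
proof -
 have p: "path D d []" using assms(4) by simp
 show ?thesis
  using T.mul_zerol[OF cochsD[OF assms(3) p]] T.mul_zeror[OF cochsD[OF assms(3) p]] p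
  by (simp add: dlc_def plus_fun_def fun_diff_def sgv_fun mulc_def rho_def bdc_def)
qed

text \<open>The shape of the formula for \<open>d\<close> of an epsilon: the two outer compositions
  and the inner sum over differentials and compositions of arguments.\<close>

lemma dl_expand:
 assumes "x \<in> Ob'" "y \<in> Ob'" "phi \<in> Hc x y p" "path D d gs" "gs \<noteq> []"
 shows "dl x y p phi d gs =
  sgv (p * (Deg D (last gs) - 1)) (mul (p + wt D (butlast gs)) (R y (last gs)) (phi d (butlast gs)))
  - sgv (p + wt D (tl gs)) (mul (Deg D (hd gs)) (phi (Cod D (hd gs)) (tl gs)) (R x (hd gs)))
  + sgv p (bd D (phi d) gs)"
proof -
 have 1: "mc p (rh y) phi d gs = sgv (p * (Deg D (last gs) - 1)) (mul (p + wt D (butlast gs)) (R y (last gs)) (phi d (butlast gs)))"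
  using mulc_rho_snoc[OF assms(2,3), of d "butlast gs" "last gs"] assms(4,5) by simp
 have 2: "mc 1 phi (rh x) d gs = sgv (wt D (tl gs)) (mul (Deg D (hd gs)) (phi (Cod D (hd gs)) (tl gs)) (R x (hd gs)))"
  using mulc_rho_cons[OF assms(1,3), of d "hd gs" "tl gs"] assms(4,5) by simp
 show ?thesis
  unfolding dlc_def plus_fun_def fun_diff_def sgv_fun 1 2 bdc_def using assms(4) by simp
qed

text \<open>The two outer terms are the same twisting cochain with opposite signs, and the bar
  differential never produces the empty list, on which the unit is supported.\<close>

lemma dl_idc:
 assumes "x \<in> Ob'"
 shows "dl x x 0 (idc D idn (Ph x)) = 0"
proof -
 have "bdc D (idc D idn (Ph x)) = 0"
  by (intro ext) (simp add: bdc_def bd_nonempty idc_def)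
 thus ?thesis
  using CC.mul_idr[OF rho_H[OF assms]] CC.mul_idl[OF rho_H[OF assms]] by (simp add: dlc_def)
qed

end

lemma sum_list_sgv: "sgv n (\<Sum>x\<leftarrow>xs. f x) = (\<Sum>x\<leftarrow>xs. sgv n (f x))"
 by (induction xs) (simp_all add: sgv_add)

context tensor_pair
begin

sublocale G: graded_category K T by (rule T_graded)

sublocale V: vgc K "Obj T" "rH T" "rsc T" "\<lambda>_. rmul T" "\<lambda>x. emb T (Idn T x)"
 by (rule G.real_vgc)

definition ev :: "('k, 'c, 'f, 'd, 'g) tterm => ('c \<times> 'd, ('k, 'c, 'f, 'd, 'g) tterm set) dual" where
 "ev t = emb T (clt t)"

lemma cls_mor': "wft t ==> clt t \<in> mor T (dmt t) (cdt t) (dgt t)"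
 by (rule cls_mor) simp_all

lemma T_obj: "wft t ==> dmt t \<in> Obj T" "wft t ==> cdt t \<in> Obj T"
 using tdom_obj tcod_obj by simp_all

lemma ev_H: "wft t ==> ev t \<in> rH T (dmt t) (cdt t) (dgt t)"
 unfolding ev_def by (rule G.rH_I[OF T_obj cls_mor'])

lemma ev_zero: "x \<in> Obj T ==> y \<in> Obj T ==> ev (TZero x y n) = 0"
 unfolding ev_def zero_T[symmetric] by (rule G.emb_zero)

lemma ev_add:
 assumes "wft s" "wft t" "part s t"
 shows "ev (TAdd s t) = ev s + ev t"
 using G.emb_add[OF T_obj[OF assms(1)] cls_mor'[OF assms(1)], of "clt t"] cls_mor'[OF assms(2)] assms(3)
 by (simp add: ev_def add_T[OF assms] tpar_def)

lemma ev_scale: "wft t ==> a \<in> carrier K ==> ev (TScale a t) = rsc T a (ev t)"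
 using G.rsc_emb[OF T_obj _ cls_mor', of t a] by (simp add: ev_def smult_T)

lemma ev_comp:
 assumes "wft s" "wft t" "dmt s = cdt t"
 shows "ev (TComp s t) = rmul T (ev s) (ev t)"
 using G.rmul_emb[OF T_obj[OF assms(2)] T_obj(2)[OF assms(1)] cls_mor'[OF assms(2)], of "clt s"]
  cls_mor'[OF assms(1)] assms(3)
 by (simp add: ev_def Comp_T[OF assms])

lemma ev_id: "ev (TId x) = emb T (Idn T x)"
 by (simp add: ev_def Idn_T)

lemma ev_rel: "relt s t ==> ev s = ev t"
 unfolding ev_def by (simp add: cls_eqI)

text \<open>For parallel expressions, an equation in the group type is an instance of the
  congruence. Relations between expressions can thus be proved by computing values.\<close>

lemma ev_inj:
 assumes "wft s" "wft t" "part s t" "ev s = ev t"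
 shows "relt s t"
 using G.emb_inj[OF T_obj[OF assms(1)] cls_mor'[OF assms(1)], of "clt t"] cls_mor'[OF assms(2)] assms(3,4)
  cls_eq_iff[OF assms(1)] by (simp add: ev_def tpar_def)

lemma ev_tsum:
 assumes "x \<in> Obj T" "y \<in> Obj T"
  "\<And>t. t \<in> set ts ==> wft t \<and> dmt t = x \<and> cdt t = y \<and> dgt t = n"
 shows "ev (tsum x y n ts) = (\<Sum>t\<leftarrow>ts. ev t)"
 using assms(3)
proof (induction ts)
 case Nil
 show ?case using ev_zero[OF assms(1,2)] by (simp add: tsum_def)
next
 case (Cons t ts)
 have t: "wft t" "dmt t = x" "cdt t = y" "dgt t = n" using Cons.prems by auto
 have s: "wft (tsum x y n ts) \<and> dmt (tsum x y n ts) = x \<and>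
  cdt (tsum x y n ts) = y \<and> dgt (tsum x y n ts) = n"
  by (rule tsum_typed) (use assms(1,2) Cons.prems in auto)
 have "ev (tsum x y n (t # ts)) = ev (TAdd t (tsum x y n ts))" by (simp add: tsum_def)
 also have "\<dots> = ev t + ev (tsum x y n ts)" by (rule ev_add) (use t s in "simp_all add: tpar_def")
 finally show ?case using Cons by simp
qed

lemma rH_ev:
 assumes "v \<in> rH T x y n" "x \<in> Obj T" "y \<in> Obj T"
 obtains t where "v = ev t" "wft t" "dmt t = x" "cdt t = y" "dgt t = n"
 using assms(1)
proof (rule G.rH_E)
 fix f assume *: "f \<in> mor T x y n" "v = emb T f"
 thus ?thesis using that unfolding carrier_T ev_def by blast
qed (use assms(2,3) in simp)

text \<open>The universal cochains \<open>f \<mapsto> \<epsilon>(f; -)\<close> and the universal functors \<open>g \<mapsto> id\<^sub>c \<otimes> g\<close>.\<close>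

definition Lu :: "'f => 'd => 'g list => ('c \<times> 'd, ('k, 'c, 'f, 'd, 'g) tterm set) dual" where
 "Lu f d gs = (if path D d gs then ev (TE0 f gs (pend D d gs)) else 0)"

definition Ru :: "'c => 'g => ('c \<times> 'd, ('k, 'c, 'f, 'd, 'g) tterm set) dual" where
 "Ru c g = ev (TR c g)"

lemma Ru_add:
 assumes "c \<in> Obj C" "u \<in> Obj D" "v \<in> Obj D" "g \<in> mor D u v n" "g' \<in> mor D u v n"
 shows "Ru c (madd D u v n g g') = Ru c g + Ru c g'"
 using ev_rel[OF trel.R_add[OF assms(2-5,1)]] ev_add[of "TR c g" "TR c g'"] assms
  D.mor_DCD[OF assms(2-4)] D.mor_DCD[OF assms(2,3,5)] D.arrI[OF assms(2-4)] D.arrI[OF assms(2,3,5)]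
 by (simp add: Ru_def tpar_def)

lemma Ru_scale:
 assumes "c \<in> Obj C" "u \<in> Obj D" "v \<in> Obj D" "g \<in> mor D u v n" "a \<in> carrier K"
 shows "Ru c (mscale D u v n a g) = rsc T a (Ru c g)"
 using ev_rel[OF trel.R_scale[OF assms(2-5,1)]] ev_scale[of "TR c g" a] assms D.arrI[OF assms(2-4)]
 by (simp add: Ru_def)

sublocale N: coch K D "Obj T" "rH T" "rsc T" "\<lambda>_. rmul T" "\<lambda>x. emb T (Idn T x)" "Obj C" Pair Ru
proof (standard, goal_cases)
 show "\<And>y d. y \<in> Obj C ==> d \<in> Obj D ==> (y, d) \<in> Obj T" by simp
 next case that: (2 y g) show ?case
  using ev_H[of "TR y g"] that by (simp add: Ru_def)
 next case *: (3 y u v g n g' a b) show ?case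
 proof -
  interpret M: module K "Mor D u v n" using * by simp
  show ?thesis using * by (simp add: Ru_add Ru_scale)
 qed
 next case that: (4 y g g') show ?case
  using ev_rel[OF trel.R_comp[OF that(2-4,1)]] ev_comp[of "TR y g'" "TR y g"] that by (simp add: Ru_def)
 next case that: (5 y d) show ?case
  using ev_rel[OF trel.R_id[OF that]] by (simp add: Ru_def ev_id)
qed

lemma Lu_H:
 assumes "f \<in> arr C"
 shows "Lu f \<in> N.Hc (Dom C f) (Cod C f) (Deg C f)"
proof (rule N.cochsI, goal_cases)
 case p: (1 d gs)
 show ?case
  using ev_H[OF TE0_typed(1)[OF assms p]] TE0_typed(2-4)[OF assms p] by (simp add: Lu_def p)
qed (simp add: Lu_def)

lemma Lu_H': "x \<in> Obj C ==> y \<in> Obj C ==> f \<in> mor C x y n ==> Lu f \<in> N.Hc x y n"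
 using Lu_H[OF C.arrI] C.mor_DCD by metis

lemma Lu_path: "path D d gs ==> Lu f d gs = ev (TE0 f gs (pend D d gs))"
 by (simp add: Lu_def)

lemma Lu_add:
 assumes "x \<in> Obj C" "y \<in> Obj C" "f \<in> mor C x y n" "f' \<in> mor C x y n"
 shows "Lu (madd C x y n f f') = Lu f + Lu f'"
proof (intro ext, goal_cases)
 case (1 d gs)
 note t = C.mor_DCD[OF assms(1-3)] C.mor_DCD[OF assms(1,2,4)] C.arrI[OF assms(1-3)] C.arrI[OF assms(1,2,4)]
 show ?case
 proof (cases "path D d gs")
  case p: True
  note ty = TE0_typed[OF t(7) p] TE0_typed[OF t(8) p]
  have "relt (TE0 (madd C x y n f f') gs (pend D d gs))
    (TAdd (TE0 f gs (pend D d gs)) (TE0 f' gs (pend D d gs)))"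
  proof (cases "gs = []")
   case True
   thus ?thesis using trel.L_add[OF assms, of d] p by (simp add: TE0_def)
  next
   case False
   thus ?thesis using trel.E_add_left[OF assms conjunct1[OF D.path_chain[OF p False]]] by (simp add: TE0_def)
  qed
  from ev_rel[OF this] ev_add[OF ty(1,5)] ty t show ?thesis by (simp add: Lu_path[OF p] tpar_def)
 qed (simp add: Lu_def)
qed

lemma Lu_scale:
 assumes "x \<in> Obj C" "y \<in> Obj C" "f \<in> mor C x y n" "a \<in> carrier K"
 shows "Lu (mscale C x y n a f) = scc (rsc T) a (Lu f)"
proof (intro ext, goal_cases)
 case (1 d gs)
 show ?case
 proof (cases "path D d gs")
  case p: True
  have "relt (TE0 (mscale C x y n a f) gs (pend D d gs)) (TScale a (TE0 f gs (pend D d gs)))"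
  proof (cases "gs = []")
   case True
   thus ?thesis using trel.L_scale[OF assms, of d] p by (simp add: TE0_def)
  next
   case False
   thus ?thesis using trel.E_scale_left[OF assms conjunct1[OF D.path_chain[OF p False]]] by (simp add: TE0_def)
  qed
  from ev_rel[OF this] ev_scale[OF TE0_typed(1)[OF C.arrI[OF assms(1-3)] p] assms(4)]
  show ?thesis by (simp add: Lu_path[OF p] scc_def)
 qed (simp add: Lu_def scc_def)
qed

lemma Lu_zero:
 assumes "x \<in> Obj C" "y \<in> Obj C"
 shows "Lu \<zero>\<^bsub>Mor C x y n\<^esub> = 0"
proof -
 interpret M: module K "Mor C x y n" using assms by simp
 show ?thesis using Lu_add[OF assms M.zero_closed M.zero_closed] by simp
qed

lemma Lu_id:
 assumes "c \<in> Obj C"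
 shows "Lu (Idn C c) = idc D (\<lambda>x. emb T (Idn T x)) (Pair c)"
proof (intro ext, goal_cases)
 case (1 d gs)
 show ?case
 proof (cases "path D d gs")
  case p: True
  show ?thesis
  proof (cases "gs = []")
   case True
   thus ?thesis
    using ev_rel[OF trel.L_id[OF assms, of d]] p by (simp add: Lu_def TE0_def idc_def ev_id)
  next
   case False
   note ch = D.path_chain[OF p False]
   have w: "wft (TE (Idn C c) gs)" using ch C.idn_arr[OF assms] by simp
   show ?thesis
    using ev_rel[OF trel.E_id_left[OF assms conjunct1[OF ch] HOL.refl]]
     ev_zero[OF T_obj[OF w]] False p by (simp add: Lu_def TE0_def idc_def)
  qed
 next
  case False
  thus ?thesis by (auto simp: Lu_def idc_def)
 qed
qed

lemma E_comp_ev: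
 assumes "f1 \<in> arr C" "f2 \<in> arr C" "Cod C f1 = Dom C f2" "path D d gs" "gs \<noteq> []"
  and F: "\<And>m. F m = TScale (sg K (Deg C f1 * wt D (drop m gs)))
           (TComp (TE0 f2 (drop m gs) (Cod D (last gs)))
              (TE0 f1 (take m gs) (Dom D (hd gs))))"
 shows "F m = TScale (sg K (Deg C f1 * wt D (drop m gs)))
   (TComp (TE0 f2 (drop m gs) (pend D (pend D d (take m gs)) (drop m gs)))
    (TE0 f1 (take m gs) (pend D d (take m gs))))"
proof -
 have 1: "pend D (pend D d (take m gs)) (drop m gs) = Cod D (last gs)"
  using pend_last[OF assms(5)] by (metis append_take_drop_id pend_append)
 have 2: "TE0 f1 (take m gs) (Dom D (hd gs)) = TE0 f1 (take m gs) (pend D d (take m gs))"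
  using D.path_chain[OF assms(4,5)] assms(5) by (auto simp: TE0_def)
 show ?thesis unfolding F 1 2 ..
qed

text \<open>The defining relation for a composed first argument, read as multiplicativity for the
  cup product; for no arguments it is \<open>L_comp\<close>.\<close>

lemma Lu_comp:
 assumes f: "f1 \<in> arr C" "f2 \<in> arr C" "Cod C f1 = Dom C f2"
 shows "Lu (Comp C f2 f1) = mulc D (\<lambda>_. rmul T) (Deg C f1) (Lu f2) (Lu f1)"
proof (intro ext, goal_cases)
 case (1 d gs)
 show ?case
 proof (cases "path D d gs")
  case p: True
  have split: "ev (TComp (TE0 f2 bs (pend D (pend D d as) bs)) (TE0 f1 as (pend D d as)))
    = rmul T (Lu f2 (pend D d as) bs) (Lu f1 d as)" if "as @ bs = gs" for as bs
  proof -
   have pa: "path D d as" "path D (pend D d as) bs" using p that by auto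
   show ?thesis
    using ev_comp[OF TE0_typed(1)[OF f(2) pa(2)] TE0_typed(1)[OF f(1) pa(1)]]
     TE0_typed[OF f(2) pa(2)] TE0_typed[OF f(1) pa(1)] f(3) pa by (simp add: Lu_path)
  qed
  show ?thesis
  proof (cases "gs = []")
   case True
   thus ?thesis
    using split[of "[]" "[]"] ev_rel[OF trel.L_comp[OF f, of d]] p
    by (simp add: mulc_def Lu_def TE0_def)
  next
   case False
   note ch = D.path_chain[OF p False]
   let ?t = "TE (Comp C f2 f1) gs"
   define F :: "nat => ('k, 'c, 'f, 'd, 'g) tterm" where "F m = TScale (sg K (Deg C f1 * wt D (drop m gs)))
           (TComp (TE0 f2 (drop m gs) (Cod D (last gs)))
              (TE0 f1 (take m gs) (Dom D (hd gs))))" for m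
   have w: "wft ?t" using ch C.comp_arr[OF f] by simp
   have ty: "wft u \<and> dmt u = dmt ?t \<and> cdt u = cdt ?t \<and> dgt u = dgt ?t"
    if "u \<in> set (map F [0..<Suc (length gs)])" for u
    using that E_comp_typed[OF f conjunct1[OF ch] HOL.refl HOL.refl HOL.refl HOL.refl] f
    unfolding F_def by (auto simp: sg_closed C.comp_arr simp del: upt_Suc twf.simps(8) tdom.simps(8) tcod.simps(8) tdeg.simps(8))
   have "relt ?t (tsum (dmt ?t) (cdt ?t) (dgt ?t) (map F [0..<Suc (length gs)]))"
    using trel.E_comp[OF f conjunct1[OF ch] HOL.refl] unfolding F_def .
   from ev_rel[OF this] ev_tsum[OF T_obj[OF w] ty, of "map F [0..<Suc (length gs)]"]
   have "ev ?t = (\<Sum>m\<leftarrow>[0..<Suc (length gs)]. ev (F m))" by (simp add: comp_def del: upt_Suc)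
   also have "\<dots> = (\<Sum>m\<leftarrow>[0..<Suc (length gs)]. sgv (Deg C f1 * wt D (drop m gs))
     (rmul T (Lu f2 (pend D d (take m gs)) (drop m gs)) (Lu f1 d (take m gs))))"
   proof (intro arg_cong[where f = sum_list] map_cong HOL.refl, goal_cases)
    case (1 m)
    let ?u = "TComp (TE0 f2 (drop m gs) (pend D (pend D d (take m gs)) (drop m gs)))
    (TE0 f1 (take m gs) (pend D d (take m gs)))"
    note q = D.path_take_drop[OF p, of m]
    have wu: "wft ?u"
     using TE0_typed[OF f(2) q(2)] TE0_typed[OF f(1) q(1)] f(3) by simp
    have "ev (F m) = ev (TScale (sg K (Deg C f1 * wt D (drop m gs))) ?u)"
     by (simp only: E_comp_ev[OF f p False F_def])
    also have "\<dots> = sgv (Deg C f1 * wt D (drop m gs)) (ev ?u)"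
     using ev_scale[OF wu sg_closed] V.sc_sg[OF ev_H[OF wu]] by simp
    finally show ?case
     using split[of "take m gs" "drop m gs"] by simp
   qed
   finally show ?thesis
    using p False by (simp add: Lu_path TE0_def mulc_def cut_index del: upt_Suc)
  qed
 qed (simp add: Lu_def mulc_def)
qed

lemma Lu_lin:
 assumes f: "f \<in> arr C"
 shows "linc K D (rsc T) (Lu f)"
 unfolding linc_def ling_def
proof (intro allI impI, goal_cases)
 case *: (1 d as bs x y u v n a b)
 interpret M: module K "Mor D u v n" using * by simp
 have sc: "Lu f d (as @ (mscale D u v n a x) # bs) = rsc T a (Lu f d (as @ x # bs))"
  if *: "x \<in> mor D u v n" "a \<in> carrier K" and p: "path D d (as @ x # bs)" for x a
 proof -
  have ax: "mscale D u v n a x \<in> mor D u v n" using * by simp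
  note m = N.mor_par(1)[OF \<open>u \<in> Obj D\<close> \<open>v \<in> Obj D\<close> ax *(1), of d as bs]
  have ch: "chain D (as @ x # bs)" using D.path_chain[OF p] by simp
  have w: "wft (TE f (as @ x # bs))" using ch f by simp
  show ?thesis
   using ev_rel[OF trel.E_scale_right[OF f \<open>u \<in> Obj D\<close> \<open>v \<in> Obj D\<close> * ch]] ev_scale[OF w *(2)] p m
   by (simp add: Lu_def TE0_def del: D.path_append)
 qed
 have add: "Lu f d (as @ (madd D u v n x y) # bs) = Lu f d (as @ x # bs) + Lu f d (as @ y # bs)"
  if *: "x \<in> mor D u v n" "y \<in> mor D u v n" and p: "path D d (as @ x # bs)" for x y
 proof -
  have ax: "madd D u v n x y \<in> mor D u v n" using * by simp
  note m = N.mor_par(1,2)[OF \<open>u \<in> Obj D\<close> \<open>v \<in> Obj D\<close> ax *(1), of d as bs]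
   N.mor_par(3)[OF \<open>u \<in> Obj D\<close> \<open>v \<in> Obj D\<close> ax *(1), of as bs]
   N.mor_par(1,2)[OF \<open>u \<in> Obj D\<close> \<open>v \<in> Obj D\<close> *, of d as bs]
   N.mor_par(3)[OF \<open>u \<in> Obj D\<close> \<open>v \<in> Obj D\<close> *, of as bs]
  have p': "path D d (as @ y # bs)" using m(4) p by blast
  have ch: "chain D (as @ x # bs)" "chain D (as @ y # bs)" using D.path_chain[OF p] D.path_chain[OF p'] by simp_all
  have w: "wft (TE f (as @ x # bs))" "wft (TE f (as @ y # bs))" using ch f by simp_all
  have "Cod D (last (as @ x # bs)) = Cod D (last (as @ y # bs))"
   using m(5) pend_last[of "as @ x # bs" D d] pend_last[of "as @ y # bs" D d]
   by (metis list.distinct(1) append_is_Nil_conv)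
  hence "part (TE f (as @ x # bs)) (TE f (as @ y # bs))"
   using m(6) conjunct2[OF D.path_chain[OF p]] conjunct2[OF D.path_chain[OF p']] unfolding tpar_def
   by (simp only: tdom.simps tcod.simps tdeg.simps append_is_Nil_conv list.distinct simp_thms)
  from ev_add[OF w this] show ?thesis
   using ev_rel[OF trel.E_add_right[OF f \<open>u \<in> Obj D\<close> \<open>v \<in> Obj D\<close> * ch(1)]] p p' m(1)
   by (simp add: Lu_def TE0_def del: D.path_append)
 qed
 have p2: "path D d (as @ (mscale D u v n a x) # bs)" "path D d (as @ y # bs)"
  using N.mor_par(1)[OF *(1,2) M.smult_closed[OF *(5,3)] *(3), of d as bs]
   N.mor_par(1)[OF *(1-4), of d as bs] *(7) by blast+
 show ?case
  using * by (simp only: add[OF _ _ p2(1)] sc[OF _ _ *(7)] sc[OF _ _ p2(2)] M.smult_closed)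
qed

lemma Lu_red:
 assumes f: "f \<in> arr C"
 shows "redc D (Lu f)"
 unfolding redc_def
proof (intro allI impI, goal_cases)
 case (1 d as bs c)  note c = 1(1) and p = 1(2)
 have ch: "chain D (as @ Idn D c # bs)" using D.path_chain[OF p] by simp
 have w: "wft (TE f (as @ Idn D c # bs))" using ch f by simp
 have "Idn D c \<in> set (as @ Idn D c # bs)" by simp
 from ev_rel[OF trel.E_id_right[OF f ch c this HOL.refl]] ev_zero[OF T_obj[OF w]]
 show ?case using p by (simp add: Lu_def TE0_def)
qed

text \<open>The value that \<open>d\<close> must take on the epsilons of \<open>f\<close>: the
  equation between the total differential of \<open>Lu f\<close> and \<open>Lu (Dif C f)\<close>,
  solved for its internal part. It makes sense before \<open>d\<close> is known to be well defined
  on classes.\<close>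

definition Ld :: "'f => 'd => 'g list => ('c \<times> 'd, ('k, 'c, 'f, 'd, 'g) tterm set) dual" where
 "Ld f = Lu (Dif C f) - N.dl (Dom C f) (Cod C f) (Deg C f) (Lu f)"

lemma Ld_H:
 assumes "f \<in> arr C"
 shows "Ld f \<in> N.Hc (Dom C f) (Cod C f) (Deg C f + 1)"
proof -
 note t = C.arr_typed[OF assms] and d = C.dif_arr[OF assms]
 show ?thesis unfolding Ld_def
  using N.CC.H_diff[OF _ N.dl_H[OF t(1,2) Lu_H[OF assms]], of "Lu (Dif C f)"] Lu_H[OF d(1)] d by simp
qed

lemma tdif_TE_wf:
 assumes f: "f \<in> arr C" and p: "path D d gs" and ne: "gs \<noteq> []"
 shows "wft (dft (TE f gs)) \<and> dmt (dft (TE f gs)) = (Dom C f, d)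
  \<and> cdt (dft (TE f gs)) = (Cod C f, pend D d gs)
  \<and> dgt (dft (TE f gs)) = Deg C f + wt D gs + 1"
proof -
 note ch = D.path_chain[OF p ne]
 note ft = C.arr_typed[OF f] and fd = C.dif_arr[OF f]
 let ?t = "TE f gs" and ?p = "Deg C f" and ?n = "length gs"
 let ?x = "(Dom C f, d)" and ?y = "(Cod C f, pend D d gs)" and ?k = "?p + wt D gs + 1"
 have w: "wft ?t" using ch f by simp
 have xy: "dmt ?t = ?x" "cdt ?t = ?y" "dgt ?t + 1 = ?k"
  using ch pend_last[OF ne, of D d] by simp_all
 define A :: "nat => ('k, 'c, 'f, 'd, 'g) tterm" where "A j = TScale (sg K (?p + wt D (drop (j + 1) gs) + 1)) (TE f (gs[j := Dif D (gs ! j)]))" for j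
 define B1 :: "('k, 'c, 'f, 'd, 'g) tterm" where "B1 = TScale (sg K (?p * Deg D (last gs) + ?p))
        (TComp (TR (Cod C f) (last gs)) (TE0 f (butlast gs) (Dom D (hd gs))))"
 define B2 :: "('k, 'c, 'f, 'd, 'g) tterm" where "B2 = TScale (sg K (?p + wt D (tl gs) + 1))
        (TComp (TE0 f (tl gs) (Cod D (last gs))) (TR (Dom C f) (hd gs)))"
 define B3 :: "nat => ('k, 'c, 'f, 'd, 'g) tterm" where "B3 i = TScale (sg K (?p + wt D (drop (i + 1) gs)))
           (TE f (take i gs @ [Comp D (gs ! (i + 1)) (gs ! i)] @ drop (i + 2) gs))" for i
 define ok where "ok u \<longleftrightarrow> wft u \<and> dmt u = ?x \<and> cdt u = ?y \<and> dgt u = ?k" for u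
 have okS: "ok (TScale a u) \<longleftrightarrow> a \<in> carrier K \<and> ok u" for a u by (auto simp: ok_def)
 have TEok: "ok (TE f' xs)"
  if "f' \<in> arr C" "Dom C f' = Dom C f" "Cod C f' = Cod C f" "path D d xs" "pend D d xs = pend D d gs"
   "xs \<noteq> []" "Deg C f' + wt D xs = ?k" for f' xs
  using that D.path_chain[OF that(4,6)] pend_last[OF that(6), of D d] by (auto simp: ok_def)
 have 1: "ok (TE (Dif C f) gs)"
  using TEok[of "Dif C f" gs] fd p ne by auto
 have 2: "ok (A j)" if "j < ?n" for j
  unfolding A_def okS using D.path_dif[OF p that] f ne sg_closed by (intro conjI TEok) auto
 have 3: "ok B1"
 proof -
  have gs: "gs = butlast gs @ [last gs]" using ne by simp
  hence pb: "path D d (butlast gs)" "last gs \<in> arr D" "pend D d (butlast gs) = Dom D (last gs)"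
    "pend D d gs = Cod D (last gs)" "wt D gs = wt D (butlast gs) + (Deg D (last gs) - 1)"
   using p by (metis D.path_append path.simps(2) pend.simps(1,2) pend_append wt_simps(1,2,3) add.right_neutral)+
  have e: "TE0 f (butlast gs) (Dom D (hd gs)) = TE0 f (butlast gs) (pend D d (butlast gs))"
   using ch by (auto simp: TE0_def)
  show ?thesis unfolding B1_def okS e using TE0_typed[OF f pb(1)] pb ft sg_closed by (simp add: ok_def)
 qed
 have 4: "ok B2"
 proof -
  have gs: "gs = hd gs # tl gs" using ne by simp
  hence pb: "path D (Cod D (hd gs)) (tl gs)" "hd gs \<in> arr D" "Dom D (hd gs) = d"
    "pend D (Cod D (hd gs)) (tl gs) = Cod D (last gs)" "wt D gs = (Deg D (hd gs) - 1) + wt D (tl gs)"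
   using p pend_last[OF ne, of D d] by (metis path.simps(2) pend.simps(2) wt_simps(2))+
  show ?thesis unfolding B2_def okS
   using TE0_typed[OF f pb(1), unfolded pb(4)] pb ft pend_last[OF ne, of D d] sg_closed by (simp add: ok_def)
 qed
 have 5: "ok (B3 i)" if "i < ?n - 1" for i
  unfolding B3_def okS using D.path_merge[OF p, of i] that f sg_closed by (intro conjI TEok) auto
 define ts where "ts = [TE (Dif C f) gs] @ map A [0..<?n] @ map (TScale (m1 K)) ([B1, B2] @ map B3 [0..<?n - 1])"
 have tdif: "dft ?t = tsum ?x ?y ?k ts"
  unfolding tdif.simps Let_def ts_def xy A_def B1_def B2_def B3_def by (simp only:)
 have okts: "ok u" if "u \<in> set ts" for u
  using that 1 2 3 4 5 unfolding ts_def by (auto simp: okS)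
 have o: "?x \<in> Obj T" "?y \<in> Obj T" using T_obj[OF w] unfolding xy .
 show ?thesis
  unfolding tdif by (rule tsum_typed) (use o okts in "auto simp: ok_def")
qed

end

section \<open>The universal property of the twisted tensor product\<close>

text \<open>Evaluation of expressions in arbitrary data \<open>Lc\<close>, \<open>Rc\<close>. The
  degree handed to \<open>mul\<close> is that of the factor applied first.\<close>

primrec interp where
 "interp C D sc mul idn ob Lc Rc (TZero x y n) = 0"
| "interp C D sc mul idn ob Lc Rc (TId x) = idn (ob (fst x) (snd x))"
| "interp C D sc mul idn ob Lc Rc (TL f d) = Lc f d []"
| "interp C D sc mul idn ob Lc Rc (TR c g) = Rc c g"
| "interp C D sc mul idn ob Lc Rc (TE f gs) = Lc f (Dom D (hd gs)) gs"
| "interp C D sc mul idn ob Lc Rc (TAdd s t) = interp C D sc mul idn ob Lc Rc s + interp C D sc mul idn ob Lc Rc t"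
| "interp C D sc mul idn ob Lc Rc (TScale a t) = sc a (interp C D sc mul idn ob Lc Rc t)"
| "interp C D sc mul idn ob Lc Rc (TComp s t) =
  mul (tdeg C D t) (interp C D sc mul idn ob Lc Rc s) (interp C D sc mul idn ob Lc Rc t)"

text \<open>A functor to \<open>X\<close> is given by functors \<open>Rc c\<close> from \<open>D\<close> and by a functor \<open>Lc\<close> from \<open>C\<close> to the
 category of reduced cochains between them.\<close>

locale up = tensor_pair K C D + Y: coch K D Ob H sc mul idn "Obj C" ob Rc
 for K :: "'k ring" and C :: "('k, 'c, 'f) dgcat" and D :: "('k, 'd, 'g) dgcat"
  and Ob :: "'x set" and H :: "'x => 'x => int => 'v::ab_group_add set" and sc mul idn ob Rc +
 fixes Lc :: "'f => 'd => 'g list => 'v"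
 assumes Lc_H: "[| x \<in> Obj C; y \<in> Obj C; f \<in> mor C x y n|] ==> Lc f \<in> cochs D H (ob x) (ob y) n"
  and Lc_add: "[| x \<in> Obj C; y \<in> Obj C; f \<in> mor C x y n; f' \<in> mor C x y n|] ==>
   Lc (madd C x y n f f') = Lc f + Lc f'"
  and Lc_scale: "[| x \<in> Obj C; y \<in> Obj C; f \<in> mor C x y n; a \<in> carrier K|] ==>
   Lc (mscale C x y n a f) = scc sc a (Lc f)"
  and Lc_comp: "[| f1 \<in> arr C; f2 \<in> arr C; Cod C f1 = Dom C f2|] ==>
   Lc (Comp C f2 f1) = mulc D mul (Deg C f1) (Lc f2) (Lc f1)"
  and Lc_id: "c \<in> Obj C ==> Lc (Idn C c) = idc D idn (ob c)"
  and Lc_lin: "f \<in> arr C ==> linc K D sc (Lc f)"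
  and Lc_red: "f \<in> arr C ==> redc D (Lc f)"
begin

abbreviation "ip \<equiv> interp C D sc mul idn ob Lc Rc"

lemma ip_TE0:
 assumes "path D d gs"
 shows "ip (TE0 f gs (pend D d gs)) = Lc f d gs"
 using D.path_chain[OF assms] by (cases "gs = []") (simp_all add: TE0_def)

lemma ip_tsum: "ip (tsum x y n ts) = (\<Sum>t\<leftarrow>ts. ip t)"
 by (induction ts) (simp_all add: tsum_def)

lemma Lc_HD: "f \<in> arr C ==> Lc f \<in> cochs D H (ob (Dom C f)) (ob (Cod C f)) (Deg C f)"
 using Lc_H C.arr_typed by blast

text \<open>The formula for \<open>d\<close> of an epsilon, computed in an arbitrary target. For the
  universal data it identifies this differential with \<open>Ld\<close>; for other data it is the
  step that makes interpretations commute with differentials.\<close>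

lemma ip_tdif_TE:
 assumes f: "f \<in> arr C" and p: "path D d gs" and ne: "gs \<noteq> []"
 shows "ip (dft (TE f gs))
  = Lc (Dif C f) d gs - Y.dl (Dom C f) (Cod C f) (Deg C f) (Lc f) d gs"
proof -
 note ch = D.path_chain[OF p ne]
 note ft = C.arr_typed[OF f]
 let ?p = "Deg C f" and ?n = "length gs" and ?L = "Lc f"
 let ?H = "H (ob (Dom C f) d) (ob (Cod C f) (pend D d gs)) (?p + wt D gs + 1)"
 note L = Y.cochsD[OF Lc_HD[OF f]]
 have sg: "sc (sg K m) v = sgv m v" "sgv m v \<in> ?H" if "v \<in> ?H" for m v
  using that Y.T.sc_sg Y.T.H_sgv by auto
 have neg: "sc (m1 K) v = - v" if "v \<in> ?H" for v
  using Y.T.sc_neg_one[OF that] .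
 have LH: "Lc f d xs \<in> ?H" if "path D d xs" "pend D d xs = pend D d gs" "wt D xs = wt D gs + 1" for xs
  using L[OF that(1)] that by (simp add: algebra_simps)
 have A: "Lc f (Dom D (hd (gs[j := Dif D (gs ! j)]))) (gs[j := Dif D (gs ! j)]) = Lc f d (gs[j := Dif D (gs ! j)])"
  "Lc f d (gs[j := Dif D (gs ! j)]) \<in> ?H" if "j < ?n" for j
  using D.path_dif[OF p that] D.path_chain[OF D.path_dif(1)[OF p that]] ne LH by auto
 have B: "Lc f (Dom D (hd xs)) xs = Lc f d xs" "Lc f d xs \<in> ?H"
  if "i < ?n - 1" "xs = take i gs @ [Comp D (gs ! (i + 1)) (gs ! i)] @ drop (i + 2) gs" for i xs
  using D.path_merge[OF p, of i] D.path_chain[OF D.path_merge(1)[OF p, of i]] that LH by auto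
 have gsb: "gs = butlast gs @ [last gs]" and gst: "gs = hd gs # tl gs" using ne by simp_all
 hence pb: "path D d (butlast gs)" "last gs \<in> arr D" "pend D d (butlast gs) = Dom D (last gs)"
   "pend D d gs = Cod D (last gs)" "wt D gs = wt D (butlast gs) + (Deg D (last gs) - 1)"
  using p by (metis D.path_append path.simps(2) pend.simps(1,2) pend_append wt_simps(1,2,3) add.right_neutral)+
 from gst have pt: "path D (Cod D (hd gs)) (tl gs)" "hd gs \<in> arr D" "Dom D (hd gs) = d"
   "pend D (Cod D (hd gs)) (tl gs) = Cod D (last gs)" "wt D gs = (Deg D (hd gs) - 1) + wt D (tl gs)"
  using p pend_last[OF ne, of D d] by (metis path.simps(2) pend.simps(2) wt_simps(2))+
 define b1 where "b1 = mul (?p + wt D (butlast gs)) (Rc (Cod C f) (last gs)) (Lc f d (butlast gs))"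
 define b2 where "b2 = mul (Deg D (hd gs)) (Lc f (Cod D (hd gs)) (tl gs)) (Rc (Dom C f) (hd gs))"
 have e1: "ip (TComp (TR (Cod C f) (last gs)) (TE0 f (butlast gs) d)) = b1"
  using TE0_typed[OF f pb(1)] ip_TE0[OF pb(1), of f] ch by (auto simp: b1_def TE0_def)
 have e2: "ip (TComp (TE0 f (tl gs) (Cod D (last gs))) (TR (Dom C f) (hd gs))) = b2"
  using ip_TE0[OF pt(1), of f, unfolded pt(4)] by (simp add: b2_def)
 have b1H: "b1 \<in> ?H"
 proof -
  have n: "?p + wt D (butlast gs) + Deg D (last gs) = ?p + wt D gs + 1" using pb(5) by simp
  show ?thesis
   using Y.T.mul_H[OF L[OF pb(1), unfolded pb(3)] Y.R_H[OF ft(2) pb(2)]] unfolding n b1_def pb(4) .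
 qed
 have b2H: "b2 \<in> ?H"
 proof -
  have n: "Deg D (hd gs) + (?p + wt D (tl gs)) = ?p + wt D gs + 1" using pt(5) by simp
  show ?thesis
   using Y.T.mul_H[OF Y.R_H[OF ft(1) pt(2)] L[OF pt(1)]] unfolding n b2_def pb(4) pt(3,4) .
 qed
 have s1: "(\<Sum>j\<leftarrow>[0..<?n]. sc (sg K (?p + wt D (drop (j + 1) gs) + 1))
    (Lc f (Dom D (hd (gs[j := Dif D (gs ! j)]))) (gs[j := Dif D (gs ! j)])))
   = (\<Sum>j\<leftarrow>[0..<?n]. sgv (?p + 1 + wt D (drop (j + 1) gs)) (Lc f d (gs[j := Dif D (gs ! j)])))"
 proof (intro arg_cong[where f = sum_list] map_cong HOL.refl, goal_cases)
  case (1 j)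
  hence j: "j < ?n" by simp
  show ?case
   unfolding A(1)[OF j] sg(1)[OF A(2)[OF j]] by (rule sgv_cong) simp
 qed
 let ?m = "\<lambda>i. take i gs @ [Comp D (gs ! (i + 1)) (gs ! i)] @ drop (i + 2) gs"
 have s2: "(\<Sum>i\<leftarrow>[0..<?n - 1]. sc (m1 K) (sc (sg K (?p + wt D (drop (i + 1) gs))) (Lc f (Dom D (hd (?m i))) (?m i))))
   = - (\<Sum>i\<leftarrow>[0..<?n - 1]. sgv (?p + wt D (drop (i + 1) gs)) (Lc f d (?m i)))"
  unfolding uminus_sum_list_map comp_def
 proof (intro arg_cong[where f = sum_list] map_cong HOL.refl, goal_cases)
  case (1 i)
  hence i: "i < ?n - 1" by simp
  show ?case
   unfolding B(1)[OF i HOL.refl] sg(1)[OF B(2)[OF i HOL.refl]] by (rule neg[OF sg(2)[OF B(2)[OF i HOL.refl]]])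
 qed
 have bdi: "sgv ?p (bd D (Lc f d) gs) =
   - (\<Sum>j\<leftarrow>[0..<?n]. sgv (?p + 1 + wt D (drop (j + 1) gs)) (Lc f d (gs[j := Dif D (gs ! j)])))
   + (\<Sum>i\<leftarrow>[0..<?n - 1]. sgv (?p + wt D (drop (i + 1) gs)) (Lc f d (?m i)))"
 proof -
  have s: "sgv (?p + 1 + k) v = - sgv (?p + k) v" for k and v :: 'v
   by (simp add: sgv_def)
  show ?thesis
   unfolding bd_index sgv_add sum_list_sgv sgv_sgv s
   by (simp add: uminus_sum_list_map comp_def)
 qed
 have "ip (dft (TE f gs)) = Lc (Dif C f) d gs
   + (\<Sum>j\<leftarrow>[0..<?n]. sgv (?p + 1 + wt D (drop (j + 1) gs)) (Lc f d (gs[j := Dif D (gs ! j)])))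
   + (- sgv (?p * Deg D (last gs) + ?p) b1 + - sgv (?p + wt D (tl gs) + 1) b2
   + - (\<Sum>i\<leftarrow>[0..<?n - 1]. sgv (?p + wt D (drop (i + 1) gs)) (Lc f d (?m i))))"
  unfolding tdif.simps Let_def ip_tsum map_append map_map sum_list_append list.map comp_def
   interp.simps(5,7) e1 e2 s1 s2 sg(1)[OF b1H] sg(1)[OF b2H] neg[OF sg(2)[OF b1H]] neg[OF sg(2)[OF b2H]] pt(3)
  by (simp add: add.assoc)
 \<comment> \<open>Adding or subtracting the degree of \<open>f\<close> once has the same
   parity.\<close>
 also have "sgv (?p * Deg D (last gs) + ?p) b1 = sgv (?p * (Deg D (last gs) - 1)) b1"
  by (rule sgv_cong) (simp add: algebra_simps)
 also have "sgv (?p + wt D (tl gs) + 1) b2 = - sgv (?p + wt D (tl gs)) b2"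
  by (simp add: sgv_def)
 also have "Lc (Dif C f) d gs
   + (\<Sum>j\<leftarrow>[0..<?n]. sgv (?p + 1 + wt D (drop (j + 1) gs)) (Lc f d (gs[j := Dif D (gs ! j)])))
   + (- sgv (?p * (Deg D (last gs) - 1)) b1 + - (- sgv (?p + wt D (tl gs)) b2)
   + - (\<Sum>i\<leftarrow>[0..<?n - 1]. sgv (?p + wt D (drop (i + 1) gs)) (Lc f d (?m i))))
   = Lc (Dif C f) d gs - (sgv (?p * (Deg D (last gs) - 1)) b1 - sgv (?p + wt D (tl gs)) b2 + sgv ?p (bd D (Lc f d) gs))"
  unfolding bdi by simp
 also have "sgv (?p * (Deg D (last gs) - 1)) b1 - sgv (?p + wt D (tl gs)) b2 + sgv ?p (bd D (Lc f d) gs)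
   = Y.dl (Dom C f) (Cod C f) (Deg C f) (Lc f) d gs"
  unfolding Y.dl_expand[OF ft(1,2) Lc_HD[OF f] p ne] b1_def b2_def ..
 finally show ?thesis .
qed

end

context tensor_pair
begin

lemma Lu_up: "up K C D (Obj T) (rH T) (rsc T) (\<lambda>_. rmul T) (\<lambda>x. emb T (Idn T x)) Pair Ru Lu"
 by (intro up.intro up_axioms.intro tensor_pair_axioms N.coch_axioms Lu_H' Lu_add Lu_scale Lu_comp Lu_id
   Lu_lin Lu_red)

text \<open>With the universal data, interpretation is passage to the class; results about
  \<open>ip\<close> thereby specialize to the twisted tensor product itself.\<close>

lemma ev_interp:
 "wft t ==> interp C D (rsc T) (\<lambda>_. rmul T) (\<lambda>x. emb T (Idn T x)) Pair Lu Ru t = ev t"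
proof (induction t)
 case (TZero x y n)
 thus ?case using ev_zero by simp
next
 case (TL f d)
 thus ?case by (simp add: Lu_def TE0_def)
next
 case (TE f gs)
 thus ?case by (auto simp: Lu_def TE0_def D.chain_path)
qed (auto simp: ev_id Ru_def ev_add ev_scale ev_comp)

lemma tdif_TE_typed:
 assumes f: "f \<in> arr C" and p: "path D d gs" and ne: "gs \<noteq> []"
 shows "wft (dft (TE f gs)) \<and> dmt (dft (TE f gs)) = dmt (TE f gs)
  \<and> cdt (dft (TE f gs)) = cdt (TE f gs)
  \<and> dgt (dft (TE f gs)) = dgt (TE f gs) + 1
  \<and> ev (dft (TE f gs)) = Ld f d gs"
proof -
 note w = tdif_TE_wf[OF assms]
 have "ev (dft (TE f gs)) = Ld f d gs"
  using up.ip_tdif_TE[OF Lu_up assms] ev_interp[OF conjunct1[OF w]] by (simp add: Ld_def fun_diff_def)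
 thus ?thesis using w D.path_chain[OF p ne] pend_last[OF ne, of D d] by (simp del: tdif.simps)
qed

end

context up
begin

abbreviation "obp x \<equiv> ob (fst x) (snd x)"
abbreviation "ipH t \<equiv> H (obp (dmt t)) (obp (cdt t)) (dgt t)"

lemma Lc_HD': "f \<in> arr C ==> path D d gs ==>
  Lc f d gs \<in> H (ob (Dom C f) d) (ob (Cod C f) (pend D d gs)) (Deg C f + wt D gs)"
 by (rule Y.cochsD[OF Lc_HD])

lemma ip_H: "wft t ==> ip t \<in> ipH t"
proof (induction t)
 case (TId x)
 thus ?case using Y.T.idn_H[OF Y.Phi_Ob] by auto
next
 case (TL f d)
 thus ?case using Lc_HD'[of f d "[]"] by simp
next
 case (TR c g)
 thus ?case using Y.R_H by simp
next
 case (TE f gs)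
 hence "path D (Dom D (hd gs)) gs" "gs \<noteq> []" "f \<in> arr C" by (auto simp: D.chain_path)
 thus ?case using Lc_HD'[of f "Dom D (hd gs)" gs] pend_last[of gs D "Dom D (hd gs)"] by simp
next
 case (TAdd s t)
 thus ?case by (auto simp: tpar_def intro: Y.T.H_add)
next
 case (TScale a t)
 thus ?case by (auto intro: Y.T.sc_closed)
next
 case (TComp s t)
 thus ?case using Y.T.mul_H[of "ip t" _ _ "dgt t" "ip s"] by (auto simp: add.commute)
qed simp

lemma Rc_add:
 assumes "c \<in> Obj C" "u \<in> Obj D" "v \<in> Obj D" "g \<in> mor D u v n" "g' \<in> mor D u v n"
 shows "Rc c (madd D u v n g g') = Rc c g + Rc c g'"
proof -
 interpret M: module K "Mor D u v n" using assms by simp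
 show ?thesis
  using Y.R_lin[OF assms C.one_closed C.one_closed] assms(4,5) Y.T.sc_one[OF Y.R_H[OF assms(1)]]
   D.arrI[OF assms(2-4)] D.arrI[OF assms(2,3,5)] by simp
qed

lemma Rc_scale:
 assumes "c \<in> Obj C" "u \<in> Obj D" "v \<in> Obj D" "g \<in> mor D u v n" "a \<in> carrier K"
 shows "Rc c (mscale D u v n a g) = sc a (Rc c g)"
proof -
 interpret M: module K "Mor D u v n" using assms by simp
 show ?thesis
  using Y.R_lin[OF assms(1-4,4,5) C.zero_closed] assms(4,5) Y.T.sc_null[OF Y.R_H[OF assms(1)]]
   D.arrI[OF assms(2-4)] by (simp add: M.smult_l_null)
qed

lemma ip_Ecomp:
 assumes f: "f1 \<in> arr C" "f2 \<in> arr C" "Cod C f1 = Dom C f2" and ch: "chain D gs" and t: "t = TE (Comp C f2 f1) gs"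
 shows "ip t = ip (tsum (dmt t) (cdt t) (dgt t)
       (map (\<lambda>m. TScale (sg K (Deg C f1 * wt D (drop m gs)))
           (TComp (TE0 f2 (drop m gs) (Cod D (last gs)))
              (TE0 f1 (take m gs) (Dom D (hd gs)))))
          [0..<Suc (length gs)]))"
proof -
 let ?d = "Dom D (hd gs)"
 have p: "path D ?d gs" "gs \<noteq> []" using ch by (auto simp: D.chain_path)
 define F :: "nat => ('k, 'c, 'f, 'd, 'g) tterm" where "F m = TScale (sg K (Deg C f1 * wt D (drop m gs)))
           (TComp (TE0 f2 (drop m gs) (Cod D (last gs)))
              (TE0 f1 (take m gs) (Dom D (hd gs))))" for m
 have "ip (tsum (dmt t) (cdt t) (dgt t) (map F [0..<Suc (length gs)]))
   = (\<Sum>m\<leftarrow>[0..<Suc (length gs)]. ip (F m))"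
  by (simp add: ip_tsum comp_def del: upt_Suc)
 also have "\<dots> = (\<Sum>m\<leftarrow>[0..<Suc (length gs)]. sgv (Deg C f1 * wt D (drop m gs))
   (mul (Deg C f1 + wt D (take m gs)) (Lc f2 (pend D ?d (take m gs)) (drop m gs)) (Lc f1 ?d (take m gs))))"
 proof (intro arg_cong[where f = sum_list] map_cong HOL.refl, goal_cases)
  case (1 m)
  note q = D.path_take_drop[OF p(1), of m]
  note ty = TE0_typed[OF f(1) q(1)]
  have H: "mul (Deg C f1 + wt D (take m gs)) (Lc f2 (pend D ?d (take m gs)) (drop m gs)) (Lc f1 ?d (take m gs))
   \<in> H (ob (Dom C f1) ?d) (ob (Cod C f2) (pend D (pend D ?d (take m gs)) (drop m gs)))
    (Deg C f1 + wt D (take m gs) + (Deg C f2 + wt D (drop m gs)))"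
   by (rule Y.T.mul_H[OF Lc_HD'[OF f(1) q(1)] Lc_HD'[OF f(2) q(2), folded f(3)]])
  show ?case
   unfolding E_comp_ev[OF f p F_def] interp.simps ip_TE0[OF q(1)] ip_TE0[OF q(2)] ty(4)
   by (rule Y.T.sc_sg[OF H])
 qed
 also have "\<dots> = Lc (Comp C f2 f1) ?d gs"
  unfolding Lc_comp[OF f] Y.mulc_path[OF p(1)] cut_index ..
 finally show ?thesis unfolding F_def t by simp
qed

text \<open>Soundness of interpretations: the category laws hold in the target, and each of the
  other relations is one of the conditions on \<open>Lc\<close> or \<open>Rc\<close>.\<close>

lemma ip_rel: "relt s t ==> ip s = ip t"
proof (induction rule: trel.induct)
 case (comp_cong s s' t t')
 thus ?case using trel_typed by (auto simp: tpar_def)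
next
 case (add_assoc s t u)
 thus ?case by (simp add: add.assoc)
next
 case (add_comm s t)
 thus ?case by (simp add: add.commute)
next
 case (scale_zero t)
 thus ?case using Y.T.sc_null[OF ip_H] by simp
next
 case (scale_one t)
 thus ?case using Y.T.sc_one[OF ip_H] by simp
next
 case (scale_scale a b t)
 thus ?case using Y.T.sc_sc[OF _ _ ip_H] by simp
next
 case (scale_add_scalar a b t)
 thus ?case using Y.T.sc_plus[OF _ _ ip_H] by simp
next
 case (scale_add a s t)
 hence "ip t \<in> ipH s" using ip_H[of t] by (auto simp: tpar_def)
 thus ?case using scale_add Y.T.sc_add[OF _ ip_H] by simp
next
 case (comp_assoc s t u)
 hence w: "wft s" "wft t" "wft u" "dmt s = cdt t" "dmt t = cdt u"
  by auto
 show ?case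
  using Y.T.mul_assoc[OF ip_H[OF w(3)] ip_H[OF w(2), unfolded w(5)] ip_H[OF w(1), unfolded w(4)]]
  by (simp add: add.commute)
next
 case (comp_id_left t)
 thus ?case using Y.T.mul_idl[OF ip_H] by simp
next
 case (comp_id_right t)
 thus ?case using Y.T.mul_idr[OF ip_H] by simp
next
 case (comp_add_left s s' t)
 hence w: "wft s" "wft s'" "wft t" "dmt s = cdt t" "dmt s' = dmt s"
  "cdt s' = cdt s" "dgt s' = dgt s" by (auto simp: tpar_def)
 show ?case
  using Y.T.mul_addl[OF ip_H[OF w(3), folded w(4)] ip_H[OF w(1)] ip_H[OF w(2), unfolded w(5-7)]] by simp
next
 case (comp_add_right s t t')
 hence w: "wft s" "wft t" "wft t'" "cdt t = dmt s" "dmt t' = dmt t"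
  "cdt t' = dmt s" "dgt t' = dgt t" by (auto simp: tpar_def)
 show ?case
  using Y.T.mul_addr[OF ip_H[OF w(2), unfolded w(4)] ip_H[OF w(3), unfolded w(5-7)] ip_H[OF w(1)]] w(7) by simp
next
 case (comp_scale_left a s t)
 hence w: "wft s" "wft t" "dmt s = cdt t" "a \<in> carrier K" by auto
 show ?case using Y.T.mul_scl[OF w(4) ip_H[OF w(2), folded w(3)] ip_H[OF w(1)]] by simp
next
 case (comp_scale_right s a t)
 hence w: "wft s" "wft t" "dmt s = cdt t" "a \<in> carrier K" by auto
 show ?case using Y.T.mul_scr[OF w(4) ip_H[OF w(2), folded w(3)] ip_H[OF w(1)]] by simp
next
 case (L_add x y f n f' d)
 thus ?case using Lc_add by simp
next
 case (L_scale x y f n a d)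
 thus ?case using Lc_scale by (simp add: scc_def)
next
 case (R_add x y g n g' c)
 thus ?case using Rc_add by simp
next
 case (R_scale x y g n a c)
 thus ?case using Rc_scale by simp
next
 case (E_add_left x y f n f' gs)
 thus ?case using Lc_add by simp
next
 case (E_scale_left x y f n a gs)
 thus ?case using Lc_scale by (simp add: scc_def)
next
 case (E_add_right f x y g n g' as bs)
 interpret M: module K "Mor D x y n" using E_add_right by simp
 note s = M.a_closed[OF E_add_right(4,5)]
 let ?d = "Dom D (hd (as @ g # bs))"
 have p: "path D ?d (as @ g # bs)" using E_add_right(6) by (simp add: D.chain_path)
 have p2: "path D ?d (as @ g' # bs)" "path D ?d (as @ (madd D x y n g g') # bs)"
  using p N.mor_par(1)[OF E_add_right(2-5), of ?d as bs] N.mor_par(1)[OF E_add_right(2,3) s E_add_right(4), of ?d as bs] by blast+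
 note ch = D.path_chain[OF p2(1)] D.path_chain[OF p2(2)]
 have "Lc f ?d (as @ (madd D x y n g g') # bs) = Lc f ?d (as @ g # bs) + Lc f ?d (as @ g' # bs)"
  by (rule Y.ling_add[OF _ Lc_HD'[OF E_add_right(1)] E_add_right(2-5) p])
   (use Lc_lin[OF E_add_right(1)] in "simp add: linc_def")
 thus ?case using ch by (simp del: D.path_append)
next
 case (E_scale_right f x y g n a as bs)
 interpret M: module K "Mor D x y n" using E_scale_right by simp
 note s = M.smult_closed[OF E_scale_right(5,4)]
 let ?d = "Dom D (hd (as @ g # bs))"
 have p: "path D ?d (as @ g # bs)" using E_scale_right(6) by (simp add: D.chain_path)
 have p2: "path D ?d (as @ (mscale D x y n a g) # bs)"
  using p N.mor_par(1)[OF E_scale_right(2,3) s E_scale_right(4), of ?d as bs] by blast+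
 note ch = D.path_chain[OF p2(1)]
 have "Lc f ?d (as @ (mscale D x y n a g) # bs) = sc a (Lc f ?d (as @ g # bs))"
  by (rule Y.ling_scale[OF _ Lc_HD'[OF E_scale_right(1)] E_scale_right(2-5) p])
   (use Lc_lin[OF E_scale_right(1)] in "simp add: linc_def")
 thus ?case using ch by (simp del: D.path_append)
next
 case (L_id c d)
 thus ?case by (simp add: Lc_id idc_def)
next
 case (R_id c d)
 thus ?case using Y.R_id by simp
next
 case (L_comp f1 f2 d)
 have p: "path D d []" using L_comp by simp
 show ?case using L_comp p by (simp add: Lc_comp Y.mulc_path[OF p])
next
 case (R_comp g1 g2 c)
 thus ?case using Y.R_comp by simp
next
 case (E_id_left c gs t)
 thus ?case by (auto simp: Lc_id idc_def D.chain_path)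
next
 case (E_id_right f gs d t)
 from E_id_right(4) obtain as bs where gs: "gs = as @ Idn D d # bs" by (meson split_list)
 have "path D (Dom D (hd gs)) gs" using E_id_right(2) by (simp add: D.chain_path)
 hence "Lc f (Dom D (hd gs)) gs = 0"
  using Lc_red[OF E_id_right(1)] E_id_right(3) unfolding gs redc_def by blast
 thus ?case using E_id_right by simp
next
 case (E_comp f1 f2 gs t)
 thus ?case by (rule ip_Ecomp)
qed simp_all

end

section \<open>The differential respects the relations and squares to zero\<close>

context tensor_pair
begin

lemma tdif_TE0_typed:
 assumes f: "f \<in> arr C" and p: "path D d gs"
 shows "wft (dft (TE0 f gs (pend D d gs)))
  \<and> dmt (dft (TE0 f gs (pend D d gs))) = (Dom C f, d)
  \<and> cdt (dft (TE0 f gs (pend D d gs))) = (Cod C f, pend D d gs)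
  \<and> dgt (dft (TE0 f gs (pend D d gs))) = Deg C f + wt D gs + 1
  \<and> ev (dft (TE0 f gs (pend D d gs))) = Ld f d gs"
proof (cases "gs = []")
 case True
 have "Ld f d [] = Lu (Dif C f) d []"
  using N.dl_Nil[OF C.arr_typed(1,2)[OF f] Lu_H[OF f], of d] p True by (simp add: Ld_def)
 thus ?thesis using True p C.dif_arr[OF f] f by (simp add: TE0_def Lu_def)
next
 case False
 show ?thesis
  using tdif_TE_typed[OF f p False] TE0_typed[OF f p, unfolded TE0_obj[OF False]]
  unfolding TE0_obj[OF False] by (simp del: tdif.simps)
qed

lemma tdif_typed:
 "wft t ==> wft (dft t) \<and> dmt (dft t) = dmt t
  \<and> cdt (dft t) = cdt t \<and> dgt (dft t) = dgt t + 1"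
proof (induction t)
 case (TE f gs)
 hence "path D (Dom D (hd gs)) gs" "gs \<noteq> []" "f \<in> arr C" by (auto simp: D.chain_path)
 from tdif_TE_typed[OF this(3,1,2)] show ?case by blast
qed (auto simp: C.dif_arr D.dif_arr tpar_def sg_closed)

definition dev :: "('k, 'c, 'f, 'd, 'g) tterm => ('c \<times> 'd, ('k, 'c, 'f, 'd, 'g) tterm set) dual" where
 "dev t = ev (dft t)"

lemma dev_H: "wft t ==> dev t \<in> rH T (dmt t) (cdt t) (dgt t + 1)"
 using ev_H[of "dft t"] tdif_typed[of t] by (simp add: dev_def)

lemma dev_add: "wft (TAdd s t) ==> dev (TAdd s t) = dev s + dev t"
 using ev_add[of "dft s" "dft t"] tdif_typed[of s] tdif_typed[of t]
 by (simp add: dev_def tpar_def)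

lemma dev_scale: "wft (TScale a t) ==> dev (TScale a t) = rsc T a (dev t)"
 using ev_scale[of "dft t" a] tdif_typed[of t] by (simp add: dev_def)

lemma dev_comp:
 assumes "wft (TComp s t)"
 shows "dev (TComp s t) = rmul T (dev s) (ev t) + sgv (dgt s) (rmul T (ev s) (dev t))"
proof -
 have st: "wft s" "wft t" "dmt s = cdt t" using assms by auto
 note s = tdif_typed[OF st(1)] and t = tdif_typed[OF st(2)]
 let ?a = "TComp (dft s) t" and ?b = "TComp s (dft t)"
 have ab: "wft ?a" "wft ?b" using st s t by simp_all
 have "ev (TAdd ?a (TScale (sg K (dgt s)) ?b)) = ev ?a + ev (TScale (sg K (dgt s)) ?b)"
  by (rule ev_add) (use st s t in "simp_all add: tpar_def sg_closed")
 moreover have "ev (TScale (sg K (dgt s)) ?b) = sgv (dgt s) (ev ?b)"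
  using ev_scale[OF ab(2) sg_closed] V.sc_sg[OF ev_H[OF ab(2)]] by simp
 moreover have "ev ?a = rmul T (dev s) (ev t)" "ev ?b = rmul T (ev s) (dev t)"
  using ev_comp[of "dft s" t] ev_comp[of s "dft t"] st s t by (simp_all add: dev_def)
 ultimately show ?thesis by (simp add: dev_def)
qed

lemma dev_zero: "x \<in> Obj T ==> y \<in> Obj T ==> dev (TZero x y n) = 0"
 using ev_zero by (simp add: dev_def)

lemma dev_id: "x \<in> Obj T ==> dev (TId x) = 0"
 using ev_zero by (simp add: dev_def)

lemma dev_TE0:
 assumes "f \<in> arr C" "path D d gs"
 shows "dev (TE0 f gs (pend D d gs)) = Ld f d gs"
 using tdif_TE0_typed[OF assms] by (simp add: dev_def)

text \<open>Both parts of \<open>Ld\<close> obey the Leibniz rule: the first by the Leibniz rule in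
  \<open>C\<close> and multiplicativity of \<open>Lu\<close>, the second by
  \<open>dl_mulc\<close>.\<close>

lemma Ld_comp:
 assumes f: "f1 \<in> arr C" "f2 \<in> arr C" "Cod C f1 = Dom C f2"
 shows "Ld (Comp C f2 f1) = mulc D (\<lambda>_. rmul T) (Deg C f1) (Ld f2) (Lu f1)
  + sgv (Deg C f2) (mulc D (\<lambda>_. rmul T) (Deg C f1 + 1) (Lu f2) (Ld f1))"
proof -
 note t1 = C.arr_typed[OF f(1)] and t2 = C.arr_typed[OF f(2), folded f(3)]
 note d1 = C.dif_arr[OF f(1)] and d2 = C.dif_arr[OF f(2)] and c = C.comp_arr[OF f]
 let ?p = "Deg C f1" and ?q = "Deg C f2" and ?x = "Dom C f1" and ?y = "Cod C f1" and ?z = "Cod C f2"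
 let ?mc = "mulc D (\<lambda>_. rmul T)"
 note L1 = Lu_H[OF f(1)] and L2 = Lu_H[OF f(2), folded f(3)]
 have D1: "Lu (Dif C f1) \<in> N.Hc ?x ?y (?p + 1)" using Lu_H[OF d1(1)] d1 by simp
 have D2: "Lu (Dif C f2) \<in> N.Hc ?y ?z (?q + 1)" using Lu_H[OF d2(1)] d2 f(3) by simp
 let ?M = "Mor C ?x ?z (?p + ?q + 1)"
 interpret M: module K ?M using t1 t2 by simp
 have c1: "Comp C (Dif C f2) f1 \<in> carrier ?M"
  using C.comp_closed[OF t1(1,2) t2(2) t1(3) C.dif_closed[OF t2]] by (simp add: algebra_simps)
 have c2: "Comp C f2 (Dif C f1) \<in> carrier ?M"
  using C.comp_closed[OF t1(1,2) t2(2) C.dif_closed[OF t1] t2(3)] by (simp add: algebra_simps)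
 have "Lu (Dif C (Comp C f2 f1)) = Lu (Comp C (Dif C f2) f1) + scc (rsc T) (sg K ?q) (Lu (Comp C f2 (Dif C f1)))"
  unfolding C.dif_comp[OF t1(1,2) t2(2) t1(3) t2(3)]
   Lu_add[OF t1(1) t2(2) c1 M.smult_closed[OF sg_closed c2]] Lu_scale[OF t1(1) t2(2) c2 sg_closed] ..
 also have "scc (rsc T) (sg K ?q) (Lu (Comp C f2 (Dif C f1))) = sgv ?q (Lu (Comp C f2 (Dif C f1)))"
  by (rule N.CC.sc_sg[OF Lu_H'[OF t1(1) t2(2) c2]])
 also have "Lu (Comp C (Dif C f2) f1) = ?mc ?p (Lu (Dif C f2)) (Lu f1)"
  by (rule Lu_comp[OF f(1) d2(1)]) (use f(3) d2 in simp)
 also have "Lu (Comp C f2 (Dif C f1)) = ?mc (?p + 1) (Lu f2) (Lu (Dif C f1))"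
  using Lu_comp[OF d1(1) f(2)] f(3) d1 by simp
 finally have A: "Lu (Dif C (Comp C f2 f1))
   = ?mc ?p (Lu (Dif C f2)) (Lu f1) + sgv ?q (?mc (?p + 1) (Lu f2) (Lu (Dif C f1)))" .
 have B: "N.dl ?x ?z (?p + ?q) (Lu (Comp C f2 f1)) = ?mc ?p (N.dl ?y ?z ?q (Lu f2)) (Lu f1)
   + sgv ?q (?mc (?p + 1) (Lu f2) (N.dl ?x ?y ?p (Lu f1)))"
  unfolding Lu_comp[OF f] by (rule N.dl_mulc[OF t1(1,2) t2(2) L1 L2])
 have C2: "?mc ?p (Ld f2) (Lu f1) = ?mc ?p (Lu (Dif C f2)) (Lu f1) - ?mc ?p (N.dl ?y ?z ?q (Lu f2)) (Lu f1)"
  unfolding Ld_def f(3)[symmetric]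
  by (rule N.CC.mul_diffl[OF L1 D2 N.dl_H[OF t2(1,2) L2]])
 have C1: "?mc (?p + 1) (Lu f2) (Ld f1) = ?mc (?p + 1) (Lu f2) (Lu (Dif C f1))
   - ?mc (?p + 1) (Lu f2) (N.dl ?x ?y ?p (Lu f1))"
  unfolding Ld_def by (rule N.CC.mul_diffr[OF D1 N.dl_H[OF t1(1,2) L1] L2])
 have "Ld (Comp C f2 f1) = Lu (Dif C (Comp C f2 f1)) - N.dl ?x ?z (?p + ?q) (Lu (Comp C f2 f1))"
  unfolding Ld_def c ..
 thus ?thesis
  unfolding A B C1 C2 sgv_diff
  by (simp only: diff_conv_add_uminus minus_add_distrib ab_semigroup_add_class.add_ac)
qed

text \<open>The relations for sums, scalars and identities among the arguments survive
  differentiation because \<open>dl\<close> preserves multilinear and normalized cochains.\<close>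

lemma Ld_lin_red:
 assumes f: "f \<in> arr C"
 shows "linc K D (rsc T) (Ld f)" "redc D (Ld f)"
proof -
 note t = C.arr_typed[OF f] and d = C.dif_arr[OF f]
 note H1 = Lu_H[OF d(1), unfolded d] and H2 = N.dl_H[OF t(1,2) Lu_H[OF f]]
 have "linc K D (rsc T) (Lu (Dif C f) + - N.dl (Dom C f) (Cod C f) (Deg C f) (Lu f))"
  by (rule N.linc_plus[OF Lu_lin[OF d(1)] H1 N.linc_neg[OF N.linc_dl[OF t(1,2) Lu_H[OF f] Lu_lin[OF f]] H2] N.CC.H_neg[OF H2]])
 thus "linc K D (rsc T) (Ld f)" by (simp add: Ld_def)
 show "redc D (Ld f)"
  using Lu_red[OF d(1)] N.redc_dl[OF t(1,2) Lu_H[OF f] Lu_lin[OF f] Lu_red[OF f]]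
  unfolding redc_def Ld_def by (simp add: fun_diff_def)
qed

lemma Ld_add:
 assumes "x \<in> Obj C" "y \<in> Obj C" "f \<in> mor C x y n" "f' \<in> mor C x y n"
 shows "Ld (madd C x y n f f') = Ld f + Ld f'"
proof -
 interpret M: module K "Mor C x y n" using assms by simp
 note s = M.a_closed[OF assms(3,4)]
 note t = C.mor_DCD[OF assms(1-3)] C.mor_DCD[OF assms(1,2,4)] C.mor_DCD[OF assms(1,2) s]
 show ?thesis
  unfolding Ld_def t C.dif_add[OF assms] Lu_add[OF assms(1,2) C.dif_closed[OF assms(1-3)] C.dif_closed[OF assms(1,2,4)]]
   Lu_add[OF assms] N.dl_add[OF assms(1,2) Lu_H'[OF assms(1-3)] Lu_H'[OF assms(1,2,4)]]
  by simp
qed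

lemma Ld_scale:
 assumes "x \<in> Obj C" "y \<in> Obj C" "f \<in> mor C x y n" "a \<in> carrier K"
 shows "Ld (mscale C x y n a f) = scc (rsc T) a (Ld f)"
proof -
 interpret M: module K "Mor C x y n" using assms by simp
 note s = M.smult_closed[OF assms(4,3)]
 note t = C.mor_DCD[OF assms(1-3)] C.mor_DCD[OF assms(1,2) s]
 show ?thesis
  unfolding Ld_def t C.dif_smult[OF assms(1,2,4,3)] Lu_scale[OF assms(1,2) C.dif_closed[OF assms(1-3)] assms(4)]
   Lu_scale[OF assms] N.dl_sc[OF assms(1,2) Lu_H'[OF assms(1-3)] assms(4)]
  by (rule N.CC.sc_diff[OF assms(4) Lu_H'[OF assms(1,2) C.dif_closed[OF assms(1-3)]]
    N.dl_H[OF assms(1,2) Lu_H'[OF assms(1-3)]], symmetric])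
qed

lemma Ld_id: "c \<in> Obj C ==> Ld (Idn C c) = 0"
 by (simp add: Ld_def C.idn_arr C.dif_idn Lu_zero Lu_id N.dl_idc)

lemma Ru_H:
 assumes "c \<in> Obj C" "g \<in> arr D"
 shows "Ru c g \<in> rH T (c, Dom D g) (c, Cod D g) (Deg D g)"
 by (rule N.R_H[OF assms])

lemma dev_TR: "dev (TR c g) = Ru c (Dif D g)"
 by (simp add: dev_def Ru_def)

lemma dev_TL:
 assumes "f \<in> arr C" "d \<in> Obj D"
 shows "dev (TL f d) = Ld f d []"
 using dev_TE0[of f d "[]"] assms by (simp add: TE0_def)

lemma dev_TE:
 assumes "f \<in> arr C" "chain D gs"
 shows "dev (TE f gs) = Ld f (Dom D (hd gs)) gs"
 using tdif_TE_typed[of f "Dom D (hd gs)" gs] assms by (auto simp: dev_def D.chain_path)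

lemma Ru_dif_comp:
 assumes "g1 \<in> arr D" "g2 \<in> arr D" "Cod D g1 = Dom D g2" "c \<in> Obj C"
 shows "Ru c (Dif D (Comp D g2 g1)) = rmul T (Ru c (Dif D g2)) (Ru c g1)
  + sgv (Deg D g2) (rmul T (Ru c g2) (Ru c (Dif D g1)))"
proof -
 note t1 = D.arr_typed[OF assms(1)] and t2 = D.arr_typed[OF assms(2), folded assms(3)]
 note d1 = D.dif_arr[OF assms(1)] and d2 = D.dif_arr[OF assms(2)]
 let ?M = "Mor D (Dom D g1) (Cod D g2) (Deg D g1 + Deg D g2 + 1)"
 interpret M: module K ?M using t1 t2 by simp
 have c1: "Comp D (Dif D g2) g1 \<in> carrier ?M"
  using D.comp_closed[OF t1(1,2) t2(2) t1(3) D.dif_closed[OF t2]] by (simp add: algebra_simps)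
 have c2: "Comp D g2 (Dif D g1) \<in> carrier ?M"
  using D.comp_closed[OF t1(1,2) t2(2) D.dif_closed[OF t1] t2(3)] by (simp add: algebra_simps)
 have "Ru c (Comp D g2 (Dif D g1)) \<in> rH T (c, Dom D g1) (c, Cod D g2) (Deg D g1 + Deg D g2 + 1)"
  using Ru_H[OF assms(4) D.arrI[OF t1(1) t2(2) c2]] D.mor_DCD[OF t1(1) t2(2) c2] by simp
 from V.sc_sg[OF this] show ?thesis
  unfolding D.dif_comp[OF t1(1,2) t2(2) t1(3) t2(3)]
   Ru_add[OF assms(4) t1(1) t2(2) c1 M.smult_closed[OF sg_closed c2]] Ru_scale[OF assms(4) t1(1) t2(2) c2 sg_closed]
  using N.R_comp[OF assms(4,1) d2(1)] N.R_comp[OF assms(4) d1(1) assms(2)] d1 d2 assms(3) by simp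
qed

text \<open>The algebra of dual numbers over the realization, in which a degree \<open>1\<close> derivation \<open>\<delta>\<close>
 becomes the homomorphism \<open>v \<mapsto> (v, (-1)\<^bsup>|v|\<^esup> \<delta> v)\<close>. The sign is needed because a product
 only knows the degree of its right factor.\<close>

abbreviation "H2 x y n \<equiv> rH T x y n \<times> rH T x y (n + 1)"
abbreviation "sc2 a \<equiv> map_prod (rsc T a) (rsc T a)"
abbreviation "mul2 p v w \<equiv> (rmul T (fst v) (fst w), sgv p (rmul T (snd v) (fst w)) + rmul T (fst v) (snd w))"
abbreviation "id2 x \<equiv> (emb T (Idn T x), 0 :: ('c \<times> 'd, ('k, 'c, 'f, 'd, 'g) tterm set) dual)"
abbreviation "Ru2 c g \<equiv> (Ru c g, sgv (Deg D g) (Ru c (Dif D g)))"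
abbreviation "Lu2 f d gs \<equiv> (Lu f d gs, sgv (Deg C f + wt D gs) (Ld f d gs))"

lemma mul2_H:
 assumes "v \<in> rH T y z n" "w \<in> rH T x y m"
 shows "k = m + n ==> rmul T v w \<in> rH T x z k"
 using V.mul_H[OF assms(2,1)] by simp

lemma Ru_dif_idn:
 assumes "c \<in> Obj C" "d \<in> Obj D"
 shows "Ru c (Dif D (Idn D d)) = 0"
proof -
 interpret M: module K "Mor D d d 1" using assms by simp
 show ?thesis using Ru_add[OF assms(1,2,2) M.zero_closed M.zero_closed] assms by (simp add: D.dif_idn)
qed

lemma vgc2: "vgc K (Obj T) H2 sc2 mul2 id2"
proof
 fix x y z m n f and g g' assume "f \<in> H2 x y m" "g \<in> H2 y z n" "g' \<in> H2 y z n"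
 thus "mul2 m (g + g') f = mul2 m g f + mul2 m g' f"
  by (auto simp: V.mul_addl sgv_add)
next
 fix x y z m n f f' and g assume "f \<in> H2 x y m" "f' \<in> H2 x y m" "g \<in> H2 y z n"
 thus "mul2 m g (f + f') = mul2 m g f + mul2 m g f'"
  by (auto simp: V.mul_addr sgv_add)
next
 fix x y z m n f g a assume a: "a \<in> carrier K" and *: "f \<in> H2 x y m" "g \<in> H2 y z n"
 have m: "rmul T (snd g) (fst f) \<in> rH T x z (m + n + 1)" "rmul T (fst g) (snd f) \<in> rH T x z (m + n + 1)"
  using * by (auto intro!: mul2_H)
 show "mul2 m (sc2 a g) f = sc2 a (mul2 m g f)" "mul2 m g (sc2 a f) = sc2 a (mul2 m g f)"
  using a * by (auto simp: V.mul_scl V.mul_scr V.sc_add[OF a V.H_sgv[OF m(1)] m(2)] V.sc_sgv[OF a m(1)])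
next
 fix x y z u m n k f g h assume *: "f \<in> H2 x y m" "g \<in> H2 y z n" "h \<in> H2 z u k"
 have m: "rmul T (snd g) (fst f) \<in> rH T x z (m + n + 1)" "rmul T (fst g) (snd f) \<in> rH T x z (m + n + 1)"
  "rmul T (snd h) (fst g) \<in> rH T y u (n + k + 1)" "rmul T (fst h) (snd g) \<in> rH T y u (n + k + 1)"
  and f: "fst f \<in> rH T x y m" and h: "fst h \<in> rH T z u k"
  using * by (auto intro!: mul2_H)
 show "mul2 m (mul2 n h g) f = mul2 (m + n) h (mul2 m g f)"
  using * by (auto simp: V.mul_addl[OF f V.H_sgv[OF m(3)] m(4)] V.mul_addr[OF V.H_sgv[OF m(1)] m(2) h]
   V.mul_sgvl[OF f m(3)] V.mul_sgvr[OF m(1) h] V.mul_assoc sgv_add add.assoc)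
qed (auto simp: V.H_add V.sc_closed V.sc_add V.sc_plus V.sc_sc V.sc_one V.mul_idl V.mul_idr mul2_H V.H_sgv V.mul_zerol V.mul_zeror V.idn_H zero_prod_def)

text \<open>In the first component these are the conditions for the universal data. In the second
  they say that \<open>Ld\<close> and \<open>g \<mapsto> Ru c (Dif D g)\<close> are linear and
  vanish where required, and that they satisfy the Leibniz rule on composites.\<close>

lemma up2: "up K C D (Obj T) H2 sc2 mul2 id2 Pair Ru2 Lu2"
proof (intro up.intro up_axioms.intro tensor_pair_axioms coch.intro coch_axioms.intro coch_base.intro vgc2
  D.dg_category_axioms)
 have sc: "rsc T a (sgv m (Ld f d gs)) = sgv m (rsc T a (Ld f d gs))" if "f \<in> arr C" "a \<in> carrier K" for f a m d gs
  using V.sc_sgv[OF that(2) N.cochsD[OF Ld_H[OF that(1)]]] N.cochs_ext[OF Ld_H[OF that(1)]]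
  by (cases "path D d gs") (simp_all add: V.sc_zero that)
 show "(y, d) \<in> Obj T" if "y \<in> Obj C" "d \<in> Obj D" for y d using that by simp
 show "Ru2 c g \<in> H2 (c, Dom D g) (c, Cod D g) (Deg D g)" if "c \<in> Obj C" "g \<in> arr D" for c g
  using Ru_H[OF that] Ru_H[OF that(1) D.dif_arr(1)[OF that(2)]] D.dif_arr[OF that(2)] by (simp add: V.H_sgv)
 show "Ru2 c (lc D u v n a g b g') = sc2 a (Ru2 c g) + sc2 b (Ru2 c g')"
  if *: "c \<in> Obj C" "u \<in> Obj D" "v \<in> Obj D" "g \<in> mor D u v n" "g' \<in> mor D u v n"
  "a \<in> carrier K" "b \<in> carrier K" for c u v n g g' a b
 proof -
  interpret M: module K "Mor D u v n" using * by simp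
  note s = D.mor_DCD[OF *(2,3)]
  have d: "Ru c (Dif D x) \<in> rH T (c, u) (c, v) (n + 1)" if "x \<in> mor D u v n" for x
   using Ru_H[OF *(1) D.arrI[OF *(2,3) D.dif_closed[OF *(2,3) that]]] D.mor_DCD[OF *(2,3) D.dif_closed[OF *(2,3) that]]
   by simp
  note t = s[OF M.a_closed[OF M.smult_closed[OF *(6,4)] M.smult_closed[OF *(7,5)]]]
  show ?thesis using * by (simp add: s t D.dif_add D.dif_smult D.dif_closed sgv_add
   N.R_lin[OF *] N.R_lin[OF *(1-3) D.dif_closed[OF *(2-4)] D.dif_closed[OF *(2,3,5)] *(6,7)]
   V.sc_sgv[OF *(6) d] V.sc_sgv[OF *(7) d])
 qed
 show "Ru2 c (Comp D g' g) = mul2 (Deg D g) (Ru2 c g') (Ru2 c g)"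
  if "c \<in> Obj C" "g \<in> arr D" "g' \<in> arr D" "Cod D g = Dom D g'" for c g g'
 proof -
  note H = Ru_H[OF that(1,2)] Ru_H[OF that(1,3), folded that(4)] Ru_H[OF that(1) D.dif_arr(1)[OF that(2)]]
   Ru_H[OF that(1) D.dif_arr(1)[OF that(3)]]
  note d = D.dif_arr[OF that(2)] D.dif_arr[OF that(3)]
  show ?thesis
   using Ru_dif_comp[OF that(2-4,1)] N.R_comp[OF that] D.comp_arr[OF that(2-4)]
   by (simp add: V.mul_sgvl[OF H(1) H(4)[unfolded d that(4)[symmetric]]]
    V.mul_sgvr[OF H(3)[unfolded d] H(2)] sgv_add
    sgv_cong[of "Deg D g + Deg D g' * 2" "Deg D g"] algebra_simps)
 qed
 show "Ru2 c (Idn D d) = id2 (c, d)" if "c \<in> Obj C" "d \<in> Obj D" for c d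
  using N.R_id[OF that] Ru_dif_idn[OF that] by (simp add: D.dif_idn D.idn_arr)
 show "Lu2 f \<in> cochs D H2 (Pair x) (Pair y) n" if "x \<in> Obj C" "y \<in> Obj C" "f \<in> mor C x y n" for x y n f
  using N.cochsD[OF Lu_H'[OF that]] N.cochsD[OF Ld_H[OF C.arrI[OF that]]] C.mor_DCD[OF that]
   N.cochs_ext[OF Lu_H'[OF that]] N.cochs_ext[OF Ld_H[OF C.arrI[OF that]]]
  by (auto simp: cochs_def V.H_sgv zero_prod_def algebra_simps)
 show "Lu2 (madd C x y n f f') = Lu2 f + Lu2 f'"
  if "x \<in> Obj C" "y \<in> Obj C" "f \<in> mor C x y n" "f' \<in> mor C x y n" for x y n f f'
 proof -
  interpret M: module K "Mor C x y n" using that by simp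
  show ?thesis using C.mor_DCD[OF that(1,2)] that
   by (intro ext) (simp add: Lu_add Ld_add sgv_add C.mor_DCD(3)[OF that(1,2) M.a_closed[OF that(3,4)]])
 qed
 show "Lu2 (mscale C x y n a f) = scc sc2 a (Lu2 f)"
  if "x \<in> Obj C" "y \<in> Obj C" "f \<in> mor C x y n" "a \<in> carrier K" for x y n f a
 proof -
  interpret M: module K "Mor C x y n" using that by simp
  show ?thesis using C.mor_DCD[OF that(1,2)] that
   by (intro ext) (simp add: Lu_scale Ld_scale scc_def C.mor_DCD(3)[OF that(1,2) M.smult_closed[OF that(4,3)]] sc[OF C.arrI[OF that(1-3)]])
 qed
 show "Lu2 (Comp C f2 f1) = mulc D mul2 (Deg C f1) (Lu2 f2) (Lu2 f1)"
  if f: "f1 \<in> arr C" "f2 \<in> arr C" "Cod C f1 = Dom C f2" for f1 f2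
 proof (intro ext, goal_cases)
  case (1 d gs) show ?case
  proof (cases "path D d gs")
   case p: True
   have "sgv (Deg C f2 + Deg C f1 + wt D gs) (Ld (Comp C f2 f1) d gs) = cut (\<lambda>as bs. sgv (Deg C f1 * wt D bs)
     (sgv (Deg C f1 + wt D as) (rmul T (sgv (Deg C f2 + wt D bs) (Ld f2 (pend D d as) bs)) (Lu f1 d as))
     + rmul T (Lu f2 (pend D d as) bs) (sgv (Deg C f1 + wt D as) (Ld f1 d as)))) gs"
    unfolding Ld_comp[OF f] plus_fun_def sgv_fun N.mulc_path[OF p] cut_sgv[symmetric] cut_add[symmetric]
   proof (rule cut_cong, goal_cases)
    case s: (1 as bs)
    hence "path D d as" "path D (pend D d as) bs" using p by auto
    note H = N.cochsD[OF Lu_H[OF f(1)] this(1)] N.cochsD[OF Lu_H[OF f(2)] this(2), folded f(3)]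
     N.cochsD[OF Ld_H[OF f(1)] this(1)] N.cochsD[OF Ld_H[OF f(2)] this(2), folded f(3)]
    show ?case
     unfolding V.mul_sgvl[OF H(1,4)] V.mul_sgvr[OF H(3,2)] sgv_add sgv_sgv s[symmetric]
     by (intro arg_cong2[where f = "(+)"] sgv_cong) (simp_all add: algebra_simps)
   qed
   thus ?thesis
    using p C.comp_arr[OF f] by (simp add: Lu_comp[OF f] mulc_def sgv_prod cut_prod add.commute)
  qed (simp add: Lu_def N.cochs_ext[OF Ld_H, OF C.comp_arr(1)[OF f]] mulc_def zero_prod_def)
 qed
 show "Lu2 (Idn C c) = idc D id2 (Pair c)" if "c \<in> Obj C" for c
  using that by (intro ext) (simp add: Lu_id Ld_id idc_def zero_prod_def)
 show "linc K D sc2 (Lu2 f)" if "f \<in> arr C" for f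
  unfolding linc_def ling_def
 proof (intro allI impI, goal_cases)
  case *: (1 d as bs x y u v n a b)
  interpret M: module K "Mor D u v n" using * by simp
  note s = D.mor_DCD(3)[OF *(1,2)]
  show ?case
   using Lu_lin[OF that, unfolded linc_def ling_def, rule_format, OF *]
    Ld_lin_red(1)[OF that, unfolded linc_def ling_def, rule_format, OF *]
    s[OF M.a_closed[OF M.smult_closed[OF *(5,3)] M.smult_closed[OF *(6,4)]]] s *(3,4)
   by (simp add: sc[OF that *(5)] sc[OF that *(6)] sgv_add)
 qed
 show "redc D (Lu2 f)" if "f \<in> arr C" for f
  using Lu_red[OF that] Ld_lin_red(2)[OF that] by (simp add: redc_def zero_prod_def)
qed

text \<open>The interpretation in dual numbers records the value of an expression together with that
  of its differential, signed by the degree.\<close>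

lemma dev_ip: "wft t ==> interp C D sc2 mul2 id2 Pair Lu2 Ru2 t = (ev t, sgv (dgt t) (dev t))"
proof (induction t)
 case (TE f gs)
 thus ?case by (auto simp: Lu_path TE0_def D.chain_path dev_TE)
next
 case (TScale a t)
 thus ?case using V.sc_sgv[OF _ dev_H, of a t] by (simp add: ev_scale dev_scale)
next
 case (TComp s t)
 hence "wft s" "wft t" "dmt s = cdt t" by auto
 note H = ev_H[OF this(2), folded this(3)] dev_H[OF this(1)] dev_H[OF this(2), folded this(3)] ev_H[OF this(1)]
 show ?case using TComp
  by (simp add: ev_comp dev_comp V.mul_sgvl[OF H(1,2)] V.mul_sgvr[OF H(3,4)] sgv_add
   sgv_cong[of "dgt t + 2 * dgt s" "dgt t"] algebra_simps)
qed (auto simp: zero_prod_def ev_zero dev_zero ev_id dev_id Lu_path TE0_def Ru_def dev_TR dev_TL ev_add dev_add sgv_add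
 tpar_def)

text \<open>Second component of the soundness of the interpretation in dual numbers. Related
  expressions have the same degree, so the sign can be removed.\<close>

lemma trel_dev:
 assumes "relt s t"
 shows "dev s = dev t"
proof -
 have "sgv (dgt s) (dev s) = sgv (dgt s) (dev t)"
  using up.ip_rel[OF up2 assms] trel_typed[OF assms] by (simp add: dev_ip tpar_def)
 from arg_cong[OF this, of "sgv (dgt s)"] show ?thesis by simp (simp add: sgv_def)
qed

lemma Dif_T: "wft t ==> Dif T (clt t) = clt (dft t)"
proof -
 assume w: "wft t"
 have "clt (dft t') = clt (dft t)" if r: "relt t t'" for t'
 proof (rule cls_eqI, rule ev_inj)
  show "ev (dft t') = ev (dft t)" using trel_dev[OF r] by (simp add: dev_def)
 qed (use trel_typed[OF r] tdif_typed[of t] tdif_typed[of t'] in "auto simp: tpar_def")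
 from cls_Union[where F = "\<lambda>t. clt (dft t)", OF w this] show ?thesis by (simp add: ttensor_def)
qed

text \<open>An expression of value 0 is related to a zero expression, whose differential vanishes;
  this agrees with the default value of \<open>rdif\<close> at 0.\<close>

lemma rdif_ev:
 assumes "wft t"
 shows "rdif T (ev t) = ev (dft t)"
proof (cases "ev t = 0")
 case True
 let ?z = "TZero (dmt t) (cdt t) (dgt t) :: ('k, 'c, 'f, 'd, 'g) tterm"
 have "relt t ?z"
  by (rule ev_inj) (use assms True T_obj[OF assms] ev_zero in "auto simp: tpar_def")
 from trel_dev[OF this] dev_zero[OF T_obj[OF assms]] show ?thesis using True by (simp add: rdif_def dev_def)
next
 case False
 thus ?thesis
  using G.pr_emb[OF cls_arr[OF assms]] by (simp add: rdif_def ev_def Dif_T[OF assms])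
qed

lemma T_vdg: "vdg K (Obj T) (rH T) (rsc T) (\<lambda>_. rmul T) (\<lambda>x. emb T (Idn T x)) (\<lambda>_ _ _. rdif T)"
proof (intro vdg.intro vdg_axioms.intro V.vgc_axioms, goal_cases)
 case *: (1 x y v n)
 obtain t where t: "v = ev t" "wft t" "dmt t = x" "cdt t = y" "dgt t = n"
  by (rule rH_ev[OF *(3,1,2)])
 show ?case using dev_H[OF t(2)] t by (simp add: rdif_ev dev_def)
next
 case *: (2 x y v n w)
 obtain s where s: "v = ev s" "wft s" "dmt s = x" "cdt s = y" "dgt s = n"
  by (rule rH_ev[OF *(3,1,2)])
 obtain t where t: "w = ev t" "wft t" "dmt t = x" "cdt t = y" "dgt t = n"
  by (rule rH_ev[OF *(4,1,2)])
 have p: "part s t" using s t by (simp add: tpar_def)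
 have w: "wft (TAdd s t)" using s t p by simp
 show ?case
  using ev_add[OF s(2) t(2) p] dev_add[OF w] rdif_ev[OF w] rdif_ev[OF s(2)] rdif_ev[OF t(2)]
  by (simp add: s t dev_def)
next
 case *: (3 x y a v n)
 obtain s where s: "v = ev s" "wft s" "dmt s = x" "cdt s = y" "dgt s = n"
  by (rule rH_ev[OF *(4,1,2)])
 have w: "wft (TScale a s)" using s * by simp
 show ?case
  using ev_scale[OF s(2) *(3)] dev_scale[OF w] rdif_ev[OF w] rdif_ev[OF s(2)] by (simp add: s dev_def)
next
 case *: (4 x y z f m g n)
 obtain s where s: "f = ev s" "wft s" "dmt s = x" "cdt s = y" "dgt s = m"
  by (rule rH_ev[OF *(4,1,2)])
 obtain t where t: "g = ev t" "wft t" "dmt t = y" "cdt t = z" "dgt t = n"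
  by (rule rH_ev[OF *(5,2,3)])
 have w: "wft (TComp t s)" using s t by simp
 show ?case
  using ev_comp[OF t(2) s(2)] dev_comp[OF w] rdif_ev[OF w] rdif_ev[OF s(2)] rdif_ev[OF t(2)] s t
  by (simp add: dev_def)
qed

sublocale V: vdg K "Obj T" "rH T" "rsc T" "\<lambda>_. rmul T" "\<lambda>x. emb T (Idn T x)" "\<lambda>_ _ _. rdif T"
 by (rule T_vdg)

sublocale N: coch_dg K D "Obj T" "rH T" "rsc T" "\<lambda>_. rmul T" "\<lambda>x. emb T (Idn T x)" "Obj C" Pair Ru "\<lambda>_ _ _. rdif T"
 by (intro coch_dg.intro N.coch_axioms V.vdg_axioms)

lemma rdif_Ru: "c \<in> Obj C ==> g \<in> arr D ==> rdif T (Ru c g) = Ru c (Dif D g)"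
 using rdif_ev[of "TR c g"] by (simp add: Ru_def)

text \<open>The defining equation of \<open>Ld\<close>, now that the differential on classes is
  known to realize it.\<close>

lemma df_Lu:
 assumes "x \<in> Obj C" "y \<in> Obj C" "f \<in> mor C x y n"
 shows "N.df x y n (Lu f) = Lu (Dif C f)"
proof (intro ext, goal_cases)
 case (1 d gs)
 note f = C.arrI[OF assms] and t = C.mor_DCD[OF assms]
 show ?case
 proof (cases "path D d gs")
  case p: True
  have "rdif T (Lu f d gs) = Ld f d gs"
   using rdif_ev[OF TE0_typed(1)[OF f p]] dev_TE0[OF f p] by (simp add: Lu_path[OF p] dev_def)
  hence "N.dd x y n (Lu f) d gs = Lu (Dif C f) d gs - N.dl x y n (Lu f) d gs"
   using p by (simp add: ddc_def Ld_def t fun_diff_def)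
  thus ?thesis by (simp add: difc_def plus_fun_def)
 next
  case False
  thus ?thesis
   by (simp add: difc_def dlc_def plus_fun_def fun_diff_def ddc_def mulc_def sgv_fun bdc_def Lu_def)
 qed
qed

text \<open>By \<open>df_df\<close> the square of the internal differential on \<open>Lu f\<close>
  equals the square of the total one, and by \<open>df_Lu\<close> the latter is \<open>Lu\<close> of
  \<open>ddf = 0\<close>.\<close>

lemma dd_dd_Lu:
 assumes f: "f \<in> arr C" and p: "path D d gs"
 shows "rdif T (rdif T (Lu f d gs)) = 0"
proof -
 note t = C.arr_typed[OF f]
 let ?x = "Dom C f" and ?y = "Cod C f" and ?n = "Deg C f"
 have "N.df ?x ?y (?n + 1) (N.df ?x ?y ?n (Lu f)) = N.dd ?x ?y (?n + 1) (N.dd ?x ?y ?n (Lu f))"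
  by (rule N.df_df[OF t(1,2) Lu_H[OF f] Lu_lin[OF f] rdif_Ru])
 moreover have "N.df ?x ?y (?n + 1) (N.df ?x ?y ?n (Lu f)) = 0"
  unfolding df_Lu[OF t] df_Lu[OF t(1,2) C.dif_closed[OF t]] C.dif_dif[OF t] Lu_zero[OF t(1,2)] ..
 ultimately have "N.dd ?x ?y (?n + 1) (N.dd ?x ?y ?n (Lu f)) d gs = 0" by simp
 thus ?thesis using p by (simp add: ddc_def)
qed

text \<open>From generators to all expressions by linearity and the Leibniz rule; in a composite the
  two mixed terms have opposite signs.\<close>

lemma rdif_rdif: "wft t ==> rdif T (rdif T (ev t)) = 0"
proof (induction t)
 case (TZero x y n)
 thus ?case using ev_zero[of x y n] by (simp add: rdif_def)
next
 case (TId x)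
 thus ?case using rdif_ev[of "TId x"] ev_zero[of x x 1] by (simp add: rdif_def)
next
 case (TL f d)
 thus ?case using dd_dd_Lu[of f d "[]"] by (simp add: Lu_def TE0_def)
next
 case (TR c g)
 have "Ru c (Dif D (Dif D g)) = 0"
 proof -
  note t = D.arr_typed[of g]
  interpret M: module K "Mor D (Dom D g) (Cod D g) (Deg D g + 2)" using t TR by simp
  show ?thesis
   using Ru_add[OF _ t(1,2) M.zero_closed M.zero_closed, of c] D.dif_dif[OF t] TR by simp
 qed
 thus ?case using TR rdif_ev[of "TR c g"] rdif_ev[of "TR c (Dif D g)"] by (simp add: D.dif_arr Ru_def)
next
 case (TE f gs)
 thus ?case using dd_dd_Lu[of f "Dom D (hd gs)" gs] by (simp add: D.chain_path Lu_def TE0_def)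
next
 case (TAdd s t)
 hence w: "wft s" "wft t" "part s t" by auto
 have o: "dmt s \<in> Obj T" "cdt s \<in> Obj T" using T_obj[OF w(1)] .
 have H: "ev s \<in> rH T (dmt s) (cdt s) (dgt s)" "ev t \<in> rH T (dmt s) (cdt s) (dgt s)"
  using ev_H[OF w(1)] ev_H[OF w(2)] w(3) by (auto simp: tpar_def)
 show ?case using TAdd.IH w
  by (simp add: ev_add V.dif_add[OF o H] V.dif_add[OF o V.dif_H[OF o H(1)] V.dif_H[OF o H(2)]])
next
 case (TScale a t)
 hence w: "wft t" "a \<in> carrier K" by auto
 note o = T_obj[OF w(1)] and H = ev_H[OF w(1)]
 show ?case using TScale.IH w
  by (simp add: ev_scale V.dif_sc[OF o w(2) H] V.dif_sc[OF o w(2) V.dif_H[OF o H]])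
next
 case (TComp s t)
 hence w: "wft s" "wft t" "dmt s = cdt t" by auto
 note os = T_obj[OF w(1)] and ot = T_obj(1)[OF w(2)]
 note Hs = ev_H[OF w(1)] and Ht = ev_H[OF w(2), folded w(3)]
 note ds = V.dif_H[OF os Hs] and dt = V.dif_H[OF ot os(1) Ht]
 let ?m = "dgt t" and ?n = "dgt s"
 have m1: "rmul T (rdif T (ev s)) (ev t) \<in> rH T (dmt t) (cdt s) (?m + ?n + 1)"
  using V.mul_H[OF Ht ds] by (simp add: algebra_simps)
 have m2: "rmul T (ev s) (rdif T (ev t)) \<in> rH T (dmt t) (cdt s) (?m + ?n + 1)"
  using V.mul_H[OF dt Hs] by (simp add: algebra_simps)
 have "rdif T (rdif T (rmul T (ev s) (ev t)))
  = rdif T (rmul T (rdif T (ev s)) (ev t)) + sgv ?n (rdif T (rmul T (ev s) (rdif T (ev t))))"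
  unfolding V.dif_mul[OF ot os Ht Hs]
  by (simp only: V.dif_add[OF ot os(2) m1 V.H_sgv[OF m2]] V.dif_sgv[OF ot os(2) m2])
 also have "\<dots> = 0"
  unfolding V.dif_mul[OF ot os Ht ds] V.dif_mul[OF ot os dt Hs] TComp.IH(1)[OF w(1)] TComp.IH(2)[OF w(2)]
  by (simp add: V.mul_zerol[OF Ht] V.mul_zeror[OF Hs] sgv_add) (simp add: sgv_def)
 finally show ?case using w by (simp add: ev_comp)
qed

theorem T_dg: "dg_category K T"
proof (intro dg_category.intro dg_category_axioms.intro C.field_axioms)
 fix x y A n assume *: "x \<in> Obj T" "y \<in> Obj T" "A \<in> mor T x y n"
 then obtain t where t: "A = clt t" "wft t" "dmt t = x" "cdt t = y" "dgt t = n"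
  unfolding carrier_T by blast
 note d = tdif_typed[OF t(2)]
 show "Dif T A \<in> mor T x y (n + 1)"
  using d t by (auto simp: Dif_T intro!: cls_mor)
 have "rdif T (rdif T (ev t)) = ev (dft (dft t))"
  using d t by (simp add: rdif_ev)
 hence "ev (dft (dft t)) = ev (TZero x y (n + 2))"
  using rdif_rdif[OF t(2)] ev_zero[OF *(1,2)] by simp
 hence "relt (dft (dft t)) (TZero x y (n + 2))"
  by (rule ev_inj[rotated 3]) (use d t tdif_typed[OF conjunct1[OF d]] * in "auto simp: tpar_def")
 thus "Dif T (Dif T A) = \<zero>\<^bsub>Mor T x y (n + 2)\<^esub>"
  using d t by (simp add: Dif_T zero_T cls_eqI)
 { fix B assume "B \<in> mor T x y n"
  then obtain s where s: "B = clt s" "wft s" "dmt s = x" "cdt s = y" "dgt s = n"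
   unfolding carrier_T by blast
  show "Dif T (madd T x y n A B) = Dif T A \<oplus>\<^bsub>Mor T x y (n + 1)\<^esub> Dif T B"
   using d t s tdif_typed[OF s(2)] by (simp add: add_T Dif_T tpar_def) }
 { fix a assume "a \<in> carrier K"
  thus "Dif T (mscale T x y n a A) = a \<odot>\<^bsub>Mor T x y (n + 1)\<^esub> Dif T A"
   using d t by (simp add: smult_T Dif_T) }
next
 fix x y z A B m n
 assume *: "x \<in> Obj T" "y \<in> Obj T" "z \<in> Obj T" "A \<in> mor T x y m" "B \<in> mor T y z n"
 then obtain s t where s: "A = clt s" "B = clt t"
    "wft s" "wft t" "dmt s = x" "dmt t = y"
    "cdt s = y" "cdt t = z" "dgt s = m" "dgt t = n"
  unfolding carrier_T by blast
 note d = tdif_typed[OF s(3)] tdif_typed[OF s(4)]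
 show "Dif T (Comp T B A) = Comp T (Dif T B) A
       \<oplus>\<^bsub>Mor T x z (m + n + 1)\<^esub> sg K n \<odot>\<^bsub>Mor T x z (m + n + 1)\<^esub> Comp T B (Dif T A)"
  using s d by (simp add: Comp_T Dif_T smult_T add_T tpar_def sg_closed)
qed (fact G.mor_module G.mor_typed G.idn_closed G.comp_closed G.comp_add_left G.comp_add_right
   G.comp_smult_left G.comp_smult_right G.comp_assoc G.comp_idn_left G.comp_idn_right)+

end

section \<open>Interpretations that commute with differentials\<close>

locale up_dg = up K C D Ob H sc mul idn ob Rc Lc + X: vdg K Ob H sc mul idn dif
 for K :: "'k ring" and C :: "('k, 'c, 'f) dgcat" and D :: "('k, 'd, 'g) dgcat"
  and Ob :: "'x set" and H :: "'x => 'x => int => 'v::ab_group_add set" and sc mul idn ob Rc Lc dif +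
 assumes Lc_dif: "[| x \<in> Obj C; y \<in> Obj C; f \<in> mor C x y n|] ==>
   Lc (Dif C f) = difc D mul dif (ob x) (ob y) (Rc x) (Rc y) n (Lc f)"
  and Rc_dif: "[| c \<in> Obj C; g \<in> arr D|] ==>
   Rc c (Dif D g) = dif (ob c (Dom D g)) (ob c (Cod D g)) (Deg D g) (Rc c g)"
begin

sublocale Y: coch_dg K D Ob H sc mul idn "Obj C" ob Rc dif
 by (intro coch_dg.intro Y.coch_axioms X.vdg_axioms)

lemma ip_ob:
 assumes "wft t"
 shows "obp (dmt t) \<in> Ob" "obp (cdt t) \<in> Ob"
 using tdom_obj[OF assms] tcod_obj[OF assms] Y.Phi_Ob by auto

lemma ip_dif_TE0:
 assumes f: "f \<in> arr C" and p: "path D d gs"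
 shows "Lc (Dif C f) d gs - Y.dl (Dom C f) (Cod C f) (Deg C f) (Lc f) d gs
  = dif (ob (Dom C f) d) (ob (Cod C f) (pend D d gs)) (Deg C f + wt D gs) (Lc f d gs)"
 using p unfolding Lc_dif[OF C.arr_typed[OF f]] by (simp add: difc_def plus_fun_def ddc_def)

text \<open>By linearity and the Leibniz rule only epsilons are at stake. There
  \<open>ip_tdif_TE\<close> leaves the total differential of \<open>Lc f\<close> minus its
  Hochschild part, which is the internal differential of the target.\<close>

lemma ip_dif:
 "wft t ==> ip (dft t) = dif (obp (dmt t)) (obp (cdt t)) (dgt t) (ip t)"
proof (induction t)
 case (TZero x y n)
 thus ?case using X.dif_0[of "obp x" "obp y" n] Y.Phi_Ob by auto
next
 case (TId x)
 thus ?case using X.dif_idn[of "obp x"] Y.Phi_Ob by auto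
next
 case (TL f d)
 hence "path D d []" "f \<in> arr C" by simp_all
 thus ?case
  using ip_dif_TE0[of f d "[]"] Y.dl_Nil[OF C.arr_typed(1,2) Lc_HD, of f d] TL by simp
next
 case (TR c g)
 thus ?case using Rc_dif by simp
next
 case (TE f gs)
 hence p: "path D (Dom D (hd gs)) gs" "gs \<noteq> []" "f \<in> arr C" by (auto simp: D.chain_path)
 show ?case
  using ip_tdif_TE[OF p(3,1,2)] ip_dif_TE0[OF p(3,1)] pend_last[OF p(2), of D "Dom D (hd gs)"]
  by (simp del: tdif.simps)
next
 case (TAdd s t)
 hence w: "wft s" "wft t" "dmt t = dmt s" "cdt t = cdt s" "dgt t = dgt s"
  by (auto simp: tpar_def)
 show ?case
  using TAdd.IH w X.dif_add[OF ip_ob[OF w(1)] ip_H[OF w(1)] ip_H[OF w(2), unfolded w(3-5)]] by simp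
next
 case (TScale a t)
 hence w: "wft t" "a \<in> carrier K" by auto
 show ?case using TScale.IH w X.dif_sc[OF ip_ob[OF w(1)] w(2) ip_H[OF w(1)]] by simp
next
 case (TComp s t)
 hence w: "wft s" "wft t" "dmt s = cdt t" by auto
 note t = ip_H[OF w(2), folded w(3)] and s = ip_H[OF w(1)]
 note o = ip_ob(1)[OF w(2)] ip_ob[OF w(1)]
 have "mul (dgt t + 1) (ip s) (ip (dft t)) \<in> H (obp (dmt t)) (obp (cdt s)) (dgt t + 1 + dgt s)"
  using Y.T.mul_H[OF X.dif_H[OF o(1,2) t] s] TComp.IH(2)[OF w(2)] w(3) by simp
 from Y.T.sc_sg[OF this, of "dgt s"]
 show ?case
  using X.dif_mul[OF o(1,2,3) t s] TComp.IH(1)[OF w(1)] TComp.IH(2)[OF w(2)] tdif_typed[OF w(2)] w(3)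
  by (simp add: add.commute)
qed

end

section \<open>Linear functionals on the twisted tensor product\<close>

text \<open>The way back from the realization. The space of morphisms is prescribed, so that 0 has a
  definite preimage too.\<close>

definition unemb :: "('k, 'o, 'm) dgcat => 'o => 'o => int => ('o, 'm) dual => 'm" where
 "unemb C x y n v = (THE m. m \<in> mor C x y n \<and> emb C m = v)"

context graded_category
begin

lemma unemb_emb:
 assumes "x \<in> Obj C" "y \<in> Obj C" "m \<in> mor C x y n"
 shows "unemb C x y n (emb C m) = m"
 unfolding unemb_def by (rule the_equality) (use assms emb_inj in blast)+

lemma unemb_add:
 assumes "x \<in> Obj C" "y \<in> Obj C" "v \<in> rH C x y n" "w \<in> rH C x y n"
  and add: "\<And>A B. A \<in> mor C x y n ==> B \<in> mor C x y n ==>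
   theta (madd C x y n A B) = theta A + (theta B :: 'v :: ab_group_add)"
 shows "theta (unemb C x y n (v + w)) = theta (unemb C x y n v) + theta (unemb C x y n w)"
proof -
 interpret M: module K "Mor C x y n" using assms by simp
 obtain f g where f: "f \<in> mor C x y n" "v = emb C f" and g: "g \<in> mor C x y n" "w = emb C g"
  using assms(1-4) by (auto simp: rH_def)
 have "v + w = emb C (madd C x y n f g)" using emb_add[OF assms(1,2) f(1) g(1)] f g by simp
 thus ?thesis using f g assms(1,2) add by (simp add: unemb_emb)
qed

end

lemma additive_sgv:
 fixes theta :: "'a :: ab_group_add => 'v :: ab_group_add"
 assumes "\<And>v w. v \<in> S ==> w \<in> S ==> theta (v + w) = theta v + theta w" "0 \<in> S" "\<And>v. v \<in> S ==> - v \<in> S" "v \<in> S"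
 shows "theta 0 = 0" "theta (- v) = - theta v" "theta (sgv n v) = sgv n (theta v)"
proof -
 show z: "theta 0 = 0" using assms(1)[OF assms(2,2)] by simp
 show "theta (- v) = - theta v"
  using assms(1)[OF assms(4) assms(3)[OF assms(4)]] z by (simp add: eq_neg_iff_add_eq_0 add.commute)
 thus "theta (sgv n v) = sgv n (theta v)" by (simp add: sgv_def)
qed

text \<open>The class of an epsilon with a possibly empty list of arguments.\<close>

definition eps0 where "eps0 K C D f d gs = tcls K C D (TE0 f gs (pend D d gs))"

context tensor_pair
begin

abbreviation "e0 \<equiv> eps0 K C D"
abbreviation "r \<equiv> tright K C D"

lemma e0_mor:
 assumes "f \<in> arr C" "path D d gs"
 shows "e0 f d gs \<in> mor T (Dom C f, d) (Cod C f, pend D d gs) (Deg C f + wt D gs)"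
 using cls_mor'[OF TE0_typed(1)[OF assms]] TE0_typed(2-4)[OF assms] by (simp add: eps0_def)

lemma r_mor:
 assumes "c \<in> Obj C" "g \<in> arr D"
 shows "r c g \<in> mor T (c, Dom D g) (c, Cod D g) (Deg D g)"
 using cls_mor'[of "TR c g"] assms by (simp add: tright_def)

lemma e0_arr:
 assumes "f \<in> arr C" "path D d gs"
 shows "e0 f d gs \<in> arr T" "Dom T (e0 f d gs) = (Dom C f, d)" "Cod T (e0 f d gs) = (Cod C f, pend D d gs)"
  "Deg T (e0 f d gs) = Deg C f + wt D gs"
 using cls_arr[OF TE0_typed(1)[OF assms]] cls_typed[OF TE0_typed(1)[OF assms]] TE0_typed(2-4)[OF assms]
 by (simp_all add: eps0_def)

lemma r_arr:
 assumes "c \<in> Obj C" "g \<in> arr D"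
 shows "r c g \<in> arr T" "Dom T (r c g) = (c, Dom D g)" "Cod T (r c g) = (c, Cod D g)" "Deg T (r c g) = Deg D g"
 using cls_arr[of "TR c g"] cls_typed[of "TR c g"] assms by (simp_all add: tright_def)

lemma emb_r: "emb T (r c g) = Ru c g"
 by (simp add: tright_def Ru_def ev_def)

lemma emb_e0: "path D d gs ==> emb T (e0 f d gs) = Lu f d gs"
 by (simp add: eps0_def Lu_path ev_def)

lemma r_comp:
 assumes "g1 \<in> arr D" "g2 \<in> arr D" "Cod D g1 = Dom D g2" "c \<in> Obj C"
 shows "Comp T (r c g2) (r c g1) = r c (Comp D g2 g1)"
 using Comp_T[of "TR c g2" "TR c g1"] cls_eqI[OF trel.R_comp[OF assms]] assms by (simp add: tright_def)

lemma r_dif: "c \<in> Obj C ==> g \<in> arr D ==> Dif T (r c g) = r c (Dif D g)"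
 using Dif_T[of "TR c g"] by (simp add: tright_def)

lemma r_id: "c \<in> Obj C ==> d \<in> Obj D ==> r c (Idn D d) = Idn T (c, d)"
 using cls_eqI[OF trel.R_id] by (simp add: tright_def Idn_T)

lemma r_lin:
 assumes "c \<in> Obj C" "u \<in> Obj D" "v \<in> Obj D" "x \<in> mor D u v n" "y \<in> mor D u v n"
  "a \<in> carrier K" "b \<in> carrier K"
 shows "r c (lc D u v n a x b y)
  = a \<odot>\<^bsub>Mor T (c, u) (c, v) n\<^esub> r c x \<oplus>\<^bsub>Mor T (c, u) (c, v) n\<^esub> b \<odot>\<^bsub>Mor T (c, u) (c, v) n\<^esub> r c y"
proof -
 interpret M: module K "Mor D u v n" using assms by simp
 interpret N: module K "Mor T (c, u) (c, v) n" using assms by (intro T_module) simp_all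
 note t = D.mor_DCD[OF assms(2-4)] D.mor_DCD[OF assms(2,3,5)] D.arrI[OF assms(2-4)] D.arrI[OF assms(2,3,5)]
 have z: "lc D u v n a x b y \<in> mor D u v n"
  using assms by simp
 have r: "r c w \<in> mor T (c, u) (c, v) n" if "w \<in> mor D u v n" for w
  using r_mor[OF assms(1) D.arrI[OF assms(2,3) that]] D.mor_DCD[OF assms(2,3) that] by simp
 note o = \<open>c \<in> Obj C\<close> assms(2,3)
 have ob: "(c, u) \<in> Obj T" "(c, v) \<in> Obj T" using o by simp_all
 note ax = r[OF assms(4)] and ay = r[OF assms(5)]
 show ?thesis
  by (rule G.emb_inj[OF ob r[OF z] N.a_closed[OF N.smult_closed[OF assms(6) ax] N.smult_closed[OF assms(7) ay]]])
   (simp only: G.emb_add[OF ob N.smult_closed[OF assms(6) ax] N.smult_closed[OF assms(7) ay]]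
    G.rsc_emb[OF ob assms(6) ax, symmetric] G.rsc_emb[OF ob assms(7) ay, symmetric] emb_r N.R_lin[OF assms])
qed

lemma e0_lin_left:
 assumes "u \<in> Obj C" "v \<in> Obj C" "x \<in> mor C u v n" "y \<in> mor C u v n"
  "a \<in> carrier K" "b \<in> carrier K" and p: "path D d gs" and M: "M = Mor T (u, d) (v, pend D d gs) (n + wt D gs)"
 shows "e0 (lc C u v n a x b y) d gs
  = a \<odot>\<^bsub>M\<^esub> e0 x d gs \<oplus>\<^bsub>M\<^esub> b \<odot>\<^bsub>M\<^esub> e0 y d gs"
proof -
 interpret M: module K "Mor C u v n" using assms by simp
 have ob: "(u, d) \<in> Obj T" "(v, pend D d gs) \<in> Obj T" using assms D.path_obj[OF p] D.path_end[OF p] by simp_all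
 interpret N: module K M unfolding M by (rule T_module[OF ob])
 have r: "e0 w d gs \<in> carrier M" if "w \<in> mor C u v n" for w
  using e0_mor[OF C.arrI[OF assms(1,2) that] p] C.mor_DCD[OF assms(1,2) that] by (simp add: M)
 note ax = r[OF assms(3)] and ay = r[OF assms(4)]
 note sx = N.smult_closed[OF assms(5) ax] and sy = N.smult_closed[OF assms(6) ay]
 note mx = M.smult_closed[OF assms(5,3)] and my = M.smult_closed[OF assms(6,4)]
 show ?thesis
 proof (rule G.emb_inj[OF ob, where n = "n + wt D gs", folded M, OF r[OF M.a_closed[OF mx my]] N.a_closed[OF sx sy]])
  show "emb T (e0 (lc C u v n a x b y) d gs)
   = emb T (a \<odot>\<^bsub>M\<^esub> e0 x d gs \<oplus>\<^bsub>M\<^esub> b \<odot>\<^bsub>M\<^esub> e0 y d gs)"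
   unfolding G.emb_add[OF ob, where n = "n + wt D gs", folded M, OF sx sy] G.rsc_emb[OF ob assms(5), where n = "n + wt D gs", folded M, OF ax, symmetric]
    G.rsc_emb[OF ob assms(6), where n = "n + wt D gs", folded M, OF ay, symmetric] emb_e0[OF p] Lu_add[OF assms(1,2) mx my]
    Lu_scale[OF assms(1,2,3,5)] Lu_scale[OF assms(1,2,4,6)] by (simp add: scc_def)
 qed
qed

lemma e0_lin_right:
 assumes "f \<in> arr C" "u \<in> Obj D" "v \<in> Obj D" "x \<in> mor D u v n" "y \<in> mor D u v n"
  "a \<in> carrier K" "b \<in> carrier K" and p: "path D d (as @ x # bs)"
  and M: "M = Mor T (Dom C f, d) (Cod C f, pend D d (as @ x # bs)) (Deg C f + wt D (as @ x # bs))"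
 shows "e0 f d (as @ (lc D u v n a x b y) # bs)
  = a \<odot>\<^bsub>M\<^esub> e0 f d (as @ x # bs) \<oplus>\<^bsub>M\<^esub> b \<odot>\<^bsub>M\<^esub> e0 f d (as @ y # bs)"
proof -
 interpret M: module K "Mor D u v n" using assms by simp
 have ob: "(Dom C f, d) \<in> Obj T" "(Cod C f, pend D d (as @ x # bs)) \<in> Obj T"
  using C.arr_typed[OF assms(1)] D.path_obj[OF p] D.path_end[OF p] by (simp_all del: pend_append)
 interpret N: module K M unfolding M by (rule T_module[OF ob])
 have z: "lc D u v n a x b y \<in> mor D u v n"
  using assms by simp
 have pw: "path D d (as @ w # bs)" if "w \<in> mor D u v n" for w
  using p N.mor_par(1)[OF assms(2,3) that assms(4)] by blast
 have r: "e0 f d (as @ w # bs) \<in> carrier M" if "w \<in> mor D u v n" for w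
  using e0_mor[OF assms(1) pw[OF that]] N.mor_par(2,3)[OF assms(2,3) that assms(4)] unfolding M by simp
 note ax = r[OF assms(4)] and ay = r[OF assms(5)]
 note sx = N.smult_closed[OF assms(6) ax] and sy = N.smult_closed[OF assms(7) ay]
 show ?thesis
 proof (rule G.emb_inj[OF ob, where n = "Deg C f + wt D (as @ x # bs)", folded M, OF r[OF z] N.a_closed[OF sx sy]])
  show "emb T (e0 f d (as @ (lc D u v n a x b y) # bs))
   = emb T (a \<odot>\<^bsub>M\<^esub> e0 f d (as @ x # bs) \<oplus>\<^bsub>M\<^esub> b \<odot>\<^bsub>M\<^esub> e0 f d (as @ y # bs))"
   unfolding G.emb_add[OF ob, where n = "Deg C f + wt D (as @ x # bs)", folded M, OF sx sy] G.rsc_emb[OF ob assms(6), where n = "Deg C f + wt D (as @ x # bs)", folded M, OF ax, symmetric]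
    G.rsc_emb[OF ob assms(7), where n = "Deg C f + wt D (as @ x # bs)", folded M, OF ay, symmetric] emb_e0[OF pw[OF z]] emb_e0[OF pw[OF assms(4)]]
    emb_e0[OF pw[OF assms(5)]]
   using Lu_lin[OF assms(1)] assms(2-7) p unfolding linc_def ling_def by blast
 qed
qed

lemma e0_zero_iff:
 assumes "f \<in> arr C" "path D d gs" "Lu f d gs = 0"
 shows "e0 f d gs = \<zero>\<^bsub>Mor T (Dom C f, d) (Cod C f, pend D d gs) (Deg C f + wt D gs)\<^esub>"
proof -
 have ob: "(Dom C f, d) \<in> Obj T" "(Cod C f, pend D d gs) \<in> Obj T"
  using C.arr_typed[OF assms(1)] D.path_obj[OF assms(2)] D.path_end[OF assms(2)] by simp_all
 show ?thesis by (rule G.emb_eq_zeroD[OF ob e0_mor[OF assms(1,2)]]) (simp add: emb_e0 assms)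
qed

lemma e0_id_right:
 assumes "f \<in> arr C" "c \<in> Obj D" "path D d (as @ Idn D c # bs)"
 shows "e0 f d (as @ Idn D c # bs) = \<zero>\<^bsub>Mor T (Dom C f, d) (Cod C f, pend D d (as @ Idn D c # bs))
  (Deg C f + wt D (as @ Idn D c # bs))\<^esub>"
 by (rule e0_zero_iff[OF assms(1,3)]) (use Lu_red[OF assms(1)] assms(2,3) in "unfold redc_def, blast")

lemma e0_id_left:
 assumes "c \<in> Obj C" "path D d gs" "gs \<noteq> []"
 shows "e0 (Idn C c) d gs = \<zero>\<^bsub>Mor T (c, d) (c, pend D d gs) (wt D gs)\<^esub>"
 using e0_zero_iff[OF C.idn_arr(1)[OF assms(1)] assms(2)] C.idn_arr[OF assms(1)] assms
 by (simp add: Lu_id idc_def)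

lemma e0_id_Nil: "c \<in> Obj C ==> d \<in> Obj D ==> e0 (Idn C c) d [] = Idn T (c, d)"
 using cls_eqI[OF trel.L_id] by (simp add: eps0_def TE0_def Idn_T)

context
 fixes theta :: "('k, 'c, 'f, 'd, 'g) tterm set => 'v :: ab_group_add" and x y n
 assumes x: "x \<in> Obj T" and y: "y \<in> Obj T"
  and add: "\<And>A B. A \<in> mor T x y n ==> B \<in> mor T x y n ==>
   theta (madd T x y n A B) = theta A + theta B"
begin

abbreviation "thetae v \<equiv> theta (unemb T x y n v)"

lemma thetae_emb: "A \<in> mor T x y n ==> thetae (emb T A) = theta A"
 by (simp add: G.unemb_emb[OF x y])

lemma thetae_add: "v \<in> rH T x y n ==> w \<in> rH T x y n ==> thetae (v + w) = thetae v + thetae w"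
 by (rule G.unemb_add[OF x y]) (simp_all add: add)

lemma thetae_sgv: "v \<in> rH T x y n ==> thetae (sgv m v) = sgv m (thetae v)"
 using additive_sgv(3)[where theta = "\<lambda>v. thetae v" and S = "rH T x y n"] thetae_add V.H_zero V.H_neg by blast

lemma thetae_neg: "v \<in> rH T x y n ==> thetae (- v) = - thetae v"
 using additive_sgv(2)[where theta = "\<lambda>v. thetae v" and S = "rH T x y n"] thetae_add V.H_zero V.H_neg by blast

lemma thetae_diff: "v \<in> rH T x y n ==> w \<in> rH T x y n ==> thetae (v - w) = thetae v - thetae w"
 using thetae_add[of v "- w"] thetae_neg[of w] V.H_neg by simp

text \<open>The relation for a composed first argument, transported by an additive map
  \<open>theta\<close> on one space of morphisms. The typical \<open>theta\<close> inserts a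
  morphism into one place of a function of several arguments; functors composed with
  \<open>emb\<close> are another instance.\<close>

lemma theta_comp:
 assumes f: "f1 \<in> arr C" "f2 \<in> arr C" "Cod C f1 = Dom C f2" and p: "path D d gs"
  and xy: "x = (Dom C f1, d)" "y = (Cod C f2, pend D d gs)" "n = Deg C f1 + Deg C f2 + wt D gs"
 shows "theta (e0 (Comp C f2 f1) d gs)
  = cut (\<lambda>as bs. sgv (Deg C f1 * wt D bs) (theta (Comp T (e0 f2 (pend D d as) bs) (e0 f1 d as)))) gs"
proof -
 note t1 = C.arr_typed[OF f(1)] and t2 = C.arr_typed[OF f(2)]
 have m: "Comp T (e0 f2 (pend D d as) bs) (e0 f1 d as) \<in> mor T x y n"
  "emb T (Comp T (e0 f2 (pend D d as) bs) (e0 f1 d as)) = rmul T (Lu f2 (pend D d as) bs) (Lu f1 d as)"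
  if s: "as @ bs = gs" for as bs
 proof -
  have pa: "path D d as" "path D (pend D d as) bs" using p s by auto
  have o: "(Dom C f1, d) \<in> Obj T" "(Cod C f1, pend D d as) \<in> Obj T" "(Cod C f2, pend D d gs) \<in> Obj T"
   using t1 t2 p pa D.path_obj D.path_end by auto
  have e: "pend D (pend D d as) bs = pend D d gs" and w: "Deg C f1 + wt D as + (Deg C f2 + wt D bs) = n"
   using s xy by auto
  note a = e0_mor[OF f(1) pa(1)] and b = e0_mor[OF f(2) pa(2), folded f(3), unfolded e]
  show "Comp T (e0 f2 (pend D d as) bs) (e0 f1 d as) \<in> mor T x y n"
   using G.comp_closed[OF o a b] unfolding w xy(1,2) .
  show "emb T (Comp T (e0 f2 (pend D d as) bs) (e0 f1 d as)) = rmul T (Lu f2 (pend D d as) bs) (Lu f1 d as)"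
   using G.rmul_emb[OF o a b] by (simp add: emb_e0 pa)
 qed
 have mH: "rmul T (Lu f2 (pend D d as) bs) (Lu f1 d as) \<in> rH T x y n" if s: "as @ bs = gs" for as bs
  using G.rH_I[OF x y m(1)[OF s]] m(2)[OF s] by simp
 have "theta (e0 (Comp C f2 f1) d gs) = thetae (Lu (Comp C f2 f1) d gs)"
  using thetae_emb[of "e0 (Comp C f2 f1) d gs"] e0_mor[OF C.comp_arr(1)[OF f] p] C.comp_arr[OF f] xy
  by (simp add: emb_e0[OF p])
 also have "\<dots> = cut (\<lambda>as bs. thetae (sgv (Deg C f1 * wt D bs) (rmul T (Lu f2 (pend D d as) bs) (Lu f1 d as)))) gs"
  unfolding Lu_comp[OF f] N.mulc_path[OF p]
  by (rule cut_hom[where S = "rH T x y n"]) (use thetae_add V.H_add V.H_sgv[OF mH] in auto)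
 also have "\<dots> = cut (\<lambda>as bs. sgv (Deg C f1 * wt D bs) (theta (Comp T (e0 f2 (pend D d as) bs) (e0 f1 d as)))) gs"
 proof (rule cut_cong, goal_cases)
  case s: (1 as bs)
  show ?case
   unfolding thetae_sgv[OF mH[OF s]] by (simp only: m(2)[OF s, symmetric] thetae_emb[OF m(1)[OF s]])
 qed
 finally show ?thesis .
qed

text \<open>The differential of an epsilon under an additive map. The realization supplies the
  signed sums, which in the module records would have to be formed summand by summand.\<close>

lemma theta_dif:
 assumes f: "f \<in> arr C" and p: "path D d gs"
  and xy: "x = (Dom C f, d)" "y = (Cod C f, pend D d gs)" "n = Deg C f + wt D gs + 1"
 shows "theta (Dif T (e0 f d gs)) = theta (e0 (Dif C f) d gs)
  - (if gs = [] then 0 else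
    sgv (Deg C f * (Deg D (last gs) - 1)) (theta (Comp T (r (Cod C f) (last gs)) (e0 f d (butlast gs)))))
  + (if gs = [] then 0 else
    sgv (Deg C f + wt D (tl gs)) (theta (Comp T (e0 f (Cod D (hd gs)) (tl gs)) (r (Dom C f) (hd gs)))))
  - sgv (Deg C f) (bd D (\<lambda>xs. theta (e0 f d xs)) gs)"
proof -
 note ft = C.arr_typed[OF f] and fd = C.dif_arr[OF f]
 have dm: "Dif T (e0 f d gs) \<in> mor T x y n"
  and de: "emb T (Dif T (e0 f d gs)) = Ld f d gs"
 proof -
  note w = tdif_TE0_typed[OF f p]
  have "Dif T (e0 f d gs) = clt (dft (TE0 f gs (pend D d gs)))"
   using Dif_T[OF TE0_typed(1)[OF f p]] by (simp add: eps0_def)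
  thus "Dif T (e0 f d gs) \<in> mor T x y n" "emb T (Dif T (e0 f d gs)) = Ld f d gs"
   using w xy cls_mor'[OF conjunct1[OF w]] by (simp_all add: ev_def)
 qed
 have d1: "e0 (Dif C f) d gs \<in> mor T x y n"
  using e0_mor[OF fd(1) p] fd xy by (simp add: algebra_simps)
 have L0: "theta (Dif T (e0 f d gs)) = thetae (Lu (Dif C f) d gs - N.dl (Dom C f) (Cod C f) (Deg C f) (Lu f) d gs)"
  using thetae_emb[OF dm] de by (simp add: Ld_def fun_diff_def)
 have L1: "thetae (Lu (Dif C f) d gs) = theta (e0 (Dif C f) d gs)" "Lu (Dif C f) d gs \<in> rH T x y n"
  using thetae_emb[OF d1] G.rH_I[OF x y d1] by (simp_all add: emb_e0[OF p])
 show ?thesis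
 proof (cases "gs = []")
  case True
  thus ?thesis
   using L0 L1 N.dl_Nil[OF ft(1,2) Lu_H[OF f]] p by simp
 next
  case ne: False
  have gsb: "gs = butlast gs @ [last gs]" and gst: "gs = hd gs # tl gs" using ne by simp_all
  hence pb: "path D d (butlast gs)" "last gs \<in> arr D" "pend D d (butlast gs) = Dom D (last gs)"
    "pend D d gs = Cod D (last gs)" "wt D gs = wt D (butlast gs) + (Deg D (last gs) - 1)"
   using p by (metis D.path_append path.simps(2) pend.simps(1,2) pend_append wt_simps(1,2,3) add.right_neutral)+
  from gst have pt: "path D (Cod D (hd gs)) (tl gs)" "hd gs \<in> arr D" "Dom D (hd gs) = d"
    "pend D (Cod D (hd gs)) (tl gs) = pend D d gs" "wt D gs = (Deg D (hd gs) - 1) + wt D (tl gs)"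
   using p by (metis path.simps(2) pend.simps(2) wt_simps(2))+
  let ?b1 = "Comp T (r (Cod C f) (last gs)) (e0 f d (butlast gs))"
  let ?b2 = "Comp T (e0 f (Cod D (hd gs)) (tl gs)) (r (Dom C f) (hd gs))"
  have o: "(Dom C f, d) \<in> Obj T" "(Cod C f, Dom D (last gs)) \<in> Obj T" "(Cod C f, Cod D (last gs)) \<in> Obj T"
   "(Dom C f, Dom D (hd gs)) \<in> Obj T" "(Dom C f, Cod D (hd gs)) \<in> Obj T" "(Cod C f, pend D d gs) \<in> Obj T"
   using ft D.path_obj[OF p] D.path_end[OF p] D.arr_typed[OF pb(2)] D.arr_typed[OF pt(2)] by simp_all
  note m1 = G.comp_closed[OF o(1-3) e0_mor[OF f pb(1), unfolded pb(3)] r_mor[OF ft(2) pb(2)]]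
   G.rmul_emb[OF o(1-3) e0_mor[OF f pb(1), unfolded pb(3)] r_mor[OF ft(2) pb(2)]]
  note m2 = G.comp_closed[OF o(4,5,6) r_mor[OF ft(1) pt(2)] e0_mor[OF f pt(1), unfolded pt(4)]]
   G.rmul_emb[OF o(4,5,6) r_mor[OF ft(1) pt(2)] e0_mor[OF f pt(1), unfolded pt(4)]]
  have n1: "Deg C f + wt D (butlast gs) + Deg D (last gs) = n" "Deg D (hd gs) + (Deg C f + wt D (tl gs)) = n"
   using pb(5) pt(5) xy by simp_all
  have b1: "?b1 \<in> mor T x y n" using m1(1) unfolding n1 xy(1,2) pb(4) .
  have b2: "?b2 \<in> mor T x y n" using m2(1) unfolding n1 xy(1,2) pt(3) .
  have c1: "rmul T (Ru (Cod C f) (last gs)) (Lu f d (butlast gs)) = emb T ?b1"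
   using m1(2) by (simp add: emb_r emb_e0[OF pb(1)])
  have c2: "rmul T (Lu f (Cod D (hd gs)) (tl gs)) (Ru (Dom C f) (hd gs)) = emb T ?b2"
   using m2(2) by (simp add: emb_r emb_e0[OF pt(1)])
  note bH = G.rH_I[OF x y b1] G.rH_I[OF x y b2]
  have xs: "Lu f d xs \<in> rH T x y n" "thetae (Lu f d xs) = theta (e0 f d xs)"
   if "path D d xs" "pend D d xs = pend D d gs" "wt D xs = wt D gs + 1" for xs
  proof -
   have "e0 f d xs \<in> mor T x y n"
    using e0_mor[OF f that(1)] that xy by (simp add: algebra_simps)
   thus "Lu f d xs \<in> rH T x y n" "thetae (Lu f d xs) = theta (e0 f d xs)"
    using thetae_emb G.rH_I[OF x y] by (simp_all add: emb_e0[OF that(1), symmetric])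
  qed
  have bdH: "bd D (Lu f d) gs \<in> rH T x y n"
   by (rule D.bd_closed[OF p]) (use xs V.H_add V.H_neg in auto)
  have bdt: "thetae (bd D (Lu f d) gs) = bd D (\<lambda>xs. theta (e0 f d xs)) gs"
  proof -
   have "thetae (bd D (Lu f d) gs) = bd D (\<lambda>xs. thetae (Lu f d xs)) gs"
    by (rule D.bd_hom[OF p, where S = "rH T x y n" and theta = "\<lambda>v. thetae v"])
     (use xs V.H_add V.H_neg thetae_add in auto)
   also have "\<dots> = bd D (\<lambda>xs. theta (e0 f d xs)) gs"
    by (rule D.bd_cong[OF p]) (simp add: xs)
   finally show ?thesis .
  qed
  have dl: "N.dl (Dom C f) (Cod C f) (Deg C f) (Lu f) d gs
   = sgv (Deg C f * (Deg D (last gs) - 1)) (emb T ?b1) - sgv (Deg C f + wt D (tl gs)) (emb T ?b2)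
    + sgv (Deg C f) (bd D (Lu f d) gs)"
   unfolding N.dl_expand[OF ft(1,2) Lu_H[OF f] p ne] c1 c2 ..
  note H = V.H_sgv[OF bH(1)] V.H_sgv[OF bH(2)] V.H_sgv[OF bdH]
  show ?thesis
   unfolding L0 dl thetae_diff[OF L1(2) V.H_add[OF V.H_diff[OF H(1,2)] H(3)]] thetae_add[OF V.H_diff[OF H(1,2)] H(3)]
    thetae_diff[OF H(1,2)] thetae_sgv[OF bH(1)] thetae_sgv[OF bH(2)] thetae_sgv[OF bdH] L1(1) thetae_emb[OF b1] thetae_emb[OF b2] bdt
   using ne by simp
 qed
qed

end

end

section \<open>Shuffles\<close>

text \<open>The sum of the values of \<open>phi\<close> at all chains in the twisted tensor product in which the
 morphisms of \<open>fs\<close> occur in this order, each taking some consecutive morphisms of \<open>gs\<close> as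
 arguments, with the remaining morphisms of \<open>gs\<close> standing alone.\<close>

primrec sh where
 "sh K C D [] phi c d gs = phi (map (tright K C D c) gs)"
| "sh K C D (f # fs) phi c d gs = cut (\<lambda>h1 r. cut (\<lambda>h2 h3. sgv ((Deg C f - 1) * wt D h3)
   (sh K C D fs (\<lambda>us. phi (map (tright K C D c) h1 @ eps0 K C D f (pend D d h1) h2 # us))
    (Cod C f) (pend D (pend D d h1) h2) h3)) r) gs"

lemma cut_map: "cut F (map f gs) = cut (\<lambda>as bs. F (map f as) (map f bs)) gs"
 by (induction gs arbitrary: F) simp_all

lemma bd_cut_swap: "bd D (\<lambda>x. cut (F x) gs) fs = cut (\<lambda>as bs. bd D (\<lambda>x. F x as bs) fs) gs"
 by (induction gs arbitrary: F) (simp_all add: bd_add)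

text \<open>Both sides distinguish one letter \<open>x\<close>; on the left it opens the right
  piece, on the right it closes the left piece.\<close>

lemma cut_shift:
 "cut (\<lambda>as bs. case bs of [] => 0 | x # bs' => G as x bs') gs
  = cut (\<lambda>as bs. if as = [] then 0 else G (butlast as) (last as) bs) gs"
proof (induction gs arbitrary: G)
 case (Cons g gs)
 have "cut (\<lambda>as bs. if g # as = [] then 0 else G (butlast (g # as)) (last (g # as)) bs) gs
   = cut (\<lambda>as bs. (if as = [] then G [] g bs else 0)
     + (if as = [] then 0 else G (g # butlast as) (last as) bs)) gs"
  by (rule cut_cong) simp
 also have "\<dots> = G [] g gs + cut (\<lambda>as bs. if as = [] then 0 else G (g # butlast as) (last as) bs) gs"
  unfolding cut_add by (subst cut_snd) simp_all
 also have "\<dots> = G [] g gs + cut (\<lambda>as bs. case bs of [] => 0 | x # bs' => G (g # as) x bs') gs"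
  by (simp only: Cons.IH[of "\<lambda>as. G (g # as)"])
 finally show ?case by simp
qed simp

lemma sh_add: "sh K C D fs (\<lambda>us. phi us + psi us) c d gs = sh K C D fs phi c d gs + sh K C D fs psi c d gs"
 by (induction fs arbitrary: phi psi c d gs) (simp_all add: cut_add sgv_add)

lemma sh_minus: "sh K C D fs (\<lambda>us. - phi us) c d gs = - sh K C D fs phi c d gs"
 by (induction fs arbitrary: phi c d gs) (simp_all add: cut_minus sgv_minus)

lemma sh_prod: "sh K C D fs (\<lambda>us. (phi us, psi us)) c d gs = (sh K C D fs phi c d gs, sh K C D fs psi c d gs)"
 by (induction fs arbitrary: phi psi c d gs) (simp_all add: sgv_prod cut_prod)

lemma sh_sgv: "sh K C D fs (\<lambda>us. sgv n (phi us)) c d gs = sgv n (sh K C D fs phi c d gs)"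
 by (simp add: sgv_def sh_minus)

lemma sh_0 [simp]: "sh K C D fs (\<lambda>us. 0) c d gs = 0"
 by (induction fs arbitrary: c d gs) (simp_all add: cut_0)

text \<open>The summands of a shuffle whose first argument involves \<open>f\<close>.\<close>

definition shd where
 "shd K C D f fs phi d gs = cut (\<lambda>h2 h3. sgv ((Deg C f - 1) * wt D h3)
   (sh K C D fs (\<lambda>us. phi (eps0 K C D f d h2 # us)) (Cod C f) (pend D d h2) h3)) gs"

text \<open>The first entry of a shuffled list is either the one that contains \<open>f\<close> or
  the first letter of \<open>gs\<close> standing alone.\<close>

lemma sh_Cons: "sh K C D (f # fs) phi c d gs = shd K C D f fs phi d gs +
  (case gs of [] => 0 | g # gs' => sh K C D (f # fs) (\<lambda>us. phi (tright K C D c g # us)) c (Cod D g) gs')"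
 by (cases gs) (simp_all add: shd_def)

lemma sh_cut_const:
 "sh K C D fs (\<lambda>us. cut (F us) h) c d gs = cut (\<lambda>a b. sh K C D fs (\<lambda>us. F us a b) c d gs) h"
 by (induction h arbitrary: F) (simp_all add: sh_add)

text \<open>Shuffling is compatible with deconcatenation: cutting a shuffled list amounts to cutting
  \<open>fs\<close> and \<open>gs\<close> separately, because every entry stays on one side. The
  sign is that of exchanging \<open>f1\<close> with the part \<open>g2\<close> that ends up behind
  it.\<close>

lemma sh_cut:
 fixes C :: "('k, 'c, 'f) dgcat" and D :: "('k, 'd, 'g) dgcat"
 shows "sh K C D fs (cut G) c d gs = cut (\<lambda>f1 f2. cut (\<lambda>g1 g2. sgv (wt C f1 * wt D g2)
   (sh K C D f1 (\<lambda>a. sh K C D f2 (G a) (pend C c f1) (pend D d g1) g2) c d g1)) gs) fs"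
proof (induction fs arbitrary: G c d gs)
 case Nil
 show ?case unfolding sh.simps cut_map cut.simps by simp
next
 case (Cons f fs)
 let ?r = "map (tright K C D c)" and ?e = "eps0 K C D f" and ?sh = "sh K C D"
 let ?p = "\<lambda>h1 h2. pend D (pend D d h1) h2" and ?s = "\<lambda>h3. sgv ((Deg C f - 1) * wt D h3)"
 let ?N = "\<lambda>f1 f2 h1 h2 k g2. sgv (wt C (f # f1) * wt D g2) (?s k
   (?sh f1 (\<lambda>a. ?sh f2 (G (?r h1 @ ?e (pend D d h1) h2 # a)) (pend C (Cod C f) f1) (pend D (?p h1 h2) k) g2)
    (Cod C f) (?p h1 h2) k))"
 \<comment> \<open>Cuts among the letters standing alone in front of the entry of
   \<open>f\<close>.\<close>
 have 1: "cut (\<lambda>h1 r. cut (\<lambda>h2 h3. ?s h3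
   (?sh fs (\<lambda>us. cut (\<lambda>a1 a2. G (?r a1) (?r a2 @ ?e (pend D d h1) h2 # us)) h1) (Cod C f) (?p h1 h2) h3)) r) gs
  = cut (\<lambda>g1 g2. ?sh (f # fs) (G (?r g1)) c (pend D d g1) g2) gs"
 proof -
  have "cut (\<lambda>h1 r. cut (\<lambda>h2 h3. ?s h3
   (?sh fs (\<lambda>us. cut (\<lambda>a1 a2. G (?r a1) (?r a2 @ ?e (pend D d h1) h2 # us)) h1) (Cod C f) (?p h1 h2) h3)) r) gs
   = cut (\<lambda>h1 r. cut (\<lambda>a1 a2. cut (\<lambda>h2 h3. ?s h3
   (?sh fs (\<lambda>us. G (?r a1) (?r a2 @ ?e (pend D (pend D d a1) a2) h2 # us)) (Cod C f)
    (pend D (pend D (pend D d a1) a2) h2) h3)) r) h1) gs"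
  proof (rule cut_cong, goal_cases)
   case (1 h1 r)
   have "cut (\<lambda>h2 h3. ?s h3
    (?sh fs (\<lambda>us. cut (\<lambda>a1 a2. G (?r a1) (?r a2 @ ?e (pend D d h1) h2 # us)) h1) (Cod C f) (?p h1 h2) h3)) r
    = cut (\<lambda>a1 a2. cut (\<lambda>h2 h3. ?s h3
    (?sh fs (\<lambda>us. G (?r a1) (?r a2 @ ?e (pend D d h1) h2 # us)) (Cod C f) (?p h1 h2) h3)) r) h1"
    unfolding sh_cut_const cut_sgv[symmetric] by (rule cut_swap)
   also have "\<dots> = cut (\<lambda>a1 a2. cut (\<lambda>h2 h3. ?s h3
   (?sh fs (\<lambda>us. G (?r a1) (?r a2 @ ?e (pend D (pend D d a1) a2) h2 # us)) (Cod C f)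
    (pend D (pend D (pend D d a1) a2) h2) h3)) r) h1"
    by (rule cut_cong) auto
   finally show ?case .
  qed
  also have "\<dots> = cut (\<lambda>g1 g2. ?sh (f # fs) (G (?r g1)) c (pend D d g1) g2) gs"
   unfolding cut_coassoc sh.simps ..
  finally show ?thesis .
 qed
 \<comment> \<open>Cuts behind the entry of \<open>f\<close>. The induction hypothesis handles the
   rest of the list; the cuts of \<open>fs\<close> and of \<open>gs\<close> are then interchanged
   and regrouped.\<close>
 have 2: "cut (\<lambda>h1 r. cut (\<lambda>h2 h3. ?s h3
   (?sh fs (cut (\<lambda>a. G (?r h1 @ ?e (pend D d h1) h2 # a))) (Cod C f) (?p h1 h2) h3)) r) gs
  = cut (\<lambda>f1 f2. cut (\<lambda>g1 g2. sgv (wt C (f # f1) * wt D g2)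
   (?sh (f # f1) (\<lambda>a. ?sh f2 (G a) (pend C c (f # f1)) (pend D d g1) g2) c d g1)) gs) fs"
 proof -
  have "cut (\<lambda>h1 r. cut (\<lambda>h2 h3. ?s h3
   (?sh fs (cut (\<lambda>a. G (?r h1 @ ?e (pend D d h1) h2 # a))) (Cod C f) (?p h1 h2) h3)) r) gs
   = cut (\<lambda>h1 r. cut (\<lambda>h2 h3. cut (\<lambda>f1 f2. cut (\<lambda>k g2. ?N f1 f2 h1 h2 k g2) h3) fs) r) gs"
   unfolding Cons.IH cut_sgv[symmetric]
  proof (intro cut_cong)
   fix h1 r h2 f1 f2 and h3 k g2 :: "'g list" assume h: "k @ g2 = h3"
   show "?s h3 (sgv (wt C f1 * wt D g2)
     (?sh f1 (\<lambda>a. ?sh f2 (G (?r h1 @ ?e (pend D d h1) h2 # a)) (pend C (Cod C f) f1) (pend D (?p h1 h2) k) g2)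
     (Cod C f) (?p h1 h2) k)) = ?N f1 f2 h1 h2 k g2"
    unfolding h[symmetric] sgv_sgv by (rule arg_cong[where f = "\<lambda>n. sgv n _"]) (simp add: algebra_simps)
  qed
  also have "\<dots> = cut (\<lambda>h1 r. cut (\<lambda>f1 f2. cut (\<lambda>h2 h3. cut (\<lambda>k g2. ?N f1 f2 h1 h2 k g2) h3) r) fs) gs"
   by (intro cut_cong cut_swap)
  also have "\<dots> = cut (\<lambda>f1 f2. cut (\<lambda>h1 r. cut (\<lambda>h2 h3. cut (\<lambda>k g2. ?N f1 f2 h1 h2 k g2) h3) r) gs) fs"
   by (rule cut_swap)
  also have "\<dots> = cut (\<lambda>f1 f2. cut (\<lambda>g1 g2. cut (\<lambda>h1 r. cut (\<lambda>h2 k. ?N f1 f2 h1 h2 k g2) r) g1) gs) fs"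
   unfolding cut_coassoc[symmetric] ..
  also have "\<dots> = cut (\<lambda>f1 f2. cut (\<lambda>g1 g2. sgv (wt C (f # f1) * wt D g2)
    (?sh (f # f1) (\<lambda>a. ?sh f2 (G a) (pend C c (f # f1)) (pend D d g1) g2) c d g1)) gs) fs"
   unfolding sh.simps cut_sgv[symmetric] by (intro cut_cong) auto
  finally show ?thesis .
 qed
 have mid: "cut G (?r h1 @ x # us) = cut (\<lambda>a1 a2. G (?r a1) (?r a2 @ x # us)) h1 + cut (\<lambda>a. G (?r h1 @ x # a)) us"
  for h1 x us
  unfolding cut_mid cut_map ..
 have "?sh (f # fs) (cut G) c d gs = cut (\<lambda>g1 g2. ?sh (f # fs) (G (?r g1)) c (pend D d g1) g2) gs
  + cut (\<lambda>f1 f2. cut (\<lambda>g1 g2. sgv (wt C (f # f1) * wt D g2)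
    (?sh (f # f1) (\<lambda>a. ?sh f2 (G a) (pend C c (f # f1)) (pend D d g1) g2) c d g1)) gs) fs"
  by (subst sh.simps(2)) (unfold mid sh_add sgv_add cut_add 1 2, rule HOL.refl)
 thus ?case by (simp del: sh.simps(2))
qed

context tensor_pair
begin

lemma r_path: "c \<in> Obj C ==> path D d gs ==> path T (c, d) (map (r c) gs)"
 by (induction gs arbitrary: d) (auto simp: r_arr)

lemma r_pend: "c \<in> Obj C ==> path D d gs ==> pend T (c, d) (map (r c) gs) = (c, pend D d gs)"
 by (induction gs arbitrary: d) (auto simp: r_arr)

lemma r_wt: "c \<in> Obj C ==> path D d gs ==> wt T (map (r c) gs) = wt D gs"
 by (induction gs arbitrary: d) (auto simp: r_arr)

abbreviation "sf \<equiv> sh K C D"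
abbreviation "sd \<equiv> shd K C D"

lemma sh_adm:
 assumes "path C c (f # fs)" "path D d (h1 @ h2 @ h3)" and us: "path T (Cod C f, pend D (pend D d h1) h2) us"
  "pend T (Cod C f, pend D (pend D d h1) h2) us = (pend C (Cod C f) fs, pend D (pend D (pend D d h1) h2) h3)"
  "wt T us = wt C fs + wt D h3"
 defines "xs \<equiv> map (r c) h1 @ e0 f (pend D d h1) h2 # us"
 shows "path T (c, d) xs" "pend T (c, d) xs = (pend C c (f # fs), pend D d (h1 @ h2 @ h3))"
  "wt T xs = wt C (f # fs) + wt D (h1 @ h2 @ h3)"
proof -
 have c: "c \<in> Obj C" "f \<in> arr C" "Dom C f = c" using assms(1) C.arr_typed by auto
 have p: "path D d h1" "path D (pend D d h1) h2" using assms(2) by auto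
 show "path T (c, d) xs" "pend T (c, d) xs = (pend C c (f # fs), pend D d (h1 @ h2 @ h3))"
  "wt T xs = wt C (f # fs) + wt D (h1 @ h2 @ h3)"
  using c p us by (simp_all add: xs_def r_path r_pend r_wt e0_arr)
qed

text \<open>Induction principle for shuffles. The parameter \<open>i\<close> lets \<open>P\<close>
  relate several values, for instance two functions in \<open>sh_cong\<close> or the points at which
  linearity is tested in \<open>lp_sh\<close>.\<close>

lemma sh_gen:
 assumes "path C c fs" "path D d gs" "\<And>us. path T (c, d) us ==>
  pend T (c, d) us = (pend C c fs, pend D d gs) ==> wt T us = wt C fs + wt D gs ==> P (\<lambda>i. phi i us)"
  and P: "\<And>F G. P F ==> P G ==> P (\<lambda>i. F i + G i)" "\<And>F. P F ==> P (\<lambda>i. - F i)"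
 shows "P (\<lambda>i. sf fs (phi i) c d gs)"
 using assms(1-3)
proof (induction fs arbitrary: phi c d gs)
 case Nil
 thus ?case by (simp add: r_path r_pend r_wt)
next
 case (Cons f fs)
 have cut: "P (\<lambda>i. cut (F i) gs)" if "\<And>as bs. as @ bs = gs ==> P (\<lambda>i. F i as bs)" for F and gs :: "'g list"
  using that by (induction gs arbitrary: F) (auto intro!: P(1))
 have s: "P (\<lambda>i. sgv n (F i))" if "P F" for n F using that P(2) by (cases "even n") (simp_all add: sgv_def)
 show ?case
  unfolding sh.simps
 proof (rule cut, rule cut, rule s, rule Cons.IH)
  fix h1 rs h2 h3 us assume s: "h1 @ rs = gs" "h2 @ h3 = rs"
   and us: "path T (Cod C f, pend D (pend D d h1) h2) us"
   "pend T (Cod C f, pend D (pend D d h1) h2) us = (pend C (Cod C f) fs, pend D (pend D (pend D d h1) h2) h3)"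
   "wt T us = wt C fs + wt D h3"
  have "path D d (h1 @ h2 @ h3)" using Cons.prems(2) s by auto
  note a = sh_adm[OF Cons.prems(1) this us]
  show "P (\<lambda>i. phi i (map (r c) h1 @ e0 f (pend D d h1) h2 # us))"
   by (rule Cons.prems(3)) (use a s in auto)
 next
  fix h1 rs h2 h3 assume s: "h1 @ rs = gs" "h2 @ h3 = rs"
  show "path C (Cod C f) fs" "path D (pend D (pend D d h1) h2) h3" using Cons.prems(1,2) s by auto
 qed
qed

lemma sh_cong:
 assumes "path C c fs" "path D d gs" "\<And>us. path T (c, d) us ==>
  pend T (c, d) us = (pend C c fs, pend D d gs) ==> wt T us = wt C fs + wt D gs ==> phi us = psi us"
 shows "sf fs phi c d gs = sf fs psi c d gs"
 using sh_gen[OF assms(1,2), where P = "\<lambda>F. F True = F False" and phi = "\<lambda>i. if i then phi else psi"] assms(3) by simp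

lemma sh_closed:
 assumes "path C c fs" "path D d gs" "\<And>us. path T (c, d) us ==>
  pend T (c, d) us = (pend C c fs, pend D d gs) ==> wt T us = wt C fs + wt D gs ==> phi us \<in> S"
  and "\<And>v w. v \<in> S ==> w \<in> S ==> v + w \<in> S" "\<And>v. v \<in> S ==> - v \<in> S"
 shows "sf fs phi c d gs \<in> S"
 using sh_gen[OF assms(1,2), where P = "\<lambda>F. F () \<in> S" and phi = "\<lambda>_. phi"] assms(3-5) by blast

text \<open>Closure of shuffles is applied to the graph of \<open>theta\<close>, which is closed
  under sums and negation.\<close>

lemma sh_hom:
 assumes "path C c fs" "path D d gs" "\<And>us. path T (c, d) us ==>
  pend T (c, d) us = (pend C c fs, pend D d gs) ==> wt T us = wt C fs + wt D gs ==> phi us \<in> S"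
  and S: "0 \<in> S" "\<And>v w. v \<in> S ==> w \<in> S ==> v + w \<in> S" "\<And>v. v \<in> S ==> - v \<in> S"
  "\<And>v w. v \<in> S ==> w \<in> S ==> theta (v + w) = theta v + theta w"
 shows "theta (sf fs phi c d gs) = sf fs (\<lambda>us. theta (phi us)) c d gs"
proof -
 have "sf fs (\<lambda>us. (phi us, theta (phi us))) c d gs \<in> {(v, theta v) |v. v \<in> S}"
  by (rule sh_closed[OF assms(1,2)])
   (use assms(3) S additive_sgv(2)[where theta = theta and S = S, OF S(4,1,3)] in auto)
 thus ?thesis unfolding sh_prod by auto
qed

text \<open>Additivity in every place. This is what \<open>theta_comp\<close> and
  \<open>theta_dif\<close> require of the map that inserts an entry.\<close>

definition addg :: "'c \<times> 'd => (('k, 'c, 'f, 'd, 'g) tterm set list => 'v :: ab_group_add) => bool" where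
 "addg v phi \<longleftrightarrow> (\<forall>as bs x y n A B. x \<in> Obj T \<longrightarrow> y \<in> Obj T \<longrightarrow> A \<in> mor T x y n \<longrightarrow>
   B \<in> mor T x y n \<longrightarrow> path T v (as @ A # bs) \<longrightarrow>
   phi (as @ (madd T x y n A B) # bs) = phi (as @ A # bs) + phi (as @ B # bs))"

lemma addgD: "addg v phi ==> x \<in> Obj T ==> y \<in> Obj T ==> A \<in> mor T x y n ==>
   B \<in> mor T x y n ==> path T v (as @ A # bs) ==>
   phi (as @ (madd T x y n A B) # bs) = phi (as @ A # bs) + phi (as @ B # bs)"
 unfolding addg_def by blast

lemma addg_shift:
 assumes "addg v phi" "u \<in> arr T" "Dom T u = v"
 shows "addg (Cod T u) (\<lambda>us. phi (u # us))"
 unfolding addg_def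
 using addgD[OF assms(1), where as = "u # _"] assms(2,3) by simp

lemma sh_add_arg:
 assumes "addg v phi" "v \<in> Obj T" "path C c fs" "path D d gs"
  "A \<in> mor T v (c, d) n" "B \<in> mor T v (c, d) n"
 shows "sf fs (\<lambda>us. phi ((A \<oplus>\<^bsub>Mor T v (c, d) n\<^esub> B) # us)) c d gs
  = sf fs (\<lambda>us. phi (A # us)) c d gs + sf fs (\<lambda>us. phi (B # us)) c d gs"
 unfolding sh_add[symmetric]
proof (rule sh_cong[OF assms(3,4)], goal_cases)
 case us: (1 us)
 have o: "(c, d) \<in> Obj T" using C.path_obj[OF assms(3)] D.path_obj[OF assms(4)] by simp
 have "path T v (A # us)" using G.arrI[OF assms(2) o assms(5)] G.mor_DCD[OF assms(2) o assms(5)] us by simp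
 with addgD[OF assms(1,2) o assms(5,6), of "[]" us]
 show ?case by simp
qed

lemma sh_hd:
 "sf fs (\<lambda>us. case us of [] => 0 | u # us' => psi u us') c d gs =
  (case fs of [] => 0 | f # fs' => cut (\<lambda>h2 h3. sgv ((Deg C f - 1) * wt D h3)
    (sf fs' (psi (e0 f d h2)) (Cod C f) (pend D d h2) h3)) gs)
  + (case gs of [] => 0 | g # gs' => sf fs (psi (r c g)) c (Cod D g) gs')"
proof (cases fs)
 case Nil
 thus ?thesis by (cases gs) simp_all
next
 case (Cons f fs')
 show ?thesis
  using sh_Cons[of K C D f fs' "\<lambda>us. case us of [] => 0 | u # us' => psi u us'" c d gs]
  unfolding Cons by (cases gs) (simp_all add: shd_def del: sh.simps cut.simps)
qed

lemma bd_r: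
 assumes "c \<in> Obj C" "path D d gs"
 shows "bd T phi (map (r c) gs) = bd D (\<lambda>xs. phi (map (r c) xs)) gs"
 using assms(2)
proof (induction gs arbitrary: d phi)
 case (Cons g gs)
 hence g: "g \<in> arr D" "path D (Cod D g) gs" by auto
 note IH = Cons.IH[OF g(2), of "\<lambda>xs. phi (r c g # xs)"] and w = r_wt[OF assms(1) g(2)]
 show ?case
 proof (cases gs)
  case Nil
  thus ?thesis using r_dif[OF assms(1) g(1)] by simp
 next
  case (Cons g' gs')
  hence g': "g' \<in> arr D" "Cod D g = Dom D g'" using g by auto
  have "bd T phi (map (r c) (g # gs)) = sgv (wt D gs) (phi (r c (Dif D g) # map (r c) gs))
    + bd D (\<lambda>xs. phi (map (r c) (g # xs))) gs + sgv (wt D gs) (phi (r c (Comp D g' g) # map (r c) gs'))"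
   using IH w r_dif[OF assms(1) g(1)] r_comp[OF g(1) g' assms(1)] unfolding Cons
   by (simp only: list.map bd.simps list.case)
  thus ?thesis unfolding Cons by (simp only: bd.simps list.case list.map)
 qed
qed simp

text \<open>The bar differential on shuffled lists that begin with the entry of \<open>f\<close>,
  given the result for \<open>fs\<close>. The extra summand on the left composes this entry with a
  letter \<open>g\<close> in front of it; it comes from lists that begin with \<open>g\<close> and
  is included here because it cancels against a term of the differential of the entry.\<close>

lemma shd_bd:
 fixes phi :: "('k, 'c, 'f, 'd, 'g) tterm set list => 'v :: ab_group_add"
 assumes ad: "addg (c, d) phi" and pc: "path C c (f # fs)" and pd: "path D d gs"
  and IH: "\<And>c d gs (phi :: _ => 'v). path C c fs ==> path D d gs ==> addg (c, d) phi ==>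
   sf fs (bd T phi) c d gs = bd C (\<lambda>x. sf x phi c d gs) fs + sgv (wt C fs) (bd D (\<lambda>x. sf fs phi c d x) gs)"
 shows "sd f fs (bd T phi) d gs + (case gs of [] => 0 | g # gs' => sgv (wt C (f # fs) + wt D gs')
   (cut (\<lambda>h2 h3. sgv ((Deg C f - 1) * wt D h3) (sf fs (\<lambda>us. phi (Comp T (e0 f (Cod D g) h2) (r c g) # us))
    (Cod C f) (pend D (Cod D g) h2) h3)) gs'))
  = sgv (wt C fs) (sd (Dif C f) fs phi d gs) + bd C (\<lambda>x. sd f x phi d gs) fs
   + (case fs of [] => 0 | f' # fs' => sgv (wt C fs) (sd (Comp C f' f) fs' phi d gs))
   + sgv (wt C (f # fs)) (bd D (\<lambda>x. sd f fs phi d x) gs)"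
proof -
 have f: "f \<in> arr C" "Dom C f = c" "path C (Cod C f) fs" using pc by auto
 have v: "(c, d) \<in> Obj T" using C.arr_typed[OF f(1)] f(2) D.path_obj[OF pd] by simp
 let ?p = "Deg C f" and ?w = "wt C fs"
 define theta where "theta h2 h3 u = sf fs (\<lambda>us. phi (u # us)) (Cod C f) (pend D d h2) h3" for h2 h3 u
 have p: "path D d h2" "path D (pend D d h2) h3" if "h2 @ h3 = gs" for h2 h3 using pd that by auto
 \<comment> \<open>\<open>a1\<close> to \<open>a4\<close> come from the differential of the first
   entry as expanded by \<open>theta_dif\<close>, \<open>b1\<close> and \<open>b2\<close> from
   changes behind it, and \<open>k1\<close>, \<open>k2\<close> from composing it with the next
   entry, which contains a letter of \<open>fs\<close> or is a single letter of
   \<open>gs\<close>.\<close>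
 define a1 where "a1 h2 h3 = sgv (?p * wt D h3 + ?w) (theta h2 h3 (e0 (Dif C f) d h2))" for h2 h3
 define a2 where "a2 h2 h3 = (if h2 = [] then 0 else sgv (?p * wt D h3 + ?w + ?p * (Deg D (last h2) - 1))
  (theta h2 h3 (Comp T (r (Cod C f) (last h2)) (e0 f d (butlast h2)))))" for h2 h3
 define a3 where "a3 h2 h3 = (if h2 = [] then 0 else sgv (?p * wt D h3 + ?w + ?p + wt D (tl h2))
  (theta h2 h3 (Comp T (e0 f (Cod D (hd h2)) (tl h2)) (r c (hd h2)))))" for h2 h3
 define a4 where "a4 h2 h3 = sgv (?p * wt D h3 + ?w + ?p) (bd D (\<lambda>xs. theta h2 h3 (e0 f d xs)) h2)" for h2 h3
 define b1 where "b1 h2 h3 = sgv ((?p - 1) * wt D h3)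
  (bd C (\<lambda>x. sf x (\<lambda>us. phi (e0 f d h2 # us)) (Cod C f) (pend D d h2) h3) fs)" for h2 h3
 define b2 where "b2 h2 h3 = sgv ((?p - 1) * wt D h3 + ?w)
  (bd D (\<lambda>x. sf fs (\<lambda>us. phi (e0 f d h2 # us)) (Cod C f) (pend D d h2) x) h3)" for h2 h3
 define k1 where "k1 h2 h3 = (case fs of [] => 0 | f' # fs' => sgv (?p * wt D h3 + ?w)
   (cut (\<lambda>k2 k3. sgv ((Deg C f' - 1) * wt D k3) (sf fs' (\<lambda>us. phi (Comp T (e0 f' (pend D d h2) k2) (e0 f d h2) # us))
    (Cod C f') (pend D (pend D d h2) k2) k3)) h3))" for h2 h3
 define k2 where "k2 h2 h3 = (case h3 of [] => 0 | g # h3' => sgv (?p * wt D h3 + ?w)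
   (sf fs (\<lambda>us. phi (Comp T (r (Cod C f) g) (e0 f d h2) # us)) (Cod C f) (Cod D g) h3'))" for h2 h3
 have main: "sd f fs (bd T phi) d gs = cut (\<lambda>h2 h3. a1 h2 h3 - a2 h2 h3 + a3 h2 h3 - a4 h2 h3 + b1 h2 h3 + b2 h2 h3
   + k1 h2 h3 + k2 h2 h3) gs"
  unfolding shd_def
 proof (rule cut_cong, goal_cases)
  case s: (1 h2 h3)
  note p = p[OF s]
  note e = e0_arr[OF f(1) p(1)]
  let ?phi = "\<lambda>us. phi (e0 f d h2 # us)" and ?s = "\<lambda>psi. sf fs psi (Cod C f) (pend D d h2) h3"
  have ad': "addg (Cod C f, pend D d h2) ?phi" using addg_shift[OF ad e(1)] e f(2) by simp
  have "?s (\<lambda>us. bd T phi (e0 f d h2 # us))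
   = ?s (\<lambda>us. sgv (?w + wt D h3) (phi (Dif T (e0 f d h2) # us)) + bd T ?phi us
    + sgv (?w + wt D h3) (case us of [] => 0 | u' # us' => phi (Comp T u' (e0 f d h2) # us')))"
   by (rule sh_cong[OF f(3) p(2)]) (auto split: list.split simp del: wt_simps)
  also have "\<dots> = sgv (?w + wt D h3) (theta h2 h3 (Dif T (e0 f d h2)))
    + (bd C (\<lambda>x. sf x ?phi (Cod C f) (pend D d h2) h3) fs
     + sgv (wt C fs) (bd D (\<lambda>x. sf fs ?phi (Cod C f) (pend D d h2) x) h3))
    + sgv (?w + wt D h3) (?s (\<lambda>us. (case us of [] => 0 | u' # us' => phi (Comp T u' (e0 f d h2) # us'))))"
   unfolding sh_add sh_sgv theta_def IH[OF f(3) p(2) ad'] ..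
  also have "theta h2 h3 (Dif T (e0 f d h2)) = theta h2 h3 (e0 (Dif C f) d h2)
   - (if h2 = [] then 0 else
    sgv (?p * (Deg D (last h2) - 1)) (theta h2 h3 (Comp T (r (Cod C f) (last h2)) (e0 f d (butlast h2)))))
   + (if h2 = [] then 0 else
    sgv (?p + wt D (tl h2)) (theta h2 h3 (Comp T (e0 f (Cod D (hd h2)) (tl h2)) (r c (hd h2)))))
   - sgv ?p (bd D (\<lambda>xs. theta h2 h3 (e0 f d xs)) h2)"
  proof -
   have y: "(Cod C f, pend D d h2) \<in> Obj T" using C.arr_typed[OF f(1)] D.path_obj[OF p(2)] by simp
   show ?thesis
    using theta_dif[OF v y, where theta = "theta h2 h3", OF _ f(1) p(1) _ HOL.refl HOL.refl] f(2)
     sh_add_arg[OF ad v f(3) p(2)] unfolding theta_def by blast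
  qed
  finally have 1: "?s (\<lambda>us. bd T phi (e0 f d h2 # us)) = sgv (?w + wt D h3) (theta h2 h3 (e0 (Dif C f) d h2)
   - (if h2 = [] then 0 else
    sgv (?p * (Deg D (last h2) - 1)) (theta h2 h3 (Comp T (r (Cod C f) (last h2)) (e0 f d (butlast h2)))))
   + (if h2 = [] then 0 else
    sgv (?p + wt D (tl h2)) (theta h2 h3 (Comp T (e0 f (Cod D (hd h2)) (tl h2)) (r c (hd h2)))))
   - sgv ?p (bd D (\<lambda>xs. theta h2 h3 (e0 f d xs)) h2))
    + (bd C (\<lambda>x. sf x ?phi (Cod C f) (pend D d h2) h3) fs
     + sgv (wt C fs) (bd D (\<lambda>x. sf fs ?phi (Cod C f) (pend D d h2) x) h3))
    + sgv (?w + wt D h3) (?s (\<lambda>us. (case us of [] => 0 | u' # us' => phi (Comp T u' (e0 f d h2) # us'))))" .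
  have 2: "sgv ((?p - 1) * wt D h3) (sgv (?w + wt D h3) x) = sgv (?p * wt D h3 + ?w) x" for x :: 'v
   by (simp add: algebra_simps)
  show ?case
   unfolding 1 sgv_add 2 sh_hd a1_def a2_def a3_def a4_def b1_def b2_def k1_def k2_def
   by (simp add: sgv_add sgv_diff add.assoc split: list.split)
 qed
 have A1: "cut a1 gs = sgv ?w (sd (Dif C f) fs phi d gs)"
  unfolding shd_def cut_sgv[symmetric] a1_def[abs_def] theta_def using C.dif_arr[OF f(1)]
  by (intro cut_cong) (simp add: add.commute)
 \<comment> \<open>Splitting the last argument off an epsilon on the left gives the same composite
   as composing a shorter epsilon with a single letter behind it; \<open>cut_shift\<close> matches
   the two sums.\<close>
 have A2: "cut a2 gs = cut k2 gs"
 proof -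
  let ?G = "\<lambda>as x bs. sgv (?p * wt D (x # bs) + ?w)
   (sf fs (\<lambda>us. phi (Comp T (r (Cod C f) x) (e0 f d as) # us)) (Cod C f) (Cod D x) bs)"
  have "cut a2 gs = cut (\<lambda>as bs. if as = [] then 0 else ?G (butlast as) (last as) bs) gs"
   by (rule cut_cong) (auto simp: a2_def theta_def pend_last algebra_simps)
  also have "\<dots> = cut (\<lambda>as bs. case bs of [] => 0 | x # bs' => ?G as x bs') gs"
   by (rule cut_shift[symmetric])
  also have "\<dots> = cut k2 gs"
   by (rule cut_cong) (simp add: k2_def split: list.split)
  finally show ?thesis .
 qed
 \<comment> \<open>Likewise with the first argument and a single letter in front, which is the extra
   summand of the statement.\<close>
 have A3: "cut a3 gs = - (case gs of [] => 0 | g # gs' => sgv (wt C (f # fs) + wt D gs')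
   (cut (\<lambda>h2 h3. sgv ((Deg C f - 1) * wt D h3) (sf fs (\<lambda>us. phi (Comp T (e0 f (Cod D g) h2) (r c g) # us))
    (Cod C f) (pend D (Cod D g) h2) h3)) gs'))"
 proof (cases gs)
  case (Cons g gs')
  have "cut (\<lambda>h2. a3 (g # h2)) gs' = cut (\<lambda>h2 h3. - sgv (wt C (f # fs) + wt D gs')
   (sgv ((Deg C f - 1) * wt D h3) (sf fs (\<lambda>us. phi (Comp T (e0 f (Cod D g) h2) (r c g) # us))
    (Cod C f) (pend D (Cod D g) h2) h3))) gs'"
   by (rule cut_cong) (auto simp: a3_def theta_def sgv_def)
  thus ?thesis
   unfolding Cons cut.simps list.case cut_minus cut_sgv by (simp only: a3_def if_True add_0 simp_thms)
 qed (simp add: a3_def)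
 have B1: "cut b1 gs = bd C (\<lambda>x. sd f x phi d gs) fs"
  unfolding shd_def bd_cut_swap b1_def[abs_def] bd_sgv ..
 \<comment> \<open>Changes among the arguments of \<open>f\<close> and changes in the letters behind
   them are the two halves of the bar differential of \<open>gs\<close> in
   \<open>bd_cut\<close>.\<close>
 have B2: "cut b2 gs - cut a4 gs = sgv (wt C (f # fs)) (bd D (\<lambda>x. sd f fs phi d x) gs)"
  unfolding shd_def bd_cut cut_diff[symmetric] cut_sgv[symmetric]
 proof (rule cut_cong, goal_cases)
  case s: (1 as bs)
  have 1: "bd D (\<lambda>xs. sgv ((?p - 1) * wt D bs) (sf fs (\<lambda>us. phi (e0 f d xs # us)) (Cod C f) (pend D d xs) bs)) as
   = sgv ((?p - 1) * wt D bs) (bd D (\<lambda>xs. theta as bs (e0 f d xs)) as)"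
   unfolding bd_sgv[symmetric] by (rule D.bd_cong[OF p(1)[OF s]]) (simp add: theta_def)
  have 2: "bd D (\<lambda>xs. sgv ((?p - 1) * wt D xs) (sf fs (\<lambda>us. phi (e0 f d as # us)) (Cod C f) (pend D d as) xs)) bs
   = sgv ((?p - 1) * (wt D bs + 1)) (bd D (\<lambda>x. sf fs (\<lambda>us. phi (e0 f d as # us)) (Cod C f) (pend D d as) x) bs)"
   unfolding bd_sgv[symmetric] by (rule D.bd_cong[OF p(2)[OF s]]) simp
  show ?case
   unfolding 1 2 b2_def a4_def by (auto simp: sgv_def)
 qed
 \<comment> \<open>Composites of neighbouring epsilons, summed over all cuts of their arguments,
   form the epsilon of the composite of \<open>f\<close> and \<open>f'\<close>.\<close>
 have K1: "cut k1 gs = (case fs of [] => 0 | f' # fs' => sgv ?w (sd (Comp C f' f) fs' phi d gs))"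
 proof (cases fs)
  case (Cons f' fs')
  hence f': "f' \<in> arr C" "Cod C f = Dom C f'" "path C (Cod C f') fs'" using f(3) by auto
  let ?X = "\<lambda>a1 a2 b. sf fs' (\<lambda>us. phi (Comp T (e0 f' (pend D d a1) a2) (e0 f d a1) # us)) (Cod C f')
   (pend D (pend D d a1) a2) b"
  let ?Y = "\<lambda>a1 a2 b. sgv ((Deg C (Comp C f' f) - 1) * wt D b) (sgv (?p * wt D a2) (?X a1 a2 b))"
  have 1: "sf fs' (\<lambda>us. phi (e0 (Comp C f' f) d a # us)) (Cod C f') (pend D d a) b
   = cut (\<lambda>a1 a2. sgv (?p * wt D a2) (?X a1 a2 b)) a" if s: "a @ b = gs" for a b
  proof -
   have y: "(Cod C f', pend D d a) \<in> Obj T" using C.arr_typed[OF f'(1)] D.path_obj[OF p(2)[OF s]] by simp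
   have "sf fs' (\<lambda>us. phi (e0 (Comp C f' f) d a # us)) (Cod C f') (pend D d a) b
    = cut (\<lambda>a1 a2. sgv (?p * wt D a2) (sf fs' (\<lambda>us. phi (Comp T (e0 f' (pend D d a1) a2) (e0 f d a1) # us)) (Cod C f')
     (pend D d a) b)) a"
    using theta_comp[OF v y, where theta = "\<lambda>u. sf fs' (\<lambda>us. phi (u # us)) (Cod C f') (pend D d a) b",
     OF _ f(1) f'(1,2) p(1)[OF s] _ HOL.refl HOL.refl] f(2) sh_add_arg[OF ad v f'(3) p(2)[OF s]] by blast
   also have "\<dots> = cut (\<lambda>a1 a2. sgv (?p * wt D a2) (?X a1 a2 b)) a"
    by (rule cut_cong) auto
   finally show ?thesis .
  qed
  have "sd (Comp C f' f) fs' phi d gs = cut (\<lambda>a b. cut (\<lambda>a1 a2. ?Y a1 a2 b) a) gs"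
   unfolding shd_def C.comp_arr(3)[OF f(1) f'(1,2)] cut_sgv by (rule cut_cong) (simp only: 1)
  also have "\<dots> = cut (\<lambda>h2 h3. cut (\<lambda>k2 k3. ?Y h2 k2 k3) h3) gs"
   by (rule cut_coassoc)
  finally have 2: "sd (Comp C f' f) fs' phi d gs = cut (\<lambda>h2 h3. cut (\<lambda>k2 k3. ?Y h2 k2 k3) h3) gs" .
  show ?thesis
   unfolding Cons list.case 2 cut_sgv[symmetric] k1_def C.comp_arr(4)[OF f(1) f'(1,2)]
  proof (intro cut_cong)
   fix h2 h3 k2 k3 :: "'g list" assume "k2 @ k3 = h3"
   hence "wt D h3 = wt D k2 + wt D k3" by auto
   thus "sgv (?p * wt D h3 + wt C (f' # fs')) (sgv ((Deg C f' - 1) * wt D k3) (?X h2 k2 k3))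
    = sgv (wt C (f' # fs')) (sgv ((?p + Deg C f' - 1) * wt D k3) (sgv (?p * wt D k2) (?X h2 k2 k3)))"
    by (simp add: algebra_simps)
  qed
 qed (simp add: k1_def cut_0)
 show ?thesis
  unfolding main cut_add cut_diff A1 A2 A3 B1 B2[symmetric] K1[symmetric] by simp
qed

text \<open>Shuffling commutes with the bar differentials. The outer induction on \<open>fs\<close>
  treats lists beginning with the entry of \<open>f\<close>, through \<open>shd_bd\<close>; the
  inner one on \<open>gs\<close> treats those beginning with a letter of \<open>gs\<close>.\<close>

lemma sh_bd:
 fixes phi :: "('k, 'c, 'f, 'd, 'g) tterm set list => 'v :: ab_group_add"
 assumes "path C c fs" "path D d gs" "addg (c, d) phi"
 shows "sf fs (bd T phi) c d gs = bd C (\<lambda>x. sf x phi c d gs) fs + sgv (wt C fs) (bd D (\<lambda>x. sf fs phi c d x) gs)"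
 using assms
proof (induction fs arbitrary: c d gs phi)
 case Nil
 thus ?case using bd_r[of c d gs phi] by simp
next
 case (Cons f fs)
 note IHf = Cons.IH
 show ?case using Cons.prems(2,1,3)
 proof (induction gs arbitrary: d phi)
  case Nil
  have 1: "sf (f # x) psi c d [] = sd f x psi d []" for f x and psi :: "_ => 'v" by (simp add: shd_def)
  show ?case
   using shd_bd[OF Nil(3,2,1) IHf] unfolding bd.simps 1 list.case by (simp only: add_0_right sgv_zero)
 next
  case (Cons g gs)
  let ?phi = "\<lambda>us. phi (r c g # us)" and ?W = "wt C (f # fs)"
  have c: "c \<in> Obj C" using Cons.prems(2) C.path_obj by blast
  have g: "g \<in> arr D" "Dom D g = d" "path D (Cod D g) gs" using Cons.prems(1) by auto
  have ad: "addg (c, Cod D g) ?phi"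
   using addg_shift[OF Cons.prems(3) r_arr(1)[OF c g(1)]] r_arr[OF c g(1)] g(2) by simp
  define B where "B g x = sf (f # fs) (\<lambda>us. phi (r c g # us)) c (Cod D g) x" for g x
  have S1: "sf (f # x) psi c d (g # gs) = sd f x psi d (g # gs) + sf (f # x) (\<lambda>us. psi (r c g # us)) c (Cod D g) gs"
   for f x and psi :: "_ => 'v"
   using sh_Cons[of K C D f x psi c d "g # gs"] by (simp only: list.case)
  have S2: "sf (f # fs) phi c d = (\<lambda>x. sd f fs phi d x + (case x of [] => 0 | g # x' => B g x'))"
   unfolding B_def by (rule ext, rule sh_Cons)
  have L: "sf (f # fs) (\<lambda>us. bd T phi (r c g # us)) c (Cod D g) gs
   = sgv (?W + wt D gs) (B (Dif D g) gs)
    + (bd C (\<lambda>x. sf x ?phi c (Cod D g) gs) (f # fs) + sgv ?W (bd D (B g) gs))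
    + sgv (?W + wt D gs) (cut (\<lambda>h2 h3. sgv ((Deg C f - 1) * wt D h3)
      (sf fs (\<lambda>us. phi (Comp T (e0 f (Cod D g) h2) (r c g) # us)) (Cod C f) (pend D (Cod D g) h2) h3)) gs
     + (case gs of [] => 0 | g' # gs' => B (Comp D g' g) gs'))"
  proof -
   have "sf (f # fs) (\<lambda>us. bd T phi (r c g # us)) c (Cod D g) gs
    = sf (f # fs) (\<lambda>us. sgv (?W + wt D gs) (phi (r c (Dif D g) # us)) + bd T ?phi us
     + sgv (?W + wt D gs) (case us of [] => 0 | u' # us' => phi (Comp T u' (r c g) # us'))) c (Cod D g) gs"
    by (rule sh_cong[OF Cons.prems(2) g(3)]) (auto split: list.split simp: r_dif[OF c g(1)] simp del: wt_simps)
   also have "\<dots> = sgv (?W + wt D gs) (B (Dif D g) gs)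
    + (bd C (\<lambda>x. sf x ?phi c (Cod D g) gs) (f # fs) + sgv ?W (bd D (B g) gs))
    + sgv (?W + wt D gs) (sf (f # fs) (\<lambda>us. case us of [] => 0 | u' # us' => phi (Comp T u' (r c g) # us')) c (Cod D g) gs)"
    unfolding sh_add sh_sgv Cons.IH[OF g(3) Cons.prems(2) ad] B_def D.dif_arr(3)[OF g(1)] ..
   also have "sf (f # fs) (\<lambda>us. case us of [] => 0 | u' # us' => phi (Comp T u' (r c g) # us')) c (Cod D g) gs
    = cut (\<lambda>h2 h3. sgv ((Deg C f - 1) * wt D h3)
      (sf fs (\<lambda>us. phi (Comp T (e0 f (Cod D g) h2) (r c g) # us)) (Cod C f) (pend D (Cod D g) h2) h3)) gs
     + (case gs of [] => 0 | g' # gs' => B (Comp D g' g) gs')"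
   proof -
    have "sf (f # fs) (\<lambda>us. phi (Comp T (r c g') (r c g) # us)) c (Cod D g') gs' = B (Comp D g' g) gs'"
     if "gs = g' # gs'" for g' gs'
     using r_comp[OF g(1) _ _ c, of g'] D.comp_arr[OF g(1), of g'] g(3) that unfolding B_def by simp
    thus ?thesis unfolding sh_hd by (simp split: list.split)
   qed
   finally show ?thesis .
  qed
  have R: "bd D (\<lambda>x. case x of [] => 0 | g # x' => B g x') (g # gs)
   = sgv (wt D gs) (B (Dif D g) gs) + bd D (B g) gs
    + (case gs of [] => 0 | g' # gs' => sgv (wt D gs) (B (Comp D g' g) gs'))"
   by (simp split: list.split)
  have cases_add: "(case fs of [] => 0 | a # b => X a b + Y a b)
   = (case fs of [] => 0 | a # b => X a b) + (case fs of [] => 0 | a # b => Y a b)" for X Y :: "_ => _ => 'v"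
   by (cases fs) simp_all
  have cases_sgv: "sgv m (case gs of [] => 0 | a # b => sgv n (X a b))
   = sgv (m + n) (case gs of [] => 0 | a # b => X a b)" for m n and X :: "_ => _ => 'v"
   by (cases gs) simp_all
  \<comment> \<open>Additive bookkeeping: \<open>k\<close>, the composite of a leading letter with
    the entry of \<open>f\<close> behind it, completes \<open>S\<close> to the left side of
    \<open>shd_bd\<close>.\<close>
  have ac: "S + (b1 + (x + y + z + q) + (k + h)) = a + x + (b + y) + (e + z) + (v + (b1 + q + h))"
   if "S + k = a + b + e + v" for S k a b e v b1 x y z q h :: 'v
  proof -
   have "S = a + b + e + v - k" using that by (simp add: eq_diff_eq)
   thus ?thesis by (simp add: algebra_simps)
  qed
  note M = shd_bd[OF Cons.prems(3,2,1) IHf, unfolded list.case]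
  show ?case
   unfolding S1[of f fs "bd T phi"] L S2 bd_add R
   unfolding bd.simps(2)[of C _ f fs] S1 bd_add
   unfolding sgv_add sgv_sgv cases_add cases_sgv by (rule ac[OF M])
 qed
qed

end

lemma (in tensor_pair) sh_nonempty:
 "(\<And>us. us \<noteq> [] ==> phi us = 0) ==> sf (f # fs) phi c d gs = 0"
 by (simp add: cut_0)

text \<open>A shuffled list of length one is a single letter of \<open>gs\<close>, or a single
  \<open>f\<close> that takes all of \<open>gs\<close> as arguments.\<close>

lemma (in tensor_pair) sh_rho:
 assumes "path C c fs" "path D d gs"
 shows "sf fs (rho T R (c, d)) c d gs = (case fs of
   [] => (case gs of [g] => R (r c g) | _ => 0) | [f] => R (e0 f d gs) | _ => 0)"
proof (cases fs)
 case Nil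
 show ?thesis
 proof (cases "\<exists>g. gs = [g]")
  case True
  thus ?thesis using Nil assms C.path_obj[OF assms(1)] by (auto simp: rho_def r_arr)
 next
  case False
  thus ?thesis using Nil by (auto simp: rho_def length_Suc_conv split: list.split)
 qed
next
 case (Cons f fs')
 hence f: "f \<in> arr C" "Dom C f = c" using assms(1) by auto
 have 0: "rho T R (c, d) (map (r c) h1 @ e # us) = 0" if "h1 \<noteq> [] \<or> us \<noteq> []" for h1 e us
  using that by (auto simp: rho_def)
 have 1: "sf fs phi c' d' gs' = 0" if "\<And>us. phi us = 0" for fs c' d' gs' and phi :: "_ => 'w :: ab_group_add"
 proof -
  have "phi = (\<lambda>us. 0)" by (rule ext) (rule that)
  thus ?thesis by simp
 qed
 have 2: "sf fs (rho T R (c, d)) c d gs = cut (\<lambda>h2 h3. sgv ((Deg C f - 1) * wt D h3)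
   (sf fs' (\<lambda>us. rho T R (c, d) (e0 f d h2 # us)) (Cod C f) (pend D d h2) h3)) gs"
  unfolding Cons sh.simps(2) using 0 by (subst cut_snd) (auto intro!: cut_0 simp: 1)
 show ?thesis
 proof (cases fs')
  case Nil
  have "rho T R (c, d) [e0 f d gs] = R (e0 f d gs)"
   using e0_arr[OF f(1) assms(2)] f(2) C.arr_typed(2)[OF f(1)] D.path_end[OF assms(2)] by (simp add: rho_def)
  thus ?thesis unfolding 2 using Nil Cons 0[of "[]", simplified]
   by (subst cut_fst) auto
 next
  case (Cons f' fs'')
  have "sf fs' (\<lambda>us. rho T R (c, d) (e0 f d h2 # us)) (Cod C f) (pend D d h2) h3 = 0" for h2 h3
   unfolding Cons by (rule sh_nonempty) (use 0[of "[]"] in simp)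
  thus ?thesis unfolding 2 using Cons \<open>fs = f # fs'\<close> by (simp add: cut_0)
 qed
qed

section \<open>Shuffles of cochains: products, linearity, normalization and differentials\<close>

locale shuffle = tensor_pair K C D + W: coch_base K "ttensor K C D" Ob H sc mul idn
 for K :: "'k ring" and C :: "('k, 'c, 'f) dgcat" and D :: "('k, 'd, 'g) dgcat"
  and Ob :: "'x set" and H :: "'x => 'x => int => 'v::ab_group_add set" and sc mul idn
begin

lemma sh_H:
 assumes "path C c fs" "path D d gs" "phi \<in> cochs T H Ph Ps p"
 shows "sf fs (phi (c, d)) c d gs \<in> H (Ph (c, d)) (Ps (pend C c fs, pend D d gs)) (p + wt C fs + wt D gs)"
proof (rule sh_closed[OF assms(1,2)], goal_cases)
 case (1 us)
 thus ?case
  using W.cochsD[OF assms(3), of "(c, d)" us] by (simp add: add.assoc)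
qed (auto intro: W.T.H_add W.T.H_neg)

text \<open>A cup product on the twisted tensor product is a sum over cuts of the shuffled list, so
  \<open>sh_cut\<close> separates the two factors.\<close>

lemma sh_mulc:
 assumes pc: "path C c fs" and pd: "path D d gs" and phi: "phi \<in> cochs T H Ph Ps p" and psi: "psi \<in> cochs T H Ps Xi q"
 shows "sf fs (mulc T mul p psi phi (c, d)) c d gs
  = cut (\<lambda>f1 f2. cut (\<lambda>g1 g2. sgv (wt C f1 * wt D g2 + p * (wt C f2 + wt D g2))
   (mul (p + wt C f1 + wt D g1) (sf f2 (psi (pend C c f1, pend D d g1)) (pend C c f1) (pend D d g1) g2)
    (sf f1 (phi (c, d)) c d g1))) gs) fs"
proof -
 define G where "G a b = sgv (p * wt T b) (mul (p + wt T a) (psi (pend T (c, d) a) b) (phi (c, d) a))" for a b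
 have "sf fs (mulc T mul p psi phi (c, d)) c d gs = sf fs (cut G) c d gs"
  unfolding G_def by (rule sh_cong[OF pc pd]) (rule W.mulc_path)
 also have "\<dots> = cut (\<lambda>f1 f2. cut (\<lambda>g1 g2. sgv (wt C f1 * wt D g2)
   (sf f1 (\<lambda>a. sf f2 (G a) (pend C c f1) (pend D d g1) g2) c d g1)) gs) fs"
  by (rule sh_cut)
 also have "\<dots> = cut (\<lambda>f1 f2. cut (\<lambda>g1 g2. sgv (wt C f1 * wt D g2 + p * (wt C f2 + wt D g2))
   (mul (p + wt C f1 + wt D g1) (sf f2 (psi (pend C c f1, pend D d g1)) (pend C c f1) (pend D d g1) g2)
    (sf f1 (phi (c, d)) c d g1))) gs) fs"
 proof (intro cut_cong, goal_cases)
  case s: (1 f1 f2 g1 g2)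
  have p1: "path C c f1" "path D d g1" and p2: "path C (pend C c f1) f2" "path D (pend D d g1) g2"
   using pc pd s by auto
  let ?c = "pend C c f1" and ?d = "pend D d g1"
  let ?V = "sf f2 (psi (?c, ?d)) ?c ?d g2"
  note V = sh_H[OF p2 psi]
  have "sf f1 (\<lambda>a. sf f2 (G a) ?c ?d g2) c d g1
   = sf f1 (\<lambda>a. sgv (p * (wt C f2 + wt D g2)) (mul (p + wt C f1 + wt D g1) ?V (phi (c, d) a))) c d g1"
  proof (rule sh_cong[OF p1], goal_cases)
   case a: (1 a)
   let ?n = "p + wt C f1 + wt D g1"
   have fa: "phi (c, d) a \<in> H (Ph (c, d)) (Ps (?c, ?d)) ?n"
    using W.cochsD[OF phi a(1)] a by (simp add: add.assoc)
   have "sf f2 (G a) ?c ?d g2 = sgv (p * (wt C f2 + wt D g2)) (sf f2 (\<lambda>b. mul ?n (psi (?c, ?d) b) (phi (c, d) a)) ?c ?d g2)"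
    unfolding sh_sgv[symmetric] by (rule sh_cong[OF p2]) (simp add: G_def a add.assoc)
   also have "sf f2 (\<lambda>b. mul ?n (psi (?c, ?d) b) (phi (c, d) a)) ?c ?d g2 = mul ?n ?V (phi (c, d) a)"
   proof (rule sh_hom[OF p2, symmetric, where theta = "\<lambda>v. mul ?n v (phi (c, d) a)"
      and S = "H (Ps (?c, ?d)) (Xi (pend C ?c f2, pend D ?d g2)) (q + wt C f2 + wt D g2)"], goal_cases)
    case (1 us)
    thus ?case
     using W.cochsD[OF psi, of "(?c, ?d)" us] by (simp add: add.assoc)
   qed (auto intro: W.T.H_add W.T.H_neg W.T.mul_addl[OF fa])
   finally show ?case .
  qed
  also have "\<dots> = sgv (p * (wt C f2 + wt D g2)) (mul (p + wt C f1 + wt D g1) ?V (sf f1 (phi (c, d)) c d g1))"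
   unfolding sh_sgv
  proof (rule arg_cong[where f = "sgv _"], rule sh_hom[OF p1, symmetric, where theta = "mul (p + wt C f1 + wt D g1) ?V"
     and S = "H (Ph (c, d)) (Ps (?c, ?d)) (p + wt C f1 + wt D g1)"], goal_cases)
   case (1 us)
   thus ?case
    using W.cochsD[OF phi, of "(c, d)" us] by (simp add: add.assoc)
  qed (auto intro: W.T.H_add W.T.H_neg W.T.mul_addr[OF _ _ V])
  finally show ?case
   by simp
 qed
 finally show ?thesis .
qed

lemma addg_lin:
 assumes "linc K T sc phi" "phi \<in> cochs T H Ph Ps p"
 shows "addg v (phi v)"
 unfolding addg_def
proof (intro allI impI, goal_cases)
 case (1 as bs x y n A B)
 thus ?case
  using W.ling_add[OF _ W.cochsD[OF assms(2)]] assms(1) unfolding linc_def by blast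
qed

text \<open>\<open>phi\<close> is linear at \<open>U z = U (a x + b y)\<close> in every argument.\<close>

definition slot where
 "slot A B m a b x y z phi v w k U \<longleftrightarrow> (\<forall>pre post. path T v (pre @ U x # post) \<longrightarrow>
   pend T v (pre @ U x # post) = w \<longrightarrow> wt T (pre @ U x # post) = k \<longrightarrow>
   W.lp A B m a b x y z (\<lambda>t. phi (pre @ U t # post)))"

lemma slotD: "slot A B m a b x y z phi v w k U ==> path T v (pre @ U x # post) ==>
   pend T v (pre @ U x # post) = w ==> wt T (pre @ U x # post) = k ==>
   W.lp A B m a b x y z (\<lambda>t. phi (pre @ U t # post))"
 unfolding slot_def by blast

lemma slot_shift:
 assumes "slot A B m a b x y z phi v w k U" "path T v xs" "pend T v xs = v'" "wt T xs + k' = k"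
 shows "slot A B m a b x y z (\<lambda>us. phi (xs @ us)) v' w k' U"
 unfolding slot_def
proof (intro allI impI, goal_cases)
 case (1 pre post)
 thus ?case
  using slotD[OF assms(1), of "xs @ pre" post] assms(2-4) by simp
qed

lemma lp_sh:
 assumes "path C c fs" "path D d gs"
  "\<And>us. path T (c, d) us ==> pend T (c, d) us = (pend C c fs, pend D d gs) ==>
   wt T us = wt C fs + wt D gs ==> W.lp A B m a b x y z (\<lambda>w. phi w us)"
 shows "W.lp A B m a b x y z (\<lambda>w. sf fs (phi w) c d gs)"
 by (rule sh_gen[OF assms(1,2)]) (use assms(3) W.lp_add W.lp_neg in auto)

text \<open>In every shuffled list a letter of \<open>fs\<close> occurs once, as first argument of
  an epsilon, hence the premise on such places.\<close>

lemma lp_sh_left: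
 assumes par: "x \<in> arr C" "Dom C y = Dom C x" "Dom C z = Dom C x" "Cod C y = Cod C x" "Cod C z = Cod C x"
   "Deg C y = Deg C x" "Deg C z = Deg C x"
  and "path C c (as @ x # bs)" "path D d gs"
  "\<And>d' h2. path D d' h2 ==> slot A B m a b x y z phi (c, d) (pend C c (as @ x # bs), pend D d gs)
    (wt C (as @ x # bs) + wt D gs) (\<lambda>w. e0 w d' h2)"
 shows "W.lp A B m a b x y z (\<lambda>w. sf (as @ w # bs) phi c d gs)"
 using assms(8-10)
proof (induction as arbitrary: phi c d gs)
 case Nil
 let ?F = "\<lambda>w. cut (\<lambda>h1 r'. cut (\<lambda>h2 h3. sgv ((Deg C w - 1) * wt D h3)
   (sf bs (\<lambda>us. phi (map (r c) h1 @ e0 w (pend D d h1) h2 # us)) (Cod C x) (pend D (pend D d h1) h2) h3)) r') gs"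
 have "W.lp A B m a b x y z ?F"
 proof (intro W.lp_cut W.lp_sgv' lp_sh)
  fix h1 rs h2 h3 us assume s: "h1 @ rs = gs" "h2 @ h3 = rs"
   and us: "path T (Cod C x, pend D (pend D d h1) h2) us"
   "pend T (Cod C x, pend D (pend D d h1) h2) us = (pend C (Cod C x) bs, pend D (pend D (pend D d h1) h2) h3)"
   "wt T us = wt C bs + wt D h3"
  have p: "path D d (h1 @ h2 @ h3)" "path C c (x # bs)" using Nil.prems(1,2) s by auto
  note a = sh_adm[OF p(2,1) us]
  show "W.lp A B m a b x y z (\<lambda>w. phi (map (r c) h1 @ e0 w (pend D d h1) h2 # us))"
   by (rule slotD[OF Nil.prems(3)]) (use a p s in auto)
 next
  fix h1 rs h2 h3 assume s: "h1 @ rs = gs" "h2 @ h3 = rs"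
  show "path C (Cod C x) bs" "path D (pend D (pend D d h1) h2) h3" using Nil.prems(1,2) s by auto
 qed (simp_all add: par)
 thus ?case by (rule W.lp_cong) (simp_all add: par)
next
 case (Cons f as)
 show ?case
  unfolding append_Cons sh.simps
 proof (intro W.lp_cut W.lp_sgv Cons.IH)
  fix h1 rs h2 h3 d' k2 assume s: "h1 @ rs = gs" "h2 @ h3 = rs" and k: "path D d' k2"
  have f: "f \<in> arr C" "Dom C f = c" "c \<in> Obj C" using Cons.prems(1) C.arr_typed by auto
  have p: "path D d h1" "path D (pend D d h1) h2" using Cons.prems(2) s by auto
  let ?xs = "map (r c) h1 @ [e0 f (pend D d h1) h2]"
  have o: "Cod C f \<in> Obj C" "pend D (pend D d h1) h2 \<in> Obj D" using C.arr_typed[OF f(1)] D.path_end[OF p(2)] by auto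
  have "slot A B m a b x y z (\<lambda>us. phi (?xs @ us)) (Cod C f, pend D (pend D d h1) h2)
    (pend C c ((f # as) @ x # bs), pend D d gs) (wt C (as @ x # bs) + wt D h3) (\<lambda>w. e0 w d' k2)"
   by (rule slot_shift[OF Cons.prems(3)[OF k]])
    (use r_path[OF f(3) p(1)] r_pend[OF f(3) p(1)] r_wt[OF f(3) p(1)] e0_arr[OF f(1) p(2)] f s o in auto)
  thus "slot A B m a b x y z (\<lambda>us. phi (map (r c) h1 @ e0 f (pend D d h1) h2 # us))
    (Cod C f, pend D (pend D d h1) h2) (pend C (Cod C f) (as @ x # bs), pend D (pend D (pend D d h1) h2) h3)
    (wt C (as @ x # bs) + wt D h3) (\<lambda>w. e0 w d' k2)" using s by auto
 next
  fix h1 rs h2 h3 assume s: "h1 @ rs = gs" "h2 @ h3 = rs"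
  show "path C (Cod C f) (as @ x # bs)" "path D (pend D (pend D d h1) h2) h3" using Cons.prems(1,2) s by auto
 qed
qed

text \<open>A letter of \<open>gs\<close> occurs either alone or among the arguments of an epsilon,
  hence two premises.\<close>

lemma lp_sh_right:
 assumes par: "x \<in> arr D" "Dom D y = Dom D x" "Dom D z = Dom D x" "Cod D y = Cod D x" "Cod D z = Cod D x"
   "Deg D y = Deg D x" "Deg D z = Deg D x"
  and "path C c fs" "path D d (as @ x # bs)"
  "\<And>c'. c' \<in> Obj C ==> slot A B m a b x y z phi (c, d) (pend C c fs, pend D d (as @ x # bs))
    (wt C fs + wt D (as @ x # bs)) (\<lambda>w. r c' w)"
  "\<And>f d' l l'. f \<in> arr C ==> path D d' (l @ x # l') ==>
    slot A B m a b x y z phi (c, d) (pend C c fs, pend D d (as @ x # bs))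
    (wt C fs + wt D (as @ x # bs)) (\<lambda>w. e0 f d' (l @ w # l'))"
 shows "W.lp A B m a b x y z (\<lambda>w. sf fs phi c d (as @ w # bs))"
 using assms(8-11)
proof (induction fs arbitrary: phi c d as bs)
 case Nil
 have c: "c \<in> Obj C" using Nil.prems(1) by simp
 have "path T (c, d) (map (r c) as @ r c x # map (r c) bs)"
  "pend T (c, d) (map (r c) as @ r c x # map (r c) bs) = (c, pend D d (as @ x # bs))"
  "wt T (map (r c) as @ r c x # map (r c) bs) = wt D (as @ x # bs)"
  using r_path[OF c Nil.prems(2)] r_pend[OF c Nil.prems(2)] r_wt[OF c Nil.prems(2)] by simp_all
 from slotD[OF Nil.prems(3)[OF c] this(1)] this(2,3) show ?case by simp
next
 case (Cons f fs)
 have f: "f \<in> arr C" "Dom C f = c" "c \<in> Obj C" "path C (Cod C f) fs" using Cons.prems(1) C.arr_typed by auto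
 let ?p = "\<lambda>h1 h2. pend D (pend D d h1) h2"
 let ?M = "\<lambda>h1 h2 h3. sgv ((Deg C f - 1) * wt D h3)
   (sf fs (\<lambda>us. phi (map (r c) h1 @ e0 f (pend D d h1) h2 # us)) (Cod C f) (?p h1 h2) h3)"
 have adm: "path T (c, d) (map (r c) h1 @ e0 f (pend D d h1) h2 # us)"
   "pend T (c, d) (map (r c) h1 @ e0 f (pend D d h1) h2 # us) = (pend C c (f # fs), pend D d (as @ x # bs))"
   "wt T (map (r c) h1 @ e0 f (pend D d h1) h2 # us) = wt C (f # fs) + wt D (as @ x # bs)"
  if s: "h1 @ h2 @ h3 = as @ x # bs" and us: "path T (Cod C f, pend D (pend D d h1) h2) us"
   "pend T (Cod C f, pend D (pend D d h1) h2) us = (pend C (Cod C f) fs, pend D (pend D (pend D d h1) h2) h3)"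
   "wt T us = wt C fs + wt D h3" for h1 h2 h3 us
  using sh_adm[OF Cons.prems(1) Cons.prems(2)[folded s] us] unfolding s by blast+
 have pp: "path D d h1 \<and> path D (pend D d h1) h2 \<and> path D (?p h1 h2) h3" if "h1 @ h2 @ h3 = as @ x # bs" for h1 h2 h3
  using Cons.prems(2) that[symmetric] by (simp del: wt_simps)
 \<comment> \<open>The varied letter lies behind the entry of \<open>f\<close>.\<close>
 have 1: "W.lp A B m a b x y z (\<lambda>w. ?M h1 h2 (l @ w # bs))" if s: "h1 @ h2 @ l = as" for h1 h2 l
 proof -
  have s': "h1 @ h2 @ (l @ x # bs) = as @ x # bs" using s by simp
  note p = pp[OF s']
  let ?xs = "map (r c) h1 @ [e0 f (pend D d h1) h2]"
  have o: "Cod C f \<in> Obj C" "?p h1 h2 \<in> Obj D" using C.arr_typed[OF f(1)] D.path_end p by auto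
  have x: "path T (c, d) ?xs" "pend T (c, d) ?xs = (Cod C f, ?p h1 h2)"
   "wt T ?xs + (wt C fs + wt D (l @ x # bs)) = wt C (f # fs) + wt D (as @ x # bs)"
   using r_path[OF f(3)] r_pend[OF f(3)] r_wt[OF f(3)] e0_arr[OF f(1)] f s p o by auto
  have e: "(pend C c (f # fs), pend D d (as @ x # bs)) = (pend C (Cod C f) fs, pend D (?p h1 h2) (l @ x # bs))"
   using s by auto
  have "W.lp A B m a b x y z (\<lambda>w. sf fs (\<lambda>us. phi (?xs @ us)) (Cod C f) (?p h1 h2) (l @ w # bs))"
   by (rule Cons.IH[OF f(4) _ slot_shift[OF Cons.prems(3) x, unfolded e] slot_shift[OF Cons.prems(4) x, unfolded e]])
    (use p in simp_all)
  hence "W.lp A B m a b x y z (\<lambda>w. sgv ((Deg C f - 1) * wt D (l @ w # bs))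
    (sf fs (\<lambda>us. phi (?xs @ us)) (Cod C f) (?p h1 h2) (l @ w # bs)))"
   by (rule W.lp_sgv') (simp_all add: par)
  thus ?thesis by simp
 qed
 \<comment> \<open>The varied letter is an argument of \<open>f\<close>.\<close>
 have 2: "W.lp A B m a b x y z (\<lambda>w. ?M h1 (l @ w # l') h3)" if s: "h1 @ l = as" "l' @ h3 = bs" for h1 l l' h3
 proof -
  have s': "h1 @ (l @ x # l') @ h3 = as @ x # bs" using s by simp
  have "W.lp A B m a b x y z (\<lambda>w. sgv ((Deg C f - 1) * wt D h3)
   (sf fs (\<lambda>us. phi (map (r c) h1 @ e0 f (pend D d h1) (l @ w # l') # us)) (Cod C f) (?p h1 (l @ x # l')) h3))"
  proof (intro W.lp_sgv lp_sh)
   fix us assume us: "path T (Cod C f, ?p h1 (l @ x # l')) us"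
    "pend T (Cod C f, ?p h1 (l @ x # l')) us = (pend C (Cod C f) fs, pend D (?p h1 (l @ x # l')) h3)"
    "wt T us = wt C fs + wt D h3"
   show "W.lp A B m a b x y z (\<lambda>w. phi (map (r c) h1 @ e0 f (pend D d h1) (l @ w # l') # us))"
    by (rule slotD[OF Cons.prems(4)[OF f(1)]]) (use pp[OF s'] adm[OF s' us] in blast)+
  qed (use f(4) pp[OF s'] in blast)+
  thus ?thesis by (rule W.lp_cong) (simp_all add: par)
 qed
 \<comment> \<open>The varied letter stands alone in front of the entry of \<open>f\<close>.\<close>
 have 3: "W.lp A B m a b x y z (\<lambda>w. ?M (as @ w # l) h2 h3)" if s: "l @ h2 @ h3 = bs" for l h2 h3
 proof -
  have s': "(as @ x # l) @ h2 @ h3 = as @ x # bs" using s by simp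
  let ?q = "pend D d (as @ x # l)"
  have "W.lp A B m a b x y z (\<lambda>w. sgv ((Deg C f - 1) * wt D h3)
   (sf fs (\<lambda>us. phi (map (r c) as @ r c w # map (r c) l @ e0 f ?q h2 # us)) (Cod C f) (pend D ?q h2) h3))"
  proof (intro W.lp_sgv lp_sh)
   fix us assume us: "path T (Cod C f, pend D ?q h2) us"
    "pend T (Cod C f, pend D ?q h2) us = (pend C (Cod C f) fs, pend D (pend D ?q h2) h3)"
    "wt T us = wt C fs + wt D h3"
   show "W.lp A B m a b x y z (\<lambda>w. phi (map (r c) as @ r c w # map (r c) l @ e0 f ?q h2 # us))"
    by (rule slotD[OF Cons.prems(3)[OF f(3)]]) (use adm[OF s' us] in simp_all)
  qed (use f(4) pp[OF s'] in blast)+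
  thus ?thesis by (rule W.lp_cong) (simp_all add: par)
 qed
 show ?case
  unfolding sh.simps cut_mid using 1 2 3 by (intro W.lp_add W.lp_cut) auto
qed

end

context shuffle
begin

text \<open>Shuffles turn cochains on \<open>T\<close> into cochains on \<open>C\<close> with values in cochains on \<open>D\<close>.\<close>

definition shc :: "('c \<times> 'd => ('k, 'c, 'f, 'd, 'g) tterm set list => 'v) => 'c => 'f list => 'd => 'g list => 'v" where
 "shc phi c fs d gs = (if path C c fs \<and> path D d gs then sf fs (phi (c, d)) c d gs else 0)"

lemma shc_mulc:
 assumes phi: "phi \<in> cochs T H Ph Ps p" and psi: "psi \<in> cochs T H Ps Xi q"
 shows "shc (mulc T mul p psi phi) = mulc C (mulc D mul) p (shc psi) (shc phi)"
proof (intro ext, goal_cases)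
 case (1 c fs d gs)
 show ?case
 proof (cases "path C c fs \<and> path D d gs")
  case True
  have "mulc C (mulc D mul) p (shc psi) (shc phi) c fs d gs
   = cut (\<lambda>f1 f2. sgv (p * wt C f2) (mulc D mul (p + wt C f1) (shc psi (pend C c f1) f2) (shc phi c f1) d gs)) fs"
   using True by (simp add: mulc_def[of C] cut_fun sgv_fun)
  also have "\<dots> = cut (\<lambda>f1 f2. cut (\<lambda>g1 g2. sgv (wt C f1 * wt D g2 + p * (wt C f2 + wt D g2))
   (mul (p + wt C f1 + wt D g1) (sf f2 (psi (pend C c f1, pend D d g1)) (pend C c f1) (pend D d g1) g2)
    (sf f1 (phi (c, d)) c d g1))) gs) fs"
   unfolding mulc_def[of D] if_P[OF conjunct2[OF True]] cut_sgv[symmetric]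
  proof (intro cut_cong, goal_cases)
   case s: (1 f1 f2 g1 g2)
   have p: "path C c f1" "path C (pend C c f1) f2" "path D d g1" "path D (pend D d g1) g2" using True s by auto
   show ?case
    using p by (simp add: shc_def algebra_simps)
  qed
  finally show ?thesis using True sh_mulc[OF _ _ phi psi] by (simp add: shc_def)
 next
  case False
  thus ?thesis
   by (auto simp: shc_def mulc_def cut_fun sgv_fun cut_0)
 qed
qed

text \<open>The twisting cochain of the twisted tensor product splits into a part of length zero in
  \<open>C\<close>, the twisting cochain on \<open>D\<close>, and a part of length one in
  \<open>C\<close>, whose values are the epsilons.\<close>

lemma shc_rho:
 "shc (rho T R) = (\<lambda>c fs. if c \<in> Obj C \<and> fs = [] then rho D (\<lambda>g. R (r c g)) else 0)
  + rho C (\<lambda>f d gs. if path D d gs then R (e0 f d gs) else 0)"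
proof (intro ext, goal_cases)
 case (1 c fs d gs)
 show ?case
 proof (cases "path C c fs \<and> path D d gs")
  case True
  thus ?thesis
   using sh_rho[of c fs d gs R] C.path_obj[of c fs]
   by (auto simp: shc_def rho_def plus_fun_def length_Suc_conv split: list.split)
 next
  case False
  thus ?thesis by (auto simp: shc_def rho_def plus_fun_def)
 qed
qed

lemma slot_e0_left:
 assumes phi: "phi \<in> cochs T H Ph Ps p" and lin: "linc K T sc phi" and *: "u \<in> Obj C" "v \<in> Obj C" "x \<in> mor C u v n"
  "y \<in> mor C u v n" "a \<in> carrier K" "b \<in> carrier K" "z = lc C u v n a x b y"
  and p: "path D d' l"
 shows "slot (Ph q) (Ps w) (p + k) a b x y z (phi q) q w k (\<lambda>t. e0 t d' l)"
 unfolding slot_def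
proof (intro allI impI, goal_cases)
 case h: (1 pre post)
 have o: "(u, d') \<in> Obj T" "(v, pend D d' l) \<in> Obj T" using * D.path_obj[OF p] D.path_end[OF p] by simp_all
 have m: "e0 t d' l \<in> mor T (u, d') (v, pend D d' l) (n + wt D l)" if "t \<in> mor C u v n" for t
  using e0_mor[OF C.arrI[OF *(1,2) that] p] C.mor_DCD[OF *(1,2) that] by simp
 have "W.lp (Ph q) (Ps w) (p + k) a b (e0 x d' l) (e0 y d' l) (e0 z d' l) (\<lambda>t. phi q (pre @ t # post))"
  by (rule W.lp_arg[OF lin[unfolded linc_def, THEN spec] W.cochsD[OF phi] o m[OF *(3)] m[OF *(4)] *(5,6) h(1)])
   (use e0_lin_left[OF *(1-6) p HOL.refl] h in "simp_all add: *(7) del: G.path_append")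
 thus ?case
  by (rule W.lp_comp)
qed

lemma slot_e0_right:
 assumes phi: "phi \<in> cochs T H Ph Ps p" and lin: "linc K T sc phi" and *: "u \<in> Obj D" "v \<in> Obj D" "x \<in> mor D u v n"
  "y \<in> mor D u v n" "a \<in> carrier K" "b \<in> carrier K" "z = lc D u v n a x b y"
  and f: "f \<in> arr C" and p: "path D d' (l @ x # l')"
 shows "slot (Ph q) (Ps w) (p + k) a b x y z (phi q) q w k (\<lambda>t. e0 f d' (l @ t # l'))"
 unfolding slot_def
proof (intro allI impI, goal_cases)
 case h: (1 pre post)
 let ?M = "Mor T (Dom C f, d') (Cod C f, pend D d' (l @ x # l')) (Deg C f + wt D (l @ x # l'))"
 have o: "(Dom C f, d') \<in> Obj T" "(Cod C f, pend D d' (l @ x # l')) \<in> Obj T"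
  using C.arr_typed[OF f] D.path_obj[OF p] D.path_end[OF p] by (simp_all del: pend_append)
 have m: "e0 f d' (l @ t # l') \<in> carrier ?M" if "t \<in> mor D u v n" for t
  using e0_mor[OF f, of d' "l @ t # l'"] p N.mor_par(1,2)[OF *(1,2) that *(3), of d' l l']
   N.mor_par(3)[OF *(1,2) that *(3), of l l'] by (simp del: D.path_append pend_append wt_simps)
 have "W.lp (Ph q) (Ps w) (p + k) a b (e0 f d' (l @ x # l')) (e0 f d' (l @ y # l')) (e0 f d' (l @ z # l'))
   (\<lambda>t. phi q (pre @ t # post))"
  by (rule W.lp_arg[OF lin[unfolded linc_def, THEN spec] W.cochsD[OF phi] o m[OF *(3)] m[OF *(4)] *(5,6) h(1)])
   (use e0_lin_right[OF f *(1-6) p HOL.refl] h in "simp_all add: *(7) del: G.path_append D.path_append pend_append wt_simps")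
 thus ?case
  by (rule W.lp_comp)
qed

lemma slot_r:
 assumes phi: "phi \<in> cochs T H Ph Ps p" and lin: "linc K T sc phi" and *: "u \<in> Obj D" "v \<in> Obj D" "x \<in> mor D u v n"
  "y \<in> mor D u v n" "a \<in> carrier K" "b \<in> carrier K" "z = lc D u v n a x b y"
  and c: "c \<in> Obj C"
 shows "slot (Ph q) (Ps w) (p + k) a b x y z (phi q) q w k (\<lambda>t. r c t)"
 unfolding slot_def
proof (intro allI impI, goal_cases)
 case h: (1 pre post)
 have o: "(c, u) \<in> Obj T" "(c, v) \<in> Obj T" using * c by simp_all
 have m: "r c t \<in> mor T (c, u) (c, v) n" if "t \<in> mor D u v n" for t
  using r_mor[OF c D.arrI[OF *(1,2) that]] D.mor_DCD[OF *(1,2) that] by simp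
 have "W.lp (Ph q) (Ps w) (p + k) a b (r c x) (r c y) (r c z) (\<lambda>t. phi q (pre @ t # post))"
  by (rule W.lp_arg[OF lin[unfolded linc_def, THEN spec] W.cochsD[OF phi] o m[OF *(3)] m[OF *(4)] *(5,6) h(1)])
   (use r_lin[OF c *(1-6)] h in "simp_all add: *(7) del: G.path_append")
 thus ?case
  by (rule W.lp_comp)
qed

text \<open>Vanishing at \<open>x\<close> is linearity at \<open>x = 0 x + 0 x\<close>.
  Normalization of shuffles is thereby another case of \<open>lp_sh_left\<close> and
  \<open>lp_sh_right\<close>.\<close>

lemma lp_null: "f x = 0 ==> W.lp A B m \<zero>\<^bsub>K\<^esub> \<zero>\<^bsub>K\<^esub> x x x f"
 by (simp add: W.lp_def W.T.sc_zero)

lemma lp_nullD: "W.lp A B m \<zero>\<^bsub>K\<^esub> \<zero>\<^bsub>K\<^esub> x x x f ==> f x = 0"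
 using W.T.sc_null[of "f x" A B m] by (simp add: W.lp_def)

lemma cochs_zero_arg:
 assumes phi: "phi \<in> cochs T H Ph Ps p" and lin: "linc K T sc phi" and "u \<in> Obj T" "v \<in> Obj T"
  and p: "path T q (pre @ \<zero>\<^bsub>Mor T u v n\<^esub> # post)"
 shows "phi q (pre @ \<zero>\<^bsub>Mor T u v n\<^esub> # post) = 0"
proof -
 interpret M: module K "Mor T u v n" using assms by (simp add: T_module)
 note t = G.mor_DCD[OF assms(3,4) M.zero_closed]
 have l: "ling K T sc q (phi q)" using lin unfolding linc_def by blast
 show ?thesis
  by (rule W.ling_zero[OF l W.cochsD[OF phi] assms(3,4)]) (use p t in simp_all)
qed

lemma shc_linc:
 assumes phi: "phi \<in> cochs T H Ph Ps p" and lin: "linc K T sc phi"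
 shows "linc K C (scc sc) (shc phi)"
 unfolding linc_def ling_def
proof (intro allI impI ext, goal_cases)
 case (1 c as bs x y u v n a b d gs)  note * = 1(1-6) and p = 1(7)
 let ?z = "lc C u v n a x b y"
 interpret M: module K "Mor C u v n" using * by simp
 have z: "?z \<in> mor C u v n" using * by simp
 note t = C.mor_DCD[OF *(1-3)] C.mor_DCD[OF *(1,2,4)] C.mor_DCD[OF *(1,2) z]
  C.arrI[OF *(1-3)] C.arrI[OF *(1,2,4)] C.arrI[OF *(1,2) z]
 show ?case
 proof (cases "path D d gs")
  case pd: True
  have "W.lp (Ph (c, d)) (Ps (pend C c (as @ x # bs), pend D d gs)) (p + (wt C (as @ x # bs) + wt D gs)) a b x y ?z
    (\<lambda>w. sf (as @ w # bs) (phi (c, d)) c d gs)"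
   by (rule lp_sh_left[OF t(10) _ _ _ _ _ _ p pd slot_e0_left[OF phi lin * HOL.refl]]) (simp_all add: t)
  thus ?thesis using p pd t by (simp add: W.lp_def shc_def scc_def)
 qed (simp add: shc_def scc_def W.T.sc_zero *)
qed

lemma shc_redc:
 assumes phi: "phi \<in> cochs T H Ph Ps p" and lin: "linc K T sc phi" and red: "redc T phi"
 shows "redc C (shc phi)"
 unfolding redc_def
proof (intro allI impI ext, goal_cases)
 case (1 c as bs x d gs)  note x = 1(1) and p = 1(2)
 show ?case
 proof (cases "path D d gs")
  case pd: True
  let ?i = "Idn C x"
  note i = C.idn_arr[OF x]
  have s: "slot (Ph (c, d)) (Ps w) m \<zero>\<^bsub>K\<^esub> \<zero>\<^bsub>K\<^esub> ?i ?i ?i (phi (c, d)) (c, d) w k (\<lambda>t. e0 t d' l)"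
   if l: "path D d' l" for d' l w k m
   unfolding slot_def
  proof (intro allI impI lp_null, goal_cases)
   case h: (1 pre post)
   have o: "(x, d') \<in> Obj T" "(x, pend D d' l) \<in> Obj T" using x D.path_obj[OF l] D.path_end[OF l] by simp_all
   show ?case
   \<comment> \<open>Without arguments the epsilon of an identity is an identity, which the
     normalized \<open>phi\<close> kills; with arguments it is zero, which the multilinear
     \<open>phi\<close> kills.\<close>
   proof (cases "l = []")
    case True
    thus ?thesis using red h o e0_id_Nil[OF x, of d'] unfolding redc_def by auto
   next
    case False
    thus ?thesis using cochs_zero_arg[OF phi lin o] h e0_id_left[OF x l False] by metis
   qed
  qed
  have "W.lp (Ph (c, d)) (Ps (pend C c (as @ ?i # bs), pend D d gs)) 0 \<zero>\<^bsub>K\<^esub> \<zero>\<^bsub>K\<^esub> ?i ?i ?i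
    (\<lambda>w. sf (as @ w # bs) (phi (c, d)) c d gs)"
   by (rule lp_sh_left[OF i(1) _ _ _ _ _ _ p pd s]) simp_all
  from lp_nullD[OF this] show ?thesis by (simp add: shc_def)
 qed (simp add: shc_def)
qed

lemma shc_linc_right:
 assumes phi: "phi \<in> cochs T H Ph Ps p" and lin: "linc K T sc phi"
 shows "linc K D sc (shc phi c fs)"
 unfolding linc_def ling_def
proof (intro allI impI, goal_cases)
 case (1 d as bs x y u v n a b)  note * = 1(1-6) and p = 1(7)
 let ?z = "lc D u v n a x b y"
 interpret M: module K "Mor D u v n" using * by simp
 have z: "?z \<in> mor D u v n" using * by simp
 note t = D.mor_DCD[OF *(1-3)] D.mor_DCD[OF *(1,2,4)] D.mor_DCD[OF *(1,2) z]
  D.arrI[OF *(1-3)] D.arrI[OF *(1,2,4)] D.arrI[OF *(1,2) z]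
 show ?case
 proof (cases "path C c fs")
  case pc: True
  have "W.lp (Ph (c, d)) (Ps (pend C c fs, pend D d (as @ x # bs))) (p + (wt C fs + wt D (as @ x # bs))) a b x y ?z
    (\<lambda>w. sf fs (phi (c, d)) c d (as @ w # bs))"
   by (rule lp_sh_right[OF t(10) _ _ _ _ _ _ pc p slot_r[OF phi lin * HOL.refl] slot_e0_right[OF phi lin * HOL.refl]])
    (simp_all add: t)
  thus ?thesis using p pc t by (simp add: W.lp_def shc_def)
 qed (simp add: shc_def W.T.sc_zero *)
qed

lemma shc_redc_right:
 assumes phi: "phi \<in> cochs T H Ph Ps p" and lin: "linc K T sc phi" and red: "redc T phi"
 shows "redc D (shc phi c fs)"
 unfolding redc_def
proof (intro allI impI, goal_cases)
 case (1 d as bs x)  note x = 1(1) and p = 1(2)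
 show ?case
 proof (cases "path C c fs")
  case pc: True
  let ?i = "Idn D x"
  note i = D.idn_arr[OF x]
  have s: "slot (Ph (c, d)) (Ps w) m \<zero>\<^bsub>K\<^esub> \<zero>\<^bsub>K\<^esub> ?i ?i ?i (phi (c, d)) (c, d) w k (\<lambda>t. e0 f d' (l @ t # l'))"
   if f: "f \<in> arr C" and l: "path D d' (l @ ?i # l')" for d' l l' w k m f
   unfolding slot_def
  proof (intro allI impI lp_null, goal_cases)
   case h: (1 pre post)
   have o: "(Dom C f, d') \<in> Obj T" "(Cod C f, pend D d' (l @ ?i # l')) \<in> Obj T"
    using C.arr_typed[OF f] D.path_obj[OF l] D.path_end[OF l] by (simp_all del: pend_append)
   show ?case
    using cochs_zero_arg[OF phi lin o] h e0_id_right[OF f x l] by metis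
  qed
  have s': "slot (Ph (c, d)) (Ps w) m \<zero>\<^bsub>K\<^esub> \<zero>\<^bsub>K\<^esub> ?i ?i ?i (phi (c, d)) (c, d) w k (\<lambda>t. r c' t)"
   if c: "c' \<in> Obj C" for c' w k m
   unfolding slot_def
  proof (intro allI impI lp_null, goal_cases)
   case h: (1 pre post)
   show ?case
    using red h r_id[OF c x] c x unfolding redc_def by auto
  qed
  have "W.lp (Ph (c, d)) (Ps (pend C c fs, pend D d (as @ ?i # bs))) 0 \<zero>\<^bsub>K\<^esub> \<zero>\<^bsub>K\<^esub> ?i ?i ?i
    (\<lambda>w. sf fs (phi (c, d)) c d (as @ w # bs))"
   by (rule lp_sh_right[OF i(1) _ _ _ _ _ _ pc p s' s]) simp_all
  from lp_nullD[OF this] show ?thesis by (simp add: shc_def)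
 qed (simp add: shc_def)
qed

text \<open>The result \<open>sh_bd\<close> for cochains: the bar differential of the twisted tensor
  product becomes the sum of those in the two variables.\<close>

lemma shc_bd:
 assumes phi: "phi \<in> cochs T H Ph Ps p" and lin: "linc K T sc phi" and pc: "path C c fs" and pd: "path D d gs"
 shows "shc (bdc T phi) c fs d gs = bdc C (shc phi) c fs d gs + sgv (wt C fs) (bdc D (shc phi c fs) d gs)"
proof -
 have "shc (bdc T phi) c fs d gs = sf fs (bd T (phi (c, d))) c d gs"
  using pc pd by (auto simp: shc_def bdc_def intro!: sh_cong)
 also have "\<dots> = bd C (\<lambda>x. sf x (phi (c, d)) c d gs) fs + sgv (wt C fs) (bd D (\<lambda>x. sf fs (phi (c, d)) c d x) gs)"
  by (rule sh_bd[OF pc pd addg_lin[OF lin phi]])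
 also have "bd C (\<lambda>x. sf x (phi (c, d)) c d gs) fs = bd C (\<lambda>x. shc phi c x d gs) fs"
  by (rule C.bd_cong[OF pc]) (simp add: shc_def pd)
 also have "bd D (\<lambda>x. sf fs (phi (c, d)) c d x) gs = bd D (\<lambda>x. shc phi c fs d x) gs"
  by (rule D.bd_cong[OF pd]) (simp add: shc_def pc)
 finally show ?thesis using pc pd by (simp add: bdc_def[of C] bdc_def[of D] bd_fun)
qed

end

section \<open>Functors out of the twisted tensor product\<close>

locale up_real = up_dg K C D "Obj B" "rH B" "rsc B" "\<lambda>_. rmul B" "\<lambda>x. emb B (Idn B x)" ob Rc Lc "\<lambda>_ _ _. rdif B"
  + B: dg_category K B
 for K :: "'k ring" and C :: "('k, 'c, 'f) dgcat" and D :: "('k, 'd, 'g) dgcat" and B :: "('k, 'o, 'm) dgcat"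
  and ob Rc Lc
begin

text \<open>Any representative gives the same interpretation, by \<open>ip_rel\<close>;
  \<open>unemb\<close> returns from the realization to the morphisms of \<open>B\<close>.\<close>

definition upm where
 "upm A = unemb B (obp (Dom T A)) (obp (Cod T A)) (Deg T A) (ip (SOME t. wft t \<and> clt t = A))"

definition upF where
 "upF = \<lparr>FObj = restrict (\<lambda>x. obp x) (Obj T), FMor = restrict upm (arr T)\<rparr>"

lemma upF_cls:
 assumes t: "wft t"
 shows "FMor upF (clt t) \<in> mor B (obp (dmt t)) (obp (cdt t)) (dgt t)"
  "emb B (FMor upF (clt t)) = ip t"
proof -
 define s where "s = (SOME s. wft s \<and> clt s = clt t)"
 have s: "wft s \<and> clt s = clt t"
  unfolding s_def by (rule someI[of _ t]) (use t in simp)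
 hence rel: "ip s = ip t" using cls_eq_iff ip_rel by blast
 note o = ip_ob[OF t]
 obtain m where m: "m \<in> mor B (obp (dmt t)) (obp (cdt t)) (dgt t)" "ip t = emb B m"
  using ip_H[OF t] o by (auto simp: rH_def)
 have "FMor upF (clt t) = m"
  using cls_arr[OF t] cls_typed[OF t] m rel B.unemb_emb[OF o m(1)] by (simp add: upF_def upm_def s_def)
 thus "FMor upF (clt t) \<in> mor B (obp (dmt t)) (obp (cdt t)) (dgt t)"
  "emb B (FMor upF (clt t)) = ip t" using m by simp_all
qed

lemma FObj_upF: "x \<in> Obj T ==> FObj upF x = obp x"
 by (simp add: upF_def)

lemma upF_functor: "dg_functor K T B upF"
proof (intro dg_functor.intro dg_functor_axioms.intro T_dg B.dg_category_axioms)
 show "FObj upF \<in> Obj T \<rightarrow>\<^sub>E Obj B"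
  using Y.Phi_Ob by (auto simp: upF_def)
 show "FMor upF \<in> extensional (arr T)" by (simp add: upF_def)
next
 fix x y A n assume "x \<in> Obj T" "y \<in> Obj T" "A \<in> mor T x y n"
 then obtain a where a: "A = clt a" "wft a" "dmt a = x" "cdt a = y" "dgt a = n"
  and xy: "x \<in> Obj T" "y \<in> Obj T" unfolding carrier_T by blast
 note ob = ip_ob[OF a(2)]
 show "FMor upF A \<in> mor B (FObj upF x) (FObj upF y) n"
  using upF_cls[OF a(2)] a xy by (simp add: FObj_upF)
 { fix b assume b: "b \<in> carrier K"
  hence w: "wft (TScale b a)" using a by simp
  interpret M: module K "Mor B (obp x) (obp y) n" using ob a by simp
  show "FMor upF (mscale T x y n b A) = b \<odot>\<^bsub>Mor B (FObj upF x) (FObj upF y) n\<^esub> FMor upF A"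
   using B.emb_inj[OF ob, of "FMor upF (clt (TScale b a))" n "b \<odot>\<^bsub>Mor B (obp x) (obp y) n\<^esub> FMor upF A"]
    upF_cls[OF w] upF_cls[OF a(2)] a b xy B.rsc_emb[OF ob b, of "FMor upF A" n]
   by (simp add: smult_T FObj_upF) }
 { fix A' assume "A' \<in> mor T x y n"
  then obtain a' where a': "A' = clt a'" "wft a'" "dmt a' = x" "cdt a' = y" "dgt a' = n"
   unfolding carrier_T by blast
  have w: "wft (TAdd a a')" using a a' by (simp add: tpar_def)
  interpret M: module K "Mor B (obp x) (obp y) n" using ob a by simp
  show "FMor upF (madd T x y n A A') = FMor upF A \<oplus>\<^bsub>Mor B (FObj upF x) (FObj upF y) n\<^esub> FMor upF A'"
   using B.emb_inj[OF ob, of "FMor upF (clt (TAdd a a'))" n "FMor upF A \<oplus>\<^bsub>Mor B (obp x) (obp y) n\<^esub> FMor upF A'"]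
    upF_cls[OF w] upF_cls[OF a(2)] upF_cls[OF a'(2)] a a' xy B.emb_add[OF ob, of "FMor upF A" n "FMor upF A'"]
   by (simp add: add_T tpar_def FObj_upF) }
next
 fix x assume x: "x \<in> Obj T"
 hence w: "wft (TId x)" by simp
 note ob = ip_ob(1)[OF w]
 show "FMor upF (Idn T x) = Idn B (FObj upF x)"
  using B.emb_inj[OF ob ob, of "FMor upF (clt (TId x))" 0 "Idn B (obp x)"] upF_cls[OF w] B.idn_closed[OF ob] x
  by (simp add: Idn_T FObj_upF)
next
 fix f g assume "f \<in> arr T" "g \<in> arr T" and c: "Cod T f = Dom T g"
 then obtain s t where s: "f = clt s" "g = clt t" "wft s" "wft t"
  unfolding arr_T by blast
 hence e: "dmt t = cdt s" using c by (simp add: cls_typed)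
 have w: "wft (TComp t s)" using s e by simp
 note o = ip_ob[OF s(3)] ip_ob(2)[OF s(4)]
 note m = upF_cls[OF s(3)] upF_cls[OF s(4), unfolded e]
 show "FMor upF (Comp T g f) = Comp B (FMor upF g) (FMor upF f)"
  using B.emb_inj[OF o(1,3), OF _ B.comp_closed[OF o(1,2,3) m(1,3)], of "FMor upF (clt (TComp t s))"]
   upF_cls[OF w] B.rmul_emb[OF o(1,2,3) m(1,3)] m s e
  by (simp add: Comp_T add.commute)
next
 fix f assume "f \<in> arr T"
 then obtain s where s: "f = clt s" "wft s" unfolding arr_T by blast
 note o = ip_ob[OF s(2)] and d = tdif_typed[OF s(2)]
 show "FMor upF (Dif T f) = Dif B (FMor upF f)"
  using B.emb_inj[OF o, OF _ B.dif_closed[OF o upF_cls(1)[OF s(2)]], of "FMor upF (clt (dft s))"]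
   upF_cls[of "dft s"] B.rdif_emb[OF o upF_cls(1)[OF s(2)]] upF_cls(2)[OF s(2)] ip_dif[OF s(2)] s d
  by (simp add: Dif_T)
qed

end

context shuffle
begin

lemma shc_add: "shc (phi + psi) = shc phi + shc psi"
 by (intro ext) (simp add: shc_def plus_fun_def sh_add)

lemma shc_sgv: "shc (sgv n phi) = sgv n (shc phi)"
proof (intro ext, goal_cases)
 case (1 c fs d gs)
 have "(sgv n phi) (c, d) = (\<lambda>us. sgv n (phi (c, d) us))" by (intro ext) (simp add: sgv_fun)
 thus ?case by (simp add: shc_def sgv_fun sh_sgv)
qed

lemma shc_diff: "shc (phi - psi) = shc phi - shc psi"
proof -
 have "phi - psi = phi + sgv 1 psi" by (simp add: sgv_def)
 hence "shc (phi - psi) = shc phi + sgv 1 (shc psi)" by (simp only: shc_add shc_sgv)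
 thus ?thesis by (simp add: sgv_def)
qed

lemma shc_bdc:
 assumes phi: "phi \<in> cochs T H Ph Ps p" and lin: "linc K T sc phi" and pc: "path C c fs"
 shows "shc (bdc T phi) c fs = bdc C (shc phi) c fs + sgv (wt C fs) (bdc D (shc phi c fs))"
proof (intro ext, goal_cases)
 case (1 d gs)
 show ?case
 proof (cases "path D d gs")
  case True
  thus ?thesis using shc_bd[OF phi lin pc] by (simp add: sgv_fun)
 next
  case False
  hence "bd C (shc phi c) fs d gs = 0" by (simp add: bd_fun shc_def)
  thus ?thesis using False pc by (simp add: shc_def bdc_def sgv_fun)
 qed
qed

end

section \<open>The associator\<close>

locale tensor_triple = CD: tensor_pair K C D + DE: tensor_pair K D E
 for K :: "'k ring" and C :: "('k, 'c, 'f) dgcat" and D :: "('k, 'd, 'g) dgcat" and E :: "('k, 'e, 'h) dgcat"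
begin

sublocale TT: tensor_pair K C DE.T
 by (intro tensor_pair.intro CD.C.dg_category_axioms DE.T_dg)

sublocale SS: tensor_pair K CD.T E
 by (intro tensor_pair.intro CD.T_dg DE.D.dg_category_axioms)

abbreviation "B \<equiv> ttensor K C DE.T"

definition Phi :: "'c \<times> 'd => 'e => 'c \<times> 'd \<times> 'e" where
 "Phi p Z = (fst p, snd p, Z)"

definition Rr where "Rr p h = TT.Ru (fst p) (DE.r (snd p) h)"

text \<open>The values that the associator must take on the epsilons with first argument
  \<open>id\<close> tensor \<open>g\<close>, collected into a cochain on \<open>E\<close>.\<close>

definition Rc where "Rc X g = (\<lambda>Z hs. if path E Z hs then TT.Ru X (DE.e0 g Z hs) else 0)"

sublocale W: shuffle K D E "Obj B" "rH B" "rsc B" "\<lambda>_. rmul B" "\<lambda>x. emb B (Idn B x)"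
 by (intro shuffle.intro DE.tensor_pair_axioms TT.N.coch_base_axioms)

text \<open>Makes the category \<open>M\<close> available: its objects are those of the twisted
  tensor product of \<open>C\<close> and \<open>D\<close>, its morphisms are cochains on
  \<open>E\<close> with values in the realization of \<open>B\<close>.\<close>

lemma M_coch: "coch K E (Obj B) (rH B) (rsc B) (\<lambda>_. rmul B) (\<lambda>x. emb B (Idn B x)) (Obj CD.T) Phi Rr"
proof (intro coch.intro coch_axioms.intro coch_base.intro DE.D.dg_category_axioms TT.V.vgc_axioms, goal_cases)
 case that: (1 y d) show ?case
  using that by (auto simp: Phi_def)
 next case that: (2 y g) show ?case
  using that TT.Ru_H[of "fst y" "DE.r (snd y) g"] DE.r_arr[of "snd y" g] by (auto simp: Rr_def Phi_def)
 next case *: (3 y u v g n g' a b) show ?case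
 proof -
  have y: "fst y \<in> Obj C" "snd y \<in> Obj D" using * by auto
  have m: "DE.r (snd y) t \<in> mor DE.T (snd y, u) (snd y, v) n" if "t \<in> mor E u v n" for t
   using DE.r_mor[OF y(2) DE.D.arrI[OF *(2,3) that]] DE.D.mor_DCD[OF *(2,3) that] by simp
  show ?thesis
   unfolding Rr_def DE.r_lin[OF y(2) *(2-7)]
   by (rule TT.N.R_lin[OF y(1) _ _ m[OF *(4)] m[OF *(5)] *(6,7)]) (use y * in simp_all)
 qed
 next case *: (4 y g g') show ?case
 proof -
  have y: "fst y \<in> Obj C" "snd y \<in> Obj D" using * by auto
  show ?thesis
   unfolding Rr_def DE.r_comp[OF *(2-4) y(2), symmetric]
   by (rule TT.N.R_comp[OF y(1)]) (use DE.r_arr[OF y(2) *(2)] DE.r_arr[OF y(2) *(3)] * in simp_all)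
 qed
 next case that: (5 y d) show ?case
  using that TT.N.R_id[of "fst y" "(snd y, d)"] by (auto simp: Rr_def Phi_def DE.r_id)
qed

sublocale M: coch_dg K E "Obj B" "rH B" "rsc B" "\<lambda>_. rmul B" "\<lambda>x. emb B (Idn B x)" "Obj CD.T" Phi Rr
  "\<lambda>_ _ _. rdif B"
 by (intro coch_dg.intro M_coch TT.V.vdg_axioms)

lemma Ru_zero:
 assumes "X \<in> Obj C" "u \<in> Obj DE.T" "v \<in> Obj DE.T"
 shows "TT.Ru X \<zero>\<^bsub>Mor DE.T u v n\<^esub> = 0"
proof -
 interpret M: module K "Mor DE.T u v n" using assms by (simp add: DE.T_module)
 show ?thesis using TT.Ru_add[OF assms M.zero_closed M.zero_closed] by simp
qed

lemma Rc_H: "X \<in> Obj C ==> g \<in> arr D ==> Rc X g \<in> M.Hc (X, Dom D g) (X, Cod D g) (Deg D g)"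
 by (rule M.cochsI) (use TT.Ru_H[OF _ DE.e0_arr(1)] in "auto simp: Rc_def Phi_def DE.e0_arr")

text \<open>\<open>Rc X\<close> is a functor from \<open>D\<close> to \<open>M\<close>.
  Multiplicativity is the relation for a composed first argument in the twisted tensor product of
  \<open>D\<close> and \<open>E\<close>, transported by the additive map
  \<open>TT.Ru X\<close>.\<close>

lemma I_coch: "coch K D (Obj CD.T) M.Hc (scc (rsc B)) (mulc E (\<lambda>_. rmul B))
  (\<lambda>x. idc E (\<lambda>x. emb B (Idn B x)) (Phi x)) (Obj C) Pair Rc"
proof (intro coch.intro coch_axioms.intro coch_base.intro CD.D.dg_category_axioms M.CC.vgc_axioms, goal_cases)
 show "(y, d) \<in> Obj CD.T" if "y \<in> Obj C" "d \<in> Obj D" for y d using that by simp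
 next case that: (2 y g) show ?case
  using that by (rule Rc_H)
 next case *: (3 y u v g n g' a b) show ?case
 proof (intro ext, goal_cases)
  case (1 Z hs)
  show ?case
  proof (cases "path E Z hs")
   case p: True
   have m: "DE.e0 t Z hs \<in> mor DE.T (u, Z) (v, pend E Z hs) (n + wt E hs)"
    if "t \<in> mor D u v n" for t
    using DE.e0_mor[OF CD.D.arrI[OF *(2,3) that] p] CD.D.mor_DCD[OF *(2,3) that] by simp
   have "TT.Ru y (DE.e0 (lc D u v n a g b g') Z hs)
    = rsc B a (TT.Ru y (DE.e0 g Z hs)) + rsc B b (TT.Ru y (DE.e0 g' Z hs))"
    unfolding DE.e0_lin_left[OF *(2-7) p HOL.refl]
    by (rule TT.N.R_lin[OF *(1) _ _ m[OF *(4)] m[OF *(5)] *(6,7)])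
     (use * DE.D.path_obj[OF p] DE.D.path_end[OF p] in simp_all)
   thus ?thesis using p by (simp add: Rc_def scc_def)
  qed (use * TT.V.sc_zero in "simp add: Rc_def scc_def")
 qed
 next case *: (4 y g g') show ?case
 proof (intro ext, goal_cases)
  case (1 Z hs)
  show ?case
  proof (cases "path E Z hs")
   case p: True
   have o: "(Dom D g, Z) \<in> Obj DE.T" "(Cod D g', pend E Z hs) \<in> Obj DE.T"
    using CD.D.arr_typed[OF *(2)] CD.D.arr_typed[OF *(3)] DE.D.path_obj[OF p] DE.D.path_end[OF p] by simp_all
   have "TT.Ru y (DE.e0 (Comp D g' g) Z hs) = cut (\<lambda>as bs. sgv (Deg D g * wt E bs)
     (TT.Ru y (Comp DE.T (DE.e0 g' (pend E Z as) bs) (DE.e0 g Z as)))) hs"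
    by (rule DE.theta_comp[OF o TT.Ru_add[OF *(1) o] *(2-4) p HOL.refl HOL.refl HOL.refl])
   also have "\<dots> = mulc E (\<lambda>_. rmul B) (Deg D g) (Rc y g') (Rc y g) Z hs"
    unfolding M.mulc_path[OF p]
   proof (rule cut_cong, goal_cases)
    case s: (1 as bs)
    have pa: "path E Z as" "path E (pend E Z as) bs" using p s by auto
    have "TT.Ru y (Comp DE.T (DE.e0 g' (pend E Z as) bs) (DE.e0 g Z as))
     = rmul B (TT.Ru y (DE.e0 g' (pend E Z as) bs)) (TT.Ru y (DE.e0 g Z as))"
     by (rule TT.N.R_comp[OF *(1)]) (use DE.e0_arr[OF *(2) pa(1)] DE.e0_arr[OF *(3) pa(2)] * in simp_all)
    thus ?case
     using pa by (simp add: Rc_def)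
   qed
   finally show ?thesis using p by (simp add: Rc_def)
  qed (simp add: Rc_def mulc_def)
 qed
 next case *: (5 y d) show ?case
 proof (intro ext, goal_cases)
  case (1 Z hs)
  show ?case
  proof (cases "path E Z hs")
   case p: True
   show ?thesis
   proof (cases "hs = []")
    case True
    thus ?thesis using p * DE.e0_id_Nil[OF *(2), of Z] TT.N.R_id[OF *(1), of "(d, Z)"]
     by (simp add: Rc_def idc_def Phi_def)
   next
    case False
    thus ?thesis
     using p * DE.e0_id_left[OF *(2) p False] DE.D.path_obj[OF p] DE.D.path_end[OF p]
     by (simp add: Rc_def idc_def Ru_zero)
   qed
  qed (auto simp: Rc_def idc_def)
 qed
qed

lemma Rc_lin: 
 assumes X: "X \<in> Obj C" and g: "g \<in> arr D"
 shows "linc K E (rsc B) (Rc X g)" "redc E (Rc X g)"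
proof -
 show "linc K E (rsc B) (Rc X g)"
  unfolding linc_def ling_def
 proof (intro allI impI, goal_cases)
  case (1 Z as bs x y u v n a b)    note * = 1(1-6) and p = 1(7)
  let ?z = "lc E u v n a x b y"
  interpret N: module K "Mor E u v n" using * by (simp add: DE.D.mor_module)
  have z: "?z \<in> mor E u v n" using * by simp
  have q: "path E Z (as @ t # bs)" "pend E Z (as @ t # bs) = pend E Z (as @ x # bs)"
   "wt E (as @ t # bs) = wt E (as @ x # bs)" if "t \<in> mor E u v n" for t
   using p M.mor_par(1,2)[OF *(1,2) that *(3), of Z as bs] M.mor_par(3)[OF *(1,2) that *(3), of as bs] by blast+
  let ?M = "Mor DE.T (Dom D g, Z) (Cod D g, pend E Z (as @ x # bs)) (Deg D g + wt E (as @ x # bs))"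
  have m: "DE.e0 g Z (as @ t # bs) \<in> carrier ?M" if "t \<in> mor E u v n" for t
   using DE.e0_mor[OF g q(1)[OF that]] unfolding q(2,3)[OF that] .
  have o: "(Dom D g, Z) \<in> Obj DE.T" "(Cod D g, pend E Z (as @ x # bs)) \<in> Obj DE.T"
   using CD.D.arr_typed[OF g] DE.D.path_obj[OF p] DE.D.path_end[OF p] by (simp_all del: pend_append)
  show ?case
   unfolding Rc_def if_P[OF p] if_P[OF q(1)[OF z]] if_P[OF q(1)[OF *(4)]] DE.e0_lin_right[OF g * p HOL.refl]
   by (rule TT.N.R_lin[OF X o m[OF *(3)] m[OF *(4)] *(5,6)])
 qed
 show "redc E (Rc X g)"
  unfolding redc_def
 proof (intro allI impI, goal_cases)
  case (1 Z as bs c)    note c = 1(1) and p = 1(2)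
  have o: "(Dom D g, Z) \<in> Obj DE.T" "(Cod D g, pend E Z (as @ Idn E c # bs)) \<in> Obj DE.T"
   using CD.D.arr_typed[OF g] DE.D.path_obj[OF p] DE.D.path_end[OF p] by (simp_all del: pend_append)
  show ?case
   unfolding Rc_def if_P[OF p] DE.e0_id_right[OF g c p] by (rule Ru_zero[OF X o])
 qed
qed

text \<open>\<open>TT.Ru X\<close> applied to the formula for \<open>d\<close> of an epsilon of
  \<open>g\<close> gives the terms of the Hochschild differential one by one, since
  \<open>TT.Ru X\<close> is multiplicative and commutes with differentials.\<close>

lemma Rc_dif:
 assumes X: "X \<in> Obj C" and g: "g \<in> arr D"
 shows "Rc X (Dif D g) = M.df (X, Dom D g) (X, Cod D g) (Deg D g) (Rc X g)"
proof (intro ext, goal_cases)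
 case (1 Z hs)
 show ?case
 proof (cases "path E Z hs")
  case p: True
  note gt = CD.D.arr_typed[OF g]
  have o: "(X, Dom D g) \<in> Obj CD.T" "(X, Cod D g) \<in> Obj CD.T" using X gt by simp_all
  have q: "(Dom D g, Z) \<in> Obj DE.T" "(Cod D g, pend E Z hs) \<in> Obj DE.T"
   using gt DE.D.path_obj[OF p] DE.D.path_end[OF p] by simp_all
  have d: "rdif B (Rc X g Z hs) = TT.Ru X (Dif DE.T (DE.e0 g Z hs))"
   using TT.rdif_Ru[OF X DE.e0_arr(1)[OF g p]] p by (simp add: Rc_def)
  have th: "TT.Ru X (Dif DE.T (DE.e0 g Z hs)) = TT.Ru X (DE.e0 (Dif D g) Z hs)
   - (if hs = [] then 0 else sgv (Deg D g * (Deg E (last hs) - 1))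
     (TT.Ru X (Comp DE.T (DE.r (Cod D g) (last hs)) (DE.e0 g Z (butlast hs)))))
   + (if hs = [] then 0 else sgv (Deg D g + wt E (tl hs))
     (TT.Ru X (Comp DE.T (DE.e0 g (Cod E (hd hs)) (tl hs)) (DE.r (Dom D g) (hd hs)))))
   - sgv (Deg D g) (bd E (\<lambda>xs. TT.Ru X (DE.e0 g Z xs)) hs)"
   by (rule DE.theta_dif[OF q TT.Ru_add[OF X q] g p HOL.refl HOL.refl HOL.refl])
  have bdc: "bd E (\<lambda>xs. TT.Ru X (DE.e0 g Z xs)) hs = bd E (Rc X g Z) hs"
   by (rule DE.D.bd_cong[OF p]) (simp add: Rc_def)
  have l: "M.df (X, Dom D g) (X, Cod D g) (Deg D g) (Rc X g) Z hs
   = rdif B (Rc X g Z hs) + M.dl (X, Dom D g) (X, Cod D g) (Deg D g) (Rc X g) Z hs"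
   using p by (simp add: difc_def plus_fun_def ddc_def)
  show ?thesis
  proof (cases "hs = []")
   case True
   thus ?thesis using l d th M.dl_Nil[OF o Rc_H[OF X g], of Z] p by (simp add: Rc_def)
  next
   case ne: False
   have hsb: "hs = butlast hs @ [last hs]" and hst: "hs = hd hs # tl hs" using ne by simp_all
   from hsb have pb: "path E Z (butlast hs)" "last hs \<in> arr E" "pend E Z (butlast hs) = Dom E (last hs)"
    using p by (metis DE.D.path_append path.simps(2))+
   from hst have pt: "path E (Cod E (hd hs)) (tl hs)" "hd hs \<in> arr E" "Dom E (hd hs) = Z"
    using p by (metis path.simps(2))+
   have 1: "TT.Ru X (Comp DE.T (DE.r (Cod D g) (last hs)) (DE.e0 g Z (butlast hs)))
    = rmul B (Rr (X, Cod D g) (last hs)) (Rc X g Z (butlast hs))"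
    unfolding Rr_def Rc_def if_P[OF pb(1)] fst_conv snd_conv
    by (rule TT.N.R_comp[OF X]) (use DE.e0_arr[OF g pb(1)] DE.r_arr[OF gt(2) pb(2)] pb in simp_all)
   have 2: "TT.Ru X (Comp DE.T (DE.e0 g (Cod E (hd hs)) (tl hs)) (DE.r (Dom D g) (hd hs)))
    = rmul B (Rc X g (Cod E (hd hs)) (tl hs)) (Rr (X, Dom D g) (hd hs))"
    unfolding Rr_def Rc_def if_P[OF pt(1)] fst_conv snd_conv
    by (rule TT.N.R_comp[OF X]) (use DE.e0_arr[OF g pt(1)] DE.r_arr[OF gt(1) pt(2)] pt in simp_all)
   show ?thesis
    using HOL.trans[OF d th] ne p Rc_def[of X "Dif D g"]
    unfolding l 1 2 bdc M.dl_expand[OF o Rc_H[OF X g] p ne] by simp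
  qed
 next
  case False
  thus ?thesis by (simp add: Rc_def difc_def ddc_def dlc_def mulc_def bdc_def sgv_fun)
 qed
qed

text \<open>The universal cochain of \<open>f\<close> on the twisted tensor product of
  \<open>D\<close> and \<open>E\<close>, shuffled. Its expansion over index lists is
  \<open>sh_assoc\<close>.\<close>

definition Lc where "Lc f = W.shc (TT.Lu f)"

lemma Lc_H:
 assumes "x \<in> Obj C" "y \<in> Obj C" "f \<in> mor C x y n"
 shows "Lc f \<in> cochs D M.Hc (Pair x) (Pair y) n"
proof -
 interpret I: coch K D "Obj CD.T" M.Hc "scc (rsc B)" "mulc E (\<lambda>_. rmul B)"
  "\<lambda>x. idc E (\<lambda>x. emb B (Idn B x)) (Phi x)" "Obj C" Pair Rc by (rule I_coch)
 note L = TT.Lu_H'[OF assms]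
 show ?thesis
 proof (rule I.cochsI, goal_cases)
  case pd: (1 Y gs)
  show ?case
  proof (rule M.cochsI, goal_cases)
   case pe: (1 Z hs)
   show ?case
    using W.sh_H[OF pd pe L] pd pe by (simp add: Lc_def W.shc_def Phi_def)
  qed (simp add: Lc_def W.shc_def)
 qed (auto simp: Lc_def W.shc_def intro!: ext)
qed

lemma Lc_scale:
 assumes "x \<in> Obj C" "y \<in> Obj C" "f \<in> mor C x y n" "a \<in> carrier K"
 shows "Lc (mscale C x y n a f) = scc (scc (rsc B)) a (Lc f)"
proof (intro ext, goal_cases)
 case (1 Y gs Z hs)
 show ?case
 proof (cases "path D Y gs \<and> path E Z hs")
  case p: True
  let ?H = "rH B (x, Y, Z) (y, pend D Y gs, pend E Z hs) (n + wt D gs + wt E hs)"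
  have "rsc B a (DE.sf gs (TT.Lu f (Y, Z)) Y Z hs) = DE.sf gs (\<lambda>us. rsc B a (TT.Lu f (Y, Z) us)) Y Z hs"
  proof (rule DE.sh_hom[where S = ?H])
   fix us assume "path DE.T (Y, Z) us" "pend DE.T (Y, Z) us = (pend D Y gs, pend E Z hs)"
    "wt DE.T us = wt D gs + wt E hs"
   thus "TT.Lu f (Y, Z) us \<in> ?H" using TT.N.cochsD[OF TT.Lu_H'[OF assms(1-3)], of "(Y, Z)" us] by (simp add: add.assoc)
  qed (use p TT.V.H_add TT.V.H_neg TT.V.sc_add[OF assms(4)] in auto)
  moreover have "TT.Lu (mscale C x y n a f) (Y, Z) = (\<lambda>us. rsc B a (TT.Lu f (Y, Z) us))"
   unfolding TT.Lu_scale[OF assms] by (intro ext) (simp add: scc_def)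
  ultimately show ?thesis using p by (simp add: Lc_def W.shc_def scc_def)
 next
  case False
  thus ?thesis using TT.V.sc_zero[OF assms(4)] by (auto simp: Lc_def W.shc_def scc_def)
 qed
qed

lemma Lc_id:
 assumes "c \<in> Obj C"
 shows "Lc (Idn C c) = idc D (\<lambda>x. idc E (\<lambda>x. emb B (Idn B x)) (Phi x)) (Pair c)"
proof (intro ext, goal_cases)
 case (1 Y gs Z hs)
 show ?case
 proof (cases "path D Y gs \<and> path E Z hs")
  case p: True
  hence o: "Y \<in> Obj D" "Z \<in> Obj E" using CD.D.path_obj DE.D.path_obj by blast+
  show ?thesis
  proof (cases gs)
   case Nil
   thus ?thesis using p o by (simp add: Lc_def W.shc_def TT.Lu_id[OF assms] idc_def Phi_def)
  next
   case (Cons g gs')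
   thus ?thesis using p
     DE.sh_nonempty[of "TT.Lu (Idn C c) (Y, Z)" g gs' Y Z hs] 
    by (simp add: Lc_def W.shc_def TT.Lu_id[OF assms] idc_def del: sh.simps)
  qed
 next
  case False
  thus ?thesis by (auto simp: Lc_def W.shc_def idc_def)
 qed
qed

text \<open>The inner interpretation: expressions in \<open>C\<close> and \<open>D\<close> become
  cochains on \<open>E\<close>.\<close>

lemma I_up: "up K C D (Obj CD.T) M.Hc (scc (rsc B)) (mulc E (\<lambda>_. rmul B))
  (\<lambda>x. idc E (\<lambda>x. emb B (Idn B x)) (Phi x)) Pair Rc Lc"
proof (intro up.intro up_axioms.intro CD.tensor_pair_axioms I_coch Lc_H Lc_scale Lc_id)
 show "Lc (madd C x y n f f') = Lc f + Lc f'"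
  if "x \<in> Obj C" "y \<in> Obj C" "f \<in> mor C x y n" "f' \<in> mor C x y n" for x y f n f'
  using that by (simp add: Lc_def TT.Lu_add W.shc_add)
 show "Lc (Comp C f2 f1) = mulc D (mulc E (\<lambda>_. rmul B)) (Deg C f1) (Lc f2) (Lc f1)"
  if "f1 \<in> arr C" "f2 \<in> arr C" "Cod C f1 = Dom C f2" for f1 f2
  using W.shc_mulc[OF TT.Lu_H[OF that(1)] TT.Lu_H[OF that(2), folded that(3)]] that
  by (simp add: Lc_def TT.Lu_comp)
 show "linc K D (scc (rsc B)) (Lc f)" "redc D (Lc f)" if "f \<in> arr C" for f
  unfolding Lc_def
  by (rule W.shc_linc[OF TT.Lu_H[OF that] TT.Lu_lin[OF that]],
    rule W.shc_redc[OF TT.Lu_H[OF that] TT.Lu_lin[OF that] TT.Lu_red[OF that]])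
qed

sublocale I: up K C D "Obj CD.T" M.Hc "scc (rsc B)" "mulc E (\<lambda>_. rmul B)"
  "\<lambda>x. idc E (\<lambda>x. emb B (Idn B x)) (Phi x)" Pair Rc Lc
 by (rule I_up)

abbreviation "mcE \<equiv> mulc E (\<lambda>_. rmul B)"
abbreviation "mcD \<equiv> mulc D mcE"

lemma shc_ddc:
 assumes x: "x \<in> Obj C" "y \<in> Obj C" and phi: "phi \<in> TT.N.Hc x y n" and pd: "path D Y gs"
 shows "W.shc (ddc DE.T (\<lambda>_ _ _. rdif B) (Pair x) (Pair y) n phi) Y gs
  = ddc E (\<lambda>_ _ _. rdif B) (Phi (x, Y)) (Phi (y, pend D Y gs)) (n + wt D gs) (W.shc phi Y gs)"
proof (intro ext, goal_cases)
 case (1 Z hs)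
 let ?d = "ddc DE.T (\<lambda>_ _ _. rdif B) (Pair x) (Pair y) n phi"
 show ?case
 proof (cases "path E Z hs")
  case pe: True
  let ?H = "rH B (x, Y, Z) (y, pend D Y gs, pend E Z hs) (n + wt D gs + wt E hs)"
  have o: "(x, Y, Z) \<in> Obj B" "(y, pend D Y gs, pend E Z hs) \<in> Obj B"
   using x CD.D.path_obj[OF pd] CD.D.path_end[OF pd] DE.D.path_obj[OF pe] DE.D.path_end[OF pe] by simp_all
  have "DE.sf gs (?d (Y, Z)) Y Z hs = DE.sf gs (\<lambda>us. rdif B (phi (Y, Z) us)) Y Z hs"
   by (rule DE.sh_cong[OF pd pe]) (simp add: ddc_def)
  also have "\<dots> = rdif B (DE.sf gs (phi (Y, Z)) Y Z hs)"
  proof (rule DE.sh_hom[OF pd pe, symmetric, where S = ?H and theta = "rdif B"], goal_cases)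
   case (1 us)
   thus ?case using TT.N.cochsD[OF phi, of "(Y, Z)" us] by (simp add: add.assoc)
  qed (auto intro: TT.V.H_add TT.V.H_neg TT.V.dif_add[OF o])
  finally show ?thesis using pd pe by (simp add: W.shc_def ddc_def)
 qed (simp add: W.shc_def ddc_def)
qed

text \<open>The twisting cochains on \<open>E\<close>, for all \<open>Y\<close>, collected into one
  cochain on \<open>D\<close> of length zero. Products with it are the outer terms of the
  differential of the category \<open>M\<close>.\<close>

definition emb0 :: "'c => 'd => 'g list => 'e => 'h list => _" where
 "emb0 X = (\<lambda>Y gs. if Y \<in> Obj D \<and> gs = [] then rho E (Rr (X, Y)) else 0)"

lemma emb0_H: "X \<in> Obj C ==> emb0 X \<in> cochs D M.Hc (Pair X) (Pair X) 1"
 by (rule I.Y.cochsI) (auto simp: emb0_def intro: M.rho_H)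

lemma mcD_emb0_left:
 assumes "psi \<in> cochs D M.Hc (Pair x) (Pair y) n" and p: "path D Y gs"
 shows "mcD n (emb0 y) psi Y gs = mcE (n + wt D gs) (rho E (Rr (y, pend D Y gs))) (psi Y gs)"
proof -
 have "mcE (n + wt D as) 0 (psi Y as) = 0" if "as @ bs = gs" for as bs
  using M.CC.mul_zerol[OF I.Y.cochsD[OF assms(1)], of Y as] p that by auto
 thus ?thesis
  unfolding I.Y.mulc_path[OF p] using CD.D.path_end[OF p] by (subst cut_fst) (auto simp: emb0_def)
qed

lemma mcD_emb0_right:
 assumes "psi \<in> cochs D M.Hc (Pair x) (Pair y) n" and p: "path D Y gs"
 shows "mcD 1 psi (emb0 x) Y gs = sgv (wt D gs) (mcE 1 (psi Y gs) (rho E (Rr (x, Y))))"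
proof -
 have "mcE m (psi (pend D Y as) bs) 0 = 0" if "as @ bs = gs" for as bs m
  using M.CC.mul_zeror[OF I.Y.cochsD[OF assms(1)], of "pend D Y as" bs] p that by auto
 thus ?thesis
  unfolding I.Y.mulc_path[OF p] using CD.D.path_obj[OF p] by (subst cut_snd) (auto simp: emb0_def)
qed

lemma shc_Ru: "W.shc (rho DE.T (TT.Ru X)) = emb0 X + rho D (Rc X)"
proof -
 have 1: "Rr (X, c) = (\<lambda>g. TT.Ru X (DE.r c g))" for c by (intro ext) (simp add: Rr_def)
 have 2: "Rc X = (\<lambda>f d gs. if path E d gs then TT.Ru X (DE.e0 f d gs) else 0)" by (intro ext) (simp add: Rc_def)
 show ?thesis unfolding W.shc_rho emb0_def 1 2 ..
qed

text \<open>\<open>TT.Lu (Dif C f)\<close> is the total differential of \<open>TT.Lu f\<close>.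
  Shuffling splits the twisting cochain into \<open>emb0\<close> and that of \<open>Rc\<close>, and
  the bar differential into those of \<open>D\<close> and \<open>E\<close>. The \<open>emb0\<close>
  terms, the bar differential of \<open>E\<close> and the internal differential recombine to
  \<open>M.df\<close>; the rest is the Hochschild part in \<open>D\<close>.\<close>

lemma Lc_dif:
 assumes xy: "x \<in> Obj C" "y \<in> Obj C" and f: "f \<in> mor C x y n"
 shows "Lc (Dif C f) = difc D mcE M.df (Pair x) (Pair y) (Rc x) (Rc y) n (Lc f)"
proof -
 let ?T = DE.T and ?mT = "mulc DE.T (\<lambda>_. rmul B)"
 note L = TT.Lu_H'[OF xy f] and LL = Lc_H[OF xy f]
 have lin: "linc K ?T (rsc B) (TT.Lu f)" by (rule TT.Lu_lin[OF CD.C.arrI[OF xy f]])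
 note rT = TT.N.rho_H[OF xy(1)] TT.N.rho_H[OF xy(2)]
 note rD = I.Y.rho_H[OF xy(1)] I.Y.rho_H[OF xy(2)]
 note e0 = emb0_H[OF xy(1)] emb0_H[OF xy(2)]
 have 1: "W.shc (?mT n (rho ?T (TT.Ru y)) (TT.Lu f)) = mcD n (emb0 y) (Lc f) + mcD n (rho D (Rc y)) (Lc f)"
  unfolding W.shc_mulc[OF L rT(2)] shc_Ru Lc_def[symmetric] by (rule I.Y.CC.mul_addl[OF LL e0(2) rD(2)])
 have 2: "W.shc (?mT 1 (TT.Lu f) (rho ?T (TT.Ru x))) = mcD 1 (Lc f) (emb0 x) + mcD 1 (Lc f) (rho D (Rc x))"
  unfolding W.shc_mulc[OF rT(1) L] shc_Ru Lc_def[symmetric] by (rule I.Y.CC.mul_addr[OF e0(1) rD(1) LL])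
 have LD: "Lc (Dif C f) = W.shc (ddc ?T (\<lambda>_ _ _. rdif B) (Pair x) (Pair y) n (TT.Lu f))
   + (mcD n (emb0 y) (Lc f) + mcD n (rho D (Rc y)) (Lc f)
    - sgv n (mcD 1 (Lc f) (emb0 x) + mcD 1 (Lc f) (rho D (Rc x))) + sgv n (W.shc (bdc ?T (TT.Lu f))))"
  unfolding Lc_def[of "Dif C f"] TT.df_Lu[OF xy f, symmetric] difc_def dlc_def W.shc_add W.shc_diff W.shc_sgv 1 2 ..
 show ?thesis
 proof (intro ext, goal_cases)
  case (1 Y gs Z hs)
  show ?case
  proof (cases "path D Y gs")
   case p: True
   note dd = shc_ddc[OF xy L p, folded Lc_def] and bb = W.shc_bdc[OF L lin p, folded Lc_def]
   note ee = mcD_emb0_left[OF LL p] mcD_emb0_right[OF LL p]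
   show ?thesis
    unfolding LD difc_def[of D] dlc_def[of D] plus_fun_def fun_diff_def sgv_fun dd bb ee ddc_def[of D] if_P[OF p]
     difc_def[of E] dlc_def[of E]
    by (simp add: sgv_fun sgv_add add.commute[of _ n])
  next
   case False
   thus ?thesis
    by (simp add: Lc_def W.shc_def difc_def[of D] dlc_def[of D] ddc_def[of D] mulc_def[of D] bdc_def[of D] sgv_fun)
  qed
 qed
qed

sublocale I: up_dg K C D "Obj CD.T" M.Hc "scc (rsc B)" mcE
  "\<lambda>x. idc E (\<lambda>x. emb B (Idn B x)) (Phi x)" Pair Rc Lc M.df
 by (intro up_dg.intro up_dg_axioms.intro I_up M.df_vdg Lc_dif Rc_dif)

text \<open>Membership in \<open>cochs\<close> says nothing about linearity and normalization, but
  the outer interpretation asks for both, so they are followed through all expressions.\<close>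

lemma I_ip_lin: "twf K C D t ==> linc K E (rsc B) (I.ip t) \<and> redc E (I.ip t)"
proof (induction t)
 case (TZero x y n)
 show ?case using M.linc_0 by (simp add: redc_def zero_fun_def)
next
 case (TId x)
 show ?case by (simp add: linc_def ling_def redc_def idc_def TT.V.sc_zero)
next
 case (TL f d)
 hence f: "f \<in> arr C" by simp
 note L = TT.Lu_H[OF f] TT.Lu_lin[OF f] TT.Lu_red[OF f]
 show ?case using W.shc_linc_right[OF L(1,2)] W.shc_redc_right[OF L] by (simp add: Lc_def)
next
 case (TR c g)
 thus ?case using Rc_lin by simp
next
 case (TE f gs)
 hence f: "f \<in> arr C" by simp
 note L = TT.Lu_H[OF f] TT.Lu_lin[OF f] TT.Lu_red[OF f]
 show ?case using W.shc_linc_right[OF L(1,2)] W.shc_redc_right[OF L] by (simp add: Lc_def)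
next
 case (TAdd s t)
 hence w: "twf K C D s" "twf K C D t" "tdom C D t = tdom C D s" "tcod C D t = tcod C D s" "tdeg C D t = tdeg C D s"
  by (auto simp: tpar_def)
 show ?case
  using TAdd.IH(1)[OF w(1)] TAdd.IH(2)[OF w(2)] M.linc_plus[OF _ I.ip_H[OF w(1)] _ I.ip_H[OF w(2), unfolded w(3-5)]]
  by (simp add: redc_def plus_fun_def)
next
 case (TScale a t)
 hence w: "twf K C D t" "a \<in> carrier K" by auto
 have "redc E (scc (rsc B) a phi)" if "redc E phi" for phi
  using that by (simp add: redc_def scc_def TT.V.sc_zero[OF w(2)])
 thus ?case
  using TScale.IH[OF w(1)] M.linc_scc[OF _ I.ip_H[OF w(1)] w(2)] unfolding interp.simps by blast
next
 case (TComp s t)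
 hence w: "twf K C D s" "twf K C D t" "tdom C D s = tcod C D t" by auto
 show ?case
  using TComp.IH(1)[OF w(1)] TComp.IH(2)[OF w(2)] M.linc_mulc[OF I.ip_H[OF w(2), folded w(3)] I.ip_H[OF w(1)]]
   M.redc_mulc[OF I.ip_H[OF w(2), folded w(3)] I.ip_H[OF w(1)]] by simp
qed

definition Lo where "Lo u = I.ip (SOME t. twf K C D t \<and> tcls K C D t = u)"

lemma Lo_cls:
 assumes "twf K C D t"
 shows "Lo (tcls K C D t) = I.ip t"
proof -
 define s where "s = (SOME s. twf K C D s \<and> tcls K C D s = tcls K C D t)"
 have s: "twf K C D s \<and> tcls K C D s = tcls K C D t"
  unfolding s_def by (rule someI[of _ t]) (use assms in simp)
 hence "I.ip s = I.ip t" using CD.cls_eq_iff I.ip_rel by blast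
 thus ?thesis by (simp add: Lo_def s_def)
qed

lemma Lo_red: "u \<in> arr CD.T ==> linc K E (rsc B) (Lo u)" "u \<in> arr CD.T ==> redc E (Lo u)"
 using I_ip_lin Lo_cls unfolding CD.arr_T by auto

text \<open>The outer interpretation takes its cochains from the values of the inner one. Its
  conditions hold because each operation on classes is interpreted by the corresponding operation on
  cochains.\<close>

lemma O_up: "up K CD.T E (Obj B) (rH B) (rsc B) (\<lambda>_. rmul B) (\<lambda>x. emb B (Idn B x)) Phi Rr Lo"
proof (intro up.intro up_axioms.intro SS.tensor_pair_axioms M_coch Lo_red)
 fix x y n f assume "x \<in> Obj CD.T" "y \<in> Obj CD.T" "f \<in> mor CD.T x y n"
 then obtain t where t: "f = tcls K C D t" "twf K C D t" "tdom C D t = x" "tcod C D t = y" "tdeg C D t = n"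
  unfolding CD.carrier_T by blast
 show "Lo f \<in> cochs E (rH B) (Phi x) (Phi y) n" using I.ip_H[OF t(2)] t Lo_cls by simp
 { fix f' assume "f' \<in> mor CD.T x y n"
  then obtain t' where t': "f' = tcls K C D t'" "twf K C D t'" "tdom C D t' = x" "tcod C D t' = y" "tdeg C D t' = n"
   unfolding CD.carrier_T by blast
  thus "Lo (f \<oplus>\<^bsub>Mor CD.T x y n\<^esub> f') = Lo f + Lo f'"
   using t Lo_cls[of "TAdd t t'"] by (simp add: CD.add_T tpar_def Lo_cls) }
 { fix a assume "a \<in> carrier K"
  thus "Lo (a \<odot>\<^bsub>Mor CD.T x y n\<^esub> f) = scc (rsc B) a (Lo f)"
   using t Lo_cls[of "TScale a t"] by (simp add: CD.smult_T Lo_cls) }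
next
 fix f1 f2 assume "f1 \<in> arr CD.T" "f2 \<in> arr CD.T" and c: "Cod CD.T f1 = Dom CD.T f2"
 then obtain s t where s: "f1 = tcls K C D s" "f2 = tcls K C D t" "twf K C D s" "twf K C D t"
  unfolding CD.arr_T by blast
 hence e: "tdom C D t = tcod C D s" using c by (simp add: CD.cls_typed)
 show "Lo (Comp CD.T f2 f1) = mcE (Deg CD.T f1) (Lo f2) (Lo f1)"
  using s e Lo_cls[of "TComp t s"] by (simp add: CD.Comp_T Lo_cls CD.cls_typed)
next
 fix c assume "c \<in> Obj CD.T"
 thus "Lo (Idn CD.T c) = idc E (\<lambda>x. emb B (Idn B x)) (Phi c)"
  using Lo_cls[of "TId c"] by (simp add: CD.Idn_T)
qed

sublocale O: up_real K CD.T E B Phi Rr Lo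
proof (intro up_real.intro up_dg.intro up_dg_axioms.intro O_up TT.V.vdg_axioms TT.T_dg, goal_cases)
 case (1 x y f n)
 then obtain t where t: "f = tcls K C D t" "twf K C D t" "tdom C D t = x" "tcod C D t = y" "tdeg C D t = n"
  unfolding CD.carrier_T by blast
 show ?case
  using t CD.tdif_typed[OF t(2)] I.ip_dif[OF t(2)] by (simp add: CD.Dif_T Lo_cls)
next
 case (2 c g)
 thus ?case
  using TT.rdif_Ru[of "fst c" "DE.r (snd c) g"] DE.r_arr[of "snd c" g] DE.r_dif[of "snd c" g] by (auto simp: Rr_def)
qed

definition "assocF = O.upF"

lemma assocF_functor: "dg_functor K SS.T B assocF"
 unfolding assocF_def by (rule O.upF_functor)

lemma FObj_assocF: "X \<in> Obj C ==> Y \<in> Obj D ==> Z \<in> Obj E ==> FObj assocF ((X, Y), Z) = (X, Y, Z)"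
 unfolding assocF_def by (simp add: O.FObj_upF Phi_def)

lemma assocF_e0:
 assumes "twf K C D t" "path E Z hs"
 shows "emb B (FMor assocF (SS.e0 (tcls K C D t) Z hs)) = I.ip t Z hs"
 using O.upF_cls(2)[OF SS.TE0_typed(1)[OF CD.cls_arr[OF assms(1)] assms(2)]] O.ip_TE0[OF assms(2)] Lo_cls[OF assms(1)]
 by (simp add: assocF_def eps0_def)

lemma assocF_r:
 assumes "X \<in> Obj C" "Y \<in> Obj D" "h \<in> arr E"
 shows "emb B (FMor assocF (SS.r (X, Y) h)) = TT.Ru X (DE.r Y h)"
 using O.upF_cls(2)[of "TR (X, Y) h"] assms by (simp add: assocF_def tright_def Rr_def)

end

section \<open>Functors are determined by their values on generators\<close>

context dg_functor
begin

lemma fobj_closed: "x \<in> Obj A ==> FObj F x \<in> Obj B"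
 using fobj by auto

lemma fmor_zero:
 assumes "x \<in> Obj A" "y \<in> Obj A"
 shows "FMor F \<zero>\<^bsub>Mor A x y n\<^esub> = \<zero>\<^bsub>Mor B (FObj F x) (FObj F y) n\<^esub>"
proof -
 interpret M: module K "Mor A x y n" using assms by simp
 interpret N: module K "Mor B (FObj F x) (FObj F y) n" using assms by (simp add: B.mor_module fobj_closed)
 show ?thesis
  using fmor_add[OF assms M.zero_closed M.zero_closed] fmor_closed[OF assms M.zero_closed] N.add.r_cancel_one' by auto
qed

lemma fmor_arr:
 assumes "f \<in> arr A"
 shows "FMor F f \<in> arr B" "Dom B (FMor F f) = FObj F (Dom A f)" "Cod B (FMor F f) = FObj F (Cod A f)"
  "Deg B (FMor F f) = Deg A f"
proof -
 note t = A.arr_typed[OF assms]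
 note o = fobj_closed[OF t(1)] fobj_closed[OF t(2)] and m = fmor_closed[OF t]
 show "FMor F f \<in> arr B" "Dom B (FMor F f) = FObj F (Dom A f)" "Cod B (FMor F f) = FObj F (Cod A f)"
  "Deg B (FMor F f) = Deg A f"
  using B.arrI[OF o m] B.mor_DCD[OF o m] by auto
qed

lemma emb_fmor_add:
 assumes "x \<in> Obj A" "y \<in> Obj A" "f \<in> mor A x y n" "g \<in> mor A x y n"
 shows "emb B (FMor F (madd A x y n f g)) = emb B (FMor F f) + emb B (FMor F g)"
 unfolding fmor_add[OF assms]
 by (rule B.emb_add[OF fobj_closed[OF assms(1)] fobj_closed[OF assms(2)] fmor_closed[OF assms(1-3)] fmor_closed[OF assms(1,2,4)]])

lemma emb_fmor_comp:
 assumes "f \<in> arr A" "g \<in> arr A" "Cod A f = Dom A g"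
 shows "emb B (FMor F (Comp A g f)) = rmul B (emb B (FMor F g)) (emb B (FMor F f))"
proof -
 note f = fmor_arr[OF assms(1)] and g = fmor_arr[OF assms(2)]
 show ?thesis
  using B.rmul_emb[OF B.arr_typed(1,2)[OF f(1)] B.arr_typed(2)[OF g(1)] B.arr_typed(3)[OF f(1)], of "FMor F g"]
   B.arr_typed(3)[OF g(1)] f g fmor_comp[OF assms] assms(3) by simp
qed

end

lemma dgfun_compI:
 assumes "dg_functor K A B F" "dg_functor K B B' G"
 shows "dg_functor K A B' (dgfun_comp A G F)"
proof -
 interpret F: dg_functor K A B F by fact
 interpret G: dg_functor K B B' G by fact
 have arr: "f \<in> arr A" if "x \<in> Obj A" "y \<in> Obj A" "f \<in> mor A x y n" for x y f n
  using F.A.arrI[OF that] .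
 have sum: "madd A x y n f g \<in> arr A" if "x \<in> Obj A" "y \<in> Obj A" "f \<in> mor A x y n" "g \<in> mor A x y n"
  for x y f g n
 proof -
  interpret M: module K "Mor A x y n" using that by (simp add: F.A.mor_module)
  show ?thesis using arr[OF that(1,2) M.a_closed[OF that(3,4)]] .
 qed
 have smult: "mscale A x y n a f \<in> arr A" if "x \<in> Obj A" "y \<in> Obj A" "a \<in> carrier K" "f \<in> mor A x y n"
  for x y f a n
 proof -
  interpret M: module K "Mor A x y n" using that by (simp add: F.A.mor_module)
  show ?thesis using arr[OF that(1,2) M.smult_closed[OF that(3,4)]] .
 qed
 show ?thesis
 proof (intro dg_functor.intro dg_functor_axioms.intro F.A.dg_category_axioms G.B.dg_category_axioms)
  show "FObj (dgfun_comp A G F) \<in> Obj A \<rightarrow>\<^sub>E Obj B'" by (auto simp: dgfun_comp_def F.fobj_closed G.fobj_closed)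
 qed (auto simp: dgfun_comp_def arr sum smult F.A.idn_arr F.A.comp_arr F.A.dif_arr F.fmor_arr F.fobj_closed
   F.fmor_closed G.fmor_closed F.fmor_add G.fmor_add F.fmor_smult G.fmor_smult F.fmor_idn G.fmor_idn
   F.fmor_comp G.fmor_comp F.fmor_dif G.fmor_dif)
qed

context tensor_pair
begin

lemma e0_cls: "f \<in> arr C ==> d \<in> Obj D ==> clt (TL f d) = e0 f d []"
 "chain D gs ==> clt (TE f gs) = e0 f (Dom D (hd gs)) gs"
 by (simp_all add: eps0_def TE0_def chain_def)

text \<open>Induction over expressions; every morphism is the class of one.\<close>

lemma functor_eqI:
 assumes P: "dg_functor K T B P" and Q: "dg_functor K T B Q" and obj: "\<And>x. x \<in> Obj T ==> FObj P x = FObj Q x"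
  and e: "\<And>f d gs. f \<in> arr C ==> path D d gs ==> FMor P (e0 f d gs) = FMor Q (e0 f d gs)"
  and r: "\<And>c g. c \<in> Obj C ==> g \<in> arr D ==> FMor P (r c g) = FMor Q (r c g)"
 shows "P = Q"
proof -
 interpret P: dg_functor K T B P by fact
 interpret Q: dg_functor K T B Q by fact
 have "FMor P (clt t) = FMor Q (clt t)" if "wft t" for t
  using that
 proof (induction t)
  case (TZero x y n)
  thus ?case
   using P.fmor_zero[of x y n] Q.fmor_zero[of x y n] by (simp add: zero_T obj)
 next
  case (TId x)
  thus ?case using P.fmor_idn[of x] Q.fmor_idn[of x] by (simp add: Idn_T obj)
 next
  case (TL f d)
  thus ?case using e[of f d "[]"] by (simp add: e0_cls)
 next
  case (TR c g)
  thus ?case using r[of c g] by (simp add: tright_def)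
 next
  case (TE f gs)
  thus ?case using e[of f "Dom D (hd gs)" gs] by (simp add: e0_cls D.chain_path)
 next
  case (TAdd s t)
  hence w: "wft s" "wft t" "part s t" by auto
  note m = T_obj[OF w(1)] cls_mor'[OF w(1)] cls_mor'[OF w(2)]
  show ?case
   using P.fmor_add[OF m(1,2,3), of "clt t"] Q.fmor_add[OF m(1,2,3), of "clt t"] TAdd.IH w m
   by (simp add: add_T[OF w] tpar_def obj[OF m(1)] obj[OF m(2)])
 next
  case (TScale a t)
  hence w: "wft t" "a \<in> carrier K" by auto
  note m = T_obj[OF w(1)] cls_mor'[OF w(1)]
  show ?case
   using P.fmor_smult[OF m(1,2) w(2) m(3)] Q.fmor_smult[OF m(1,2) w(2) m(3)] TScale.IH w
   by (simp add: smult_T[OF w] obj[OF m(1)] obj[OF m(2)])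
 next
  case (TComp s t)
  hence w: "wft s" "wft t" "dmt s = cdt t" by auto
  show ?case
   using P.fmor_comp[OF cls_arr[OF w(2)] cls_arr[OF w(1)]] Q.fmor_comp[OF cls_arr[OF w(2)] cls_arr[OF w(1)]] TComp.IH w
   by (simp add: Comp_T[OF w] cls_typed)
 qed
 hence "FMor P A = FMor Q A" for A
  using P.fmor_ext Q.fmor_ext arr_T[of A] by (cases "A \<in> arr T") (auto simp: extensional_def)
 moreover have "FObj P x = FObj Q x" for x
  using PiE_arb[OF P.fobj] PiE_arb[OF Q.fobj] obj by (cases "x \<in> Obj T") (simp_all del: Obj_T)
 ultimately show ?thesis by (intro dgfun.equality ext) simp_all
qed

lemma e0_add:
 assumes "u \<in> Obj C" "v \<in> Obj C" "x \<in> mor C u v n" "y \<in> mor C u v n" "path D d gs"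
 defines "M \<equiv> Mor T (u, d) (v, pend D d gs) (n + wt D gs)"
 shows "e0 (madd C u v n x y) d gs = e0 x d gs \<oplus>\<^bsub>M\<^esub> e0 y d gs"
  "a \<in> carrier K ==> e0 (mscale C u v n a x) d gs = a \<odot>\<^bsub>M\<^esub> e0 x d gs"
  "e0 x d gs \<in> carrier M" "(u, d) \<in> Obj T" "(v, pend D d gs) \<in> Obj T"
proof -
 show o: "(u, d) \<in> Obj T" "(v, pend D d gs) \<in> Obj T"
  using assms(1,2) D.path_obj[OF assms(5)] D.path_end[OF assms(5)] by simp_all
 interpret M: module K "Mor C u v n" using assms by simp
 interpret N: module K M using o unfolding M_def by (rule T_module)
 have m: "e0 t d gs \<in> carrier M" if "t \<in> mor C u v n" for t
  using e0_mor[OF C.arrI[OF assms(1,2) that] assms(5)] C.mor_DCD[OF assms(1,2) that] by (simp add: M_def)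
 show "e0 x d gs \<in> carrier M" by (rule m[OF assms(3)])
 show "e0 (madd C u v n x y) d gs = e0 x d gs \<oplus>\<^bsub>M\<^esub> e0 y d gs"
  using e0_lin_left[OF assms(1-4) C.one_closed C.one_closed assms(5) M_def[THEN meta_eq_to_obj_eq]] m assms(3,4) by simp
 show "e0 (mscale C u v n a x) d gs = a \<odot>\<^bsub>M\<^esub> e0 x d gs" if "a \<in> carrier K"
  using e0_lin_left[OF assms(1-3,3) that C.zero_closed assms(5) M_def[THEN meta_eq_to_obj_eq]] m assms(3) that
  by (simp add: M.smult_l_null N.smult_l_null)
qed

end

context tensor_triple
begin

text \<open>The first argument of an outer epsilon is an arbitrary morphism of the twisted tensor
  product of \<open>C\<close> and \<open>D\<close>. Linearity and the relation for composites reduce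
  it to generators, which leaves the three families of the statement.\<close>

lemma functor_eqI3:
 assumes P: "dg_functor K SS.T B' P" and Q: "dg_functor K SS.T B' Q"
  and obj: "\<And>x. x \<in> Obj SS.T ==> FObj P x = FObj Q x"
  and e: "\<And>f Y gs Z hs. f \<in> arr C ==> path D Y gs ==> path E Z hs ==>
   FMor P (SS.e0 (CD.e0 f Y gs) Z hs) = FMor Q (SS.e0 (CD.e0 f Y gs) Z hs)"
  and r1: "\<And>X g Z hs. X \<in> Obj C ==> g \<in> arr D ==> path E Z hs ==>
   FMor P (SS.e0 (CD.r X g) Z hs) = FMor Q (SS.e0 (CD.r X g) Z hs)"
  and r2: "\<And>X Y h. X \<in> Obj C ==> Y \<in> Obj D ==> h \<in> arr E ==> FMor P (SS.r (X, Y) h) = FMor Q (SS.r (X, Y) h)"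
 shows "P = Q"
proof -
 interpret P: dg_functor K SS.T B' P by fact
 interpret Q: dg_functor K SS.T B' Q by fact
 have *: "FMor P (SS.e0 (tcls K C D s) Z hs) = FMor Q (SS.e0 (tcls K C D s) Z hs)"
  if "twf K C D s" "path E Z hs" for s Z hs
  using that
 proof (induction s arbitrary: Z hs)
  case (TZero x y n)
  hence o: "x \<in> Obj CD.T" "y \<in> Obj CD.T" "(x, Z) \<in> Obj SS.T"
   "(y, pend E Z hs) \<in> Obj SS.T" using DE.D.path_obj DE.D.path_end by auto
  interpret M: module K "Mor CD.T x y n" using o by (simp add: CD.T_module)
  note t = CD.G.arrI[OF o(1,2) M.zero_closed] CD.G.mor_DCD[OF o(1,2) M.zero_closed]
  have "SS.e0 (tcls K C D (TZero x y n)) Z hs = \<zero>\<^bsub>Mor SS.T (x, Z) (y, pend E Z hs) (n + wt E hs)\<^esub>"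
   using SS.e0_zero_iff[OF t(1) TZero.prems(2)] SS.Lu_zero[OF o(1,2)] t(2-4) by (simp add: CD.zero_T)
  thus ?case using P.fmor_zero[OF o(3,4)] Q.fmor_zero[OF o(3,4)] by (simp only: obj[OF o(3)] obj[OF o(4)])
 next
  case (TId x)
  hence o: "x \<in> Obj CD.T" "(x, Z) \<in> Obj SS.T"
   "(x, pend E Z hs) \<in> Obj SS.T" using DE.D.path_obj DE.D.path_end by auto
  show ?case
  proof (cases "hs = []")
   case True
   hence "SS.e0 (tcls K C D (TId x)) Z hs = Idn SS.T (x, Z)"
    using SS.e0_id_Nil[OF o(1), of Z] o(2) by (simp add: CD.Idn_T)
   thus ?thesis using P.fmor_idn[OF o(2)] Q.fmor_idn[OF o(2)] by (simp only: obj[OF o(2)])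
  next
   case False
   hence "SS.e0 (tcls K C D (TId x)) Z hs = \<zero>\<^bsub>Mor SS.T (x, Z) (x, pend E Z hs) (wt E hs)\<^esub>"
    using SS.e0_id_left[OF o(1) TId.prems(2)] by (simp add: CD.Idn_T)
   thus ?thesis using P.fmor_zero[OF o(2,3)] Q.fmor_zero[OF o(2,3)] by (simp only: obj[OF o(2)] obj[OF o(3)])
  qed
 next
  case (TL f d)
  thus ?case using e[of f d "[]"] by (simp add: CD.e0_cls)
 next
  case (TR c g)
  thus ?case using r1[of c g] by (simp add: tright_def)
 next
  case (TE f gs)
  thus ?case using e[of f "Dom D (hd gs)" gs] by (simp add: CD.e0_cls CD.D.chain_path)
 next
  case (TAdd s t)
  hence w: "twf K C D s" "twf K C D t" "tpar C D s t" by auto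
  have "tcls K C D t \<in> mor CD.T (tdom C D s) (tcod C D s) (tdeg C D s)"
   using CD.cls_mor'[OF w(2)] w(3) by (simp add: tpar_def)
  note a = SS.e0_add[OF CD.T_obj[OF w(1)] CD.cls_mor'[OF w(1)] this TAdd.prems(2)]
   SS.e0_add(3)[OF CD.T_obj[OF w(1)] this this TAdd.prems(2)]
  show ?case
   using P.fmor_add[OF a(4,5,3,6)] Q.fmor_add[OF a(4,5,3,6)] TAdd.IH(1)[OF w(1) TAdd.prems(2)] TAdd.IH(2)[OF w(2) TAdd.prems(2)]
    a(1) by (simp add: CD.add_T[OF w] obj[OF a(4)] obj[OF a(5)])
 next
  case (TScale b s)
  hence w: "twf K C D s" "b \<in> carrier K" by auto
  note a = SS.e0_add[OF CD.T_obj[OF w(1)] CD.cls_mor'[OF w(1)] CD.cls_mor'[OF w(1)] TScale.prems(2)]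
  show ?case
   using P.fmor_smult[OF a(4,5) w(2) a(3)] Q.fmor_smult[OF a(4,5) w(2) a(3)] TScale.IH[OF w(1) TScale.prems(2)]
    a(2)[OF w(2)] by (simp add: CD.smult_T[OF w] obj[OF a(4)] obj[OF a(5)])
 next
  case (TComp s t)
  hence w: "twf K C D s" "twf K C D t" "tdom C D s = tcod C D t" by auto
  note p = TComp.prems(2)
  let ?s = "tcls K C D s" and ?t = "tcls K C D t" and ?S = SS.T
  note st = CD.cls_arr[OF w(2)] CD.cls_arr[OF w(1)] and ty = CD.cls_typed[OF w(2)] CD.cls_typed[OF w(1)]
  have c: "Cod CD.T ?t = Dom CD.T ?s" using ty w(3) by simp
  have o: "(Dom CD.T ?t, Z) \<in> Obj ?S" "(Cod CD.T ?s, pend E Z hs) \<in> Obj ?S"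
   using CD.G.arr_typed[OF st(1)] CD.G.arr_typed[OF st(2)] DE.D.path_obj[OF p] DE.D.path_end[OF p] by simp_all
  have m: "SS.e0 (Comp CD.T ?s ?t) Z hs \<in> arr ?S"
   by (rule SS.e0_arr(1)[OF CD.G.comp_arr(1)[OF st c] p])
  \<comment> \<open>An epsilon with a composite as first argument is a sum over cuts of
    \<open>hs\<close>. The induction hypotheses hold for all lists of arguments and so apply to both
    factors of each summand.\<close>
  have "emb B' (FMor P (SS.e0 (Comp CD.T ?s ?t) Z hs))
   = cut (\<lambda>as bs. sgv (Deg CD.T ?t * wt E bs) (emb B' (FMor P (Comp ?S (SS.e0 ?s (pend E Z as) bs) (SS.e0 ?t Z as))))) hs"
   by (rule SS.theta_comp[OF o P.emb_fmor_add[OF o] st c p HOL.refl HOL.refl HOL.refl])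
  also have "\<dots> = cut (\<lambda>as bs. sgv (Deg CD.T ?t * wt E bs) (emb B' (FMor Q (Comp ?S (SS.e0 ?s (pend E Z as) bs) (SS.e0 ?t Z as))))) hs"
  proof (rule cut_cong, goal_cases)
   case s: (1 as bs)
   have pa: "path E Z as" "path E (pend E Z as) bs" using p s by auto
   note a = SS.e0_arr[OF st(1) pa(1)] and b = SS.e0_arr[OF st(2) pa(2)]
   have cc: "Cod ?S (SS.e0 ?t Z as) = Dom ?S (SS.e0 ?s (pend E Z as) bs)" using a b c by simp
   show ?case
    unfolding P.emb_fmor_comp[OF a(1) b(1) cc] Q.emb_fmor_comp[OF a(1) b(1) cc] TComp.IH(1)[OF w(1) pa(2)] TComp.IH(2)[OF w(2) pa(1)] ..
  qed
  also have "\<dots> = emb B' (FMor Q (SS.e0 (Comp CD.T ?s ?t) Z hs))"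
   by (rule SS.theta_comp[OF o Q.emb_fmor_add[OF o] st c p HOL.refl HOL.refl HOL.refl, symmetric])
  finally have eq: "emb B' (FMor P (SS.e0 (Comp CD.T ?s ?t) Z hs)) = emb B' (FMor Q (SS.e0 (Comp CD.T ?s ?t) Z hs))" .
  note mt = SS.G.arr_typed[OF m]
  have "FMor P (SS.e0 (Comp CD.T ?s ?t) Z hs) = FMor Q (SS.e0 (Comp CD.T ?s ?t) Z hs)"
   using P.B.emb_inj[OF P.fobj_closed[OF mt(1)] P.fobj_closed[OF mt(2)] P.fmor_closed[OF mt] _ eq]
    Q.fmor_closed[OF mt] by (simp only: obj[OF mt(1)] obj[OF mt(2)])
  thus ?case by (simp only: CD.Comp_T[OF w])
 qed
 show ?thesis
 proof (rule SS.functor_eqI[OF P Q obj])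
  fix f d gs assume "f \<in> arr CD.T" "path E d gs"
  thus "FMor P (SS.e0 f d gs) = FMor Q (SS.e0 f d gs)" using * unfolding CD.arr_T by auto
 next
  fix c g assume "c \<in> Obj CD.T" "g \<in> arr E"
  thus "FMor P (SS.r c g) = FMor Q (SS.r c g)" using r2 by auto
 qed
qed

end

section \<open>The formula for the associator\<close>

text \<open>\<open>assoc_index\<close> with a lower bound \<open>a\<close>, the position already
  reached; the recursion over \<open>gs\<close> requires it.\<close>

definition idx :: "nat => nat => nat => (nat \<times> nat) list set" where
 "idx k a N = {ps. length ps = k \<and> sorted (a # concat (map (\<lambda>(i, j). [i, j]) ps)) \<and> (\<forall>(i, j)\<in>set ps. j \<le> N)}"

lemma idx_assoc: "assoc_index k N = idx k 0 N"
 by (simp add: assoc_index_def idx_def)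

lemma idx_0: "idx 0 a N = {[]}"
 by (auto simp: idx_def)

lemma idx_Suc: "idx (Suc k) a N = (\<Union>i\<in>{a..N}. \<Union>j\<in>{i..N}. (#) (i, j) ` idx k j N)"
proof (intro subset_antisym subsetI, goal_cases)
 case (1 ps)
 then obtain i j qs where ps: "ps = (i, j) # qs" by (cases ps) (auto simp: idx_def)
 with \<open>ps \<in> idx (Suc k) a N\<close> have "a \<le> i" "i \<le> j" "j \<le> N" "qs \<in> idx k j N"
  by (auto simp: idx_def)
 thus ?case
  unfolding ps by (intro UN_I[of i] UN_I[of j] imageI) simp_all
next
 case (2 ps)
 thus ?case by (fastforce simp: idx_def)
qed

lemma finite_idx: "finite (idx k a N)"
 by (induction k arbitrary: a) (simp_all add: idx_0 idx_Suc)

lemma sum_idx: "(\<Sum>ps\<in>idx (Suc k) a N. F ps) = (\<Sum>i\<in>{a..N}. \<Sum>j\<in>{i..N}. \<Sum>ps\<in>idx k j N. F ((i, j) # ps))"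
proof -
 have "(\<Sum>ps\<in>idx (Suc k) a N. F ps) = (\<Sum>i\<in>{a..N}. sum F (\<Union>j\<in>{i..N}. (#) (i, j) ` idx k j N))"
  unfolding idx_Suc by (rule sum.UNION_disjoint) (auto simp: finite_idx)
 also have "\<dots> = (\<Sum>i\<in>{a..N}. \<Sum>j\<in>{i..N}. \<Sum>ps\<in>idx k j N. F ((i, j) # ps))"
  by (rule sum.cong[OF HOL.refl], subst sum.UNION_disjoint) (auto simp: finite_idx sum.reindex inj_on_def)
 finally show ?thesis .
qed

lemma cut_drop:
 assumes "a \<le> length hs"
 shows "cut F (drop a hs) = (\<Sum>i\<in>{a..length hs}. F (segment a i hs) (drop i hs))"
proof -
 have "cut F (drop a hs) = (\<Sum>m\<in>{0..length hs - a}. F (take m (drop a hs)) (drop m (drop a hs)))"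
  unfolding cut_index by (simp add: interv_sum_list_conv_sum_set_nat atLeastLessThanSuc_atLeastAtMost del: upt_Suc)
 also have "\<dots> = (\<Sum>i\<in>{a..length hs}. F (segment a i hs) (drop i hs))"
  by (rule sum.reindex_bij_witness[where i = "\<lambda>i. i - a" and j = "\<lambda>m. m + a"])
   (use assms in "auto simp: segment_def add.commute")
 finally show ?thesis .
qed

lemma take_segment: "a \<le> i ==> take a hs @ segment a i hs = take i hs"
 by (simp add: segment_def take_add[symmetric])

lemma sgv_sum: "sgv n (sum f A) = (\<Sum>x\<in>A. sgv n (f x))"
 by (simp add: sgv_def sum_negf)

context tensor_pair
begin

text \<open>The convention for an empty segment is the one built into \<open>eps0\<close>.\<close>

lemma assoc_head:
 assumes p: "path D Z hs" "hs \<noteq> []" and ij: "i \<le> j" "j \<le> length hs"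
 shows "(if i = j then tleft K C D g (chain_obj D hs i) else teps K C D g (segment i j hs))
  = e0 g (pend D Z (take i hs)) (segment i j hs)"
proof (cases "i = j")
 case True
 have "chain_obj D hs i = pend D Z (take i hs)"
 proof (cases "i < length hs")
  case i: True
  hence "path D (pend D Z (take i hs)) (drop i hs)" "drop i hs = hs ! i # drop (Suc i) hs"
   using D.path_take_drop(2)[OF p(1)] by (simp_all add: Cons_nth_drop_Suc)
  thus ?thesis using i by (simp add: chain_obj_def)
 next
  case False
  thus ?thesis using pend_last[OF p(2), of D Z] by (simp add: chain_obj_def)
 qed
 thus ?thesis using True by (simp add: tleft_def eps0_def TE0_def segment_def)
next
 case False
 hence "segment i j hs \<noteq> []" using ij by (simp add: segment_def)
 thus ?thesis using False by (simp add: teps_def eps0_def TE0_def)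
qed

text \<open>Unfolding the recursion of \<open>sh\<close> chooses a pair of cut positions for every
  letter of \<open>gs\<close>. The sign of each step involves the part of \<open>hs\<close> behind
  the second position, and these signs add up to the exponent of \<open>assoc_sign\<close>.\<close>

lemma sh_assoc:
 assumes p: "path D Z hs" "hs \<noteq> []" and a: "a \<le> length hs"
 shows "sf gs phi Y (pend D Z (take a hs)) (drop a hs)
  = (\<Sum>ps\<in>idx (length gs) a (length hs).
    sgv (\<Sum>l<length gs. (Deg C (gs ! l) - 1) * wt D (drop (snd (ps ! l)) hs)) (phi (assoc_args K C D hs a Y gs ps)))"
 using a
proof (induction gs arbitrary: phi a Y)
 case Nil
 show ?case by (simp add: idx_0)
next
 case (Cons g gs)
 let ?N = "length hs"
 let ?F = "\<lambda>gs ps. \<Sum>l<length gs. (Deg C (gs ! l) - 1) * wt D (drop (snd (ps ! l)) hs)"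
 have sg: "?F (g # gs) ((i, j) # ps) = (Deg C g - 1) * wt D (drop j hs) + ?F gs ps" for i j ps
  by (simp add: sum.lessThan_Suc_shift del: sum.lessThan_Suc)
 have "sf (g # gs) phi Y (pend D Z (take a hs)) (drop a hs)
  = (\<Sum>i\<in>{a..?N}. \<Sum>j\<in>{i..?N}. sgv ((Deg C g - 1) * wt D (drop j hs))
   (sf gs (\<lambda>us. phi (map (r Y) (segment a i hs) @ e0 g (pend D Z (take i hs)) (segment i j hs) # us))
    (Cod C g) (pend D Z (take j hs)) (drop j hs)))"
  unfolding sh.simps cut_drop[OF Cons.prems]
 proof (intro sum.cong HOL.refl, goal_cases)
  case i: (1 i)
  have 1: "pend D (pend D Z (take a hs)) (segment a i hs) = pend D Z (take i hs)"
   using take_segment[of a i hs] i by (metis atLeastAtMost_iff pend_append)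
  have 2: "pend D (pend D Z (take i hs)) (segment i j hs) = pend D Z (take j hs)" if "i \<le> j" for j
   using take_segment[OF that, of hs] by (metis pend_append)
  show ?case
   unfolding 1 using i by (subst cut_drop) (auto intro!: sum.cong simp: 2)
 qed
 also have "\<dots> = (\<Sum>i\<in>{a..?N}. \<Sum>j\<in>{i..?N}. \<Sum>ps\<in>idx (length gs) j ?N. sgv (?F (g # gs) ((i, j) # ps))
   (phi (assoc_args K C D hs a Y (g # gs) ((i, j) # ps))))"
 proof (intro sum.cong HOL.refl, goal_cases)
  case ij: (1 i j)
  hence j: "j \<le> ?N" "i \<le> j" by auto
  show ?case
   unfolding Cons.IH[OF j(1)] sgv_sum sg assoc_args.simps assoc_head[OF p j(2,1)] by (simp add: sgv_sum)
 qed
 finally show ?case by (simp only: sum_idx length_Cons)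
qed

lemma assoc_args_path:
 assumes "path C Y gs" "path D Z hs" "hs \<noteq> []" "a \<le> length hs" "ps \<in> idx (length gs) a (length hs)"
 defines "us \<equiv> assoc_args K C D hs a Y gs ps"
 shows "path T (Y, pend D Z (take a hs)) us \<and> pend T (Y, pend D Z (take a hs)) us = (pend C Y gs, pend D Z hs)
  \<and> wt T us = wt C gs + wt D (drop a hs)"
 using assms(1,4,5) unfolding us_def
proof (induction gs arbitrary: Y a ps)
 case Nil
 hence "path D (pend D Z (take a hs)) (drop a hs)" "pend D (pend D Z (take a hs)) (drop a hs) = pend D Z hs"
  using D.path_take_drop(2)[OF assms(2)] by (simp_all add: pend_append[symmetric] del: pend_append)
 thus ?case using Nil r_path[of Y] r_pend[of Y] r_wt[of Y] by (simp add: idx_0)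
next
 case (Cons g gs)
 then obtain i j qs where ps: "ps = (i, j) # qs" "a \<le> i" "i \<le> j" "j \<le> length hs" "qs \<in> idx (length gs) j (length hs)"
  by (auto simp: idx_Suc)
 have 1: "pend D (pend D Z (take a hs)) (segment a i hs) = pend D Z (take i hs)"
  using take_segment[OF ps(2), of hs] by (metis pend_append)
 have 2: "pend D (pend D Z (take i hs)) (segment i j hs) = pend D Z (take j hs)"
  using take_segment[OF ps(3), of hs] by (metis pend_append)
 have 3: "segment a i hs @ segment i j hs @ drop j hs = drop a hs"
  using take_segment[OF ps(2), of hs] take_segment[OF ps(3), of hs] by (metis append_assoc append_take_drop_id same_append_eq)
 have pp: "path D (pend D Z (take a hs)) (segment a i hs @ segment i j hs @ drop j hs)"
  unfolding 3 by (rule D.path_take_drop(2)[OF assms(2)])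
 have e: "pend D (pend D Z (take j hs)) (drop j hs) = pend D Z hs" by (simp add: pend_append[symmetric] del: pend_append)
 have e': "pend D (pend D Z (take a hs)) (drop a hs) = pend D Z hs" by (simp add: pend_append[symmetric] del: pend_append)
 have IH: "path T (Cod C g, pend D Z (take j hs)) (assoc_args K C D hs j (Cod C g) gs qs) \<and>
   pend T (Cod C g, pend D Z (take j hs)) (assoc_args K C D hs j (Cod C g) gs qs) = (pend C (Cod C g) gs, pend D Z hs) \<and>
   wt T (assoc_args K C D hs j (Cod C g) gs qs) = wt C gs + wt D (drop j hs)"
  by (rule Cons.IH[OF _ ps(4,5)]) (use Cons.prems in simp)
 show ?case
  using sh_adm[OF Cons.prems(1) pp, unfolded 1 2 e, of "assoc_args K C D hs j (Cod C g) gs qs"] IH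
  unfolding ps(1) assoc_args.simps assoc_head[OF assms(2,3) ps(3,4)] 3 e' by simp
qed

end

lemma (in graded_category) emb_finsum:
 assumes "x \<in> Obj C" "y \<in> Obj C" "finite A" "\<And>i. i \<in> A ==> m i \<in> mor C x y n"
 shows "emb C (\<Oplus>\<^bsub>Mor C x y n\<^esub>i\<in>A. m i) = (\<Sum>i\<in>A. emb C (m i))"
proof -
 interpret M: module K "Mor C x y n" using assms by simp
 show ?thesis
  using assms(3,4)
 proof (induction A rule: finite_induct)
  case (insert i A)
  thus ?case
   using M.finsum_insert[of A i m] emb_add[OF assms(1,2), of "m i" n "\<Oplus>\<^bsub>Mor C x y n\<^esub>i\<in>A. m i"]
    M.finsum_closed[of m A] by (simp add: Pi_def)
 qed (simp add: emb_zero assms)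
qed

context tensor_triple
begin

lemma assocF_eqI:
 assumes u: "u \<in> arr SS.T" and m: "m \<in> arr B" "Deg B m = Deg SS.T u"
  "Dom B m = FObj assocF (Dom SS.T u)" "Cod B m = FObj assocF (Cod SS.T u)"
  and e: "emb B (FMor assocF u) = emb B m"
 shows "FMor assocF u = m"
proof -
 interpret A: dg_functor K SS.T B assocF by (rule assocF_functor)
 note a = A.fmor_arr[OF u]
 show ?thesis
  using TT.G.emb_inj[OF TT.G.arr_typed(1,2)[OF m(1)], of "FMor assocF u" _ m] TT.G.arr_typed(3)[OF a(1)] TT.G.arr_typed(3)[OF m(1)]
   a m e by simp
qed

lemma assocF_e0_r:
 assumes "X \<in> Obj C" "g \<in> arr D" "path E Z hs"
 shows "FMor assocF (SS.e0 (CD.r X g) Z hs) = TT.r X (DE.e0 g Z hs)"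
proof -
 note g = CD.r_arr[OF assms(1,2)] and e = DE.e0_arr[OF assms(2,3)]
 note t = SS.e0_arr[OF g(1) assms(3)] and r = TT.r_arr[OF assms(1) e(1)]
 show ?thesis
  by (rule assocF_eqI[OF t(1) r(1)])
   (use t r g e assms CD.D.arr_typed[OF assms(2)] DE.D.path_obj[OF assms(3)] DE.D.path_end[OF assms(3)]
    assocF_e0[of "TR X g" Z hs] in \<open>simp_all add: FObj_assocF TT.emb_r Rc_def\<close>,
    simp add: tright_def[of K C D] TT.emb_r)
qed

lemma assocF_r_r:
 assumes "X \<in> Obj C" "Y \<in> Obj D" "h \<in> arr E"
 shows "FMor assocF (SS.r (X, Y) h) = TT.r X (DE.r Y h)"
proof -
 have o: "(X, Y) \<in> Obj CD.T" using assms by simp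
 note t = SS.r_arr[OF o assms(3)] and e = DE.r_arr[OF assms(2,3)]
 note r = TT.r_arr[OF assms(1) e(1)]
 show ?thesis
  by (rule assocF_eqI[OF t(1) r(1)])
   (use t r e assms assocF_r[OF assms] DE.D.arr_typed[OF assms(3)] in "simp_all add: FObj_assocF TT.emb_r")
qed

lemma assocF_e0_e0:
 assumes "f \<in> arr C" "path D Y gs" "path E Z hs"
 shows "emb B (FMor assocF (SS.e0 (CD.e0 f Y gs) Z hs)) = DE.sf gs (TT.Lu f (Y, Z)) Y Z hs"
 using assocF_e0[OF CD.TE0_typed(1)[OF assms(1,2)] assms(3)] I.ip_TE0[OF assms(2)] assms
 by (simp add: eps0_def[of K C D] Lc_def W.shc_def)

lemma assocF_e0_e0_eqI:
 assumes "f \<in> arr C" "path D Y gs" "path E Z hs" "m \<in> mor B (Dom C f, Y, Z) (Cod C f, pend D Y gs, pend E Z hs)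
  (Deg C f + wt D gs + wt E hs)" "DE.sf gs (TT.Lu f (Y, Z)) Y Z hs = emb B m"
 shows "FMor assocF (SS.e0 (CD.e0 f Y gs) Z hs) = m"
proof -
 note g = CD.e0_arr[OF assms(1,2)]
 note t = SS.e0_arr[OF g(1) assms(3)]
 have o: "(Dom C f, Y, Z) \<in> Obj B" "(Cod C f, pend D Y gs, pend E Z hs) \<in> Obj B"
  using CD.C.arr_typed[OF assms(1)] CD.D.path_obj[OF assms(2)] CD.D.path_end[OF assms(2)] DE.D.path_obj[OF assms(3)]
   DE.D.path_end[OF assms(3)] by simp_all
 note m = TT.G.arrI[OF o assms(4)] TT.G.mor_DCD[OF o assms(4)]
 show ?thesis
  by (rule assocF_eqI[OF t(1) m(1)]) (use assocF_e0_e0[OF assms(1-3)] assms(5) t g m o in "simp_all add: FObj_assocF")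
qed

lemma sh_Nil: "DE.sf gs phi Y Z [] = phi (map (\<lambda>g. DE.e0 g Z []) gs)"
 by (induction gs arbitrary: phi Y) simp_all

lemma path_e0_Nil:
 assumes "path D Y gs" "Z \<in> Obj E"
 shows "path DE.T (Y, Z) (map (\<lambda>g. DE.e0 g Z []) gs)
  \<and> pend DE.T (Y, Z) (map (\<lambda>g. DE.e0 g Z []) gs) = (pend D Y gs, Z)
  \<and> wt DE.T (map (\<lambda>g. DE.e0 g Z []) gs) = wt D gs"
 using assms(1)
proof (induction gs arbitrary: Y)
 case (Cons g gs)
 thus ?case using DE.e0_arr[of g Z "[]"] assms(2) Cons.IH[of "Cod D g"] by simp
qed (use assms(2) in simp)

text \<open>Compares the shuffle sum with the sum in the module record after \<open>emb\<close>,
  which turns \<open>finsum\<close> into an ordinary sum and scalar signs into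
  \<open>sgv\<close>.\<close>

lemma assocF_finsum:
 assumes f: "f \<in> arr C" and pd: "path D Y gs" and pe: "path E Z hs" and ne: "gs \<noteq> []" "hs \<noteq> []"
 defines "M \<equiv> Mor B (Dom C f, Y, Z) (Cod C f, pend D Y gs, pend E Z hs) (Deg C f + wt D gs + wt E hs)"
 shows "FMor assocF (SS.e0 (CD.e0 f Y gs) Z hs) = (\<Oplus>\<^bsub>M\<^esub>ps\<in>assoc_index (length gs) (length hs).
  assoc_sign K D E gs hs ps \<odot>\<^bsub>M\<^esub> teps K C DE.T f (assoc_args K D E hs 0 Y gs ps))"
proof -
 let ?a = "\<lambda>ps. assoc_args K D E hs 0 Y gs ps"
 let ?s = "\<lambda>ps. \<Sum>l<length gs. (Deg D (gs ! l) - 1) * wt E (drop (snd (ps ! l)) hs)"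
 have o: "(Dom C f, Y, Z) \<in> Obj B" "(Cod C f, pend D Y gs, pend E Z hs) \<in> Obj B"
  using CD.C.arr_typed[OF f] CD.D.path_obj[OF pd] CD.D.path_end[OF pd] DE.D.path_obj[OF pe] DE.D.path_end[OF pe] by simp_all
 interpret M: module K M unfolding M_def by (rule TT.T_module[OF o])
 have m: "teps K C DE.T f (?a ps) \<in> carrier M"
  "emb B (assoc_sign K D E gs hs ps \<odot>\<^bsub>M\<^esub> teps K C DE.T f (?a ps)) = sgv (?s ps) (TT.Lu f (Y, Z) (?a ps))"
  if ps: "ps \<in> idx (length gs) 0 (length hs)" for ps
 proof -
  note a = DE.assoc_args_path[OF pd pe ne(2) _ ps, simplified]
  \<comment> \<open>The list of arguments is not empty because \<open>gs\<close> is not, so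
    \<open>teps\<close> and \<open>e0\<close> agree on it.\<close>
  obtain k where "length gs = Suc k" using ne(1) by (cases gs) auto
  then obtain i j qs where "ps = (i, j) # qs" using ps by (auto simp: idx_Suc)
  hence "?a ps \<noteq> []" using ne(1) by (cases gs) simp_all
  hence t: "teps K C DE.T f (?a ps) = TT.e0 f (Y, Z) (?a ps)" by (simp add: teps_def eps0_def TE0_def)
  show c: "teps K C DE.T f (?a ps) \<in> carrier M"
   unfolding t M_def using TT.e0_mor[OF f, of "(Y, Z)" "?a ps"] a by (simp add: add.assoc)
  show "emb B (assoc_sign K D E gs hs ps \<odot>\<^bsub>M\<^esub> teps K C DE.T f (?a ps)) = sgv (?s ps) (TT.Lu f (Y, Z) (?a ps))"
   using TT.G.rsc_emb[OF o CD.sg_closed c[unfolded M_def], of "?s ps"] TT.V.sc_sg[OF TT.G.rH_I[OF o c[unfolded M_def]], of "?s ps"]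
    TT.emb_e0[of "(Y, Z)" "?a ps" f] a
   by (simp add: t M_def assoc_sign_def)
 qed
 have sc: "assoc_sign K D E gs hs ps \<odot>\<^bsub>M\<^esub> teps K C DE.T f (?a ps) \<in> carrier M"
  if "ps \<in> idx (length gs) 0 (length hs)" for ps
  using m(1)[OF that] by (simp add: assoc_sign_def CD.sg_closed)
 show ?thesis
  unfolding idx_assoc
 proof (rule assocF_e0_e0_eqI[OF f pd pe])
  show "(\<Oplus>\<^bsub>M\<^esub>ps\<in>idx (length gs) 0 (length hs). assoc_sign K D E gs hs ps \<odot>\<^bsub>M\<^esub> teps K C DE.T f (?a ps))
   \<in> mor B (Dom C f, Y, Z) (Cod C f, pend D Y gs, pend E Z hs) (Deg C f + wt D gs + wt E hs)"
   unfolding M_def[symmetric] by (rule M.finsum_closed) (use sc in auto)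
  show "DE.sf gs (TT.Lu f (Y, Z)) Y Z hs = emb B (\<Oplus>\<^bsub>M\<^esub>ps\<in>idx (length gs) 0 (length hs).
    assoc_sign K D E gs hs ps \<odot>\<^bsub>M\<^esub> teps K C DE.T f (?a ps))"
   using DE.sh_assoc[OF pe ne(2), of 0 gs "TT.Lu f (Y, Z)" Y]
    TT.G.emb_finsum[OF o finite_idx sc[unfolded M_def], folded M_def, of "length gs" 0 "length hs"]
   by (simp add: m(2))
 qed
qed

lemma eps_simps: "tleft K C D f Y = CD.e0 f Y []" "tleft K D E g Z = DE.e0 g Z []"
 "tleft K C DE.T f y = TT.e0 f y []" "tleft K CD.T E u Z = SS.e0 u Z []"
 "gs \<noteq> [] ==> teps K C D f gs = CD.e0 f Y gs" "hs \<noteq> [] ==> teps K D E g hs = DE.e0 g Z hs"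
 "us \<noteq> [] ==> teps K C DE.T f us = TT.e0 f y us" "hs \<noteq> [] ==> teps K CD.T E u hs = SS.e0 u Z hs"
 by (simp_all add: tleft_def teps_def eps0_def TE0_def)

lemma assocF_associator: "associator K C D E assocF"
 unfolding associator_def Let_def
proof (intro conjI ballI allI impI assocF_functor FObj_assocF)
 fix f Y Z assume f: "f \<in> arr C" "Y \<in> Obj D" "Z \<in> Obj E"
 thus "FMor assocF (tleft K CD.T E (tleft K C D f Y) Z) = tleft K C DE.T f (Y, Z)"
  unfolding eps_simps using TT.e0_mor[of f "(Y, Z)" "[]"] by (intro assocF_e0_e0_eqI) (simp_all add: TT.emb_e0)
next
 fix X g Z assume "X \<in> Obj C" "g \<in> arr D" "Z \<in> Obj E"
 thus "FMor assocF (tleft K CD.T E (tright K C D X g) Z) = tright K C DE.T X (tleft K D E g Z)"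
  unfolding eps_simps by (intro assocF_e0_r) simp_all
next
 fix X Y h assume "X \<in> Obj C" "Y \<in> Obj D" "h \<in> arr E"
 thus "FMor assocF (tright K CD.T E (X, Y) h) = tright K C DE.T X (tright K D E Y h)"
  by (rule assocF_r_r)
next
 fix f gs Z assume f: "f \<in> arr C" "Z \<in> Obj E" "chain D gs"
 hence p: "path D (Dom D (hd gs)) gs" "gs \<noteq> []" by (simp_all add: CD.D.chain_path)
 note q = path_e0_Nil[OF p(1) f(2)]
 have ne: "map (\<lambda>g. DE.e0 g Z []) gs \<noteq> []" using p(2) by simp
 show "FMor assocF (tleft K CD.T E (teps K C D f gs) Z) = teps K C DE.T f (map (\<lambda>g. tleft K D E g Z) gs)"
  unfolding eps_simps(1-4) eps_simps(5)[OF p(2), of f "Dom D (hd gs)"]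
   eps_simps(7)[OF ne, of f "(Dom D (hd gs), Z)"]
  by (rule assocF_e0_e0_eqI) (use f p q TT.e0_mor[OF f(1) conjunct1[OF q]] in "simp_all add: sh_Nil TT.emb_e0")
next
 fix f Y hs assume f: "f \<in> arr C" "Y \<in> Obj D" "chain E hs"
 hence p: "path E (Dom E (hd hs)) hs" "hs \<noteq> []" by (simp_all add: DE.D.chain_path)
 have ne: "map (DE.r Y) hs \<noteq> []" using p(2) by simp
 note q = DE.r_path[OF f(2) p(1)] DE.r_pend[OF f(2) p(1)] DE.r_wt[OF f(2) p(1)]
 show "FMor assocF (teps K CD.T E (tleft K C D f Y) hs) = teps K C DE.T f (map (tright K D E Y) hs)"
  unfolding eps_simps(1-4) eps_simps(8)[OF p(2), of _ "Dom E (hd hs)"] eps_simps(7)[OF ne, of f "(Y, Dom E (hd hs))"]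
  by (rule assocF_e0_e0_eqI) (use f p q TT.e0_mor[OF f(1) q(1)] in "simp_all add: TT.emb_e0")
next
 fix X g hs assume f: "X \<in> Obj C" "g \<in> arr D" "chain E hs"
 hence p: "path E (Dom E (hd hs)) hs" "hs \<noteq> []" by (simp_all add: DE.D.chain_path)
 show "FMor assocF (teps K CD.T E (tright K C D X g) hs) = tright K C DE.T X (teps K D E g hs)"
  unfolding eps_simps(6,8)[OF p(2), of _ "Dom E (hd hs)"] by (rule assocF_e0_r[OF f(1,2) p(1)])
next
 fix f gs hs assume f: "f \<in> arr C" "chain D gs" "chain E hs"
 hence p: "path D (Dom D (hd gs)) gs" "gs \<noteq> []" "path E (Dom E (hd hs)) hs" "hs \<noteq> []"
  by (simp_all add: CD.D.chain_path DE.D.chain_path)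
 show "FMor assocF (teps K CD.T E (teps K C D f gs) hs) =
   (\<Oplus>\<^bsub>Mor B (Dom C f, Dom D (hd gs), Dom E (hd hs)) (Cod C f, Cod D (last gs), Cod E (last hs))
    (Deg C f + wt D gs + wt E hs)\<^esub>ps\<in>assoc_index (length gs) (length hs).
    assoc_sign K D E gs hs ps
    \<odot>\<^bsub>Mor B (Dom C f, Dom D (hd gs), Dom E (hd hs)) (Cod C f, Cod D (last gs), Cod E (last hs)) (Deg C f + wt D gs + wt E hs)\<^esub>
    teps K C DE.T f (assoc_args K D E hs 0 (Dom D (hd gs)) gs ps))"
  unfolding eps_simps(5)[OF p(2), of f "Dom D (hd gs)"] eps_simps(8)[OF p(4), of _ "Dom E (hd hs)"]
  using assocF_finsum[OF f(1) p(1,3,2,4)] by (simp only: pend_last[OF p(2)] pend_last[OF p(4)])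
qed

text \<open>The clauses of \<open>associator\<close> cover all generators of
  \<open>functor_eqI3\<close>, according to which of \<open>gs\<close> and \<open>hs\<close> are
  empty.\<close>

lemma associator_unique:
 assumes "associator K C D E alpha" "associator K C D E \<beta>"
 shows "alpha = \<beta>"
proof (rule functor_eqI3, goal_cases)
 show "dg_functor K SS.T B alpha" "dg_functor K SS.T B \<beta>"
  using assms by (simp_all add: associator_def Let_def)
 show "FObj alpha x = FObj \<beta> x" if "x \<in> Obj SS.T" for x
  using that assms by (auto simp: associator_def Let_def)
next
 case (4 f Y gs Z hs) note f = 4(1) and p = 4(2-3)
 have o: "Y \<in> Obj D" "Z \<in> Obj E" using CD.D.path_obj[OF p(1)] DE.D.path_obj[OF p(2)] .
 show ?case
 proof (cases "gs = []"; cases "hs = []")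
  assume "gs = []" "hs = []"
  thus ?thesis using assms f o by (simp add: associator_def Let_def eps_simps(1,4)[symmetric])
 next
  assume *: "gs = []" "hs \<noteq> []"
  thus ?thesis using assms f o DE.D.path_chain[OF p(2)]
   by (simp add: associator_def Let_def eps_simps(1)[symmetric] eps_simps(8)[symmetric])
 next
  assume *: "gs \<noteq> []" "hs = []"
  thus ?thesis using assms f o CD.D.path_chain[OF p(1)]
   by (simp add: associator_def Let_def eps_simps(4)[symmetric] eps_simps(5)[symmetric])
 next
  assume *: "gs \<noteq> []" "hs \<noteq> []"
  thus ?thesis using assms f o CD.D.path_chain[OF p(1)] DE.D.path_chain[OF p(2)]
   by (simp add: associator_def Let_def eps_simps(8)[symmetric] eps_simps(5)[symmetric])
 qed
next
 case (5 X g Z hs) note f = 5(1-2) and p = 5(3)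
 show ?case
 proof (cases "hs = []")
  case True
  thus ?thesis using assms f p by (simp add: associator_def Let_def eps_simps(4)[symmetric])
 next
  case False
  thus ?thesis using assms f DE.D.path_chain[OF p] by (simp add: associator_def Let_def eps_simps(8)[symmetric])
 qed
next
 case (6 X Y h)
 thus ?case using assms by (simp add: associator_def Let_def)
qed

end

section \<open>Functoriality of the twisted tensor product\<close>

locale tensor_fun = X: tensor_pair K C D + X': tensor_pair K C' D' + F: dg_functor K C C' F + G: dg_functor K D D' G
 for K :: "'k ring" and C :: "('k, 'c, 'f) dgcat" and D :: "('k, 'd, 'g) dgcat"
  and C' :: "('k, 'c1, 'f1) dgcat" and D' :: "('k, 'd1, 'g1) dgcat" and F G
begin

lemma G_path: "path D d gs ==> path D' (FObj G d) (map (FMor G) gs)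
  \<and> pend D' (FObj G d) (map (FMor G) gs) = FObj G (pend D d gs) \<and> wt D' (map (FMor G) gs) = wt D gs"
 by (induction gs arbitrary: d) (auto simp: G.fobj_closed G.fmor_arr)

text \<open>Pullback of cochains along \<open>G\<close>. It commutes with products, twisting
  cochains and all parts of the differential.\<close>

definition pb :: "('d1 => 'g1 list => 'v :: ab_group_add) => 'd => 'g list => 'v" where
 "pb phi d gs = (if path D d gs then phi (FObj G d) (map (FMor G) gs) else 0)"

lemma pb_mulc: "pb (mulc D' mul p psi phi) = mulc D mul p (pb psi) (pb phi)"
proof (intro ext, goal_cases)
 case (1 d gs)
 show ?case
 proof (cases "path D d gs")
  case True
  have "cut (\<lambda>as bs. sgv (p * wt D' (map (FMor G) bs)) (mul (p + wt D' (map (FMor G) as))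
    (psi (pend D' (FObj G d) (map (FMor G) as)) (map (FMor G) bs)) (phi (FObj G d) (map (FMor G) as)))) gs
   = cut (\<lambda>as bs. sgv (p * wt D bs) (mul (p + wt D as) (pb psi (pend D d as) bs) (pb phi d as))) gs"
  proof (rule cut_cong, goal_cases)
   case (1 as bs)
   hence "path D d as" "path D (pend D d as) bs" using True by auto
   thus ?case
    using G_path[of d as] G_path[of "pend D d as" bs] by (simp add: pb_def)
  qed
  thus ?thesis using True G_path[OF True] by (simp add: pb_def mulc_def cut_map)
 qed (simp add: pb_def mulc_def)
qed

lemma pb_rho: "pb (rho D' R) = rho D (\<lambda>g. R (FMor G g))"
 using G_path by (intro ext) (auto simp: pb_def rho_def length_Suc_conv)

lemma bd_map: "path D d gs ==> bd D' phi (map (FMor G) gs) = bd D (\<lambda>xs. phi (map (FMor G) xs)) gs"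
proof (induction gs arbitrary: d phi)
 case (Cons g gs)
 hence g: "g \<in> arr D" "path D (Cod D g) gs" by auto
 have "FMor G (Comp D g' g) = Comp D' (FMor G g') (FMor G g)" if "gs = g' # gs'" for g' gs'
  using G.fmor_comp[OF g(1)] g(2) that by simp
 moreover have w: "wt D' (map (FMor G) gs) = wt D gs" using G_path[OF g(2)] by simp
 ultimately show ?case
  unfolding list.map bd.simps w Cons.IH[OF g(2), of "\<lambda>xs. phi (FMor G g # xs)"] G.fmor_dif[OF g(1)]
  by (cases gs) simp_all
qed simp

lemma pb_bdc: "pb (bdc D' phi) = bdc D (pb phi)"
proof (intro ext, goal_cases)
 case (1 d gs)
 show ?case
 proof (cases "path D d gs")
  case True
  have "bd D (\<lambda>xs. phi (FObj G d) (map (FMor G) xs)) gs = bd D (pb phi d) gs"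
   by (rule X.D.bd_cong[OF True]) (simp add: pb_def)
  thus ?thesis using True G_path[OF True] bd_map[OF True, of "phi (FObj G d)"] by (simp add: pb_def bdc_def)
 qed (simp add: pb_def bdc_def)
qed

lemma pb_ddc:
 assumes "\<And>d. d \<in> Obj D ==> Ph' d = Ph (FObj G d)" "\<And>d. d \<in> Obj D ==> Ps' d = Ps (FObj G d)"
 shows "pb (ddc D' dif Ph Ps p phi) = ddc D dif Ph' Ps' p (pb phi)"
proof (intro ext, goal_cases)
 case (1 d gs)
 show ?case
  using G_path[of d gs] X.D.path_obj[of d gs] X.D.path_end[of d gs] assms by (simp add: pb_def ddc_def)
qed

abbreviation "T' \<equiv> ttensor K C' D'"

definition obf where "obf c d = (FObj F c, FObj G d)"
definition Rf where "Rf c g = X'.Ru (FObj F c) (FMor G g)"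
definition Lf where "Lf f = pb (X'.Lu (FMor F f))"

lemma lincomb:
 assumes "dg_functor K A A' P" "u \<in> Obj A" "v \<in> Obj A" "x \<in> mor A u v n" "y \<in> mor A u v n" "a \<in> carrier K" "b \<in> carrier K"
 defines "M \<equiv> Mor A' (FObj P u) (FObj P v) n"
 shows "FMor P (lc A u v n a x b y) = a \<odot>\<^bsub>M\<^esub> FMor P x \<oplus>\<^bsub>M\<^esub> b \<odot>\<^bsub>M\<^esub> FMor P y"
proof -
 interpret P: dg_functor K A A' P by fact
 interpret N: module K "Mor A u v n" using assms by (simp add: P.A.mor_module)
 show ?thesis using assms(2-7) by (simp add: P.fmor_add P.fmor_smult M_def)
qed

lemma R_coch: "coch K D (Obj T') (rH T') (rsc T') (\<lambda>_. rmul T') (\<lambda>x. emb T' (Idn T' x)) (Obj C) obf Rf"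
proof (intro coch.intro coch_axioms.intro coch_base.intro X.D.dg_category_axioms X'.V.vgc_axioms, goal_cases)
 case that: (1 y d) show ?case
  using that by (simp add: obf_def F.fobj_closed G.fobj_closed)
 next case that: (2 y g) show ?case
  using X'.Ru_H[OF F.fobj_closed[OF that(1)] G.fmor_arr(1)[OF that(2)]] G.fmor_arr[OF that(2)] by (simp add: Rf_def obf_def)
 next case that: (3 y u v g n g' a b) show ?case
  unfolding Rf_def lincomb[OF G.dg_functor_axioms that(2-7)]
  by (rule X'.N.R_lin) (use that in "simp_all add: F.fobj_closed G.fobj_closed G.fmor_closed")
 next case that: (4 y g g') show ?case
  unfolding Rf_def G.fmor_comp[OF that(2-4)]
  by (rule X'.N.R_comp) (use that in "simp_all add: F.fobj_closed G.fmor_arr")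
 next case that: (5 y d) show ?case
  using that X'.N.R_id[of "FObj F y" "FObj G d"] by (simp add: Rf_def obf_def G.fmor_idn F.fobj_closed G.fobj_closed)
qed

lemma Lf_H:
 assumes "x \<in> Obj C" "y \<in> Obj C" "f \<in> mor C x y n"
 shows "Lf f \<in> cochs D (rH T') (obf x) (obf y) n"
proof -
 interpret Y: coch K D "Obj T'" "rH T'" "rsc T'" "\<lambda>_. rmul T'" "\<lambda>x. emb T' (Idn T' x)" "Obj C" obf Rf by (rule R_coch)
 note L = X'.Lu_H'[OF F.fobj_closed[OF assms(1)] F.fobj_closed[OF assms(2)] F.fmor_closed[OF assms]]
 show ?thesis
 proof (rule Y.cochsI, goal_cases)
  case p: (1 d gs)
  thus ?case
   using X'.N.cochsD[OF L conjunct1[OF G_path[OF p]]] G_path[OF p] by (simp add: Lf_def pb_def obf_def)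
 qed (simp add: Lf_def pb_def)
qed

text \<open>The data that induce the tensor product of \<open>F\<close> and \<open>G\<close>: the
  universal cochains and functors of the target, pulled back along \<open>G\<close>.\<close>

lemma R_up: "up K C D (Obj T') (rH T') (rsc T') (\<lambda>_. rmul T') (\<lambda>x. emb T' (Idn T' x)) obf Rf Lf"
proof (intro up.intro up_axioms.intro X.tensor_pair_axioms R_coch Lf_H)
 fix x y f n assume *: "x \<in> Obj C" "y \<in> Obj C" "f \<in> mor C x y n"
 note o = F.fobj_closed[OF *(1)] F.fobj_closed[OF *(2)] F.fmor_closed[OF *]
 { fix f' assume "f' \<in> mor C x y n"
  thus "Lf (madd C x y n f f') = Lf f + Lf f'"
   using X'.Lu_add[OF o] * by (intro ext) (simp add: Lf_def F.fmor_add F.fmor_closed pb_def) }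
 { fix a assume a: "a \<in> carrier K"
  show "Lf (mscale C x y n a f) = scc (rsc T') a (Lf f)"
   using X'.Lu_scale[OF o a] * a X'.V.sc_zero by (intro ext) (simp add: Lf_def F.fmor_smult pb_def scc_def) }
next
 fix f1 f2 assume "f1 \<in> arr C" "f2 \<in> arr C" "Cod C f1 = Dom C f2"
 thus "Lf (Comp C f2 f1) = mulc D (\<lambda>_. rmul T') (Deg C f1) (Lf f2) (Lf f1)"
  by (simp add: Lf_def F.fmor_comp X'.Lu_comp F.fmor_arr pb_mulc)
next
 fix c assume c: "c \<in> Obj C"
 show "Lf (Idn C c) = idc D (\<lambda>x. emb T' (Idn T' x)) (obf c)"
  using X'.Lu_id[OF F.fobj_closed[OF c]] X.D.path_obj G.fobj_closed c
  by (intro ext) (auto simp: Lf_def pb_def F.fmor_idn idc_def obf_def)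
next
 fix f assume f: "f \<in> arr C"
 note f' = F.fmor_arr(1)[OF f]
 show "linc K D (rsc T') (Lf f)"
  unfolding linc_def ling_def
 proof (intro allI impI, goal_cases)
  case (1 d as bs x y u v n a b)    note * = 1(1-6) and p = 1(7)
  let ?z = "lc D u v n a x b y"
  interpret N: module K "Mor D u v n" using * by (simp add: X.D.mor_module)
  have z: "?z \<in> mor D u v n" using * by simp
  have q: "path D d (as @ ?z # bs)" "path D d (as @ y # bs)"
   using X.N.mor_par(1)[OF *(1,2) z *(3), of d as bs] X.N.mor_par(1)[OF *(1-4), of d as bs] p by blast+
  have "path D' (FObj G d) (map (FMor G) as @ FMor G x # map (FMor G) bs)"
   using G_path[OF p] by simp
  hence "X'.Lu (FMor F f) (FObj G d) (map (FMor G) as @ FMor G ?z # map (FMor G) bs)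
   = rsc T' a (X'.Lu (FMor F f) (FObj G d) (map (FMor G) as @ FMor G x # map (FMor G) bs))
   + rsc T' b (X'.Lu (FMor F f) (FObj G d) (map (FMor G) as @ FMor G y # map (FMor G) bs))"
   unfolding lincomb[OF G.dg_functor_axioms *]
   by (intro X'.Lu_lin[OF f', unfolded linc_def ling_def, rule_format] G.fobj_closed G.fmor_closed *)
  thus ?case
   using p q by (simp add: Lf_def pb_def del: X.D.path_append)
 qed
 show "redc D (Lf f)"
  unfolding redc_def
 proof (intro allI impI, goal_cases)
  case (1 d as bs c)    note c = 1(1) and p = 1(2)
  show ?case
   using X'.Lu_red[OF f'] G_path[OF p] p G.fobj_closed[OF c] G.fmor_idn[OF c] unfolding redc_def Lf_def pb_def by simp
 qed
qed

sublocale U: up_real K C D T' obf Rf Lf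
proof (intro up_real.intro up_dg.intro up_dg_axioms.intro R_up X'.V.vdg_axioms X'.T_dg, goal_cases)
 case *: (1 x y f n)
 note o = F.fobj_closed[OF *(1)] F.fobj_closed[OF *(2)] F.fmor_closed[OF *]
 have add: "pb (phi + psi) = pb phi + pb psi" "pb (phi - psi) = pb phi - pb psi" "pb (sgv m phi) = sgv m (pb phi)"
  for phi psi :: "'d1 => 'g1 list => ('c1 \<times> 'd1, ('k, 'c1, 'f1, 'd1, 'g1) tterm set) dual" and m
  by (intro ext; simp add: pb_def sgv_fun)+
 have R: "(\<lambda>g. X'.Ru (FObj F z) (FMor G g)) = Rf z" for z by (intro ext) (simp add: Rf_def)
 have "Lf (Dif C f) = pb (X'.N.df (FObj F x) (FObj F y) n (X'.Lu (FMor F f)))"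
  unfolding X'.df_Lu[OF o] Lf_def F.fmor_dif[OF X.C.arrI[OF *]] ..
 also have "\<dots> = difc D (\<lambda>_. rmul T') (\<lambda>_ _ _. rdif T') (obf x) (obf y) (Rf x) (Rf y) n (Lf f)"
  unfolding difc_def dlc_def add pb_mulc pb_rho pb_bdc R Lf_def
  by (subst pb_ddc[where Ph' = "obf x" and Ps' = "obf y"]) (simp_all add: obf_def)
 finally show ?case .
next
 case (2 c g)
 thus ?case
  by (simp add: Rf_def G.fmor_dif X'.rdif_Ru F.fobj_closed G.fmor_arr)
qed

abbreviation "mt \<equiv> map_tterm id (FObj F) (FMor F) (FObj G) (FMor G)"
abbreviation "tf \<equiv> ttensor_fun K C D C' D' F G"

text \<open>Renaming the generators of an expression realizes its interpretation in the pulled-back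
  data. Hence renaming respects the relations, and \<open>ttensor_fun\<close> inherits functoriality
  from \<open>upF\<close>.\<close>

lemma mt_ip: "twf K C D t ==> twf K C' D' (mt t) \<and> tdom C' D' (mt t) = map_prod (FObj F) (FObj G) (tdom C D t)
  \<and> tcod C' D' (mt t) = map_prod (FObj F) (FObj G) (tcod C D t) \<and> tdeg C' D' (mt t) = tdeg C D t \<and> X'.ev (mt t) = U.ip t"
proof (induction t)
 case (TZero x y n)
 thus ?case by (auto simp: F.fobj_closed G.fobj_closed X'.ev_zero)
next
 case (TId x)
 thus ?case by (auto simp: F.fobj_closed G.fobj_closed X'.ev_id obf_def)
next
 case (TL f d)
 thus ?case by (simp add: F.fmor_arr G.fobj_closed Lf_def pb_def X'.Lu_def TE0_def)
next
 case (TR c g)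
 thus ?case by (simp add: G.fmor_arr F.fobj_closed Rf_def X'.Ru_def)
next
 case (TE f gs)
 hence p: "path D (Dom D (hd gs)) gs" "gs \<noteq> []" "f \<in> arr C" by (auto simp: X.D.chain_path)
 have g: "hd gs \<in> arr D" "last gs \<in> arr D" using X.D.path_arr[OF p(1)] p(2) by auto
 show ?case
  using p G_path[OF p(1)] g X'.D.path_chain[of _ "map (FMor G) gs"]
  by (auto simp: F.fmor_arr G.fmor_arr hd_map last_map Lf_def pb_def X'.Lu_def TE0_def)
next
 case (TAdd s t)
 thus ?case by (auto simp: tpar_def X'.ev_add)
next
 case (TScale a t)
 thus ?case by (auto simp: X'.ev_scale)
next
 case (TComp s t)
 thus ?case by (auto simp: X'.ev_comp)
qed

lemma tf_cls:
 assumes t: "twf K C D t"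
 shows "FMor tf (tcls K C D t) = tcls K C' D' (mt t)"
proof -
 have "tcls K C' D' (mt s) = tcls K C' D' (mt t)" if r: "trel K C D t s" for s
 proof -
  have "twf K C D s" "tpar C D t s" using X.trel_typed[OF r] by auto
  thus ?thesis
   using mt_ip[OF t] mt_ip[of s] U.ip_rel[OF r] by (intro X'.cls_eqI X'.ev_inj) (simp_all add: tpar_def)
 qed
 thus ?thesis
  using X.cls_arr[OF t] X.cls_Union[OF t, of "\<lambda>t. tcls K C' D' (mt t)"] by (simp add: ttensor_fun_def)
qed

lemma tf_functor: "dg_functor K (ttensor K C D) T' tf"
proof -
 have "FMor tf A = FMor U.upF A" for A
 proof (cases "A \<in> arr (ttensor K C D)")
  case True
  then obtain t where t: "A = tcls K C D t" "twf K C D t" unfolding X.arr_T by blast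
  note m = mt_ip[OF t(2)] and u = U.upF_cls[OF t(2)] and o = U.ip_ob[OF t(2)]
  have "tcls K C' D' (mt t) = FMor U.upF (tcls K C D t)"
   by (rule X'.G.emb_inj[OF o _ u(1)])
    (use m u(2) X'.cls_mor'[of "mt t"] in \<open>simp_all add: obf_def X'.ev_def map_prod_def split_beta\<close>)
  thus ?thesis by (simp add: t tf_cls)
 qed (simp add: ttensor_fun_def U.upF_def)
 moreover have "FObj tf = FObj U.upF"
  by (intro ext) (auto simp: ttensor_fun_def U.upF_def obf_def restrict_def)
 ultimately have "tf = U.upF" by (intro dgfun.equality ext) simp_all
 thus ?thesis using U.upF_functor by simp
qed

lemma FObj_tf: "c \<in> Obj C ==> d \<in> Obj D ==> FObj tf (c, d) = (FObj F c, FObj G d)"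
 by (simp add: ttensor_fun_def)

lemma tf_e0:
 assumes "f \<in> arr C" "path D d gs"
 shows "FMor tf (X.e0 f d gs) = X'.e0 (FMor F f) (FObj G d) (map (FMor G) gs)"
proof -
 have "mt (TE0 f gs (pend D d gs) :: ('k, 'c, 'f, 'd, 'g) tterm) = TE0 (FMor F f) (map (FMor G) gs) (pend D' (FObj G d) (map (FMor G) gs))"
  using G_path[OF assms(2)] by (simp add: TE0_def)
 thus ?thesis using tf_cls[OF X.TE0_typed(1)[OF assms]] by (simp add: eps0_def)
qed

lemma tf_r: "c \<in> Obj C ==> g \<in> arr D ==> FMor tf (X.r c g) = X'.r (FObj F c) (FMor G g)"
 using tf_cls[of "TR c g"] by (simp add: tright_def)

text \<open>Shuffled lists are formed from epsilons and single letters, and both are natural in the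
  two categories.\<close>

lemma sh_tf:
 "path C c fs ==> path D d gs ==> X.sf fs (\<lambda>us. psi (map (FMor tf) us)) c d gs
  = X'.sf (map (FMor F) fs) psi (FObj F c) (FObj G d) (map (FMor G) gs)"
proof (induction fs arbitrary: psi c d gs)
 case Nil
 have "map (FMor tf) (map (X.r c) gs) = map (X'.r (FObj F c)) (map (FMor G) gs)"
  using Nil X.D.path_arr[OF Nil(2)] by (auto simp: tf_r)
 thus ?case by (simp only: sh.simps list.map)
next
 case (Cons f fs)
 hence f: "f \<in> arr C" "Dom C f = c" "path C (Cod C f) fs" by auto
 have c: "c \<in> Obj C" using X.C.arr_typed[OF f(1)] f(2) by simp
 show ?case
  unfolding list.map sh.simps cut_map
 proof (intro cut_cong, goal_cases)
  case s: (1 h1 r' h2 h3)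
  have p: "path D d h1" "path D (pend D d h1) h2" "path D (pend D (pend D d h1) h2) h3" using Cons.prems(2) s by auto
  have e: "map (FMor tf) (map (X.r c) h1 @ X.e0 f (pend D d h1) h2 # us)
   = map (X'.r (FObj F c)) (map (FMor G) h1) @ X'.e0 (FMor F f) (FObj G (pend D d h1)) (map (FMor G) h2) # map (FMor tf) us" for us
   using X.D.path_arr[OF p(1)] by (auto simp: tf_r[OF c] tf_e0[OF f(1) p(2)])
  show ?case
   unfolding e using Cons.IH[OF f(3) p(3), of "\<lambda>us. psi (map (X'.r (FObj F c)) (map (FMor G) h1) @
     X'.e0 (FMor F f) (FObj G (pend D d h1)) (map (FMor G) h2) # us)"]
    G_path[OF p(1)] G_path[OF p(2)] G_path[OF p(3)] F.fmor_arr[OF f(1)] by simp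
 qed
qed

end

text \<open>By \<open>functor_eqI3\<close> generators suffice. On nested epsilons both sides are
  shuffles of the universal cochain of the image of \<open>f\<close>, by \<open>sh_hom\<close> and
  \<open>sh_tf\<close>; on the other generators both are given by explicit values.\<close>

lemma associator_natural:
 assumes "dg_functor K C C' F" "dg_functor K D D' G" "dg_functor K E E' H"
 shows "dgfun_comp (ttensor K (ttensor K C D) E)
   (ttensor_fun K C (ttensor K D E) C' (ttensor K D' E') F (ttensor_fun K D E D' E' G H)) (tensor_triple.assocF K C D E)
  = dgfun_comp (ttensor K (ttensor K C D) E) (tensor_triple.assocF K C' D' E')
    (ttensor_fun K (ttensor K C D) E (ttensor K C' D') E' (ttensor_fun K C D C' D' F G) H)"
proof -
 interpret F: dg_functor K C C' F by fact
 interpret G: dg_functor K D D' G by fact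
 interpret H: dg_functor K E E' H by fact
 interpret A: tensor_triple K C D E
  by (intro tensor_triple.intro tensor_pair.intro F.A.dg_category_axioms G.A.dg_category_axioms H.A.dg_category_axioms)
 interpret A': tensor_triple K C' D' E'
  by (intro tensor_triple.intro tensor_pair.intro F.B.dg_category_axioms G.B.dg_category_axioms H.B.dg_category_axioms)
 interpret FG: tensor_fun K C D C' D' F G
  by (intro tensor_fun.intro A.CD.tensor_pair_axioms A'.CD.tensor_pair_axioms assms)
 interpret GH: tensor_fun K D E D' E' G H
  by (intro tensor_fun.intro A.DE.tensor_pair_axioms A'.DE.tensor_pair_axioms assms)
 interpret L: tensor_fun K C "ttensor K D E" C' "ttensor K D' E'" F GH.tf
  by (intro tensor_fun.intro A.TT.tensor_pair_axioms A'.TT.tensor_pair_axioms assms GH.tf_functor)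
 interpret R: tensor_fun K "ttensor K C D" E "ttensor K C' D'" E' FG.tf H
  by (intro tensor_fun.intro A.SS.tensor_pair_axioms A'.SS.tensor_pair_axioms assms FG.tf_functor)
 interpret a: dg_functor K "ttensor K (ttensor K C D) E" A.B A.assocF by (rule A.assocF_functor)
 interpret a': dg_functor K "ttensor K (ttensor K C' D') E'" A'.B A'.assocF by (rule A'.assocF_functor)
 interpret l: dg_functor K A.B A'.B L.tf by (rule L.tf_functor)
 let ?S = "ttensor K (ttensor K C D) E"
 let ?P = "dgfun_comp ?S L.tf A.assocF" and ?Q = "dgfun_comp ?S A'.assocF R.tf"
 have FM: "FMor ?P u = FMor L.tf (FMor A.assocF u)" "FMor ?Q u = FMor A'.assocF (FMor R.tf u)" if "u \<in> arr ?S" for u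
  using that by (simp_all add: dgfun_comp_def)
 have P: "dg_functor K ?S A'.B ?P" by (rule dgfun_compI[OF A.assocF_functor L.tf_functor])
 have Q: "dg_functor K ?S A'.B ?Q" by (rule dgfun_compI[OF R.tf_functor A'.assocF_functor])
 interpret p: dg_functor K ?S A'.B ?P by (rule P)
 interpret q: dg_functor K ?S A'.B ?Q by (rule Q)
 have obj: "FObj ?P x = FObj ?Q x" if "x \<in> Obj ?S" for x
  using that by (auto simp: dgfun_comp_def A.FObj_assocF A'.FObj_assocF L.FObj_tf R.FObj_tf FG.FObj_tf GH.FObj_tf
    F.fobj_closed G.fobj_closed H.fobj_closed)
 show ?thesis
 proof (rule A.functor_eqI3[OF P Q obj])
  fix f Y gs Z hs assume f: "f \<in> arr C" and pd: "path D Y gs" and pe: "path E Z hs"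
  let ?u = "A.SS.e0 (A.CD.e0 f Y gs) Z hs"
  note cd = A.CD.e0_arr[OF f pd]
  note u = A.SS.e0_arr[OF cd(1) pe]
  note ut = A.SS.G.arr_typed[OF u(1)]
  have o: "(Dom C f, Y, Z) \<in> Obj A.B" "(Cod C f, pend D Y gs, pend E Z hs) \<in> Obj A.B"
   using F.A.arr_typed[OF f] G.A.path_obj[OF pd] G.A.path_end[OF pd] H.A.path_obj[OF pe] H.A.path_end[OF pe] by simp_all
  let ?n = "Deg C f + wt D gs + wt E hs"
  \<comment> \<open>The functor \<open>L.tf\<close> on one space of morphisms, transported to the
    realizations. It is additive there, so it may be moved inside the shuffle.\<close>
  define theta where "theta v = emb A'.B (FMor L.tf (unemb A.B (Dom C f, Y, Z) (Cod C f, pend D Y gs, pend E Z hs) ?n v))" for v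
  have thetae: "theta (emb A.B m) = emb A'.B (FMor L.tf m)"
   if "m \<in> mor A.B (Dom C f, Y, Z) (Cod C f, pend D Y gs, pend E Z hs) ?n" for m
   by (simp add: theta_def A.TT.G.unemb_emb[OF o that])
  have fc: "FObj A.assocF (Dom ?S ?u) = (Dom C f, Y, Z)" "FObj A.assocF (Cod ?S ?u) = (Cod C f, pend D Y gs, pend E Z hs)"
   using u cd o by (simp_all add: A.FObj_assocF)
  have eu: "emb A'.B (FMor L.tf (FMor A.assocF ?u)) = theta (A.DE.sf gs (A.TT.Lu f (Y, Z)) Y Z hs)"
   unfolding A.assocF_e0_e0[OF f pd pe, symmetric]
   by (rule thetae[symmetric]) (use a.fmor_closed[OF ut] u(4) cd(4) fc in simp)
  also have "\<dots> = A.DE.sf gs (\<lambda>us. theta (A.TT.Lu f (Y, Z) us)) Y Z hs"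
  proof (rule A.DE.sh_hom[OF pd pe, where S = "rH A.B (Dom C f, Y, Z) (Cod C f, pend D Y gs, pend E Z hs) ?n"])
   fix us assume "path (ttensor K D E) (Y, Z) us" "pend (ttensor K D E) (Y, Z) us = (pend D Y gs, pend E Z hs)"
    "wt (ttensor K D E) us = wt D gs + wt E hs"
   thus "A.TT.Lu f (Y, Z) us \<in> rH A.B (Dom C f, Y, Z) (Cod C f, pend D Y gs, pend E Z hs) ?n"
    using A.TT.N.cochsD[OF A.TT.Lu_H[OF f], of "(Y, Z)" us] by (simp add: add.assoc)
  next
   fix v w assume "v \<in> rH A.B (Dom C f, Y, Z) (Cod C f, pend D Y gs, pend E Z hs) ?n"
    "w \<in> rH A.B (Dom C f, Y, Z) (Cod C f, pend D Y gs, pend E Z hs) ?n"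
   thus "theta (v + w) = theta v + theta w"
    unfolding theta_def by (rule A.TT.G.unemb_add[OF o _ _ l.emb_fmor_add[OF o]])
  qed (auto intro: A.TT.V.H_add A.TT.V.H_neg)
  also have "\<dots> = A.DE.sf gs (\<lambda>us. A'.TT.Lu (FMor F f) (FObj G Y, FObj H Z) (map (FMor GH.tf) us)) Y Z hs"
  proof (rule A.DE.sh_cong[OF pd pe], goal_cases)
   case us: (1 us)
   have m: "A.TT.e0 f (Y, Z) us \<in> mor A.B (Dom C f, Y, Z) (Cod C f, pend D Y gs, pend E Z hs) ?n"
    using A.TT.e0_mor[OF f us(1)] us by (simp add: add.assoc)
   have YZ: "FObj GH.tf (Y, Z) = (FObj G Y, FObj H Z)"
    using o by (simp add: GH.FObj_tf)
   have "theta (A.TT.Lu f (Y, Z) us) = emb A'.B (FMor L.tf (A.TT.e0 f (Y, Z) us))"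
    using thetae[OF m] A.TT.emb_e0[OF us(1)] by simp
   also have "\<dots> = A'.TT.Lu (FMor F f) (FObj G Y, FObj H Z) (map (FMor GH.tf) us)"
    using L.tf_e0[OF f us(1)] A'.TT.emb_e0[OF conjunct1[OF L.G_path[OF us(1)]]] YZ by simp
   finally show ?case .
  qed
  also have "\<dots> = A'.DE.sf (map (FMor G) gs) (A'.TT.Lu (FMor F f) (FObj G Y, FObj H Z)) (FObj G Y) (FObj H Z) (map (FMor H) hs)"
   by (rule GH.sh_tf[OF pd pe])
  also have "\<dots> = emb A'.B (FMor A'.assocF (FMor R.tf ?u))"
   unfolding R.tf_e0[OF cd(1) pe] FG.tf_e0[OF f pd]
   by (rule A'.assocF_e0_e0[symmetric]) (use F.fmor_arr[OF f] FG.G_path[OF pd] GH.G_path[OF pe] in simp_all)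
  finally have "emb A'.B (FMor ?P ?u) = emb A'.B (FMor ?Q ?u)" unfolding FM[OF u(1)] .
  thus "FMor ?P ?u = FMor ?Q ?u"
   using A'.TT.G.emb_inj[OF p.fobj_closed[OF ut(1)] p.fobj_closed[OF ut(2)] p.fmor_closed[OF ut]] q.fmor_closed[OF ut]
   by (simp only: obj[OF ut(1)] obj[OF ut(2)])
 next
  fix X g Z hs assume X: "X \<in> Obj C" "g \<in> arr D" and pe: "path E Z hs"
  note cd = A.CD.r_arr[OF X]
  have "FMor ?P (A.SS.e0 (A.CD.r X g) Z hs) = FMor L.tf (A.TT.r X (A.DE.e0 g Z hs))"
   using FM(1)[OF A.SS.e0_arr(1)[OF cd(1) pe]] A.assocF_e0_r[OF X pe] by simp
  also have "\<dots> = A'.TT.r (FObj F X) (A'.DE.e0 (FMor G g) (FObj H Z) (map (FMor H) hs))"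
   unfolding L.tf_r[OF X(1) A.DE.e0_arr(1)[OF X(2) pe]] GH.tf_e0[OF X(2) pe] ..
  also have "\<dots> = FMor A'.assocF (FMor R.tf (A.SS.e0 (A.CD.r X g) Z hs))"
   unfolding R.tf_e0[OF cd(1) pe] FG.tf_r[OF X]
   by (rule A'.assocF_e0_r[symmetric]) (use X pe in "simp_all add: F.fobj_closed G.fmor_arr GH.G_path")
  finally show "FMor ?P (A.SS.e0 (A.CD.r X g) Z hs) = FMor ?Q (A.SS.e0 (A.CD.r X g) Z hs)"
   using FM(2)[OF A.SS.e0_arr(1)[OF cd(1) pe]] by simp
 next
  fix X Y h assume X: "X \<in> Obj C" "Y \<in> Obj D" "h \<in> arr E"
  have o: "(X, Y) \<in> Obj (ttensor K C D)" using X by simp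
  show "FMor ?P (A.SS.r (X, Y) h) = FMor ?Q (A.SS.r (X, Y) h)"
   using X by (simp add: FM[OF A.SS.r_arr(1)[OF o X(3)]] A.assocF_r_r L.tf_r R.tf_r[OF o] GH.tf_r A.DE.r_arr
     FG.FObj_tf A'.assocF_r_r F.fobj_closed G.fobj_closed H.fmor_arr)
 qed
qed

theorem theorem3p1:
  fixes K :: "'k ring"
    and C :: "('k, 'c, 'f) dgcat" and D :: "('k, 'd, 'g) dgcat" and E :: "('k, 'e, 'h) dgcat"
  assumes "field K"
    and "dg_category K C" and "dg_category K D" and "dg_category K E"
  shows "(\<exists>!\<alpha>. associator K C D E \<alpha>) \<and>
    (\<forall>(C' :: ('k, 'c1, 'f1) dgcat) (D' :: ('k, 'd1, 'g1) dgcat) (E' :: ('k, 'e1, 'h1) dgcat)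
      F G H \<alpha> \<alpha>'.
      dg_functor K C C' F \<longrightarrow> dg_functor K D D' G \<longrightarrow> dg_functor K E E' H \<longrightarrow>
      associator K C D E \<alpha> \<longrightarrow> associator K C' D' E' \<alpha>' \<longrightarrow>
      (let CD = ttensor K C D; DE = ttensor K D E;
           CD' = ttensor K C' D'; DE' = ttensor K D' E';
           S = ttensor K CD E
       in dgfun_comp S (ttensor_fun K C DE C' DE' F (ttensor_fun K D E D' E' G H)) \<alpha> =
          dgfun_comp S \<alpha>' (ttensor_fun K CD E CD' E' (ttensor_fun K C D C' D' F G) H)))"
proof (intro conjI allI impI)
  interpret A: tensor_triple K C D E by (intro tensor_triple.intro tensor_pair.intro assms)
  show "\<exists>!\<alpha>. associator K C D E \<alpha>"
    using A.assocF_associator A.associator_unique by blast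
  fix C' :: "('k, 'c1, 'f1) dgcat" and D' :: "('k, 'd1, 'g1) dgcat" and E' :: "('k, 'e1, 'h1) dgcat" and F G H \<alpha> \<alpha>'
  assume f: "dg_functor K C C' F" "dg_functor K D D' G" "dg_functor K E E' H"
    and a: "associator K C D E \<alpha>" "associator K C' D' E' \<alpha>'"
  interpret A': tensor_triple K C' D' E'
    using f by (intro tensor_triple.intro tensor_pair.intro) (simp_all add: dg_functor_def)
  have "\<alpha> = A.assocF" "\<alpha>' = A'.assocF"
    \<comment> \<open>Uniqueness reduces naturality for arbitrary associators to the constructed
      ones.\<close>
    using A.associator_unique[OF a(1) A.assocF_associator] A'.associator_unique[OF a(2) A'.assocF_associator] by simp_all
  then show "let CD = ttensor K C D; DE = ttensor K D E; CD' = ttensor K C' D'; DE' = ttensor K D' E'; S = ttensor K CD E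
       in dgfun_comp S (ttensor_fun K C DE C' DE' F (ttensor_fun K D E D' E' G H)) \<alpha> =
          dgfun_comp S \<alpha>' (ttensor_fun K CD E CD' E' (ttensor_fun K C D C' D' F G) H)"
    unfolding Let_def using associator_natural[OF f] by simp
qed

end
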